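(* Let $\mu>0$, let $\{Y_{i,j}:(i,j)\in\mathbb Z_+^2\}$ be i.i.d. with $Y_{i,j}^{-1}\sim\mathrm{Gamma}(\mu)$, let $(s,t)\in(0,\infty)^2$ and let $\xi\in\mathbb R$. Then the limit $$\Lambda_{s,t}(\xi)=\lim_{n\to\infty}n^{-1}\log\mathbb E\,e^{\xi\log Z_{\lfloor ns\rfloor,\lfloor nt\rfloor}}$$ exists in $(-\infty,\infty]$ and is given by $$\Lambda_{s,t}(\xi)=I_{s,t}^*(\xi)=\begin{cases}p(s,t)\,\xi, & \xi<0,\\[2pt] \displaystyle\inf_{\theta\in(\xi,\mu)}\big\{t\,M_\theta(\xi)-s\,M_{\mu-\theta}(-\xi)\big\}, & 0\le\xi<\mu,\\[2pt] \infty, & \xi\ge\mu.\end{cases}$$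
   Context: $\mathbb Z_+$ denotes the nonnegative integers. $\mathrm{Gamma}(\mu)$ is the distribution on $(0,\infty)$ with density $\Gamma(\mu)^{-1}x^{\mu-1}e^{-x}$. For $\nu>0$, $M_\nu(\xi)=\log\Gamma(\nu-\xi)-\log\Gamma(\nu)$ for $\xi<\nu$ and $M_\nu(\xi)=\infty$ for $\xi\ge\nu$. A directed path from $(0,0)$ to $(m,n)$ is a sequence $x_0=(0,0),x_1,\dots,x_{m+n}=(m,n)$ in $\mathbb Z_+^2$ with each step $x_{k+1}-x_k\in\{(1,0),(0,1)\}$. The partition function is $Z_{m,n}=\sum_{x_\cdot}\prod_{j=1}^{m+n}Y_{x_j}$, summed over all directed paths from $(0,0)$ to $(m,n)$. The limiting free energy is the almost sure limit $p(s,t)=\lim_{n\to\infty}n^{-1}\log Z_{\lfloor ns\rfloor,\lfloor nt\rfloor}$, a finite constant, equal to $\inf_{0<\rho<\mu}\{-s\Psi_0(\rho)-t\Psi_0(\mu-\rho)\}$, where $\Psi_0=\Gamma'/\Gamma$ is the digamma function. The function $I_{s,t}:\mathbb R\to[0,\infty]$ is defined by $I_{s,t}(r)=\sup_{\xi\in[0,\mu)}\{r\xi-\inf_{\theta\in(\xi,\mu)}(t\,M_\theta(\xi)-s\,M_{\mu-\theta}(-\xi))\}$ for $r\ge p(s,t)$ and $I_{s,t}(r)=\infty$ for $r<p(s,t)$. The convex dual of $f:\mathbb R\to(-\infty,\infty]$ is $f^*(y)=\sup_{x\in\mathbb R}\{xy-f(x)\}$. *)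

theory Defs
  imports "HOL-Probability.Probability"
begin

definition gamma_density :: "real \<Rightarrow> real \<Rightarrow> real" where
  "gamma_density \<mu> x = (if x > 0 then x powr (\<mu> - 1) * exp (- x) / Gamma \<mu> else 0)"

definition ln_ennreal :: "ennreal \<Rightarrow> ereal" where
  "ln_ennreal x = (if x = 0 then -\<infinity> else if x = \<infinity> then \<infinity> else ereal (ln (enn2real x)))"

definition log_gamma_mgf :: "real \<Rightarrow> real \<Rightarrow> ereal" where
  "log_gamma_mgf \<nu> \<xi> = (if \<xi> < \<nu> then ereal (ln (Gamma (\<nu> - \<xi>)) - ln (Gamma \<nu>)) else \<infinity>)"

text \<open>A path is the list of its points, so it has one more entry than it has steps.\<close>

definition directed_paths :: "nat \<Rightarrow> nat \<Rightarrow> (nat \<times> nat) list set" where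
  "directed_paths m n = {x. length x = m + n + 1 \<and> x ! 0 = (0, 0) \<and> x ! (m + n) = (m, n) \<and>
     (\<forall>k < m + n. x ! (k + 1) = x ! k + (1, 0) \<or> x ! (k + 1) = x ! k + (0, 1))}"

text \<open>The weight at the starting point does not enter the product.\<close>

definition partition_fun :: "(nat \<times> nat \<Rightarrow> 'a \<Rightarrow> real) \<Rightarrow> nat \<Rightarrow> nat \<Rightarrow> 'a \<Rightarrow> real" where
  "partition_fun Y m n \<omega> = (\<Sum>x \<in> directed_paths m n. \<Prod>j = 1..m + n. Y (x ! j) \<omega>)"

definition scaled_partition_fun ::
    "(nat \<times> nat \<Rightarrow> 'a \<Rightarrow> real) \<Rightarrow> real \<Rightarrow> real \<Rightarrow> nat \<Rightarrow> 'a \<Rightarrow> real" where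
  "scaled_partition_fun Y s t n = partition_fun Y (nat \<lfloor>real n * s\<rfloor>) (nat \<lfloor>real n * t\<rfloor>)"

definition free_energy ::
    "'a measure \<Rightarrow> (nat \<times> nat \<Rightarrow> 'a \<Rightarrow> real) \<Rightarrow> real \<Rightarrow> real \<Rightarrow> real" where
  "free_energy M Y s t =
     (THE p. AE \<omega> in M. (\<lambda>n. ln (scaled_partition_fun Y s t n \<omega>) / real n) \<longlonglongrightarrow> p)"

text \<open>For \<open>0 \<le> \<xi> < \<theta> < \<mu>\<close> both terms of the difference are finite.\<close>

definition inf_gamma_mgf :: "real \<Rightarrow> real \<Rightarrow> real \<Rightarrow> real \<Rightarrow> ereal" where
  "inf_gamma_mgf \<mu> s t \<xi> = (INF \<theta> \<in> {\<xi><..<\<mu>}.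
     ereal t * log_gamma_mgf \<theta> \<xi> - ereal s * log_gamma_mgf (\<mu> - \<theta>) (- \<xi>))"

definition rate_fun ::
    "'a measure \<Rightarrow> (nat \<times> nat \<Rightarrow> 'a \<Rightarrow> real) \<Rightarrow> real \<Rightarrow> real \<Rightarrow> real \<Rightarrow> real \<Rightarrow> ereal" where
  "rate_fun M Y \<mu> s t r =
     (if free_energy M Y s t \<le> r
      then SUP \<xi> \<in> {0..<\<mu>}. ereal (r * \<xi>) - inf_gamma_mgf \<mu> s t \<xi>
      else \<infinity>)"

definition convex_dual :: "(real \<Rightarrow> ereal) \<Rightarrow> real \<Rightarrow> ereal" where
  "convex_dual f y = (SUP x. ereal (x * y) - f x)"

text \<open>The expectation may be infinite, hence a nonnegative integral with values in \<open>[0, \<infinity>]\<close>.\<close>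

definition scaled_log_mgf ::
    "'a measure \<Rightarrow> (nat \<times> nat \<Rightarrow> 'a \<Rightarrow> real) \<Rightarrow> real \<Rightarrow> real \<Rightarrow> real \<Rightarrow> nat \<Rightarrow> ereal" where
  "scaled_log_mgf M Y s t \<xi> n =
     ln_ennreal (\<integral>\<^sup>+ \<omega>. ennreal (exp (\<xi> * ln (scaled_partition_fun Y s t n \<omega>))) \<partial>M) / ereal (real n)"

end

theory Submission
  imports Defs "HOL-Real_Asymp.Real_Asymp"
begin

text \<open>
  Prescribing inverse gamma weights of parameters \<open>\<mu> - \<theta>'\<close> and \<open>\<theta>'\<close> on the two axes, with
  \<open>0 < \<theta>' < \<mu>\<close>, makes the ratios of neighbouring partition functions stationary (the Burke property), so
  the moments of the stationary partition function are explicit. Splitting its paths at the point where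
  they leave the axes and keeping one term gives
  \<open>E Z\<^sup>\<xi> \<le> C exp (N (t M\<^sub>\<theta>(\<xi>) - s M\<^sub>\<mu>\<^sub>-\<^sub>\<theta>(-\<xi>)))\<close> for all \<open>0 \<le> \<xi> < \<theta> < \<mu>\<close>. At a critical \<open>\<theta>\<close> the terms
  leaving the axes far from the origin are exponentially negligible, which yields the matching lower bound
  for \<open>0 < \<xi> < \<mu>\<close>; differentiating at \<open>\<xi> = 0\<close> gives the same for small negative moments. Larger negative
  moments are reduced to small ones: \<open>Z\<close> dominates the partition functions of many disjoint tubes of blocks,
  hence their geometric mean, and independence does the rest. Therefore \<open>E Z\<^sup>\<xi>\<close> grows at the linear rate
  \<open>p \<xi>\<close> for \<open>\<xi> < 0\<close>; here the lower bound is convexity of the logarithm of the moments. Exponential Markov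
  bounds and Borel--Cantelli identify \<open>p\<close> with the free energy. The limit is convex on \<open>[0, \<mu>)\<close>, lies above
  \<open>p \<xi>\<close> and explodes at \<open>\<mu>\<close>, so its subgradients compute the convex dual of the rate function.
\<close>

section \<open>Directed paths with general weights\<close>

text \<open>The Burke property rests on the independence of the sum and the fraction of two gamma
  variables: the recursion of the partition functions replaces the sum by a fresh gamma variable of
  the same law. A moment of order \<xi> calls for the tilted axis parameters \<theta> - \<xi> and
  \<mu> - \<theta> + \<xi>, whose sum is still \<mu>. The infimum over \<theta> is identified by
  comparison: the upper bound holds for every \<theta> and the lower bound at a critical one, so the
  critical value is the minimum.

  The obstacle is the negative moments. The exit decomposition bounds Z from below only where the
  near exits dominate. On the rare event where the far exits do, nothing better than the weight of
  one path is available, at a cost of order c N for the moment of order - c, whereas the rarity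
  gains a rate fixed by another exponent \<eta>. So \<eta> comes first and c must be small against
  that gain; larger orders are spread over K tubes that carry the order a / K each. Convexity of the
  log-moments, which vanish at order 0, then turns upper bounds on one side of 0 into lower bounds
  on the other.\<close>

fun pf :: "(nat \<times> nat \<Rightarrow> real) \<Rightarrow> nat \<Rightarrow> nat \<Rightarrow> real" where
  "pf w 0 0 = 1"
| "pf w (Suc m) 0 = w (Suc m, 0) * pf w m 0"
| "pf w 0 (Suc n) = w (0, Suc n) * pf w 0 n"
| "pf w (Suc m) (Suc n) = w (Suc m, Suc n) * (pf w m (Suc n) + pf w (Suc m) n)"

text \<open>The environment seen from (a, b). As \<open>pf\<close> omits the weight at its origin,
  the weight at (a, b) does not enter \<open>pf (shift a b w)\<close>.\<close>

definition shift :: "nat \<Rightarrow> nat \<Rightarrow> (nat \<times> nat \<Rightarrow> 'b) \<Rightarrow> nat \<times> nat \<Rightarrow> 'b" where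
  "shift a b w = (\<lambda>p. w (a + fst p, b + snd p))"

lemma shift_apply [simp]: "shift a b w (i, j) = w (a + i, b + j)"
  by (simp add: shift_def)

lemma shift_0 [simp]: "shift 0 0 w = w"
  by (simp add: shift_def)

lemma shift_shift [simp]: "shift a b (shift c d w) = shift (c + a) (d + b) w"
  by (simp add: shift_def add.assoc)

lemma directed_paths_0: "directed_paths 0 0 = {[(0, 0)]}"
  by (auto simp: directed_paths_def length_Suc_conv)

lemma directed_paths_snoc:
  assumes "x \<in> directed_paths m n" "(m', n') = (m + 1, n) \<or> (m', n') = (m, n + 1)"
  shows "x @ [(m', n')] \<in> directed_paths m' n'"
proof -
  have mn: "m' + n' = Suc (m + n)" using assms(2) by auto
  have "(x @ [(m', n')]) ! (k + 1) = (x @ [(m', n')]) ! k + (1, 0) \<or>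
        (x @ [(m', n')]) ! (k + 1) = (x @ [(m', n')]) ! k + (0, 1)" if k: "k < m' + n'" for k
  proof (cases "k = m + n")
    case True
    then show ?thesis using assms by (auto simp: directed_paths_def nth_append)
  next
    case False
    then show ?thesis using assms k mn by (auto simp: directed_paths_def nth_append)
  qed
  then show ?thesis using assms mn by (auto simp: directed_paths_def nth_append)
qed

lemma directed_paths_butlast:
  assumes x: "x \<in> directed_paths m n" "m + n > 0"
  shows "(\<exists>m' y. m = Suc m' \<and> y \<in> directed_paths m' n \<and> x = y @ [(m, n)]) \<or>
         (\<exists>n' y. n = Suc n' \<and> y \<in> directed_paths m n' \<and> x = y @ [(m, n)])"
proof -
  obtain k where k: "m + n = Suc k" using assms(2) gr0_conv_Suc by blast
  have len: "length x = k + 2" and last: "x ! Suc k = (m, n)"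
    using x k by (auto simp: directed_paths_def)
  define y where "y = take (Suc k) x"
  have xy: "x = y @ [(m, n)]"
    unfolding y_def using len last by (metis add_2_eq_Suc' lessI take_Suc_conv_app_nth take_all_iff order_refl)
  have ny: "y ! i = x ! i" if "i \<le> k" for i
    using that by (simp add: y_def)
  have ly: "length y = Suc k" by (simp add: y_def len)
  have st: "x ! (i + 1) = x ! i + (1, 0) \<or> x ! (i + 1) = x ! i + (0, 1)" if "i < Suc k" for i
    using x k that by (simp add: directed_paths_def)
  have 0: "y ! 0 = (0,0)" using ny[of 0] x by (simp add: directed_paths_def)
  from st[of k] have "(m, n) = x ! k + (1, 0) \<or> (m, n) = x ! k + (0, 1)"
    using last by simp
  then show ?thesis
  proof
    assume a: "(m, n) = x ! k + (1, 0)"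
    then obtain m' where m': "m = Suc m'" "x ! k = (m', n)"
      by (cases "x ! k") auto
    have "y \<in> directed_paths m' n"
      using 0 ly st ny m' k by (auto simp: directed_paths_def)
    then show ?thesis using m' xy by blast
  next
    assume a: "(m, n) = x ! k + (0, 1)"
    then obtain n' where m': "n = Suc n'" "x ! k = (m, n')"
      by (cases "x ! k") auto
    have "y \<in> directed_paths m n'"
      using 0 ly st ny m' k by (auto simp: directed_paths_def)
    then show ?thesis using m' xy by blast
  qed
qed

lemma directed_paths_Suc_0: "directed_paths (Suc m) 0 = (\<lambda>y. y @ [(Suc m, 0)]) ` directed_paths m 0"
  using directed_paths_snoc[of _ m 0 "Suc m" 0] directed_paths_butlast[of _ "Suc m" 0] by fastforce

lemma directed_paths_0_Suc: "directed_paths 0 (Suc n) = (\<lambda>y. y @ [(0, Suc n)]) ` directed_paths 0 n"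
  using directed_paths_snoc[of _ 0 n 0 "Suc n"] directed_paths_butlast[of _ 0 "Suc n"] by fastforce

lemma directed_paths_Suc_Suc:
  "directed_paths (Suc m) (Suc n) = (\<lambda>y. y @ [(Suc m, Suc n)]) ` directed_paths m (Suc n) \<union>
     (\<lambda>y. y @ [(Suc m, Suc n)]) ` directed_paths (Suc m) n"
  using directed_paths_snoc[of _ m "Suc n" "Suc m" "Suc n"] directed_paths_snoc[of _ "Suc m" n "Suc m" "Suc n"]
    directed_paths_butlast[of _ "Suc m" "Suc n"] by fastforce

text \<open>The prefixes end at different points, so no path into (Suc m, Suc n) is counted twice
  when paths are split by their last step.\<close>

lemma directed_paths_disjoint:
  "(\<lambda>y. y @ [z]) ` directed_paths m (Suc n) \<inter> (\<lambda>y. y @ [z]) ` directed_paths (Suc m) n = {}"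
  by (auto simp: directed_paths_def)

lemma finite_directed_paths: "finite (directed_paths m n)"
proof (induction "m + n" arbitrary: m n)
  case 0
  then show ?case by (simp add: directed_paths_0)
next
  case (Suc k)
  then show ?case
    by (cases m; cases n) (simp_all add: directed_paths_Suc_0 directed_paths_0_Suc directed_paths_Suc_Suc)
qed

lemma path_weight_snoc:
  assumes "y \<in> directed_paths m n" "m' + n' = Suc (m + n)"
  shows "(\<Prod>j = 1..m' + n'. w ((y @ [z]) ! j)) = w z * (\<Prod>j = 1..m + n. w (y ! j) :: real)"
proof -
  have l: "length y = Suc (m + n)" using assms by (simp add: directed_paths_def)
  have "(\<Prod>j = 1..m' + n'. w ((y @ [z]) ! j)) = w z * (\<Prod>j = 1..m + n. w ((y @ [z]) ! j))"
    using l by (simp add: assms(2) prod.nat_ivl_Suc' nth_append)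
  also have "(\<Prod>j = 1..m + n. w ((y @ [z]) ! j)) = (\<Prod>j = 1..m + n. w (y ! j))"
    using l by (intro prod.cong) (auto simp: nth_append)
  finally show ?thesis .
qed

text \<open>Splitting the sum over point lists by the last step produces the recursion, on which all
  later arguments work.\<close>

lemma partition_fun_eq_pf: "partition_fun Y m n \<omega> = pf (\<lambda>p. Y p \<omega>) m n"
proof (induction "\<lambda>p. Y p \<omega>" m n rule: pf.induct)
  case 1
  then show ?case by (simp add: partition_fun_def directed_paths_0)
next
  case (2 m)
  have "partition_fun Y (Suc m) 0 \<omega> = Y (Suc m, 0) \<omega> * partition_fun Y m 0 \<omega>"
    using path_weight_snoc[of _ m 0 "Suc m" 0 "\<lambda>p. Y p \<omega>" "(Suc m, 0)"]
    by (simp add: partition_fun_def directed_paths_Suc_0 sum.reindex inj_on_def sum_distrib_left cong: sum.cong)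
  then show ?case using 2 by simp
next
  case (3 n)
  have "partition_fun Y 0 (Suc n) \<omega> = Y (0, Suc n) \<omega> * partition_fun Y 0 n \<omega>"
    using path_weight_snoc[of _ 0 n 0 "Suc n" "\<lambda>p. Y p \<omega>" "(0, Suc n)"]
    by (simp add: partition_fun_def directed_paths_0_Suc sum.reindex inj_on_def sum_distrib_left cong: sum.cong)
  then show ?case using 3 by simp
next
  case (4 m n)
  have a: "(\<Sum>x\<in>directed_paths m (Suc n). \<Prod>j = Suc 0..Suc (Suc (m + n)). Y ((x @ [(Suc m, Suc n)]) ! j) \<omega>) =
     Y (Suc m, Suc n) \<omega> * partition_fun Y m (Suc n) \<omega>"
    using path_weight_snoc[of _ m "Suc n" "Suc m" "Suc n" "\<lambda>p. Y p \<omega>" "(Suc m, Suc n)"]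
    by (simp add: partition_fun_def sum_distrib_left cong: sum.cong)
  have b: "(\<Sum>x\<in>directed_paths (Suc m) n. \<Prod>j = Suc 0..Suc (Suc (m + n)). Y ((x @ [(Suc m, Suc n)]) ! j) \<omega>) =
     Y (Suc m, Suc n) \<omega> * partition_fun Y (Suc m) n \<omega>"
    using path_weight_snoc[of _ "Suc m" n "Suc m" "Suc n" "\<lambda>p. Y p \<omega>" "(Suc m, Suc n)"]
    by (simp add: partition_fun_def sum_distrib_left cong: sum.cong)
  have "partition_fun Y (Suc m) (Suc n) \<omega> =
     Y (Suc m, Suc n) \<omega> * partition_fun Y m (Suc n) \<omega> + Y (Suc m, Suc n) \<omega> * partition_fun Y (Suc m) n \<omega>"
    unfolding a[symmetric] b[symmetric]
    by (subst partition_fun_def, subst directed_paths_Suc_Suc, subst sum.union_disjoint)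
       (simp_all add: finite_directed_paths directed_paths_disjoint sum.reindex inj_on_def)
  then show ?case using 4 by (simp add: distrib_left)
qed

lemma pf_pos: "(\<And>p. w p > 0) \<Longrightarrow> pf w m n > 0"
  by (induction w m n rule: pf.induct) (auto intro: add_pos_pos)

lemma pf_swap: "pf (w \<circ> prod.swap) n m = pf w m n"
  by (induction w m n rule: pf.induct) auto

lemma pf_right: "pf w m 0 = (\<Prod>i=1..m. w (i, 0))"
  by (induction m) (auto simp: prod.nat_ivl_Suc')

lemma pf_up: "pf w 0 n = (\<Prod>j=1..n. w (0, j))"
  by (induction n) (auto simp: prod.nat_ivl_Suc')

text \<open>The left side collects the paths through (a, b); the weight there belongs to the first
  factor only.\<close>

lemma pf_superadditive:
  assumes pos: "\<And>p. w p > 0"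
  shows "pf w a b * pf (shift a b w) m n \<le> pf w (a + m) (b + n)"
proof (induction "m + n" arbitrary: m n)
  case 0
  then show ?case by simp
next
  case (Suc k)
  have p: "pf w i j \<ge> 0" for i j by (intro less_imp_le pf_pos pos)
  show ?case
  proof (cases m)
    case 0
    then obtain n' where n: "n = Suc n'" using Suc by (cases n) auto
    have IH: "pf w a b * pf (shift a b w) 0 n' \<le> pf w a (b + n')"
      using Suc(1)[of 0 n'] Suc(2) 0 n by simp
    have "pf w a b * pf (shift a b w) 0 n = w (a, Suc (b + n')) * (pf w a b * pf (shift a b w) 0 n')"
      by (simp add: n)
    also have "\<dots> \<le> w (a, Suc (b + n')) * pf w a (b + n')"
      using IH pos[of "(a, Suc (b + n'))"] by (intro mult_left_mono) auto
    also have "\<dots> \<le> pf w a (Suc (b + n'))"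
      using p pos[of "(a, Suc (b + n'))"] by (cases a) (auto simp: algebra_simps)
    finally show ?thesis by (simp add: 0 n)
  next
    case (Suc m') note m = this
    show ?thesis
    proof (cases n)
      case 0
      have IH: "pf w a b * pf (shift a b w) m' 0 \<le> pf w (a + m') b"
        using Suc.hyps(1)[of m' 0] Suc.hyps(2) 0 m by simp
      have "pf w a b * pf (shift a b w) m 0 = w (Suc (a + m'), b) * (pf w a b * pf (shift a b w) m' 0)"
        by (simp add: m)
      also have "\<dots> \<le> w (Suc (a + m'), b) * pf w (a + m') b"
        using IH pos[of "(Suc (a + m'), b)"] by (intro mult_left_mono) auto
      also have "\<dots> \<le> pf w (Suc (a + m')) b"
        using p pos[of "(Suc (a + m'), b)"] by (cases b) (auto simp: algebra_simps)
      finally show ?thesis by (simp add: 0 m)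
    next
      case (Suc n')
      have IH: "pf w a b * pf (shift a b w) m' n \<le> pf w (a + m') (b + n)"
         "pf w a b * pf (shift a b w) m n' \<le> pf w (a + m) (b + n')"
        using Suc.hyps(1)[of m' n] Suc.hyps(1)[of m n'] Suc.hyps(2) m Suc by simp_all
      have "pf w a b * pf (shift a b w) m n =
        w (a + m, b + n) * (pf w a b * pf (shift a b w) m' n + pf w a b * pf (shift a b w) m n')"
        by (simp add: m Suc algebra_simps)
      also have "\<dots> \<le> w (a + m, b + n) * (pf w (a + m') (b + n) + pf w (a + m) (b + n'))"
        using IH pos[of "(a + m, b + n)"] by (intro mult_left_mono add_mono) auto
      finally show ?thesis by (simp add: m Suc)
    qed
  qed
qed

lemma pf_first_right: "pf w (Suc m) 0 = w (1, 0) * pf (shift 1 0 w) m 0"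
  by (induction m) auto

lemma pf_first_up: "pf w 0 (Suc n) = w (0, 1) * pf (shift 0 1 w) 0 n"
  by (induction n) auto

text \<open>\<open>pf\<close> recurses on the last step, but the exit from an axis is a matter of
  the first steps. The claim is applied to both predecessors of the endpoint and the result is
  regrouped.\<close>

lemma pf_first_step:
  "pf w (Suc m) (Suc n) = w (1, 0) * pf (shift 1 0 w) m (Suc n) + w (0, 1) * pf (shift 0 1 w) (Suc m) n"
proof (induction "m + n" arbitrary: m n rule: less_induct)
  case less
  \<comment> \<open>For m = 0 no path begins with a step to the right, hence the value 0 in place of
    a term with \<open>m - 1\<close>.\<close>
  have A: "pf w m (Suc n) = (if m = 0 then 0 else w (1, 0) * pf (shift 1 0 w) (m - 1) (Suc n)) + w (0, 1) * pf (shift 0 1 w) m n"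
    using less[of "m - 1" n] pf_first_up[of w n] by (cases m) auto
  have B: "pf w (Suc m) n = w (1, 0) * pf (shift 1 0 w) m n + (if n = 0 then 0 else w (0, 1) * pf (shift 0 1 w) (Suc m) (n - 1))"
    using less[of m "n - 1"] pf_first_right[of w m] by (cases n) auto
  show ?case
    by (subst pf.simps(4), subst A, subst B) (cases m; cases n; simp add: algebra_simps)
qed

text \<open>Iterates the first-step decomposition: a path whose first step is upward leaves the
  vertical axis at some height l, and (1, l) is its first point off the axis.\<close>

lemma pf_exit_up:
  "w (0, 1) * pf (shift 0 1 w) (Suc m) n =
    (\<Sum>l = 1..Suc n. (\<Prod>j=1..l. w (0, j)) * (w (1, l) * pf (shift 1 l w) m (Suc n - l)))"
proof (induction n arbitrary: w)
  case 0
  then show ?case using pf_first_right[of "shift 0 1 w" m] by simp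
next
  case (Suc n)
  have "w (0, 1) * pf (shift 0 1 w) (Suc m) (Suc n) =
     w (0, 1) * (w (1, 1) * pf (shift 1 1 w) m (Suc n)) +
     w (0, 1) * (shift 0 1 w (0, 1) * pf (shift 0 1 (shift 0 1 w)) (Suc m) n)"
    by (subst pf_first_step) (simp add: algebra_simps)
  also have "shift 0 1 w (0, 1) * pf (shift 0 1 (shift 0 1 w)) (Suc m) n =
     (\<Sum>l = 1..Suc n. (\<Prod>j=1..l. w (0, Suc j)) * (w (1, Suc l) * pf (shift 1 (Suc l) w) m (Suc n - l)))"
    using Suc[of "shift 0 1 w"] by (simp del: sum.cl_ivl_Suc)
  also have "w (0, 1) * \<dots> = (\<Sum>l = 1..Suc n. (w (0, 1) * (\<Prod>j=1..l. w (0, Suc j))) * (w (1, Suc l) * pf (shift 1 (Suc l) w) m (Suc n - l)))"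
    by (simp add: sum_distrib_left mult.assoc del: sum.cl_ivl_Suc)
  also have "\<dots> = (\<Sum>l = 1..Suc n. (\<Prod>j=1..Suc l. w (0, j)) * (w (1, Suc l) * pf (shift 1 (Suc l) w) m (Suc n - l)))"
    by (intro sum.cong refl arg_cong2[where f="(*)"])
       (simp add: prod.atLeast_Suc_atMost[of 1 "Suc _"] prod.atLeast_Suc_atMost_Suc_shift
          prod.atLeast_Suc_atMost[of 0] del: prod.cl_ivl_Suc)
  also have "\<dots> = (\<Sum>l = 2..Suc (Suc n). (\<Prod>j=1..l. w (0, j)) * (w (1, l) * pf (shift 1 l w) m (Suc (Suc n) - l)))"
    unfolding numeral_2_eq_2 One_nat_def sum.atLeast_Suc_atMost_Suc_shift o_def diff_Suc_Suc ..
  finally show ?case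
    by (subst sum.atLeast_Suc_atMost) (simp_all add: numeral_2_eq_2 del: sum.cl_ivl_Suc)
qed

lemma shift_swap: "shift a b w \<circ> prod.swap = shift b a (w \<circ> prod.swap)"
  by (auto simp: shift_def fun_eq_iff)

text \<open>Transposing the environment exchanges the two axes.\<close>

lemma pf_exit_right:
  "w (1, 0) * pf (shift 1 0 w) m (Suc n) =
    (\<Sum>k = 1..Suc m. (\<Prod>i=1..k. w (i, 0)) * (w (k, 1) * pf (shift k 1 w) (Suc m - k) n))"
proof -
  have "pf (shift 0 1 (w \<circ> prod.swap)) (Suc n) m = pf (shift 1 0 w) m (Suc n)"
    by (subst pf_swap[symmetric]) (simp add: shift_swap comp_assoc)
  moreover have "pf (shift 1 k (w \<circ> prod.swap)) n (Suc m - k) = pf (shift k 1 w) (Suc m - k) n" for k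
    by (subst pf_swap[symmetric]) (simp add: shift_swap comp_assoc)
  ultimately show ?thesis
    using pf_exit_up[of "w \<circ> prod.swap" n m] by (simp del: sum.cl_ivl_Suc prod.cl_ivl_Suc)
qed

lemma pf_exit:
  "pf w (Suc m) (Suc n) =
    (\<Sum>l = 1..Suc n. (\<Prod>j=1..l. w (0, j)) * (w (1, l) * pf (shift 1 l w) m (Suc n - l))) +
    (\<Sum>k = 1..Suc m. (\<Prod>i=1..k. w (i, 0)) * (w (k, 1) * pf (shift k 1 w) (Suc m - k) n))"
  by (simp only: pf_first_step pf_exit_up pf_exit_right add.commute)

section \<open>The Burke property of gamma variables\<close>

definition gamma_law :: "real \<Rightarrow> real measure" where
  "gamma_law a = density lborel (\<lambda>x. ennreal (gamma_density a x))"

lemma gamma_density_measurable [measurable]: "gamma_density a \<in> borel_measurable borel"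
  unfolding gamma_density_def by measurable

lemma sets_gamma_law [simp, measurable_cong]: "sets (gamma_law a) = sets borel"
  by (simp add: gamma_law_def)

lemma space_gamma_law [simp]: "space (gamma_law a) = UNIV"
  by (simp add: gamma_law_def)

lemma nn_integral_gamma_law:
  fixes f :: "real \<Rightarrow> ennreal"
  assumes [measurable]: "f \<in> borel_measurable borel"
  shows "(\<integral>\<^sup>+x. f x \<partial>gamma_law a) = (\<integral>\<^sup>+x. gamma_density a x * f x \<partial>lborel)"
  unfolding gamma_law_def by (subst nn_integral_density) auto

lemma nn_integral_Gamma:
  assumes "b > (0::real)"
  shows "(\<integral>\<^sup>+x. ennreal (if x > 0 then x powr (b - 1) * exp (- x) else 0) \<partial>lborel) = ennreal (Gamma b)"
proof -
  have "(\<integral>\<^sup>+x. ennreal (if x > 0 then x powr (b - 1) * exp (- x) else 0) \<partial>lborel) =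
        (\<integral>\<^sup>+x. ennreal (indicator {0..} x * x powr (b - 1) / exp x) \<partial>lborel)"
    by (intro nn_integral_cong) (auto simp: indicator_def exp_minus field_simps)
  also have "\<dots> = ennreal (Gamma b)" using Gamma_conv_nn_integral_real[OF assms] by simp
  finally show ?thesis .
qed

lemma nn_integral_gamma_law_powr:
  assumes "a > 0" "\<xi> > - a"
  shows "(\<integral>\<^sup>+x. ennreal (x powr \<xi>) \<partial>gamma_law a) = ennreal (Gamma (a + \<xi>) / Gamma a)"
proof -
  have "(\<integral>\<^sup>+x. ennreal (x powr \<xi>) \<partial>gamma_law a) = (\<integral>\<^sup>+x. gamma_density a x * ennreal (x powr \<xi>) \<partial>lborel)"
    by (intro nn_integral_gamma_law) simp
  also have "\<dots> = (\<integral>\<^sup>+x. ennreal (1 / Gamma a) * ennreal (if x > 0 then x powr (a + \<xi> - 1) * exp (- x) else 0) \<partial>lborel)"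
    using assms Gamma_real_pos[of a]
    by (intro nn_integral_cong)
       (auto simp: gamma_density_def powr_add powr_diff field_simps ennreal_mult'[symmetric])
  also have "\<dots> = ennreal (1 / Gamma a) * ennreal (Gamma (a + \<xi>))"
    using assms by (subst nn_integral_cmult) (simp_all add: nn_integral_Gamma)
  also have "\<dots> = ennreal (Gamma (a + \<xi>) / Gamma a)"
    using assms Gamma_real_pos[of a] Gamma_real_pos[of "a + \<xi>"] by (simp add: ennreal_mult'[symmetric])
  finally show ?thesis .
qed

definition gker :: "real \<Rightarrow> real \<Rightarrow> real" where
  "gker a x = (if x > 0 then x powr (a - 1) * exp (- x) else 0)"

lemma gker_measurable [measurable]: "gker a \<in> borel_measurable borel"
  unfolding gker_def by measurable

lemma gker_nonneg [simp]: "gker a x \<ge> 0"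
  by (simp add: gker_def)

text \<open>The unnormalised beta density, which is the law of the fraction u / (u + v) for
  independent gamma variables u and v.\<close>

definition bker :: "real \<Rightarrow> real \<Rightarrow> real \<Rightarrow> real" where
  "bker a b x = (if 0 < x \<and> x < 1 then x powr (a - 1) * (1 - x) powr (b - 1) else 0)"

lemma bker_measurable [measurable]: "bker a b \<in> borel_measurable borel"
  unfolding bker_def by measurable

lemma bker_nonneg [simp]: "bker a b x \<ge> 0"
  by (simp add: bker_def)

text \<open>Change of variables u = w x, v = w (1 - x) with Jacobian w. The kernel factorises into a
  gamma kernel of the sum w and a beta kernel of the fraction x, which is their
  independence.\<close>

lemma gker_polar:
  fixes f :: "real \<Rightarrow> real \<Rightarrow> ennreal"
  assumes [measurable]: "case_prod f \<in> borel_measurable (borel \<Otimes>\<^sub>M borel)"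
  shows "(\<integral>\<^sup>+u. \<integral>\<^sup>+v. ennreal (gker a u * gker b v) * f u v \<partial>lborel \<partial>lborel) =
    (\<integral>\<^sup>+w. \<integral>\<^sup>+x. ennreal (gker (a + b) w * bker a b x) * f (w * x) (w * (1 - x)) \<partial>lborel \<partial>lborel)"
proof -
  have f [measurable]: "(\<lambda>x. f (g x) (h x)) \<in> borel_measurable N"
    if [measurable]: "g \<in> borel_measurable N" "h \<in> borel_measurable N" for g h and N :: "'z measure"
    using measurable_compose[OF measurable_Pair[OF that] assms] by simp
  have "(\<integral>\<^sup>+u. \<integral>\<^sup>+v. ennreal (gker a u * gker b v) * f u v \<partial>lborel \<partial>lborel) =
     (\<integral>\<^sup>+u. \<integral>\<^sup>+w. ennreal (gker a u * gker b (w - u)) * f u (w - u) \<partial>lborel \<partial>lborel)"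
  proof (rule nn_integral_cong)
    fix u :: real
    show "(\<integral>\<^sup>+v. ennreal (gker a u * gker b v) * f u v \<partial>lborel) =
      (\<integral>\<^sup>+w. ennreal (gker a u * gker b (w - u)) * f u (w - u) \<partial>lborel)"
      by (subst nn_integral_real_affine[where c=1 and t="-u"]) simp_all
  qed
  also have "\<dots> = (\<integral>\<^sup>+w. \<integral>\<^sup>+u. ennreal (gker a u * gker b (w - u)) * f u (w - u) \<partial>lborel \<partial>lborel)"
    by (rule lborel_pair.Fubini') measurable
  also have "\<dots> = (\<integral>\<^sup>+w. \<integral>\<^sup>+x. ennreal (gker (a + b) w * bker a b x) * f (w * x) (w * (1 - x)) \<partial>lborel \<partial>lborel)"
  proof (rule nn_integral_cong)
    fix w :: real
    show "(\<integral>\<^sup>+u. ennreal (gker a u * gker b (w - u)) * f u (w - u) \<partial>lborel) =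
      (\<integral>\<^sup>+x. ennreal (gker (a + b) w * bker a b x) * f (w * x) (w * (1 - x)) \<partial>lborel)"
    proof (cases "w > 0")
      case False
      \<comment> \<open>For w <= 0 the numbers u and w - u cannot both be positive.\<close>
      then have z: "ennreal (gker a u * gker b (w - u)) = 0" for u by (auto simp: gker_def)
      have "gker (a + b) w = 0" using False by (auto simp: gker_def)
      then show ?thesis unfolding z by simp
    next
      case True
      have "(\<integral>\<^sup>+u. ennreal (gker a u * gker b (w - u)) * f u (w - u) \<partial>lborel) =
        ennreal \<bar>w\<bar> * (\<integral>\<^sup>+x. ennreal (gker a (w * x) * gker b (w - w * x)) * f (w * x) (w - w * x) \<partial>lborel)"
        using True by (subst nn_integral_real_affine[where c=w and t=0]) simp_all
      also have "\<dots> = (\<integral>\<^sup>+x. ennreal \<bar>w\<bar> * (ennreal (gker a (w * x) * gker b (w - w * x)) * f (w * x) (w - w * x)) \<partial>lborel)"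
        by (subst nn_integral_cmult) simp_all
      also have "\<dots> = (\<integral>\<^sup>+x. ennreal (gker (a + b) w * bker a b x) * f (w * x) (w * (1 - x)) \<partial>lborel)"
      proof (intro nn_integral_cong)
        fix x :: real
        have iff: "w - w * x > 0 \<longleftrightarrow> x < 1" "w * x > 0 \<longleftrightarrow> x > 0"
          using True by (simp_all add: zero_less_mult_iff)
        have "w * (gker a (w * x) * gker b (w - w * x)) = gker (a + b) w * bker a b x"
        proof (cases "0 < x \<and> x < 1")
          case x: True
          have e: "w - w * x = w * (1 - x)" by (simp add: algebra_simps)
          have "w * (gker a (w * x) * gker b (w - w * x)) =
             w * ((w * x) powr (a - 1) * exp (- (w * x)) * ((w * (1 - x)) powr (b - 1) * exp (- (w - w * x))))"
            using x iff by (simp add: gker_def e)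
          also have "\<dots> = (w powr 1 * w powr (a - 1) * w powr (b - 1)) * (x powr (a - 1) * (1 - x) powr (b - 1)) * (exp (- (w * x)) * exp (- (w - w * x)))"
            using x True by (simp add: powr_mult)
          also have "exp (- (w * x)) * exp (- (w - w * x)) = exp (- w)"
            by (simp add: exp_add[symmetric])
          also have "w powr 1 * w powr (a - 1) * w powr (b - 1) = w powr (a + b - 1)"
            using True by (simp only: powr_add[symmetric]) (simp add: algebra_simps)
          finally show ?thesis using x True by (simp add: gker_def bker_def)
        next
          case False
          then have "gker a (w * x) * gker b (w - w * x) = 0" unfolding gker_def iff by auto
          moreover have "bker a b x = 0" using False by (auto simp: bker_def)
          ultimately show ?thesis by simp
        qed
        then have "ennreal w * ennreal (gker a (w * x) * gker b (w - w * x)) = ennreal (gker (a + b) w * bker a b x)"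
          using True by (simp add: ennreal_mult'[symmetric])
        then show "ennreal \<bar>w\<bar> * (ennreal (gker a (w * x) * gker b (w - w * x)) * f (w * x) (w - w * x)) =
          ennreal (gker (a + b) w * bker a b x) * f (w * x) (w * (1 - x))"
          using True by (simp only: abs_of_pos mult.assoc[symmetric] right_diff_distrib mult_1_right)
      qed
      finally show ?thesis .
    qed
  qed
  finally show ?thesis .
qed

text \<open>The inner integral depends on (u, v) through the fraction alone. In polar form the sum w
  integrates out to the factor \<open>Gamma (a + b)\<close>, and y takes its place.\<close>

lemma gker_Burke:
  fixes f :: "real \<Rightarrow> real \<Rightarrow> ennreal"
  assumes f[measurable]: "case_prod f \<in> borel_measurable (borel \<Otimes>\<^sub>M borel)" and "a > 0" "b > 0"
  shows "(\<integral>\<^sup>+u. \<integral>\<^sup>+v. gker a u * gker b v * (\<integral>\<^sup>+y. ennreal (gker (a + b) y) * f (y * (u / (u + v))) (y * (v / (u + v))) \<partial>lborel) \<partial>lborel \<partial>lborel) =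
    Gamma (a + b) * (\<integral>\<^sup>+u. \<integral>\<^sup>+v. ennreal (gker a u * gker b v) * f u v \<partial>lborel \<partial>lborel)"
proof -
  have f' [measurable]: "(\<lambda>x. f (g x) (h x)) \<in> borel_measurable N"
    if [measurable]: "g \<in> borel_measurable N" "h \<in> borel_measurable N" for g h and N :: "'z measure"
    using measurable_compose[OF measurable_Pair[OF that] f] by simp
  define g where "g u v = (\<integral>\<^sup>+y. ennreal (gker (a + b) y) * f (y * (u / (u + v))) (y * (v / (u + v))) \<partial>lborel)" for u v :: real
  define h where "h x = (\<integral>\<^sup>+y. ennreal (gker (a + b) y * bker a b x) * f (y * x) (y * (1 - x)) \<partial>lborel)" for x :: real
  have gm: "case_prod g \<in> borel_measurable (borel \<Otimes>\<^sub>M borel)"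
    unfolding g_def by measurable
  have hm [measurable]: "h \<in> borel_measurable borel"
    unfolding h_def by measurable
  have "(\<integral>\<^sup>+u. \<integral>\<^sup>+v. ennreal (gker a u * gker b v) * g u v \<partial>lborel \<partial>lborel) =
     (\<integral>\<^sup>+w. \<integral>\<^sup>+x. ennreal (gker (a + b) w * bker a b x) * g (w * x) (w * (1 - x)) \<partial>lborel \<partial>lborel)"
    by (rule gker_polar[OF gm])
  also have "\<dots> = (\<integral>\<^sup>+w. \<integral>\<^sup>+x. gker (a + b) w * h x \<partial>lborel \<partial>lborel)"
  proof (intro nn_integral_cong)
    fix w x :: real
    show "ennreal (gker (a + b) w * bker a b x) * g (w * x) (w * (1 - x)) = gker (a + b) w * h x"
    proof (cases "w > 0")
      case True
      have "w * x / (w * x + w * (1 - x)) = x" "w * (1 - x) / (w * x + w * (1 - x)) = 1 - x"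
        using True by (simp_all add: field_simps)
      then have "ennreal (bker a b x) * g (w * x) (w * (1 - x)) =
        ennreal (bker a b x) * (\<integral>\<^sup>+y. ennreal (gker (a + b) y) * f (y * x) (y * (1 - x)) \<partial>lborel)"
        unfolding g_def by simp
      also have "\<dots> = h x"
        unfolding h_def by (subst nn_integral_cmult[symmetric]) (auto simp: ennreal_mult' mult_ac intro!: nn_integral_cong)
      finally show ?thesis by (simp add: ennreal_mult' mult.assoc)
    qed (simp add: gker_def)
  qed
  also have "\<dots> = (\<integral>\<^sup>+w. gker (a + b) w * (\<integral>\<^sup>+x. h x \<partial>lborel) \<partial>lborel)"
    by (intro nn_integral_cong nn_integral_cmult) simp
  also have "\<dots> = (\<integral>\<^sup>+w. gker (a + b) w \<partial>lborel) * (\<integral>\<^sup>+x. h x \<partial>lborel)"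
    by (intro nn_integral_multc) simp
  also have "(\<integral>\<^sup>+w. gker (a + b) w \<partial>lborel) = Gamma (a + b)"
    unfolding gker_def using assms by (intro nn_integral_Gamma) simp
  also have "(\<integral>\<^sup>+x. h x \<partial>lborel) = (\<integral>\<^sup>+w. \<integral>\<^sup>+x. ennreal (gker (a + b) w * bker a b x) * f (w * x) (w * (1 - x)) \<partial>lborel \<partial>lborel)"
    unfolding h_def by (rule lborel_pair.Fubini') measurable
  also have "\<dots> = (\<integral>\<^sup>+u. \<integral>\<^sup>+v. ennreal (gker a u * gker b v) * f u v \<partial>lborel \<partial>lborel)"
    by (rule gker_polar[symmetric, OF f])
  finally show ?thesis unfolding g_def .
qed

lemma gamma_density_gker: "gamma_density a x = gker a x / Gamma a"
  by (simp add: gamma_density_def gker_def)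

lemma prob_space_gamma_law:
  assumes "a > 0"
  shows "prob_space (gamma_law a)"
proof
  have "emeasure (gamma_law a) (space (gamma_law a)) = (\<integral>\<^sup>+x. ennreal (1 / Gamma a) * ennreal (gker a x) \<partial>lborel)"
    using Gamma_real_pos[OF assms] unfolding gamma_law_def
    by (subst emeasure_density) (auto simp: gamma_density_gker ennreal_mult'[symmetric] intro!: nn_integral_cong)
  also have "\<dots> = ennreal (1 / Gamma a) * ennreal (Gamma a)"
    using assms by (subst nn_integral_cmult) (simp_all add: gker_def nn_integral_Gamma)
  also have "\<dots> = 1"
    using Gamma_real_pos[OF assms] by (simp add: ennreal_mult'[symmetric])
  finally show "emeasure (gamma_law a) (space (gamma_law a)) = 1" .
qed

text \<open>The fraction u / (u + v) is independent of u + v, and y has the law of that sum; so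
  rescaling (u, v) to the total y leaves their joint law unchanged.\<close>

lemma gamma_law_Burke:
  fixes f :: "real \<Rightarrow> real \<Rightarrow> ennreal"
  assumes f[measurable]: "case_prod f \<in> borel_measurable (borel \<Otimes>\<^sub>M borel)" and "a > 0" "b > 0"
  shows "(\<integral>\<^sup>+u. \<integral>\<^sup>+v. \<integral>\<^sup>+y. f (y * (u / (u + v))) (y * (v / (u + v))) \<partial>gamma_law (a + b) \<partial>gamma_law b \<partial>gamma_law a) =
    (\<integral>\<^sup>+u. \<integral>\<^sup>+v. f u v \<partial>gamma_law b \<partial>gamma_law a)"
proof -
  have f' [measurable]: "(\<lambda>x. f (g x) (h x)) \<in> borel_measurable N"
    if [measurable]: "g \<in> borel_measurable N" "h \<in> borel_measurable N" for g h and N :: "'z measure"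
    using measurable_compose[OF measurable_Pair[OF that] f] by simp
  have G: "Gamma a > 0" "Gamma b > 0" "Gamma (a + b) > 0"
    using assms by (auto intro!: Gamma_real_pos)
  define k where "k c = ennreal (1 / Gamma c)" for c :: real
  have dens: "(\<integral>\<^sup>+x. g x \<partial>gamma_law c) = k c * (\<integral>\<^sup>+x. ennreal (gker c x) * g x \<partial>lborel)"
    if [measurable]: "g \<in> borel_measurable borel" and "c > 0" for g :: "real \<Rightarrow> ennreal" and c
  proof -
    have "(\<integral>\<^sup>+x. g x \<partial>gamma_law c) = (\<integral>\<^sup>+x. k c * (ennreal (gker c x) * g x) \<partial>lborel)"
      using Gamma_real_pos[OF \<open>c > 0\<close>] unfolding nn_integral_gamma_law[OF that(1)] k_def
      by (intro nn_integral_cong) (simp add: gamma_density_gker mult.assoc[symmetric] ennreal_mult'[symmetric])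
    also have "\<dots> = k c * (\<integral>\<^sup>+x. ennreal (gker c x) * g x \<partial>lborel)"
      by (intro nn_integral_cmult) simp
    finally show ?thesis .
  qed
  have two: "(\<integral>\<^sup>+u. \<integral>\<^sup>+v. g u v \<partial>gamma_law b \<partial>gamma_law a) =
    k a * k b * (\<integral>\<^sup>+u. \<integral>\<^sup>+v. ennreal (gker a u * gker b v) * g u v \<partial>lborel \<partial>lborel)"
    if g: "case_prod g \<in> borel_measurable (borel \<Otimes>\<^sub>M borel)" for g :: "real \<Rightarrow> real \<Rightarrow> ennreal"
  proof -
    have [measurable]: "(\<lambda>x. g (g' x) (h x)) \<in> borel_measurable N"
      if [measurable]: "g' \<in> borel_measurable N" "h \<in> borel_measurable N" for g' h and N :: "'z measure"
      using measurable_compose[OF measurable_Pair[OF that] g] by simp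
    have "(\<integral>\<^sup>+u. \<integral>\<^sup>+v. g u v \<partial>gamma_law b \<partial>gamma_law a) = (\<integral>\<^sup>+u. k b * (\<integral>\<^sup>+v. ennreal (gker b v) * g u v \<partial>lborel) \<partial>gamma_law a)"
      using assms by (intro nn_integral_cong dens) auto
    also have "\<dots> = k a * (\<integral>\<^sup>+u. ennreal (gker a u) * (k b * (\<integral>\<^sup>+v. ennreal (gker b v) * g u v \<partial>lborel)) \<partial>lborel)"
      using assms by (intro dens) auto
    also have "\<dots> = k a * (\<integral>\<^sup>+u. k b * (\<integral>\<^sup>+v. ennreal (gker a u) * (ennreal (gker b v) * g u v) \<partial>lborel) \<partial>lborel)"
      by (subst nn_integral_cmult) (simp_all add: mult_ac)
    also have "\<dots> = k a * (k b * (\<integral>\<^sup>+u. (\<integral>\<^sup>+v. ennreal (gker a u) * (ennreal (gker b v) * g u v) \<partial>lborel) \<partial>lborel))"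
      by (subst nn_integral_cmult) simp_all
    finally show ?thesis by (simp add: mult.assoc ennreal_mult')
  qed
  have "(\<integral>\<^sup>+u. \<integral>\<^sup>+v. \<integral>\<^sup>+y. f (y * (u / (u + v))) (y * (v / (u + v))) \<partial>gamma_law (a + b) \<partial>gamma_law b \<partial>gamma_law a) =
    (\<integral>\<^sup>+u. \<integral>\<^sup>+v. k (a + b) * (\<integral>\<^sup>+y. ennreal (gker (a + b) y) * f (y * (u / (u + v))) (y * (v / (u + v))) \<partial>lborel) \<partial>gamma_law b \<partial>gamma_law a)"
    using assms by (intro nn_integral_cong dens) auto
  also have "\<dots> = k (a + b) * (\<integral>\<^sup>+u. \<integral>\<^sup>+v. (\<integral>\<^sup>+y. ennreal (gker (a + b) y) * f (y * (u / (u + v))) (y * (v / (u + v))) \<partial>lborel) \<partial>gamma_law b \<partial>gamma_law a)"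
  proof -
    interpret B: prob_space "gamma_law b" by (rule prob_space_gamma_law[OF \<open>b > 0\<close>])
    define q where "q u v = (\<integral>\<^sup>+y. ennreal (gker (a + b) y) * f (y * (u / (u + v))) (y * (v / (u + v))) \<partial>lborel)" for u v :: real
    have qm: "case_prod q \<in> borel_measurable (borel \<Otimes>\<^sub>M borel)"
      unfolding q_def by measurable
    have [measurable]: "(\<lambda>x. q (g' x) (h x)) \<in> borel_measurable N"
      if [measurable]: "g' \<in> borel_measurable N" "h \<in> borel_measurable N" for g' h and N :: "'z measure"
      using measurable_compose[OF measurable_Pair[OF that] qm] by simp
    have "(\<integral>\<^sup>+u. \<integral>\<^sup>+v. k (a + b) * q u v \<partial>gamma_law b \<partial>gamma_law a) = (\<integral>\<^sup>+u. k (a + b) * (\<integral>\<^sup>+v. q u v \<partial>gamma_law b) \<partial>gamma_law a)"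
      by (rule nn_integral_cong) (rule nn_integral_cmult, measurable)
    also have "\<dots> = k (a + b) * (\<integral>\<^sup>+u. (\<integral>\<^sup>+v. q u v \<partial>gamma_law b) \<partial>gamma_law a)"
      by (rule nn_integral_cmult) measurable
    finally show ?thesis unfolding q_def .
  qed
  also have "\<dots> = k (a + b) * (k a * k b * (Gamma (a + b) * (\<integral>\<^sup>+u. \<integral>\<^sup>+v. ennreal (gker a u * gker b v) * f u v \<partial>lborel \<partial>lborel)))"
    by (subst two, measurable) (simp only: gker_Burke[OF f assms(2,3)])
  also have "\<dots> = (k (a + b) * Gamma (a + b)) * (k a * k b * (\<integral>\<^sup>+u. \<integral>\<^sup>+v. ennreal (gker a u * gker b v) * f u v \<partial>lborel \<partial>lborel))"
    by (simp add: mult_ac)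
  also have "k (a + b) * Gamma (a + b) = 1"
    using G by (simp add: k_def ennreal_mult'[symmetric])
  also have "1 * (k a * k b * (\<integral>\<^sup>+u. \<integral>\<^sup>+v. ennreal (gker a u * gker b v) * f u v \<partial>lborel \<partial>lborel)) = (\<integral>\<^sup>+u. \<integral>\<^sup>+v. f u v \<partial>gamma_law b \<partial>gamma_law a)"
    by (simp add: two f)
  finally show ?thesis .
qed

lemma gamma_law_Burke_prod:
  fixes f g :: "real \<Rightarrow> ennreal"
  assumes [measurable]: "f \<in> borel_measurable borel" "g \<in> borel_measurable borel" and "a > 0" "b > 0"
  shows "(\<integral>\<^sup>+u. \<integral>\<^sup>+v. \<integral>\<^sup>+y. f (y * (u / (u + v))) * g (y * (v / (u + v))) \<partial>gamma_law (a + b) \<partial>gamma_law b \<partial>gamma_law a) =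
    (\<integral>\<^sup>+u. f u \<partial>gamma_law a) * (\<integral>\<^sup>+v. g v \<partial>gamma_law b)"
proof -
  have "(\<integral>\<^sup>+u. \<integral>\<^sup>+v. \<integral>\<^sup>+y. f (y * (u / (u + v))) * g (y * (v / (u + v))) \<partial>gamma_law (a + b) \<partial>gamma_law b \<partial>gamma_law a) =
    (\<integral>\<^sup>+u. \<integral>\<^sup>+v. f u * g v \<partial>gamma_law b \<partial>gamma_law a)"
    using assms by (intro gamma_law_Burke[where f="\<lambda>u v. f u * g v"]) measurable
  also have "\<dots> = (\<integral>\<^sup>+u. f u * (\<integral>\<^sup>+v. g v \<partial>gamma_law b) \<partial>gamma_law a)"
    by (intro nn_integral_cong nn_integral_cmult) simp
  also have "\<dots> = (\<integral>\<^sup>+u. f u \<partial>gamma_law a) * (\<integral>\<^sup>+v. g v \<partial>gamma_law b)"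
    by (intro nn_integral_multc) simp
  finally show ?thesis .
qed

section \<open>Families of independent gamma variables under one Burke step\<close>

context prob_space begin

definition gamma_family :: "'i set \<Rightarrow> ('i \<Rightarrow> 'a \<Rightarrow> real) \<Rightarrow> ('i \<Rightarrow> real) \<Rightarrow> bool" where
  "gamma_family I F par \<longleftrightarrow> indep_vars (\<lambda>_. borel) F I \<and> (\<forall>i\<in>I. distr M borel (F i) = gamma_law (par i))"

lemma gamma_family_rv: "gamma_family I F par \<Longrightarrow> i \<in> I \<Longrightarrow> F i \<in> borel_measurable M"
  by (auto simp: gamma_family_def indep_vars_def)

lemma gamma_family_subset: "gamma_family I F par \<Longrightarrow> J \<subseteq> I \<Longrightarrow> gamma_family J F par"
  by (auto simp: gamma_family_def intro: indep_vars_subset)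

lemma gamma_family_cong:
  "(\<And>i. i \<in> I \<Longrightarrow> F i = G i) \<Longrightarrow> gamma_family I F par \<longleftrightarrow> gamma_family I G par"
  using indep_vars_cong[of I I F G "\<lambda>_. borel" "\<lambda>_. borel"] by (simp add: gamma_family_def)

lemma gamma_family_nn_integral:
  assumes F: "gamma_family I F par" and S: "finite S" "S \<subseteq> I" "S \<noteq> {}"
    and [measurable]: "H \<in> borel_measurable (PiM S (\<lambda>_. borel))"
  shows "(\<integral>\<^sup>+\<omega>. H (\<lambda>i\<in>S. F i \<omega>) \<partial>M) = (\<integral>\<^sup>+w. H w \<partial>PiM S (\<lambda>i. gamma_law (par i)))"
proof -
  have rv: "F i \<in> borel_measurable M" if "i \<in> S" for i
    using gamma_family_rv[OF F] that S by auto
  have "indep_vars (\<lambda>_. borel) F S"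
    using F S by (auto simp: gamma_family_def intro: indep_vars_subset)
  then have "distr M (PiM S (\<lambda>_. borel)) (\<lambda>\<omega>. \<lambda>i\<in>S. F i \<omega>) = PiM S (\<lambda>i. distr M borel (F i))"
    using rv by (subst (asm) indep_vars_iff_distr_eq_PiM'[OF S(3)]) auto
  also have "\<dots> = PiM S (\<lambda>i. gamma_law (par i))"
    using F S by (intro PiM_cong) (auto simp: gamma_family_def)
  finally have "(\<integral>\<^sup>+w. H w \<partial>PiM S (\<lambda>i. gamma_law (par i))) = (\<integral>\<^sup>+w. H w \<partial>distr M (PiM S (\<lambda>_. borel)) (\<lambda>\<omega>. \<lambda>i\<in>S. F i \<omega>))"
    by simp
  also have "\<dots> = (\<integral>\<^sup>+\<omega>. H (\<lambda>i\<in>S. F i \<omega>) \<partial>M)"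
    using rv by (subst nn_integral_distr) (auto intro!: measurable_restrict)
  finally show ?thesis ..
qed

lemma gamma_family_one:
  assumes F: "gamma_family I F par" and "i \<in> I" and [measurable]: "f \<in> borel_measurable borel"
  shows "(\<integral>\<^sup>+\<omega>. f (F i \<omega>) \<partial>M) = (\<integral>\<^sup>+x. f x \<partial>gamma_law (par i))"
proof -
  have [measurable]: "F i \<in> borel_measurable M" using gamma_family_rv[OF F] assms by auto
  have "gamma_law (par i) = distr M borel (F i)" using F assms by (auto simp: gamma_family_def)
  then show ?thesis by (simp add: nn_integral_distr)
qed

text \<open>One Burke step: a and b receive the parts of \<open>F c\<close> in the proportion of
  \<open>F a\<close> to \<open>F b\<close>. The value at c is left in place but is spent, since it
  is no longer independent of the new ones.\<close>

definition burke_update :: "'i \<Rightarrow> 'i \<Rightarrow> 'i \<Rightarrow> ('i \<Rightarrow> 'a \<Rightarrow> real) \<Rightarrow> 'i \<Rightarrow> 'a \<Rightarrow> real" where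
  "burke_update a b c F = F(a := \<lambda>\<omega>. F c \<omega> * (F a \<omega> / (F a \<omega> + F b \<omega>)), b := \<lambda>\<omega>. F c \<omega> * (F b \<omega> / (F a \<omega> + F b \<omega>)))"

text \<open>With the remaining labels fixed, integrating over a, b and c is an instance of
  \<open>gamma_law_Burke_prod\<close>; the remaining labels contribute a product integral.\<close>

lemma burke_update_integral:
  assumes F: "gamma_family I F par" and par: "\<And>i. par i > 0"
    and abc: "a \<in> I" "b \<in> I" "c \<in> I" "a \<noteq> b" "a \<noteq> c" "b \<noteq> c" "par c = par a + par b"
    and R: "finite R" "R \<subseteq> I - {a, b, c}"
    and fm [measurable]: "\<And>i. f i \<in> borel_measurable borel"
  shows "(\<integral>\<^sup>+\<omega>. f a (burke_update a b c F a \<omega>) * f b (burke_update a b c F b \<omega>) * (\<Prod>i\<in>R. f i (burke_update a b c F i \<omega>)) \<partial>M) =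
    (\<integral>\<^sup>+x. f a x \<partial>gamma_law (par a)) * (\<integral>\<^sup>+x. f b x \<partial>gamma_law (par b)) * (\<Prod>i\<in>R. \<integral>\<^sup>+x. f i x \<partial>gamma_law (par i))"
proof -
  interpret G: product_sigma_finite "\<lambda>i. gamma_law (par i)"
    unfolding product_sigma_finite_def by (auto intro!: prob_space_imp_sigma_finite prob_space_gamma_law par)
  define h where "h u v y = f a (y * (u / (u + v))) * f b (y * (v / (u + v)))" for u v y :: real
  define S where "S = insert c (insert b (insert a R))"
  define H where "H w = h (w a) (w b) (w c) * (\<Prod>i\<in>R. f i (w i))" for w
  have S: "a \<in> S" "b \<in> S" "c \<in> S" "R \<subseteq> S" "finite S" "S \<subseteq> I" "S \<noteq> {}"
    using abc R by (auto simp: S_def)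
  have "(\<lambda>w. w i) \<in> borel_measurable (PiM S (\<lambda>_. borel))" if "i \<in> S" for i
    using that by simp
  note [measurable] = this[OF S(1)] this[OF S(2)] this[OF S(3)]
  have [measurable]: "(\<lambda>w. f i (w i)) \<in> borel_measurable (PiM S (\<lambda>_. borel))" if "i \<in> R" for i
  proof -
    have [measurable]: "(\<lambda>w. w i) \<in> borel_measurable (PiM S (\<lambda>_. borel))"
      using that S by (intro measurable_component_singleton) auto
    show ?thesis by measurable
  qed
  have Hm: "H \<in> borel_measurable (PiM S (\<lambda>_. borel))"
    unfolding H_def h_def by measurable
  then have Hm': "H \<in> borel_measurable (PiM S (\<lambda>i. gamma_law (par i)))"
    by (simp cong: measurable_cong_sets sets_PiM_cong)
  have hm: "(\<lambda>y. h u v y) \<in> borel_measurable borel" for u v unfolding h_def by measurable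
  have Ra: "a \<notin> R" "b \<notin> insert a R" "c \<notin> insert b (insert a R)" using abc R by auto
  have "(\<integral>\<^sup>+\<omega>. f a (burke_update a b c F a \<omega>) * f b (burke_update a b c F b \<omega>) * (\<Prod>i\<in>R. f i (burke_update a b c F i \<omega>)) \<partial>M) =
    (\<integral>\<^sup>+\<omega>. H (\<lambda>i\<in>S. F i \<omega>) \<partial>M)"
  proof (rule nn_integral_cong)
    fix \<omega>
    have "(\<Prod>i\<in>R. f i (burke_update a b c F i \<omega>)) = (\<Prod>i\<in>R. f i ((\<lambda>i\<in>S. F i \<omega>) i))"
      using Ra S by (intro prod.cong) (auto simp: burke_update_def)
    then show "f a (burke_update a b c F a \<omega>) * f b (burke_update a b c F b \<omega>) * (\<Prod>i\<in>R. f i (burke_update a b c F i \<omega>)) = H (\<lambda>i\<in>S. F i \<omega>)"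
      unfolding H_def h_def using S abc by (simp add: burke_update_def)
  qed
  also have "\<dots> = (\<integral>\<^sup>+w. H w \<partial>PiM S (\<lambda>i. gamma_law (par i)))"
    using gamma_family_nn_integral[OF F _ _ _ Hm] S by auto
  \<comment> \<open>The order of integration is that of \<open>gamma_law_Burke\<close>, with the
    spent label c innermost.\<close>
  also have "\<dots> = (\<integral>\<^sup>+w. (\<integral>\<^sup>+u. \<integral>\<^sup>+v. \<integral>\<^sup>+y. H (w(a := u, b := v, c := y)) \<partial>gamma_law (par c) \<partial>gamma_law (par b) \<partial>gamma_law (par a)) \<partial>PiM R (\<lambda>i. gamma_law (par i)))"
  proof -
    have 1: "(\<integral>\<^sup>+w. H w \<partial>PiM S (\<lambda>i. gamma_law (par i))) =
        (\<integral>\<^sup>+w. \<integral>\<^sup>+y. H (w(c := y)) \<partial>gamma_law (par c) \<partial>PiM (insert b (insert a R)) (\<lambda>i. gamma_law (par i)))"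
      unfolding S_def using R Ra Hm' by (intro G.product_nn_integral_insert) (auto simp: S_def)
    define H1 where "H1 w = (\<integral>\<^sup>+y. H (w(c := y)) \<partial>gamma_law (par c))" for w
    have H1m: "H1 \<in> borel_measurable (PiM (insert b (insert a R)) (\<lambda>i. gamma_law (par i)))"
      using sigma_finite_measure.borel_measurable_nn_integral_fst[OF G.sigma_finite_measures
          measurable_compose[OF measurable_add_dim Hm'[unfolded S_def]]]
      by (simp add: H1_def[abs_def])
    have 2: "(\<integral>\<^sup>+w. H1 w \<partial>PiM (insert b (insert a R)) (\<lambda>i. gamma_law (par i))) =
        (\<integral>\<^sup>+w. \<integral>\<^sup>+v. H1 (w(b := v)) \<partial>gamma_law (par b) \<partial>PiM (insert a R) (\<lambda>i. gamma_law (par i)))"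
      using R Ra H1m by (intro G.product_nn_integral_insert) auto
    define H2 where "H2 w = (\<integral>\<^sup>+v. H1 (w(b := v)) \<partial>gamma_law (par b))" for w
    have H2m: "H2 \<in> borel_measurable (PiM (insert a R) (\<lambda>i. gamma_law (par i)))"
      using sigma_finite_measure.borel_measurable_nn_integral_fst[OF G.sigma_finite_measures
          measurable_compose[OF measurable_add_dim H1m]]
      by (simp add: H2_def[abs_def])
    have 3: "(\<integral>\<^sup>+w. H2 w \<partial>PiM (insert a R) (\<lambda>i. gamma_law (par i))) =
        (\<integral>\<^sup>+w. \<integral>\<^sup>+u. H2 (w(a := u)) \<partial>gamma_law (par a) \<partial>PiM R (\<lambda>i. gamma_law (par i)))"
      using R Ra H2m by (intro G.product_nn_integral_insert) auto
    show ?thesis using 1 2 3 unfolding H1_def H2_def by simp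
  qed
  also have "\<dots> = (\<integral>\<^sup>+w. (\<integral>\<^sup>+x. f a x \<partial>gamma_law (par a)) * (\<integral>\<^sup>+x. f b x \<partial>gamma_law (par b)) * (\<Prod>i\<in>R. f i (w i)) \<partial>PiM R (\<lambda>i. gamma_law (par i)))"
  proof (rule nn_integral_cong)
    fix w
    have e: "H (w(a := u, b := v, c := y)) = h u v y * (\<Prod>i\<in>R. f i (w i))" for u v y
    proof -
      have "(\<Prod>i\<in>R. f i ((w(a := u, b := v, c := y)) i)) = (\<Prod>i\<in>R. f i (w i))"
        using Ra by (intro prod.cong) auto
      then show ?thesis using abc by (simp add: H_def)
    qed
    define P where "P = (\<Prod>i\<in>R. f i (w i))"
    interpret Gc: sigma_finite_measure "gamma_law (par a + par b)" using G.sigma_finite_measures[of c] abc by simp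
    interpret Gb: sigma_finite_measure "gamma_law (par b)" by (rule G.sigma_finite_measures)
    have "(\<integral>\<^sup>+u. \<integral>\<^sup>+v. \<integral>\<^sup>+y. h u v y * P \<partial>gamma_law (par a + par b) \<partial>gamma_law (par b) \<partial>gamma_law (par a)) =
      (\<integral>\<^sup>+u. \<integral>\<^sup>+v. (\<integral>\<^sup>+y. h u v y \<partial>gamma_law (par a + par b)) * P \<partial>gamma_law (par b) \<partial>gamma_law (par a))"
      using hm by (intro nn_integral_cong nn_integral_multc) (simp cong: measurable_cong_sets)
    also have "\<dots> = (\<integral>\<^sup>+u. (\<integral>\<^sup>+v. (\<integral>\<^sup>+y. h u v y \<partial>gamma_law (par a + par b)) \<partial>gamma_law (par b)) * P \<partial>gamma_law (par a))"
      by (intro nn_integral_cong nn_integral_multc) (simp add: h_def)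
    also have "\<dots> = (\<integral>\<^sup>+u. (\<integral>\<^sup>+v. (\<integral>\<^sup>+y. h u v y \<partial>gamma_law (par a + par b)) \<partial>gamma_law (par b)) \<partial>gamma_law (par a)) * P"
      by (intro nn_integral_multc) (simp add: h_def)
    also have "\<dots> = (\<integral>\<^sup>+x. f a x \<partial>gamma_law (par a)) * (\<integral>\<^sup>+x. f b x \<partial>gamma_law (par b)) * P"
      unfolding h_def using par by (subst gamma_law_Burke_prod) auto
    finally show "(\<integral>\<^sup>+u. \<integral>\<^sup>+v. \<integral>\<^sup>+y. H (w(a := u, b := v, c := y)) \<partial>gamma_law (par c) \<partial>gamma_law (par b) \<partial>gamma_law (par a)) =
       (\<integral>\<^sup>+x. f a x \<partial>gamma_law (par a)) * (\<integral>\<^sup>+x. f b x \<partial>gamma_law (par b)) * (\<Prod>i\<in>R. f i (w i))"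
      unfolding e P_def abc(7) .
  qed
  also have "\<dots> = (\<integral>\<^sup>+x. f a x \<partial>gamma_law (par a)) * (\<integral>\<^sup>+x. f b x \<partial>gamma_law (par b)) * (\<integral>\<^sup>+w. (\<Prod>i\<in>R. f i (w i)) \<partial>PiM R (\<lambda>i. gamma_law (par i)))"
  proof (rule nn_integral_cmult)
    have "(\<lambda>w. \<Prod>i\<in>R. f i (w i)) \<in> borel_measurable (PiM R (\<lambda>_. borel))" by measurable
    then show "(\<lambda>w. \<Prod>i\<in>R. f i (w i)) \<in> borel_measurable (PiM R (\<lambda>i. gamma_law (par i)))"
      by (simp cong: measurable_cong_sets sets_PiM_cong)
  qed
  also have "(\<integral>\<^sup>+w. (\<Prod>i\<in>R. f i (w i)) \<partial>PiM R (\<lambda>i. gamma_law (par i))) = (\<Prod>i\<in>R. \<integral>\<^sup>+x. f i x \<partial>gamma_law (par i))"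
    using R fm by (intro G.product_nn_integral_prod) (auto cong: measurable_cong_sets)
  finally show ?thesis .
qed

text \<open>Integrals of product test functions determine both the marginal laws and the
  independence; indicators are the factors in the end.\<close>

lemma gamma_family_burke_update:
  assumes F: "gamma_family I F par" and par: "\<And>i. par i > 0"
    and abc: "a \<in> I" "b \<in> I" "c \<in> I" "a \<noteq> b" "a \<noteq> c" "b \<noteq> c" "par c = par a + par b"
  shows "gamma_family (I - {c}) (burke_update a b c F) par"
proof -
  let ?F = "burke_update a b c F"
  have rvF: "F i \<in> borel_measurable M" if "i \<in> I" for i using gamma_family_rv[OF F that] .
  note [measurable] = rvF[OF abc(1)] rvF[OF abc(2)] rvF[OF abc(3)]
  have rv: "?F i \<in> borel_measurable M" if "i \<in> I - {c}" for i
    using rvF[of i] that by (auto simp: burke_update_def)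
  have core: "(\<integral>\<^sup>+\<omega>. (\<Prod>i\<in>J. f i (?F i \<omega>)) \<partial>M) = (\<Prod>i\<in>J. \<integral>\<^sup>+x. f i x \<partial>gamma_law (par i))"
    if J: "finite J" "J \<subseteq> I - {c}" and fm: "\<And>i. f i \<in> borel_measurable borel" for J and f :: "_ \<Rightarrow> real \<Rightarrow> ennreal"
  proof -
    \<comment> \<open>Padding with the constant 1 covers the sets J that do not contain a or
      b.\<close>
    define g where "g i = (if i \<in> J then f i else (\<lambda>_. 1))" for i
    have gm: "g i \<in> borel_measurable borel" for i using fm by (auto simp: g_def)
    have P: "(\<Prod>i\<in>J. q i) = q' a * q' b * (\<Prod>i\<in>J - {a, b}. q' i)" if "\<And>i. i \<in> J \<Longrightarrow> q i = q' i" "\<And>i. i \<notin> J \<Longrightarrow> q' i = 1" for q q' :: "_ \<Rightarrow> ennreal"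
    proof -
      have "(\<Prod>i\<in>J. q i) = (\<Prod>i\<in>insert a (insert b (J - {a, b})). q' i)"
        using J that by (intro prod.mono_neutral_cong_left) auto
      also have "\<dots> = q' a * q' b * (\<Prod>i\<in>J - {a, b}. q' i)"
        using J abc by (simp add: mult.assoc)
      finally show ?thesis .
    qed
    have one: "emeasure (gamma_law (par i)) UNIV = 1" for i
      using prob_space.emeasure_space_1[OF prob_space_gamma_law[OF par[of i]]] by simp
    have "(\<integral>\<^sup>+\<omega>. (\<Prod>i\<in>J. f i (?F i \<omega>)) \<partial>M) = (\<integral>\<^sup>+\<omega>. g a (?F a \<omega>) * g b (?F b \<omega>) * (\<Prod>i\<in>J - {a, b}. g i (?F i \<omega>)) \<partial>M)"
      by (intro nn_integral_cong P) (auto simp: g_def)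
    also have "\<dots> = (\<integral>\<^sup>+x. g a x \<partial>gamma_law (par a)) * (\<integral>\<^sup>+x. g b x \<partial>gamma_law (par b)) * (\<Prod>i\<in>J - {a, b}. \<integral>\<^sup>+x. g i x \<partial>gamma_law (par i))"
      using J by (intro burke_update_integral[OF F par abc] gm) auto
    also have "\<dots> = (\<Prod>i\<in>J. \<integral>\<^sup>+x. f i x \<partial>gamma_law (par i))"
      by (rule P[symmetric]) (auto simp: g_def one)
    finally show ?thesis .
  qed
  have core1: "(\<integral>\<^sup>+\<omega>. f (?F i \<omega>) \<partial>M) = (\<integral>\<^sup>+x. f x \<partial>gamma_law (par i))" if "i \<in> I - {c}" "f \<in> borel_measurable borel" for i f
    using core[of "{i}" "\<lambda>_. f"] that by simp
  have law: "distr M borel (?F i) = gamma_law (par i)" if i: "i \<in> I - {c}" for i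
  proof (rule measure_eqI)
    fix A assume "A \<in> sets (distr M borel (?F i))"
    then have [measurable]: "A \<in> sets borel" by simp
    have "emeasure (distr M borel (?F i)) A = (\<integral>\<^sup>+x. indicator A x \<partial>distr M borel (?F i))" by simp
    also have "\<dots> = (\<integral>\<^sup>+\<omega>. indicator A (?F i \<omega>) \<partial>M)"
      using rv[OF i] by (intro nn_integral_distr) auto
    also have "\<dots> = emeasure (gamma_law (par i)) A" using core1[OF i, of "indicator A"] by simp
    finally show "emeasure (distr M borel (?F i)) A = emeasure (gamma_law (par i)) A" .
  qed simp
  have "indep_sets (\<lambda>i. {?F i -` A \<inter> space M |A. A \<in> sets borel}) (I - {c})"
  proof (rule indep_setsI)
    fix i assume "i \<in> I - {c}"
    then show "{?F i -` A \<inter> space M |A. A \<in> sets borel} \<subseteq> events"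
      using rv by (auto intro: measurable_sets)
  next
    fix B J assume J: "J \<noteq> {}" "J \<subseteq> I - {c}" "finite J" and B: "\<forall>j\<in>J. B j \<in> {?F j -` A \<inter> space M |A. A \<in> sets borel}"
    then obtain A where A: "\<And>j. j \<in> J \<Longrightarrow> A j \<in> sets borel \<and> B j = ?F j -` A j \<inter> space M"
      by simp metis
    define A' where "A' j = (if j \<in> J then A j else UNIV)" for j
    have A': "A' j \<in> sets borel" for j using A by (auto simp: A'_def)
    have BA: "B j = ?F j -` A' j \<inter> space M" if "j \<in> J" for j using A that by (simp add: A'_def)
    have Bm: "B j \<in> events" if "j \<in> J" for j
      unfolding BA[OF that] using that J A' by (intro measurable_sets[OF rv]) auto
    have "ennreal (prob (\<Inter>j\<in>J. B j)) = emeasure M (\<Inter>j\<in>J. B j)" by (simp add: emeasure_eq_measure)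
    also have "\<dots> = (\<integral>\<^sup>+\<omega>. indicator (\<Inter>j\<in>J. B j) \<omega> \<partial>M)"
      using J Bm by (subst nn_integral_indicator) auto
    also have "\<dots> = (\<integral>\<^sup>+\<omega>. (\<Prod>j\<in>J. indicator (A' j) (?F j \<omega>)) \<partial>M)"
    proof (rule nn_integral_cong)
      fix \<omega> assume "\<omega> \<in> space M"
      then have "indicator (A' j) (?F j \<omega>) = (indicator (B j) \<omega> :: ennreal)" if "j \<in> J" for j
        using BA[OF that] by (auto simp: indicator_def)
      then have "(\<Prod>j\<in>J. indicator (A' j) (?F j \<omega>)) = (\<Prod>j\<in>J. indicator (B j) \<omega> :: ennreal)"
        by (intro prod.cong) auto
      also have "\<dots> = indicator (\<Inter>j\<in>J. B j) \<omega>"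
      proof (cases "\<forall>j\<in>J. \<omega> \<in> B j")
        case False
        then show ?thesis using J(3) by (auto simp: indicator_def intro!: prod_zero)
      qed (use J in auto)
      finally show "indicator (\<Inter>j\<in>J. B j) \<omega> = (\<Prod>j\<in>J. indicator (A' j) (?F j \<omega>) :: ennreal)" ..
    qed
    also have "\<dots> = (\<Prod>j\<in>J. \<integral>\<^sup>+x. indicator (A' j) x \<partial>gamma_law (par j))"
      using A' J by (intro core) auto
    also have "\<dots> = (\<Prod>j\<in>J. ennreal (prob (B j)))"
    proof (rule prod.cong)
      fix j assume j: "j \<in> J"
      then have jj: "j \<in> I - {c}" using J by auto
      have "(\<integral>\<^sup>+x. indicator (A' j) x \<partial>gamma_law (par j)) = emeasure (distr M borel (?F j)) (A' j)"
        using A'[of j] by (simp add: law[OF jj])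
      also have "\<dots> = ennreal (prob (B j))"
        using BA[OF j] rv[OF jj] A' by (subst emeasure_distr) (auto simp: emeasure_eq_measure)
      finally show "(\<integral>\<^sup>+x. indicator (A' j) x \<partial>gamma_law (par j)) = ennreal (prob (B j))" .
    qed simp
    also have "\<dots> = ennreal (\<Prod>j\<in>J. prob (B j))" by (simp add: prod_ennreal)
    finally show "prob (\<Inter>j\<in>J. B j) = (\<Prod>j\<in>J. prob (B j))" by (simp add: prod_nonneg)
  qed
  then show ?thesis using rv law by (auto simp: gamma_family_def indep_vars_def2)
qed

end

section \<open>Environments with independent inverse gamma weights\<close>

text \<open>The finite branch of \<open>log_gamma_mgf\<close> as a real number: the logarithm of the
  \<xi>-th moment of an inverse gamma weight.\<close>

definition lgm :: "real \<Rightarrow> real \<Rightarrow> real" where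
  "lgm \<nu> \<xi> = ln (Gamma (\<nu> - \<xi>)) - ln (Gamma \<nu>)"

lemma exp_lgm: "\<nu> > 0 \<Longrightarrow> \<xi> < \<nu> \<Longrightarrow> exp (lgm \<nu> \<xi>) = Gamma (\<nu> - \<xi>) / Gamma \<nu>"
  by (simp add: lgm_def exp_diff)

text \<open>The sites whose weights enter \<open>pf (shift a b w) m n\<close>. Because the corner is
  left out, a rectangle and another one starting at its far corner are disjoint, hence
  independent.\<close>

definition sites :: "nat \<Rightarrow> nat \<Rightarrow> nat \<Rightarrow> nat \<Rightarrow> (nat \<times> nat) set" where
  "sites a b m n = {a..a + m} \<times> {b..b + n} - {(a, b)}"

lemma pf_cong: "(\<And>p. p \<in> sites 0 0 m n \<Longrightarrow> w p = w' p) \<Longrightarrow> pf w m n = pf w' m n"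
proof (induction w m n rule: pf.induct)
  case (4 w m n)
  have "pf w m (Suc n) = pf w' m (Suc n)" by (rule 4(1)) (rule 4(3), auto simp: sites_def)
  moreover have "pf w (Suc m) n = pf w' (Suc m) n" by (rule 4(2)) (rule 4(3), auto simp: sites_def)
  ultimately show ?case using 4(3)[of "(Suc m, Suc n)"] by (simp add: sites_def)
qed (auto simp: sites_def)

lemma shift_sites: "p \<in> sites 0 0 m n \<Longrightarrow> (a + fst p, b + snd p) \<in> sites a b m n"
  by (cases p) (auto simp: sites_def)

lemma pf_shift_cong: "(\<And>p. p \<in> sites a b m n \<Longrightarrow> w p = w' p) \<Longrightarrow> pf (shift a b w) m n = pf (shift a b w') m n"
  unfolding shift_def by (rule pf_cong) (blast intro: shift_sites)

lemma pf_measurable: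
  assumes "\<And>p. p \<in> sites 0 0 m n \<Longrightarrow> (\<lambda>\<omega>. W \<omega> p) \<in> borel_measurable N"
  shows "(\<lambda>\<omega>. pf (W \<omega>) m n) \<in> borel_measurable N"
  using assms
proof (induction "m + n" arbitrary: m n rule: less_induct)
  case less
  have s: "sites 0 0 m' n' \<subseteq> sites 0 0 m n" if "m' \<le> m" "n' \<le> n" for m' n'
    using that by (auto simp: sites_def)
  have IH: "(\<lambda>\<omega>. pf (W \<omega>) m' n') \<in> borel_measurable N" if "m' \<le> m" "n' \<le> n" "m' + n' < m + n" for m' n'
    using less(1)[OF that(3)] less(2) s[OF that(1,2)] by blast
  have W: "(\<lambda>\<omega>. W \<omega> (m, n)) \<in> borel_measurable N" if "m + n > 0"
    using that by (intro less(2)) (auto simp: sites_def)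
  show ?case
  proof (cases m; cases n)
    fix m' n' assume [simp]: "m = Suc m'" "n = Suc n'"
    show ?thesis using IH[of m' n] IH[of m n'] W by simp
  next
    fix m' assume [simp]: "m = Suc m'" "n = 0"
    show ?thesis using IH[of m' n] W by simp
  next
    fix n' assume [simp]: "m = 0" "n = Suc n'"
    show ?thesis using IH[of m n'] W by simp
  qed simp
qed

text \<open>The moment \<open>E Z\<^sup>\<xi>\<close> computed on one fixed probability space, so that statements about it can be
  proved in whichever environment is convenient.\<close>

definition Zmom :: "real \<Rightarrow> nat \<Rightarrow> nat \<Rightarrow> real \<Rightarrow> ennreal" where
  "Zmom \<mu> m n \<xi> = (\<integral>\<^sup>+w. ennreal (pf (\<lambda>p. inverse (w p)) m n powr \<xi>) \<partial>PiM ({0..m} \<times> {0..n}) (\<lambda>_. gamma_law \<mu>))"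

text \<open>Used for translations, which turn an environment into an environment.\<close>

lemma (in prob_space) gamma_family_reindex:
  assumes F: "gamma_family UNIV F par" and "inj f"
  shows "gamma_family UNIV (\<lambda>i. F (f i)) (\<lambda>i. par (f i))"
proof -
  have ind: "indep_sets (\<lambda>i. {F i -` A \<inter> space M |A. A \<in> sets borel}) UNIV" and rv: "\<And>i. F i \<in> borel_measurable M"
    using F by (auto simp: gamma_family_def indep_vars_def2)
  have "indep_sets (\<lambda>i. {F (f i) -` A \<inter> space M |A. A \<in> sets borel}) UNIV"
  proof (rule indep_setsI)
    fix i show "{F (f i) -` A \<inter> space M |A. A \<in> sets borel} \<subseteq> events"
      using rv by (auto intro: measurable_sets)
  next
    fix A J assume J: "J \<noteq> {}" "J \<subseteq> UNIV" "finite J" and A: "\<forall>j\<in>J. A j \<in> {F (f j) -` A \<inter> space M |A. A \<in> sets borel}"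
    define B where "B i = A (inv f i)" for i
    have B: "B (f j) = A j" for j using \<open>inj f\<close> by (simp add: B_def)
    have "prob (\<Inter>j\<in>f ` J. B j) = (\<Prod>j\<in>f ` J. prob (B j))"
      using J A by (intro indep_setsD[OF ind]) (auto simp: B)
    then show "prob (\<Inter>j\<in>J. A j) = (\<Prod>j\<in>J. prob (A j))"
      using \<open>inj f\<close> by (simp add: B prod.reindex inj_on_subset[OF _ subset_UNIV])
  qed
  then show ?thesis using F rv by (auto simp: gamma_family_def indep_vars_def2)
qed

text \<open>Weights are positive everywhere and not just almost surely, so that pointwise estimates
  hold without an exceptional set. The parameter depends on the site to allow for special weights on
  the axes.\<close>

locale lg_env = prob_space M for M :: "'a measure" +
  fixes X :: "nat \<times> nat \<Rightarrow> 'a \<Rightarrow> real" and par :: "nat \<times> nat \<Rightarrow> real"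
  assumes family: "gamma_family UNIV (\<lambda>p \<omega>. inverse (X p \<omega>)) par"
    and par_pos: "\<And>p. par p > 0" and X_pos: "\<And>p \<omega>. X p \<omega> > 0"
begin

lemma X_rv [measurable]: "X p \<in> borel_measurable M"
  using borel_measurable_inverse[OF gamma_family_rv[OF family UNIV_I, of p]] by simp

lemma indep_X: "indep_vars (\<lambda>_. borel) X UNIV"
proof -
  have "indep_vars (\<lambda>_. borel) (\<lambda>p \<omega>. inverse (X p \<omega>)) UNIV"
    using family by (simp add: gamma_family_def)
  from indep_vars_compose2[OF this, of "\<lambda>_. inverse" "\<lambda>_. borel"]
  have "indep_vars (\<lambda>_. borel) (\<lambda>p \<omega>. inverse (inverse (X p \<omega>))) UNIV" by simp
  then show ?thesis by simp
qed

lemma moment: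
  assumes "\<xi> < par p"
  shows "(\<integral>\<^sup>+\<omega>. ennreal (X p \<omega> powr \<xi>) \<partial>M) = ennreal (exp (lgm (par p) \<xi>))"
proof -
  have "X p \<omega> powr \<xi> = inverse (X p \<omega>) powr - \<xi>" for \<omega>
    using X_pos[of p \<omega>] by (simp add: powr_minus inverse_powr)
  then have "(\<integral>\<^sup>+\<omega>. ennreal (X p \<omega> powr \<xi>) \<partial>M) = (\<integral>\<^sup>+\<omega>. ennreal (inverse (X p \<omega>) powr - \<xi>) \<partial>M)" by simp
  also have "\<dots> = (\<integral>\<^sup>+x. ennreal (x powr - \<xi>) \<partial>gamma_law (par p))"
    by (rule gamma_family_one[OF family UNIV_I, where f="\<lambda>x. ennreal (x powr - \<xi>)"]) measurable
  also have "\<dots> = ennreal (exp (lgm (par p) \<xi>))"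
    using par_pos[of p] assms by (simp add: nn_integral_gamma_law_powr exp_lgm)
  finally show ?thesis .
qed

text \<open>Were the moment a finite c, then all moments of order \<eta> < \<open>par p\<close>
  would be at most 1 + c, as x^\<eta> <= 1 + x^\<xi>. They are the quotients of
  \<open>Gamma (par p - \<eta>)\<close> by \<open>Gamma (par p)\<close>, and Gamma has a pole at
  0.\<close>

lemma moment_infinite:
  assumes "\<xi> \<ge> par p"
  shows "(\<integral>\<^sup>+\<omega>. ennreal (X p \<omega> powr \<xi>) \<partial>M) = \<infinity>"
proof (rule ccontr)
  assume "(\<integral>\<^sup>+\<omega>. ennreal (X p \<omega> powr \<xi>) \<partial>M) \<noteq> \<infinity>"
  then obtain c where c: "c \<ge> 0" "(\<integral>\<^sup>+\<omega>. ennreal (X p \<omega> powr \<xi>) \<partial>M) = ennreal c"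
    by (cases "\<integral>\<^sup>+\<omega>. ennreal (X p \<omega> powr \<xi>) \<partial>M") auto
  have a: "par p > 0" by (rule par_pos)
  have G: "Gamma \<delta> \<le> (1 + c) * Gamma (par p)" if \<delta>: "0 < \<delta>" "\<delta> < par p" for \<delta>
  proof -
    define \<eta> where "\<eta> = par p - \<delta>"
    have le: "X p \<omega> powr \<eta> \<le> 1 + X p \<omega> powr \<xi>" for \<omega>
    proof (cases "X p \<omega> \<le> 1")
      case True
      then have "X p \<omega> powr \<eta> \<le> 1" using X_pos[of p \<omega>] \<delta> by (intro powr_le1) (auto simp: \<eta>_def)
      then show ?thesis using powr_ge_zero[of "X p \<omega>" \<xi>] by linarith
    next
      case False
      then have "X p \<omega> powr \<eta> \<le> X p \<omega> powr \<xi>" using \<delta> assms by (intro powr_mono) (auto simp: \<eta>_def)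
      then show ?thesis by linarith
    qed
    have "ennreal (exp (lgm (par p) \<eta>)) = (\<integral>\<^sup>+\<omega>. ennreal (X p \<omega> powr \<eta>) \<partial>M)"
      using \<delta> by (intro moment[symmetric]) (simp add: \<eta>_def)
    also have "\<dots> \<le> (\<integral>\<^sup>+\<omega>. ennreal 1 + ennreal (X p \<omega> powr \<xi>) \<partial>M)"
      using le by (intro nn_integral_mono) (subst ennreal_plus[symmetric], auto intro!: ennreal_leI simp del: ennreal_plus)
    also have "\<dots> = ennreal (1 + c)"
    proof -
      have "(\<integral>\<^sup>+\<omega>. ennreal 1 + ennreal (X p \<omega> powr \<xi>) \<partial>M) = (\<integral>\<^sup>+\<omega>. ennreal 1 \<partial>M) + (\<integral>\<^sup>+\<omega>. ennreal (X p \<omega> powr \<xi>) \<partial>M)"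
        by (rule nn_integral_add) simp_all
      also have "\<dots> = ennreal 1 + ennreal c" unfolding c(2) by (simp add: emeasure_space_1)
      finally show ?thesis using c(1) by simp
    qed
    finally have "exp (lgm (par p) \<eta>) \<le> 1 + c" using c(1) by (subst (asm) ennreal_le_iff) auto
    moreover have "exp (lgm (par p) \<eta>) = Gamma \<delta> / Gamma (par p)"
      using \<delta> by (subst exp_lgm) (auto simp: \<eta>_def a)
    ultimately show ?thesis using Gamma_real_pos[OF a] by (simp add: divide_le_eq)
  qed
  define K where "K = (1 + c) * Gamma (par p)"
  have "filterlim Gamma at_infinity (at (0::real))" using Gamma_poles[of 0] by simp
  then have "\<forall>r>0. eventually (\<lambda>x. norm (Gamma x) \<ge> r) (at (0::real))"
    by (subst (asm) filterlim_at_infinity[of 0]) auto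
  moreover have "K + 1 > 0" using Gamma_real_pos[OF a] c(1) by (simp add: K_def add_pos_pos)
  ultimately have "eventually (\<lambda>x. norm (Gamma x) \<ge> K + 1) (at (0::real))" by blast
  then have "eventually (\<lambda>x. norm (Gamma x) \<ge> K + 1) (at_right (0::real))"
    by (rule eventually_mono[OF filter_leD[OF at_le[OF subset_UNIV]]])
  moreover have "eventually (\<lambda>x. x \<in> {0<..<par p}) (at_right (0::real))"
    using eventually_at_right_real[OF a] .
  ultimately have "eventually (\<lambda>x::real. False) (at_right 0)"
  proof eventually_elim
    case (elim x)
    then show ?case using G[of x] Gamma_real_pos[of x] by (auto simp: K_def)
  qed
  then show False by simp
qed

lemma pf_rv: "(\<lambda>\<omega>. pf (shift a b (\<lambda>p. X p \<omega>)) m n) \<in> borel_measurable M"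
  by (rule pf_measurable[where W="\<lambda>\<omega>. shift a b (\<lambda>p. X p \<omega>)"]) (simp add: shift_def)

lemma pf_rv0 [measurable]: "(\<lambda>\<omega>. pf (\<lambda>p. X p \<omega>) m n) \<in> borel_measurable M"
  using pf_rv[of 0 0] by simp

lemma pf_X_pos: "pf (shift a b (\<lambda>p. X p \<omega>)) m n > 0"
  by (rule pf_pos) (simp add: shift_def X_pos)

lemma pf_X_pos0: "pf (\<lambda>p. X p \<omega>) m n > 0"
  using pf_X_pos[of 0 0] by simp

lemma lg_env_shift: "lg_env M (shift a b X) (shift a b par)"
proof
  have "inj (\<lambda>p. (a + fst p, b + snd p))" by (auto simp: inj_def)
  from gamma_family_reindex[OF family this]
  show "gamma_family UNIV (\<lambda>p \<omega>. inverse (shift a b X p \<omega>)) (shift a b par)" by (simp add: shift_def)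
qed (auto simp: shift_def par_pos X_pos)

lemma Zmom_eq0:
  assumes "\<And>p. par p = \<mu>"
  shows "(\<integral>\<^sup>+\<omega>. ennreal (pf (\<lambda>p. X p \<omega>) m n powr \<xi>) \<partial>M) = Zmom \<mu> m n \<xi>"
proof -
  let ?S = "{0..m} \<times> {0..n}"
  define H where "H w = ennreal (pf (\<lambda>p. inverse (w p)) m n powr \<xi>)" for w
  have "(\<lambda>w. pf (\<lambda>p. inverse (w p)) m n) \<in> borel_measurable (PiM ?S (\<lambda>_. borel))"
    by (rule pf_measurable[where W="\<lambda>w p. inverse (w p)"], rule borel_measurable_inverse, rule measurable_component_singleton)
       (auto simp: sites_def)
  then have [measurable]: "H \<in> borel_measurable (PiM ?S (\<lambda>_. borel))"
    unfolding H_def by measurable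
  have "(\<integral>\<^sup>+\<omega>. ennreal (pf (\<lambda>p. X p \<omega>) m n powr \<xi>) \<partial>M) = (\<integral>\<^sup>+\<omega>. H (\<lambda>p\<in>?S. inverse (X p \<omega>)) \<partial>M)"
    unfolding H_def by (intro nn_integral_cong arg_cong[where f=ennreal] arg_cong2[where f="(powr)"] pf_cong refl)
       (auto simp: sites_def)
  also have "\<dots> = (\<integral>\<^sup>+w. H w \<partial>PiM ?S (\<lambda>p. gamma_law (par p)))"
    by (rule gamma_family_nn_integral[OF family]) auto
  finally show ?thesis by (simp add: Zmom_def H_def assms)
qed

lemma Zmom_eq:
  assumes "\<And>i j. par (a + i, b + j) = \<mu>"
  shows "(\<integral>\<^sup>+\<omega>. ennreal (pf (shift a b (\<lambda>p. X p \<omega>)) m n powr \<xi>) \<partial>M) = Zmom \<mu> m n \<xi>"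
proof -
  interpret s: lg_env M "shift a b X" "shift a b par" by (rule lg_env_shift)
  have "shift a b (\<lambda>p. X p \<omega>) = (\<lambda>p. shift a b X p \<omega>)" for \<omega> by (simp add: shift_def)
  then show ?thesis using s.Zmom_eq0[of \<mu> m n \<xi>] assms by (simp add: shift_def)
qed

text \<open>Independence is known for the restrictions of the environment to disjoint sets; the
  locality assumption \<open>loc\<close> allows the functionals to be evaluated on the full
  environment.\<close>

lemma indep_groups:
  fixes K :: "'j \<Rightarrow> (nat \<times> nat) set" and g :: "'j \<Rightarrow> (nat \<times> nat \<Rightarrow> real) \<Rightarrow> ennreal"
  assumes "finite L" "disjoint_family_on K L" "\<And>j. j \<in> L \<Longrightarrow> g j \<in> borel_measurable (PiM (K j) (\<lambda>_. borel))"
    and loc: "\<And>j w w'. j \<in> L \<Longrightarrow> (\<And>p. p \<in> K j \<Longrightarrow> w p = w' p) \<Longrightarrow> g j w = g j w'"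
  shows "(\<integral>\<^sup>+\<omega>. (\<Prod>j\<in>L. g j (\<lambda>p. X p \<omega>)) \<partial>M) = (\<Prod>j\<in>L. \<integral>\<^sup>+\<omega>. g j (\<lambda>p. X p \<omega>) \<partial>M)"
proof -
  have "indep_vars (\<lambda>j. PiM (K j) (\<lambda>_. borel)) (\<lambda>j \<omega>. restrict (\<lambda>p. X p \<omega>) (K j)) L"
    by (rule indep_vars_restrict[OF indep_X _ assms(2)]) auto
  then have "indep_vars (\<lambda>_. borel) (\<lambda>j \<omega>. g j (restrict (\<lambda>p. X p \<omega>) (K j))) L"
    by (rule indep_vars_compose2[where Y=g]) (use assms in auto)
  then have "(\<integral>\<^sup>+\<omega>. (\<Prod>j\<in>L. g j (restrict (\<lambda>p. X p \<omega>) (K j))) \<partial>M) = (\<Prod>j\<in>L. \<integral>\<^sup>+\<omega>. g j (restrict (\<lambda>p. X p \<omega>) (K j)) \<partial>M)"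
    using assms(1) by (intro indep_vars_nn_integral) auto
  moreover have "g j (restrict (\<lambda>p. X p \<omega>) (K j)) = g j (\<lambda>p. X p \<omega>)" if "j \<in> L" for j \<omega>
    by (rule loc[OF that]) simp
  ultimately show ?thesis by (simp cong: prod.cong)
qed

lemma monomial_moment:
  assumes "finite S"
  shows "(\<integral>\<^sup>+\<omega>. (\<Prod>p\<in>S. ennreal (X p \<omega> powr e p)) \<partial>M) = (\<Prod>p\<in>S. \<integral>\<^sup>+\<omega>. ennreal (X p \<omega> powr e p) \<partial>M)"
proof (rule indep_vars_nn_integral[OF assms])
  show "indep_vars (\<lambda>_. borel) (\<lambda>p \<omega>. ennreal (X p \<omega> powr e p)) S"
    using indep_vars_subset[OF indep_X subset_UNIV]
    by (rule indep_vars_compose2[where Y="\<lambda>p x. ennreal (x powr e p)"]) measurable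
qed auto

lemma pf_shift_measurable:
  assumes "sites a b m n \<subseteq> K"
  shows "(\<lambda>w. pf (shift a b w) m n) \<in> borel_measurable (PiM K (\<lambda>_. borel))"
  by (rule pf_measurable[where W="\<lambda>w. shift a b w"], unfold shift_def, rule measurable_component_singleton)
     (use assms shift_sites in blast)

lemma monomial_pf_moment:
  assumes S: "finite S" "S \<inter> sites a b m n = {}"
  shows "(\<integral>\<^sup>+\<omega>. (\<Prod>p\<in>S. ennreal (X p \<omega> powr e p)) * ennreal (pf (shift a b (\<lambda>p. X p \<omega>)) m n powr \<xi>) \<partial>M) =
    (\<Prod>p\<in>S. \<integral>\<^sup>+\<omega>. ennreal (X p \<omega> powr e p) \<partial>M) * (\<integral>\<^sup>+\<omega>. ennreal (pf (shift a b (\<lambda>p. X p \<omega>)) m n powr \<xi>) \<partial>M)"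
proof -
  define g where "g c w = (if c then (\<Prod>p\<in>S. ennreal (w p powr e p)) else ennreal (pf (shift a b w) m n powr \<xi>))" for c w
  define K where "K c = (if c then S else sites a b m n)" for c
  have "(\<integral>\<^sup>+\<omega>. (\<Prod>c\<in>UNIV. g c (\<lambda>p. X p \<omega>)) \<partial>M) = (\<Prod>c\<in>UNIV. \<integral>\<^sup>+\<omega>. g c (\<lambda>p. X p \<omega>) \<partial>M)"
  proof (rule indep_groups[where K=K])
    show "disjoint_family_on K UNIV" using S by (auto simp: disjoint_family_on_def K_def)
    fix c :: bool
    have [measurable]: "(\<lambda>w. w p) \<in> borel_measurable (PiM S (\<lambda>_. borel :: real measure))" if "p \<in> S" for p
      using that by simp
    have "g True \<in> borel_measurable (PiM S (\<lambda>_. borel))" unfolding g_def by simp measurable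
    moreover have "g False \<in> borel_measurable (PiM (sites a b m n) (\<lambda>_. borel))"
      using pf_shift_measurable[of a b m n "sites a b m n"] unfolding g_def by simp measurable
    ultimately show "g c \<in> borel_measurable (PiM (K c) (\<lambda>_. borel))" by (cases c) (auto simp: K_def)
    fix w w' :: "nat \<times> nat \<Rightarrow> real" assume "\<And>p. p \<in> K c \<Longrightarrow> w p = w' p"
    then show "g c w = g c w'"
      using pf_shift_cong[of a b m n w w'] by (cases c) (auto simp: g_def K_def intro!: prod.cong)
  qed simp
  then show ?thesis by (simp add: UNIV_bool g_def mult.commute monomial_moment[OF S(1)])
qed

end

section \<open>Existence of environments and everywhere positive versions\<close>

lemma AE_gamma_law_pos: "AE x in gamma_law a. x > 0"
  unfolding gamma_law_def by (subst AE_density) (auto simp: gamma_density_def)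

lemma (in prob_space) gamma_family_AE_pos:
  assumes "gamma_family I F par" "i \<in> I"
  shows "AE \<omega> in M. F i \<omega> > 0"
proof -
  have [measurable]: "F i \<in> borel_measurable M" by (rule gamma_family_rv[OF assms])
  have law: "distr M borel (F i) = gamma_law (par i)" using assms by (auto simp: gamma_family_def)
  have "AE x in distr M borel (F i). x > 0" unfolding law by (rule AE_gamma_law_pos)
  then show ?thesis by (subst (asm) AE_distr_iff) auto
qed

text \<open>Gamma variables are positive almost surely, so each of them is altered on a null set
  only.\<close>

lemma (in prob_space) gamma_family_positive_part:
  assumes F: "gamma_family UNIV F par"
  shows "gamma_family UNIV (\<lambda>p \<omega>. if F p \<omega> > 0 then F p \<omega> else 1) par"
proof -
  have rv [measurable]: "F p \<in> borel_measurable M" for p by (rule gamma_family_rv[OF F UNIV_I])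
  have "indep_vars (\<lambda>_. borel) F UNIV" using F by (simp add: gamma_family_def)
  from indep_vars_compose2[OF this, of "\<lambda>_ x. if x > 0 then x else 1" "\<lambda>_. borel"]
  have "indep_vars (\<lambda>_. borel) (\<lambda>p \<omega>. if F p \<omega> > 0 then F p \<omega> else 1) UNIV" by simp
  moreover have "distr M borel (\<lambda>\<omega>. if F p \<omega> > 0 then F p \<omega> else 1) = distr M borel (F p)" for p
    using gamma_family_AE_pos[OF F UNIV_I, of p] by (intro distr_cong_AE) auto
  ultimately show ?thesis using F unfolding gamma_family_def by metis
qed

lemma lg_envI:
  assumes "prob_space M" "prob_space.gamma_family M UNIV (\<lambda>p \<omega>. inverse (Y p \<omega>)) par" "\<And>p. par p > 0"
  shows "lg_env M (\<lambda>p \<omega>. if Y p \<omega> > 0 then Y p \<omega> else 1) par"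
proof -
  interpret prob_space M by fact
  \<comment> \<open>The default value 1 is its own inverse, so modifying the weights and modifying
    their inverses is the same.\<close>
  have e: "(\<lambda>p \<omega>. inverse (if Y p \<omega> > 0 then Y p \<omega> else 1)) = (\<lambda>p \<omega>. if inverse (Y p \<omega>) > 0 then inverse (Y p \<omega>) else 1)"
    by (intro ext) (simp del: inverse_eq_divide)
  show ?thesis
  proof
    show "gamma_family UNIV (\<lambda>p \<omega>. inverse (if Y p \<omega> > 0 then Y p \<omega> else 1)) par"
      unfolding e by (rule gamma_family_positive_part[OF assms(2)])
  qed (simp_all add: assms(3))
qed

lemma lg_env_exists:
  assumes par: "\<And>p. par p > 0"
  shows "\<exists>(M :: (nat \<times> nat \<Rightarrow> real) measure) X. lg_env M X par"
proof -
  define P where "P = PiM UNIV (\<lambda>p :: nat \<times> nat. gamma_law (par p))"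
  interpret G: product_prob_space "\<lambda>p. gamma_law (par p)" UNIV
    by (intro product_prob_spaceI prob_space_gamma_law par)
  interpret P: prob_space P unfolding P_def by (rule G.prob_space_axioms)
  have rv: "(\<lambda>w. w p) \<in> borel_measurable P" for p
    using measurable_component_singleton[of p UNIV "\<lambda>p. gamma_law (par p)"] by (simp add: P_def cong: measurable_cong_sets)
  have law: "distr P borel (\<lambda>w. w p) = gamma_law (par p)" for p
  proof -
    have "distr P borel (\<lambda>w. w p) = distr P (gamma_law (par p)) (\<lambda>w. w p)" by (rule distr_cong) auto
    also have "\<dots> = gamma_law (par p)" unfolding P_def by (rule G.PiM_component) simp
    finally show ?thesis .
  qed
  have sP: "sets P = sets (PiM UNIV (\<lambda>_::nat \<times> nat. borel :: real measure))"
    unfolding P_def by (rule sets_PiM_cong) auto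
  have "distr P (PiM UNIV (\<lambda>_. borel)) (\<lambda>w. \<lambda>i\<in>UNIV. w i) = PiM UNIV (\<lambda>i. distr P borel (\<lambda>w. w i))"
    unfolding law using distr_id2[OF sP[symmetric]] by (simp add: P_def restrict_UNIV)
  then have "P.indep_vars (\<lambda>_. borel) (\<lambda>p w. w p) UNIV"
    using rv by (subst P.indep_vars_iff_distr_eq_PiM') auto
  then have "P.gamma_family UNIV (\<lambda>p w. inverse (inverse (w p))) par"
    using law by (simp add: P.gamma_family_def)
  from lg_envI[where par=par, OF P.prob_space_axioms this par] show ?thesis by blast
qed

section \<open>The stationary model\<close>

text \<open>That the bulk parameter is the sum of the axis parameters is the relation under which a
  Burke step applies at every bulk site.\<close>

locale boundary_env = lg_env +
  fixes \<alpha> \<beta> :: real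
  assumes par_right: "\<And>i. i > 0 \<Longrightarrow> par (i, 0) = \<beta>"
    and par_up: "\<And>j. j > 0 \<Longrightarrow> par (0, j) = \<alpha>"
    and par_bulk: "\<And>i j. i > 0 \<Longrightarrow> j > 0 \<Longrightarrow> par (i, j) = \<alpha> + \<beta>"
begin

abbreviation Z :: "nat \<Rightarrow> nat \<Rightarrow> 'a \<Rightarrow> real" where
  "Z m n \<omega> \<equiv> pf (\<lambda>p. X p \<omega>) m n"

text \<open>Reciprocals of the ratios are used because these are the gamma variables; on the axes
  they are the inverse weights.\<close>

definition recip_right :: "nat \<Rightarrow> nat \<Rightarrow> 'a \<Rightarrow> real" where
  "recip_right i j \<omega> = Z (i - 1) j \<omega> / Z i j \<omega>"

definition recip_up :: "nat \<Rightarrow> nat \<Rightarrow> 'a \<Rightarrow> real" where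
  "recip_up i j \<omega> = Z i (j - 1) \<omega> / Z i j \<omega>"

lemma recip_right_0: "i > 0 \<Longrightarrow> recip_right i 0 \<omega> = inverse (X (i, 0) \<omega>)"
  using pf_X_pos0[of \<omega> "i - 1" 0, THEN less_imp_neq] by (cases i) (simp_all add: recip_right_def inverse_eq_divide)

lemma recip_up_0: "j > 0 \<Longrightarrow> recip_up 0 j \<omega> = inverse (X (0, j) \<omega>)"
  using pf_X_pos0[of \<omega> 0 "j - 1", THEN less_imp_neq] by (cases j) (simp_all add: recip_up_def inverse_eq_divide)

text \<open>Dividing the recursion for Z at the new corner by its two predecessors shows that the
  reciprocal ratios move across a unit square by a Burke step driven by the inverse weight at that
  corner.\<close>

lemma recip_step:
  "inverse (X (Suc i, Suc j) \<omega>) * (recip_right (Suc i) j \<omega> / (recip_right (Suc i) j \<omega> + recip_up i (Suc j) \<omega>)) =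
     recip_right (Suc i) (Suc j) \<omega>" (is ?A)
  "inverse (X (Suc i, Suc j) \<omega>) * (recip_up i (Suc j) \<omega> / (recip_right (Suc i) j \<omega> + recip_up i (Suc j) \<omega>)) =
     recip_up (Suc i) (Suc j) \<omega>" (is ?B)
proof -
  define x y z w where "x = X (Suc i, Suc j) \<omega>" and "y = Z (Suc i) j \<omega>" and "z = Z i (Suc j) \<omega>" and "w = Z i j \<omega>"
  have pos: "x > 0" "y > 0" "z > 0" "w > 0" by (simp_all add: x_def y_def z_def w_def X_pos pf_X_pos0)
  define c where "c = w / (y * z)"
  have c: "c > 0" "w / y = c * z" "w / z = c * y" using pos by (simp_all add: c_def)
  have "(w / y) / (w / y + w / z) = z / (z + y)" "(w / z) / (w / y + w / z) = y / (z + y)"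
    unfolding c distrib_left[symmetric] using c(1) by simp_all
  then show ?A ?B
    by (simp_all add: recip_right_def recip_up_def x_def y_def z_def w_def divide_inverse)
qed

text \<open>The label \<open>(i, 0)\<close> carries the current horizontal ratio in column \<open>i\<close>, the label
  \<open>(0, j)\<close> the current vertical ratio in row \<open>j\<close>, and \<open>(i, j)\<close> the weight of a site not yet
  visited; the sites are visited row by row, and \<open>(n, k)\<close> says that \<open>n\<close> rows and \<open>k\<close> sites of the
  next one are done.\<close>

definition stage :: "nat \<Rightarrow> nat \<Rightarrow> nat \<times> nat \<Rightarrow> 'a \<Rightarrow> real" where
  "stage n k p \<omega> = (if snd p = 0 then (if fst p \<le> k then recip_right (fst p) (Suc n) \<omega> else recip_right (fst p) n \<omega>)
     else if p = (0, Suc n) then recip_up k (Suc n) \<omega> else inverse (X p \<omega>))"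

definition stage_labels :: "nat \<Rightarrow> nat \<Rightarrow> nat \<Rightarrow> (nat \<times> nat) set" where
  "stage_labels m n k = {1..m} \<times> {0} \<union> {0} \<times> {Suc n..} \<union> {1..} \<times> {Suc (Suc n)..} \<union> {Suc k..} \<times> {Suc n}"

text \<open>Visiting a site is one application of \<open>gamma_family_burke_update\<close>, which
  spends its weight. At the end of a row its vertical label is discarded, together with the sites of
  the row beyond column m.\<close>

lemma stage_family: "k \<le> m \<Longrightarrow> gamma_family (stage_labels m n k) (stage n k) par"
proof (induction n arbitrary: k)
  have step: "gamma_family (stage_labels m n k) (stage n k) par"
    if 0: "gamma_family (stage_labels m n 0) (stage n 0) par" and "k \<le> m" for n k
    using \<open>k \<le> m\<close>
  proof (induction k)
    case 0
    then show ?case using that by simp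
  next
    case (Suc k)
    let ?a = "(Suc k, 0)" and ?b = "(0, Suc n)" and ?c = "(Suc k, Suc n)"
    have "gamma_family (stage_labels m n k - {?c}) (burke_update ?a ?b ?c (stage n k)) par"
    proof (rule gamma_family_burke_update)
      show "gamma_family (stage_labels m n k) (stage n k) par" using Suc by simp
    qed (use Suc in \<open>auto simp: par_pos stage_labels_def par_right par_up par_bulk\<close>)
    moreover have "stage_labels m n k - {?c} = stage_labels m n (Suc k)"
      by (auto simp: stage_labels_def)
    moreover have "burke_update ?a ?b ?c (stage n k) p = stage n (Suc k) p" for p
    proof (rule ext)
      fix \<omega>
      have v: "stage n k ?a \<omega> = recip_right (Suc k) n \<omega>" "stage n k ?b \<omega> = recip_up k (Suc n) \<omega>"
        "stage n k ?c \<omega> = inverse (X ?c \<omega>)" by (simp_all add: stage_def)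
      show "burke_update ?a ?b ?c (stage n k) p \<omega> = stage n (Suc k) p \<omega>"
      proof -
        consider "p = ?a" | "p = ?b" | "p \<noteq> ?a" "p \<noteq> ?b" by blast
        then show ?thesis
        proof cases
          case 1
          have "burke_update ?a ?b ?c (stage n k) ?a \<omega> =
            stage n k ?c \<omega> * (stage n k ?a \<omega> / (stage n k ?a \<omega> + stage n k ?b \<omega>))"
            by (simp add: burke_update_def del: times_divide_eq_right)
          also have "\<dots> = recip_right (Suc k) (Suc n) \<omega>" unfolding v by (rule recip_step)
          finally have "burke_update ?a ?b ?c (stage n k) p \<omega> = recip_right (Suc k) (Suc n) \<omega>" using 1 by simp
          then show ?thesis using 1 by (simp add: stage_def)
        next
          case 2
          have "burke_update ?a ?b ?c (stage n k) ?b \<omega> =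
            stage n k ?c \<omega> * (stage n k ?b \<omega> / (stage n k ?a \<omega> + stage n k ?b \<omega>))"
            by (simp add: burke_update_def del: times_divide_eq_right)
          also have "\<dots> = recip_up (Suc k) (Suc n) \<omega>" unfolding v by (rule recip_step)
          finally have "burke_update ?a ?b ?c (stage n k) p \<omega> = recip_up (Suc k) (Suc n) \<omega>" using 2 by simp
          then show ?thesis using 2 by (simp add: stage_def)
        next
          case 3
          then show ?thesis by (cases p) (auto simp: burke_update_def stage_def le_Suc_eq)
        qed
      qed
    qed
    ultimately show ?case using gamma_family_cong[of "stage_labels m n (Suc k)"] by metis
  qed
  {
    case 0
    have "gamma_family (stage_labels m 0 0) (\<lambda>p \<omega>. inverse (X p \<omega>)) par"
      by (rule gamma_family_subset[OF family]) simp
    moreover have "stage 0 0 p = (\<lambda>\<omega>. inverse (X p \<omega>))" if "p \<in> stage_labels m 0 0" for p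
      using that by (cases p) (auto simp: stage_def stage_labels_def fun_eq_iff recip_right_0 recip_up_0)
    ultimately have "gamma_family (stage_labels m 0 0) (stage 0 0) par"
      using gamma_family_cong[of "stage_labels m 0 0" "stage 0 0"] by simp
    then show ?case using step 0 by blast
  next
    case (Suc n)
    have "gamma_family (stage_labels m (Suc n) 0) (stage n m) par"
      by (rule gamma_family_subset[OF Suc.IH[OF order_refl]]) (auto simp: stage_labels_def)
    moreover have "stage (Suc n) 0 p = stage n m p" if "p \<in> stage_labels m (Suc n) 0" for p
      using that by (cases p) (auto simp: stage_def stage_labels_def fun_eq_iff recip_up_0)
    ultimately have "gamma_family (stage_labels m (Suc n) 0) (stage (Suc n) 0) par"
      using gamma_family_cong[of "stage_labels m (Suc n) 0" "stage (Suc n) 0" "stage n m"] by simp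
    then show ?case using step Suc.prems by blast
  }
qed

text \<open>The quotient telescopes along row n into inverses of independent gamma variables of
  parameter \<beta>, whatever n is.\<close>

lemma stationary_moment:
  assumes "\<xi> < \<beta>"
  shows "(\<integral>\<^sup>+\<omega>. ennreal ((Z m n \<omega> / Z 0 n \<omega>) powr \<xi>) \<partial>M) = ennreal (exp (real m * lgm \<beta> \<xi>))"
proof (cases "m = 0")
  case True
  then show ?thesis using pf_X_pos0[of _ 0 n] by (simp add: emeasure_space_1 less_imp_neq[symmetric])
next
  case False
  have \<beta>: "\<beta> > 0" using par_right[of 1] par_pos[of "(1, 0)"] by simp
  let ?S = "{1..m} \<times> {0::nat}"
  have F: "gamma_family ?S (stage n 0) par"
    by (rule gamma_family_subset[OF stage_family[of 0 m n]]) (auto simp: stage_labels_def)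
  have pos: "stage n 0 p \<omega> > 0" if "p \<in> ?S" for p \<omega>
    using that by (auto simp: stage_def recip_right_def pf_X_pos0)
  have "Z m n \<omega> / Z 0 n \<omega> = (\<Prod>i=1..m. inverse (recip_right i n \<omega>))" for \<omega>
  proof (induction m)
    case 0
    then show ?case using pf_X_pos0[of \<omega> 0 n] by simp
  next
    case (Suc m)
    have "(\<Prod>i=1..Suc m. inverse (recip_right i n \<omega>)) = Z m n \<omega> / Z 0 n \<omega> * inverse (recip_right (Suc m) n \<omega>)"
      using Suc by simp
    also have "\<dots> = Z (Suc m) n \<omega> / Z 0 n \<omega>"
      using pf_X_pos0[of \<omega> m n] by (simp add: recip_right_def)
    finally show ?case ..
  qed
  also have "(\<Prod>i=1..m. inverse (recip_right i n \<omega>)) = (\<Prod>p\<in>?S. inverse (stage n 0 p \<omega>))" for \<omega>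
    by (rule prod.reindex_bij_witness[where i=fst and j="\<lambda>i. (i, 0)"]) (auto simp: stage_def)
  finally have W: "Z m n \<omega> / Z 0 n \<omega> = (\<Prod>p\<in>?S. inverse (stage n 0 p \<omega>))" for \<omega> .
  have e: "(Z m n \<omega> / Z 0 n \<omega>) powr \<xi> = (\<Prod>p\<in>?S. stage n 0 p \<omega> powr - \<xi>)" for \<omega>
  proof -
    have "(\<Prod>p\<in>?S. inverse (stage n 0 p \<omega>)) powr \<xi> = (\<Prod>p\<in>?S. inverse (stage n 0 p \<omega>) powr \<xi>)"
      by (rule prod_powr_distrib)
    also have "\<dots> = (\<Prod>p\<in>?S. stage n 0 p \<omega> powr - \<xi>)"
    proof (rule prod.cong)
      fix p assume "p \<in> ?S"
      from pos[OF this, of \<omega>] show "inverse (stage n 0 p \<omega>) powr \<xi> = stage n 0 p \<omega> powr - \<xi>"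
        by (simp add: powr_minus inverse_powr)
    qed simp
    finally show ?thesis by (simp only: W)
  qed
  have "(\<integral>\<^sup>+\<omega>. ennreal ((Z m n \<omega> / Z 0 n \<omega>) powr \<xi>) \<partial>M) = (\<integral>\<^sup>+\<omega>. (\<Prod>p\<in>?S. ennreal (stage n 0 p \<omega> powr - \<xi>)) \<partial>M)"
    unfolding e by (simp add: prod_ennreal)
  also have "\<dots> = (\<Prod>p\<in>?S. \<integral>\<^sup>+\<omega>. ennreal (stage n 0 p \<omega> powr - \<xi>) \<partial>M)"
  proof (rule indep_vars_nn_integral)
    have "indep_vars (\<lambda>_. borel) (stage n 0) ?S" using F by (simp add: gamma_family_def)
    then show "indep_vars (\<lambda>_. borel) (\<lambda>p \<omega>. ennreal (stage n 0 p \<omega> powr - \<xi>)) ?S"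
      by (rule indep_vars_compose2[where Y="\<lambda>p x. ennreal (x powr - \<xi>)"]) measurable
  qed auto
  also have "\<dots> = (\<Prod>p\<in>?S. ennreal (exp (lgm \<beta> \<xi>)))"
  proof (rule prod.cong)
    fix p assume p: "p \<in> ?S"
    have "(\<integral>\<^sup>+\<omega>. ennreal (stage n 0 p \<omega> powr - \<xi>) \<partial>M) = (\<integral>\<^sup>+x. ennreal (x powr - \<xi>) \<partial>gamma_law (par p))"
      by (rule gamma_family_one[OF F p, where f="\<lambda>x. ennreal (x powr - \<xi>)"]) measurable
    also have "par p = \<beta>" using p by (auto simp: par_right)
    also have "(\<integral>\<^sup>+x. ennreal (x powr - \<xi>) \<partial>gamma_law \<beta>) = ennreal (exp (lgm \<beta> \<xi>))"
      using \<beta> assms by (simp add: nn_integral_gamma_law_powr exp_lgm)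
    finally show "(\<integral>\<^sup>+\<omega>. ennreal (stage n 0 p \<omega> powr - \<xi>) \<partial>M) = ennreal (exp (lgm \<beta> \<xi>))" .
  qed simp
  also have "\<dots> = ennreal (exp (real m * lgm \<beta> \<xi>))"
    by (simp add: card_cartesian_product exp_of_nat_mult ennreal_power)
  finally show ?thesis .
qed

end

section \<open>Positive moments of the partition function\<close>

text \<open>Converts moments of axis weights with tilted parameters into the exponents
  \<open>al\<close> and \<open>be\<close>.\<close>

lemma lgm_flip: "lgm (\<nu> - \<xi>) (- \<xi>) = - lgm \<nu> \<xi>"
  by (simp add: lgm_def)

text \<open>Bounding every summand by the largest costs a power of their number, which is polynomial
  in N below and harmless against exponential rates.\<close>

lemma power_sum_le:
  fixes a :: "'i \<Rightarrow> real"
  assumes "finite I" "\<And>i. i \<in> I \<Longrightarrow> a i > 0" "\<eta> \<ge> 0"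
  shows "(\<Sum>i\<in>I. a i) powr \<eta> \<le> real (card I) powr \<eta> * (\<Sum>i\<in>I. a i powr \<eta>)"
proof (cases "I = {}")
  case False
  have "Max (a ` I) \<in> a ` I" using assms(1) False by (intro Max_in) auto
  then obtain j where "j \<in> I" "Max (a ` I) = a j" by (metis imageE)
  then have j: "j \<in> I" "\<And>i. i \<in> I \<Longrightarrow> a i \<le> a j"
    using assms(1) Max_ge[of "a ` I"] by auto
  have "(\<Sum>i\<in>I. a i) powr \<eta> \<le> (real (card I) * a j) powr \<eta>"
    using assms sum_bounded_above[of I a "a j"] j by (intro powr_mono2 sum_nonneg) (auto intro: less_imp_le)
  also have "\<dots> = real (card I) powr \<eta> * a j powr \<eta>"
    by (rule powr_mult)
  also have "\<dots> \<le> real (card I) powr \<eta> * (\<Sum>i\<in>I. a i powr \<eta>)"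
    using assms(1) j(1) by (intro mult_left_mono member_le_sum) auto
  finally show ?thesis .
qed simp

section \<open>Supermultiplicative and submultiplicative moments\<close>

context lg_env begin

lemma supermult_integral:
  "(\<integral>\<^sup>+\<omega>. ennreal (pf (\<lambda>p. X p \<omega>) a b powr \<xi>) * ennreal (pf (shift a b (\<lambda>p. X p \<omega>)) m n powr \<xi>) \<partial>M) =
   (\<integral>\<^sup>+\<omega>. ennreal (pf (\<lambda>p. X p \<omega>) a b powr \<xi>) \<partial>M) * (\<integral>\<^sup>+\<omega>. ennreal (pf (shift a b (\<lambda>p. X p \<omega>)) m n powr \<xi>) \<partial>M)"
proof -
  define g where "g c w = (if c then ennreal (pf w a b powr \<xi>) else ennreal (pf (shift a b w) m n powr \<xi>))" for c w
  define K where "K c = (if c then sites 0 0 a b else sites a b m n)" for c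
  have "(\<integral>\<^sup>+\<omega>. (\<Prod>c\<in>UNIV. g c (\<lambda>p. X p \<omega>)) \<partial>M) = (\<Prod>c\<in>UNIV. \<integral>\<^sup>+\<omega>. g c (\<lambda>p. X p \<omega>) \<partial>M)"
  proof (rule indep_groups[where K=K])
    show "disjoint_family_on K UNIV" by (auto simp: disjoint_family_on_def K_def sites_def)
    fix c :: bool
    have "g True \<in> borel_measurable (PiM (sites 0 0 a b) (\<lambda>_. borel))"
      using pf_shift_measurable[of 0 0 a b "sites 0 0 a b"] unfolding g_def by simp measurable
    moreover have "g False \<in> borel_measurable (PiM (sites a b m n) (\<lambda>_. borel))"
      using pf_shift_measurable[of a b m n "sites a b m n"] unfolding g_def by simp measurable
    ultimately show "g c \<in> borel_measurable (PiM (K c) (\<lambda>_. borel))" by (cases c) (auto simp: K_def)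
    fix w w' :: "nat \<times> nat \<Rightarrow> real" assume "\<And>p. p \<in> K c \<Longrightarrow> w p = w' p"
    then show "g c w = g c w'"
      using pf_shift_cong[of a b m n w w'] pf_cong[of a b w w'] by (cases c) (auto simp: g_def K_def)
  qed simp
  then show ?thesis by (simp add: UNIV_bool g_def mult.commute)
qed

end

lemma iid_env_exists:
  assumes "\<mu> > 0"
  obtains M :: "(nat \<times> nat \<Rightarrow> real) measure" and X where "lg_env M X (\<lambda>_. \<mu>)"
  using lg_env_exists[of "\<lambda>_. \<mu>"] assms by auto

text \<open>Only paths through (a, b) are kept, and the rectangles before and after that point are
  independent. A negative power reverses the inequality, whence \<open>Zmom_sub\<close>.\<close>

lemma Zmom_super:
  assumes "\<mu> > 0" "\<xi> \<ge> 0"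
  shows "Zmom \<mu> a b \<xi> * Zmom \<mu> m n \<xi> \<le> Zmom \<mu> (a + m) (b + n) \<xi>"
proof -
  obtain M :: "(nat \<times> nat \<Rightarrow> real) measure" and X where "lg_env M X (\<lambda>_. \<mu>)" using iid_env_exists[OF assms(1)] .
  then interpret lg_env M X "\<lambda>_. \<mu>" .
  have "Zmom \<mu> a b \<xi> * Zmom \<mu> m n \<xi> =
     (\<integral>\<^sup>+\<omega>. ennreal (pf (\<lambda>p. X p \<omega>) a b powr \<xi>) * ennreal (pf (shift a b (\<lambda>p. X p \<omega>)) m n powr \<xi>) \<partial>M)"
    by (subst supermult_integral, subst Zmom_eq0[OF refl], subst Zmom_eq[OF refl]) simp
  also have "\<dots> \<le> (\<integral>\<^sup>+\<omega>. ennreal (pf (\<lambda>p. X p \<omega>) (a + m) (b + n) powr \<xi>) \<partial>M)"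
    using pf_X_pos pf_X_pos0 assms
    by (intro nn_integral_mono)
       (auto simp: ennreal_mult'[symmetric] powr_mult[symmetric] less_imp_le
         intro!: ennreal_leI powr_mono2 pf_superadditive X_pos)
  also have "\<dots> = Zmom \<mu> (a + m) (b + n) \<xi>" by (rule Zmom_eq0) simp
  finally show ?thesis .
qed

lemma Zmom_sub:
  assumes "\<mu> > 0" "\<xi> \<le> 0"
  shows "Zmom \<mu> (a + m) (b + n) \<xi> \<le> Zmom \<mu> a b \<xi> * Zmom \<mu> m n \<xi>"
proof -
  obtain M :: "(nat \<times> nat \<Rightarrow> real) measure" and X where "lg_env M X (\<lambda>_. \<mu>)" using iid_env_exists[OF assms(1)] .
  then interpret lg_env M X "\<lambda>_. \<mu>" .
  have "Zmom \<mu> (a + m) (b + n) \<xi> = (\<integral>\<^sup>+\<omega>. ennreal (pf (\<lambda>p. X p \<omega>) (a + m) (b + n) powr \<xi>) \<partial>M)"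
    by (rule Zmom_eq0[symmetric]) simp
  also have "\<dots> \<le> (\<integral>\<^sup>+\<omega>. ennreal (pf (\<lambda>p. X p \<omega>) a b powr \<xi>) * ennreal (pf (shift a b (\<lambda>p. X p \<omega>)) m n powr \<xi>) \<partial>M)"
    using pf_X_pos pf_X_pos0 assms
    by (intro nn_integral_mono)
       (auto simp: ennreal_mult'[symmetric] powr_mult[symmetric] less_imp_le
         intro!: ennreal_leI powr_mono2' pf_superadditive X_pos)
  also have "\<dots> = Zmom \<mu> a b \<xi> * Zmom \<mu> m n \<xi>"
    by (subst supermult_integral, subst Zmom_eq0[OF refl], subst Zmom_eq[OF refl]) simp
  finally show ?thesis .
qed

lemma Zmom_axis:
  assumes "\<mu> > 0" "\<xi> < \<mu>"
  shows "Zmom \<mu> m 0 \<xi> = ennreal (exp (real m * lgm \<mu> \<xi>))" "Zmom \<mu> 0 n \<xi> = ennreal (exp (real n * lgm \<mu> \<xi>))"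
proof -
  obtain M :: "(nat \<times> nat \<Rightarrow> real) measure" and X where "lg_env M X (\<lambda>_. \<mu>)" using iid_env_exists[OF assms(1)] .
  then interpret lg_env M X "\<lambda>_. \<mu>" .
  have mono: "(\<integral>\<^sup>+\<omega>. ennreal ((\<Prod>p\<in>S. X p \<omega>) powr \<xi>) \<partial>M) = ennreal (exp (real (card S) * lgm \<mu> \<xi>))" if "finite S" for S
    using monomial_moment[OF that, of "\<lambda>_. \<xi>"] moment[OF assms(2)]
    by (simp add: prod_powr_distrib prod_ennreal[symmetric] exp_of_nat_mult ennreal_power)
  have "pf (\<lambda>p. X p \<omega>) m 0 = (\<Prod>p\<in>{1..m} \<times> {0}. X p \<omega>)" for \<omega>
    unfolding pf_right by (rule prod.reindex_bij_witness[where i=fst and j="\<lambda>i. (i, 0)"]) auto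
  then show "Zmom \<mu> m 0 \<xi> = ennreal (exp (real m * lgm \<mu> \<xi>))"
    using mono[of "{1..m} \<times> {0}"] by (simp add: Zmom_eq0[OF refl, symmetric] card_cartesian_product)
  have "pf (\<lambda>p. X p \<omega>) 0 n = (\<Prod>p\<in>{0} \<times> {1..n}. X p \<omega>)" for \<omega>
    unfolding pf_up by (rule prod.reindex_bij_witness[where i=snd and j="\<lambda>i. (0, i)"]) auto
  then show "Zmom \<mu> 0 n \<xi> = ennreal (exp (real n * lgm \<mu> \<xi>))"
    using mono[of "{0} \<times> {1..n}"] by (simp add: Zmom_eq0[OF refl, symmetric] card_cartesian_product)
qed

text \<open>Keeps the single path that follows the bottom row and then the last column.\<close>

lemma Zmom_path_lower:
  assumes "\<mu> > 0" "0 \<le> \<xi>" "\<xi> < \<mu>"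
  shows "ennreal (exp (real (m + n) * lgm \<mu> \<xi>)) \<le> Zmom \<mu> m n \<xi>"
  using Zmom_super[of \<mu> \<xi> m 0 0 n] assms
  by (simp add: Zmom_axis ennreal_mult'[symmetric] exp_add[symmetric] distrib_right)

lemma Zmom_path_upper:
  assumes "\<mu> > 0" "\<xi> \<le> 0"
  shows "Zmom \<mu> m n \<xi> \<le> ennreal (exp (real (m + n) * lgm \<mu> \<xi>))"
  using Zmom_sub[of \<mu> \<xi> m 0 0 n] assms
  by (simp add: Zmom_axis ennreal_mult'[symmetric] exp_add[symmetric] distrib_right)

section \<open>Exit decomposition of the stationary partition function\<close>

context boundary_env begin

text \<open>Decomposing a path at the point where it leaves the boundary writes \<open>W\<close> as a sum of terms \<open>T\<close>
  (exit from the vertical axis at height \<open>l\<close>) and \<open>S\<close> (exit from the horizontal axis at \<open>k\<close>).\<close>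

definition W :: "nat \<Rightarrow> nat \<Rightarrow> 'a \<Rightarrow> real" where
  "W m n \<omega> = Z (Suc m) (Suc n) \<omega> / Z 0 (Suc n) \<omega>"

definition T :: "nat \<Rightarrow> nat \<Rightarrow> nat \<Rightarrow> 'a \<Rightarrow> real" where
  "T m n l \<omega> = (\<Prod>j=Suc l..Suc n. inverse (X (0, j) \<omega>)) * (X (1, l) \<omega> * pf (shift 1 l (\<lambda>p. X p \<omega>)) m (Suc n - l))"

definition S :: "nat \<Rightarrow> nat \<Rightarrow> nat \<Rightarrow> 'a \<Rightarrow> real" where
  "S m n k \<omega> = (\<Prod>j=1..Suc n. inverse (X (0, j) \<omega>)) * (\<Prod>i=1..k. X (i, 0) \<omega>) *
     (X (k, 1) \<omega> * pf (shift k 1 (\<lambda>p. X p \<omega>)) (Suc m - k) n)"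

lemma T_pos: "T m n l \<omega> > 0" and S_pos: "S m n k \<omega> > 0"
  by (auto simp: T_def S_def X_pos pf_X_pos intro!: mult_pos_pos prod_pos)

lemma T_rv [measurable]: "T m n l \<in> borel_measurable M" and S_rv [measurable]: "S m n k \<in> borel_measurable M"
proof -
  note [measurable] = pf_rv
  show "T m n l \<in> borel_measurable M" "S m n k \<in> borel_measurable M"
    unfolding T_def S_def by measurable
qed

lemma W_pos: "W m n \<omega> > 0"
  unfolding W_def by (intro divide_pos_pos pf_X_pos0)

lemma W_rv [measurable]: "W m n \<in> borel_measurable M"
  unfolding W_def by measurable

lemma W_exit: "W m n \<omega> = (\<Sum>l = 1..Suc n. T m n l \<omega>) + (\<Sum>k = 1..Suc m. S m n k \<omega>)"
proof -
  let ?V = "\<lambda>l. \<Prod>j=1..l. X (0, j) \<omega>" and ?I = "\<lambda>l. \<Prod>j=l..Suc n. inverse (X (0, j) \<omega>)"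
  have nz: "X p \<omega> \<noteq> 0" for p using X_pos[of p \<omega>] by simp
  have V0: "?V l \<noteq> 0" for l using nz by simp
  have I1: "?I 1 = 1 / ?V (Suc n)"
    using prod_inversef[of "\<lambda>j. X (0, j) \<omega>" "{1..Suc n}"] by (simp only: comp_def inverse_eq_divide)
  have Vl: "?V l / ?V (Suc n) = ?I (Suc l)" if "l \<in> {1..Suc n}" for l
  proof -
    have "{1..Suc n} = {1..l} \<union> {Suc l..Suc n}" using that by auto
    then have "?V (Suc n) = ?V l * (\<Prod>j=Suc l..Suc n. X (0, j) \<omega>)"
      by (simp add: prod.union_disjoint del: prod.cl_ivl_Suc)
    then have "?V l / ?V (Suc n) = inverse (\<Prod>j=Suc l..Suc n. X (0, j) \<omega>)"
      using V0[of l] by (simp add: inverse_eq_divide del: prod.cl_ivl_Suc)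
    then show ?thesis by (simp only: prod_inversef[unfolded comp_def])
  qed
  have "W m n \<omega> = (\<Sum>l = 1..Suc n. ?V l / ?V (Suc n) * (X (1, l) \<omega> * pf (shift 1 l (\<lambda>p. X p \<omega>)) m (Suc n - l))) +
    (\<Sum>k = 1..Suc m. 1 / ?V (Suc n) * (\<Prod>i=1..k. X (i, 0) \<omega>) * (X (k, 1) \<omega> * pf (shift k 1 (\<lambda>p. X p \<omega>)) (Suc m - k) n))"
    unfolding W_def pf_exit pf_up add_divide_distrib sum_divide_distrib
    by (intro arg_cong2[where f="(+)"] sum.cong refl) simp_all
  also have "\<dots> = (\<Sum>l = 1..Suc n. T m n l \<omega>) + (\<Sum>k = 1..Suc m. S m n k \<omega>)"
    by (intro arg_cong2[where f="(+)"] sum.cong refl) (simp_all only: T_def S_def Vl I1)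
  finally show ?thesis .
qed

text \<open>The inverse axis weights above l, the weight at (1, l) and the bulk rectangle beyond (1,
  l) use disjoint sites. The last factor has the law of the partition function without
  boundary.\<close>

lemma T_moment:
  assumes "0 \<le> \<eta>" "\<eta> < \<alpha> + \<beta>" "l \<in> {1..Suc n}"
  shows "(\<integral>\<^sup>+\<omega>. ennreal (T m n l \<omega> powr \<eta>) \<partial>M) =
    ennreal (exp (real (Suc n - l) * lgm \<alpha> (- \<eta>) + lgm (\<alpha> + \<beta>) \<eta>)) * Zmom (\<alpha> + \<beta>) m (Suc n - l) \<eta>"
proof -
  have \<alpha>: "\<alpha> > 0" using par_up[of 1] par_pos[of "(0, 1)"] by simp
  define A where "A = {0::nat} \<times> {Suc l..Suc n}"
  define e where "e p = (if p = (1, l) then \<eta> else - \<eta>)" for p :: "nat \<times> nat"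
  have f: "finite A" "(1, l) \<notin> A" by (auto simp: A_def)
  have "T m n l \<omega> powr \<eta> = (\<Prod>p\<in>insert (1, l) A. X p \<omega> powr e p) * pf (shift 1 l (\<lambda>p. X p \<omega>)) m (Suc n - l) powr \<eta>" for \<omega>
  proof -
    have "(\<Prod>j=Suc l..Suc n. inverse (X (0, j) \<omega>)) = (\<Prod>p\<in>A. inverse (X p \<omega>))"
      unfolding A_def by (rule prod.reindex_bij_witness[where i=snd and j="\<lambda>j. (0, j)"]) auto
    then have "(\<Prod>j=Suc l..Suc n. inverse (X (0, j) \<omega>)) powr \<eta> = (\<Prod>p\<in>A. X p \<omega> powr - \<eta>)"
      by (simp only: prod_powr_distrib inverse_powr powr_minus)
    also have "\<dots> = (\<Prod>p\<in>A. X p \<omega> powr e p)" using f by (intro prod.cong) (auto simp: e_def)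
    finally show ?thesis using f by (simp add: T_def powr_mult e_def mult_ac)
  qed
  then have "(\<integral>\<^sup>+\<omega>. ennreal (T m n l \<omega> powr \<eta>) \<partial>M) =
     (\<integral>\<^sup>+\<omega>. (\<Prod>p\<in>insert (1, l) A. ennreal (X p \<omega> powr e p)) * ennreal (pf (shift 1 l (\<lambda>p. X p \<omega>)) m (Suc n - l) powr \<eta>) \<partial>M)"
    by (simp only: ennreal_mult'' powr_ge_zero prod_ennreal)
  also have "\<dots> = (\<Prod>p\<in>insert (1, l) A. \<integral>\<^sup>+\<omega>. ennreal (X p \<omega> powr e p) \<partial>M) * (\<integral>\<^sup>+\<omega>. ennreal (pf (shift 1 l (\<lambda>p. X p \<omega>)) m (Suc n - l) powr \<eta>) \<partial>M)"
    by (rule monomial_pf_moment) (auto simp: A_def sites_def)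
  also have "(\<integral>\<^sup>+\<omega>. ennreal (pf (shift 1 l (\<lambda>p. X p \<omega>)) m (Suc n - l) powr \<eta>) \<partial>M) = Zmom (\<alpha> + \<beta>) m (Suc n - l) \<eta>"
    using assms by (intro Zmom_eq par_bulk) auto
  also have "(\<Prod>p\<in>insert (1, l) A. \<integral>\<^sup>+\<omega>. ennreal (X p \<omega> powr e p) \<partial>M) =
     (\<integral>\<^sup>+\<omega>. ennreal (X (1, l) \<omega> powr \<eta>) \<partial>M) * (\<Prod>p\<in>A. ennreal (exp (lgm \<alpha> (- \<eta>))))"
  proof -
    have "(\<integral>\<^sup>+\<omega>. ennreal (X p \<omega> powr e p) \<partial>M) = ennreal (exp (lgm \<alpha> (- \<eta>)))" if "p \<in> A" for p
    proof -
      have "par p = \<alpha>" "p \<noteq> (1, l)" using that f by (auto simp: A_def par_up)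
      then show ?thesis using moment[of "- \<eta>" p] assms \<alpha> by (simp add: e_def)
    qed
    then show ?thesis using f by (simp add: e_def cong: prod.cong)
  qed
  also have "\<dots> = ennreal (exp (lgm (\<alpha> + \<beta>) \<eta>)) * ennreal (exp (lgm \<alpha> (- \<eta>)) ^ (Suc n - l))"
    using assms by (subst moment) (auto simp: par_bulk A_def card_cartesian_product ennreal_power)
  also have "\<dots> = ennreal (exp (real (Suc n - l) * lgm \<alpha> (- \<eta>) + lgm (\<alpha> + \<beta>) \<eta>))"
    by (simp add: ennreal_mult'[symmetric] exp_of_nat_mult[symmetric] exp_add[symmetric] add.commute)
  finally show ?thesis .
qed

lemma S_moment:
  assumes "0 \<le> \<eta>" "\<eta> < \<beta>" "k \<in> {1..Suc m}"
  shows "(\<integral>\<^sup>+\<omega>. ennreal (S m n k \<omega> powr \<eta>) \<partial>M) =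
    ennreal (exp (real (Suc n) * lgm \<alpha> (- \<eta>) + real k * lgm \<beta> \<eta> + lgm (\<alpha> + \<beta>) \<eta>)) * Zmom (\<alpha> + \<beta>) (Suc m - k) n \<eta>"
proof -
  have \<alpha>: "\<alpha> > 0" using par_up[of 1] par_pos[of "(0, 1)"] by simp
  define A where "A = {0::nat} \<times> {1..Suc n}"
  define B where "B = {1..k} \<times> {0::nat}"
  define e where "e p = (if p \<in> A then - \<eta> else \<eta>)" for p :: "nat \<times> nat"
  let ?S = "insert (k, 1) (A \<union> B)"
  have k: "k > 0" using assms by simp
  have f: "finite A" "finite B" "(k, 1) \<notin> A" "(k, 1) \<notin> B" "A \<inter> B = {}" using k by (auto simp: A_def B_def)
  have P: "(\<Prod>p\<in>?S. q p) = q (k, 1) * ((\<Prod>p\<in>A. q p) * (\<Prod>p\<in>B. q p))" for q :: "nat \<times> nat \<Rightarrow> 'c::comm_monoid_mult"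
    using f by (simp add: prod.union_disjoint)
  have "S m n k \<omega> powr \<eta> = (\<Prod>p\<in>?S. X p \<omega> powr e p) * pf (shift k 1 (\<lambda>p. X p \<omega>)) (Suc m - k) n powr \<eta>" for \<omega>
  proof -
    have "(\<Prod>j=1..Suc n. inverse (X (0, j) \<omega>)) = (\<Prod>p\<in>A. inverse (X p \<omega>))"
      unfolding A_def by (rule prod.reindex_bij_witness[where i=snd and j="\<lambda>j. (0, j)"]) auto
    then have "(\<Prod>j=1..Suc n. inverse (X (0, j) \<omega>)) powr \<eta> = (\<Prod>p\<in>A. X p \<omega> powr - \<eta>)"
      by (simp only: prod_powr_distrib inverse_powr powr_minus)
    also have "\<dots> = (\<Prod>p\<in>A. X p \<omega> powr e p)" by (intro prod.cong) (auto simp: e_def)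
    finally have a: "(\<Prod>j=1..Suc n. inverse (X (0, j) \<omega>)) powr \<eta> = (\<Prod>p\<in>A. X p \<omega> powr e p)" .
    have "(\<Prod>i=1..k. X (i, 0) \<omega>) = (\<Prod>p\<in>B. X p \<omega>)"
      unfolding B_def by (rule prod.reindex_bij_witness[where i=fst and j="\<lambda>j. (j, 0)"]) auto
    then have "(\<Prod>i=1..k. X (i, 0) \<omega>) powr \<eta> = (\<Prod>p\<in>B. X p \<omega> powr \<eta>)"
      by (simp only: prod_powr_distrib)
    also have "\<dots> = (\<Prod>p\<in>B. X p \<omega> powr e p)" using f by (intro prod.cong) (auto simp: e_def)
    finally have b: "(\<Prod>i=1..k. X (i, 0) \<omega>) powr \<eta> = (\<Prod>p\<in>B. X p \<omega> powr e p)" .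
    show ?thesis unfolding S_def P powr_mult a b using f by (simp add: e_def mult_ac)
  qed
  then have "(\<integral>\<^sup>+\<omega>. ennreal (S m n k \<omega> powr \<eta>) \<partial>M) =
     (\<integral>\<^sup>+\<omega>. (\<Prod>p\<in>?S. ennreal (X p \<omega> powr e p)) * ennreal (pf (shift k 1 (\<lambda>p. X p \<omega>)) (Suc m - k) n powr \<eta>) \<partial>M)"
    by (simp only: ennreal_mult'' powr_ge_zero prod_ennreal)
  also have "\<dots> = (\<Prod>p\<in>?S. \<integral>\<^sup>+\<omega>. ennreal (X p \<omega> powr e p) \<partial>M) * (\<integral>\<^sup>+\<omega>. ennreal (pf (shift k 1 (\<lambda>p. X p \<omega>)) (Suc m - k) n powr \<eta>) \<partial>M)"
    using k by (intro monomial_pf_moment) (auto simp: A_def B_def sites_def)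
  also have "(\<integral>\<^sup>+\<omega>. ennreal (pf (shift k 1 (\<lambda>p. X p \<omega>)) (Suc m - k) n powr \<eta>) \<partial>M) = Zmom (\<alpha> + \<beta>) (Suc m - k) n \<eta>"
    using k by (intro Zmom_eq par_bulk) auto
  also have "(\<Prod>p\<in>?S. \<integral>\<^sup>+\<omega>. ennreal (X p \<omega> powr e p) \<partial>M) =
     ennreal (exp (lgm (\<alpha> + \<beta>) \<eta>)) * ((\<Prod>p\<in>A. ennreal (exp (lgm \<alpha> (- \<eta>)))) * (\<Prod>p\<in>B. ennreal (exp (lgm \<beta> \<eta>))))"
    unfolding P
  proof (intro arg_cong2[where f="(*)"] prod.cong refl)
    show "(\<integral>\<^sup>+\<omega>. ennreal (X (k, 1) \<omega> powr e (k, 1)) \<partial>M) = ennreal (exp (lgm (\<alpha> + \<beta>) \<eta>))"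
      using k f assms \<alpha> by (subst moment) (auto simp: par_bulk e_def)
    show "(\<integral>\<^sup>+\<omega>. ennreal (X p \<omega> powr e p) \<partial>M) = ennreal (exp (lgm \<alpha> (- \<eta>)))" if "p \<in> A" for p
    proof -
      have "par p = \<alpha>" using that by (auto simp: A_def par_up)
      then show ?thesis using moment[of "- \<eta>" p] that assms \<alpha> by (simp add: e_def)
    qed
    show "(\<integral>\<^sup>+\<omega>. ennreal (X p \<omega> powr e p) \<partial>M) = ennreal (exp (lgm \<beta> \<eta>))" if "p \<in> B" for p
    proof -
      have "p \<notin> A" "par p = \<beta>" using that f by (auto simp: B_def par_right)
      then show ?thesis using moment[of \<eta> p] assms by (simp add: e_def)
    qed
  qed
  also have "\<dots> = ennreal (exp (real (Suc n) * lgm \<alpha> (- \<eta>) + real k * lgm \<beta> \<eta> + lgm (\<alpha> + \<beta>) \<eta>))"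
    by (simp add: A_def B_def card_cartesian_product ennreal_power ennreal_mult'[symmetric] exp_of_nat_mult[symmetric]
        exp_add[symmetric] add_ac del: of_nat_Suc power_Suc)
  finally show ?thesis .
qed

lemma W_moment: "\<xi> < \<beta> \<Longrightarrow> (\<integral>\<^sup>+\<omega>. ennreal (W m n \<omega> powr \<xi>) \<partial>M) = ennreal (exp (real (Suc m) * lgm \<beta> \<xi>))"
  unfolding W_def by (rule stationary_moment)

end

section \<open>Upper bound for positive moments\<close>

lemma boundary_env_exists:
  assumes "\<alpha> > 0" "\<beta> > 0"
  obtains M :: "(nat \<times> nat \<Rightarrow> real) measure" and X par where "boundary_env M X par \<alpha> \<beta>"
proof -
  define par where "par p = (if snd p = 0 then \<beta> else if fst p = 0 then \<alpha> else \<alpha> + \<beta>)" for p :: "nat \<times> nat"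
  have "\<And>p. par p > 0" using assms by (simp add: par_def)
  from lg_env_exists[where par=par, OF this] obtain M :: "(nat \<times> nat \<Rightarrow> real) measure" and X where "lg_env M X par" by blast
  then have "boundary_env M X par \<alpha> \<beta>"
    unfolding boundary_env_def boundary_env_axioms_def by (simp add: par_def)
  then show ?thesis using that by blast
qed

text \<open>\<open>al\<close> and \<open>be\<close> are the exponential rates per vertical and per
  horizontal step; \<open>inf_gamma_mgf\<close> is the infimum of t \<open>al\<close> + s
  \<open>be\<close> over \<theta>.\<close>

definition al :: "real \<Rightarrow> real \<Rightarrow> real" where "al \<xi> \<theta> = lgm \<theta> \<xi>"
definition be :: "real \<Rightarrow> real \<Rightarrow> real \<Rightarrow> real" where "be \<mu> \<xi> \<theta> = - lgm (\<mu> - \<theta>) (- \<xi>)"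

text \<open>The exit term at height 1 contains the whole bulk rectangle and is at most
  \<open>W\<close>, whose moment is explicit.\<close>

lemma Zmom_upper:
  assumes "0 \<le> \<xi>" "\<xi> < \<theta>" "\<theta> < \<mu>"
  shows "\<exists>C>0. \<forall>m n. Zmom \<mu> m n \<xi> \<le> ennreal (C * exp (real n * al \<xi> \<theta> + real m * be \<mu> \<xi> \<theta>))"
proof -
  \<comment> \<open>Tilted by \<xi> so that, by \<open>lgm_flip\<close>, the axis weights contribute
    - \<open>al\<close> per vertical and \<open>be\<close> per horizontal step, while the bulk
    parameter stays \<mu>.\<close>
  define \<alpha> \<beta> where "\<alpha> = \<theta> - \<xi>" and "\<beta> = \<mu> - \<theta> + \<xi>"
  have ab: "\<alpha> > 0" "\<beta> > 0" "\<alpha> + \<beta> = \<mu>" "\<xi> < \<beta>" using assms by (auto simp: \<alpha>_def \<beta>_def)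
  obtain M :: "(nat \<times> nat \<Rightarrow> real) measure" and X par where "boundary_env M X par \<alpha> \<beta>"
    using boundary_env_exists[OF ab(1,2)] .
  then interpret boundary_env M X par \<alpha> \<beta> .
  have la: "lgm \<alpha> (- \<xi>) = - al \<xi> \<theta>" unfolding \<alpha>_def lgm_flip al_def ..
  have lb: "lgm \<beta> \<xi> = be \<mu> \<xi> \<theta>" using lgm_flip[of \<beta> \<xi>] by (simp add: \<beta>_def be_def)
  define C where "C = exp (be \<mu> \<xi> \<theta> - lgm \<mu> \<xi>)"
  have "Zmom \<mu> m n \<xi> \<le> ennreal (C * exp (real n * al \<xi> \<theta> + real m * be \<mu> \<xi> \<theta>))" for m n
  proof -
    have le: "T m n 1 \<omega> \<le> W m n \<omega>" for \<omega>
    proof -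
      have "T m n 1 \<omega> \<le> (\<Sum>l = 1..Suc n. T m n l \<omega>)"
        by (rule member_le_sum) (auto intro: less_imp_le T_pos)
      moreover have "0 \<le> (\<Sum>k = 1..Suc m. S m n k \<omega>)" by (intro sum_nonneg less_imp_le S_pos)
      ultimately show ?thesis unfolding W_exit by linarith
    qed
    have "ennreal (exp (- (real n * al \<xi> \<theta>) + lgm \<mu> \<xi>)) * Zmom \<mu> m n \<xi> = (\<integral>\<^sup>+\<omega>. ennreal (T m n 1 \<omega> powr \<xi>) \<partial>M)"
      using ab assms by (subst T_moment) (auto simp: la)
    also have "\<dots> \<le> (\<integral>\<^sup>+\<omega>. ennreal (W m n \<omega> powr \<xi>) \<partial>M)"
      using le assms T_pos by (intro nn_integral_mono ennreal_leI powr_mono2) (auto intro: less_imp_le)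
    also have "\<dots> = ennreal (exp (real (Suc m) * be \<mu> \<xi> \<theta>))"
      using ab by (simp add: W_moment lb del: of_nat_Suc)
    finally have le2: "ennreal (exp (- (real n * al \<xi> \<theta>) + lgm \<mu> \<xi>)) * Zmom \<mu> m n \<xi> \<le> ennreal (exp (real (Suc m) * be \<mu> \<xi> \<theta>))" .
    have "Zmom \<mu> m n \<xi> = ennreal (exp (real n * al \<xi> \<theta> - lgm \<mu> \<xi>)) * (ennreal (exp (- (real n * al \<xi> \<theta>) + lgm \<mu> \<xi>)) * Zmom \<mu> m n \<xi>)"
      by (simp add: mult.assoc[symmetric] ennreal_mult'[symmetric] exp_add[symmetric])
    also have "\<dots> \<le> ennreal (exp (real n * al \<xi> \<theta> - lgm \<mu> \<xi>)) * ennreal (exp (real (Suc m) * be \<mu> \<xi> \<theta>))"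
      by (intro mult_left_mono le2) simp
    also have "\<dots> = ennreal (C * exp (real n * al \<xi> \<theta> + real m * be \<mu> \<xi> \<theta>))"
      by (simp add: C_def ennreal_mult'[symmetric] exp_add[symmetric] algebra_simps)
    finally show ?thesis .
  qed
  moreover have "C > 0" by (simp add: C_def)
  ultimately show ?thesis by blast
qed

definition fl :: "nat \<Rightarrow> real \<Rightarrow> nat" where "fl N s = nat \<lfloor>real N * s\<rfloor>"

lemma fl_bounds:
  assumes "s \<ge> 0"
  shows "real (fl N s) \<le> real N * s" "real N * s - 1 \<le> real (fl N s)"
proof -
  have "0 \<le> real N * s" using assms by simp
  then show "real (fl N s) \<le> real N * s" "real N * s - 1 \<le> real (fl N s)"
    unfolding fl_def by linarith+
qed

lemma fl_mult_le:
  assumes "s \<ge> 0"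
  shows "real (fl N s) * c \<le> real N * s * c + \<bar>c\<bar>"
proof -
  note b = fl_bounds[OF assms, of N]
  have "(real (fl N s) - real N * s) * c \<le> \<bar>real (fl N s) - real N * s\<bar> * \<bar>c\<bar>"
    by (simp add: abs_mult[symmetric])
  also have "\<dots> \<le> 1 * \<bar>c\<bar>" using b by (intro mult_right_mono) auto
  finally show ?thesis by (simp add: algebra_simps)
qed

lemma poly_exp_tendsto:
  assumes "\<delta> > 0" "a > 0"
  shows "(\<lambda>N. K * (real N * a + 2) powr q * exp (- \<delta> * real N)) \<longlonglongrightarrow> 0"
  using assms by real_asymp

lemma poly_exp_eventually:
  assumes "\<delta> > 0" "a > 0" "e > 0"
  shows "eventually (\<lambda>N. K * (real N * a + 2) powr q * exp (- \<delta> * real N) \<le> e) sequentially"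
  using order_tendstoD(2)[OF poly_exp_tendsto[OF assms(1,2), where K=K and q=q] assms(3)]
  by eventually_elim simp

lemma ennreal_exp_shift: "ennreal (exp a) * z \<le> ennreal (exp b) \<Longrightarrow> z \<le> ennreal (exp (b - a))"
proof -
  assume "ennreal (exp a) * z \<le> ennreal (exp b)"
  then have "ennreal (exp (- a)) * (ennreal (exp a) * z) \<le> ennreal (exp (- a)) * ennreal (exp b)"
    by (intro mult_left_mono) auto
  moreover have "ennreal (exp (- a)) * (ennreal (exp a) * z) = z"
    by (simp add: mult.assoc[symmetric] ennreal_mult'[symmetric] exp_add[symmetric])
  ultimately show ?thesis by (simp add: ennreal_mult'[symmetric] exp_add[symmetric])
qed

lemma ennreal_exp_add: "ennreal (exp (a + b)) = ennreal (exp a) * ennreal (exp b)"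
  by (simp add: exp_add ennreal_mult')

lemma ennreal_exp_cancel: "ennreal (exp (- y)) * (z * ennreal (exp y)) = z"
proof -
  have "ennreal (exp (- y)) * (z * ennreal (exp y)) = z * (ennreal (exp (- y)) * ennreal (exp y))"
    by (simp only: mult_ac)
  also have "ennreal (exp (- y)) * ennreal (exp y) = 1"
    by (simp add: ennreal_mult'[symmetric] exp_add[symmetric])
  finally show ?thesis by simp
qed

lemma Zmom_finite:
  assumes "\<mu> > 0" "\<xi> < \<mu>"
  shows "Zmom \<mu> m n \<xi> < \<infinity>"
proof (cases "\<xi> \<ge> 0")
  case True
  then obtain C where "Zmom \<mu> m n \<xi> \<le> ennreal C"
    using Zmom_upper[of \<xi> "(\<xi> + \<mu>) / 2" \<mu>] assms by auto
  then show ?thesis using le_less_trans ennreal_less_top by fastforce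
next
  case False
  then show ?thesis using Zmom_path_upper[of \<mu> \<xi> m n] assms le_less_trans ennreal_less_top by fastforce
qed

text \<open>Appending a vertical segment compares a lower rectangle with the full one, at a cost
  exponential in the missing height only.\<close>

lemma Zmom_extend_up:
  assumes "\<mu> > 0" "0 \<le> \<xi>" "\<xi> < \<mu>" "b \<le> n"
  shows "Zmom \<mu> m b \<xi> \<le> ennreal (exp (- (real (n - b) * lgm \<mu> \<xi>))) * Zmom \<mu> m n \<xi>"
proof -
  have "Zmom \<mu> m b \<xi> = ennreal (exp (- (real (n - b) * lgm \<mu> \<xi>))) * (Zmom \<mu> m b \<xi> * Zmom \<mu> 0 (n - b) \<xi>)"
    using assms by (simp only: Zmom_axis ennreal_exp_cancel)
  also have "\<dots> \<le> ennreal (exp (- (real (n - b) * lgm \<mu> \<xi>))) * Zmom \<mu> m n \<xi>"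
    using Zmom_super[of \<mu> \<xi> m b 0 "n - b"] assms by (intro mult_left_mono) auto
  finally show ?thesis .
qed

lemma Zmom_extend_right:
  assumes "\<mu> > 0" "0 \<le> \<xi>" "\<xi> < \<mu>" "a \<le> m"
  shows "Zmom \<mu> a n \<xi> \<le> ennreal (exp (- (real (m - a) * lgm \<mu> \<xi>))) * Zmom \<mu> m n \<xi>"
proof -
  have "Zmom \<mu> a n \<xi> = ennreal (exp (- (real (m - a) * lgm \<mu> \<xi>))) * (Zmom \<mu> a n \<xi> * Zmom \<mu> (m - a) 0 \<xi>)"
    using assms by (simp only: Zmom_axis ennreal_exp_cancel)
  also have "\<dots> \<le> ennreal (exp (- (real (m - a) * lgm \<mu> \<xi>))) * Zmom \<mu> m n \<xi>"
    using Zmom_super[of \<mu> \<xi> a n "m - a" 0] assms by (intro mult_left_mono) auto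
  finally show ?thesis .
qed

section \<open>Far and near exits, and the lower bound for positive moments\<close>

context boundary_env begin

lemma \<alpha>_pos: "\<alpha> > 0" and \<beta>_pos: "\<beta> > 0"
  using par_up[of 1] par_pos[of "(0, 1)"] par_right[of 1] par_pos[of "(1, 0)"] by simp_all

text \<open>Let A be \<open>lgm \<alpha> (- \<eta>)\<close> and B be
  \<open>lgm \<beta> \<eta>\<close>. By \<open>Zmom_upper\<close> at \<theta>1 a vertical exit with
  l' rows left has, up to constants, a moment of at most exp (l' (A + a1) + m b1). As A + a1 >= 0,
  the worst case is l' = N (t - \<epsilon>), and there the second half of \<open>h1\<close> leaves a
  factor exp (- \<delta> N) against exp (m B), the size of the moment of \<open>W\<close>.
  Horizontal exits are treated in the same way with \<theta>2.\<close>

lemma far_moment: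
  assumes "0 \<le> \<eta>" "\<eta> < \<beta>" "\<eta> < \<theta>1" "\<theta>1 < \<alpha> + \<beta>" "\<eta> < \<theta>2" "\<theta>2 < \<alpha> + \<beta>" and st: "s > 0" "t > 0"
    and h1: "lgm \<alpha> (- \<eta>) + al \<eta> \<theta>1 \<ge> 0"
      "(t - \<epsilon>) * (lgm \<alpha> (- \<eta>) + al \<eta> \<theta>1) + s * (be (\<alpha> + \<beta>) \<eta> \<theta>1 - lgm \<beta> \<eta>) \<le> - \<delta>"
    and h2: "be (\<alpha> + \<beta>) \<eta> \<theta>2 - lgm \<beta> \<eta> \<ge> 0"
      "t * (lgm \<alpha> (- \<eta>) + al \<eta> \<theta>2) + (s - \<epsilon>) * (be (\<alpha> + \<beta>) \<eta> \<theta>2 - lgm \<beta> \<eta>) \<le> - \<delta>"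
  shows "\<exists>C>0. \<forall>N.
    (\<forall>l\<in>{1..Suc (fl N t)}. real (Suc (fl N t) - l) \<le> real N * (t - \<epsilon>) \<longrightarrow>
      (\<integral>\<^sup>+\<omega>. ennreal (T (fl N s) (fl N t) l \<omega> powr \<eta>) \<partial>M) \<le> ennreal (C * exp (real (fl N s) * lgm \<beta> \<eta> - \<delta> * real N))) \<and>
    (\<forall>k\<in>{1..Suc (fl N s)}. real (Suc (fl N s) - k) \<le> real N * (s - \<epsilon>) \<longrightarrow>
      (\<integral>\<^sup>+\<omega>. ennreal (S (fl N s) (fl N t) k \<omega> powr \<eta>) \<partial>M) \<le> ennreal (C * exp (real (fl N s) * lgm \<beta> \<eta> - \<delta> * real N)))"
proof -
  define \<mu> where "\<mu> = \<alpha> + \<beta>"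
  define A where "A = lgm \<alpha> (- \<eta>)"
  define B where "B = lgm \<beta> \<eta>"
  define \<kappa> where "\<kappa> = lgm \<mu> \<eta>"
  define a1 b1 a2 b2 where "a1 = al \<eta> \<theta>1" and "b1 = be \<mu> \<eta> \<theta>1" and "a2 = al \<eta> \<theta>2" and "b2 = be \<mu> \<eta> \<theta>2"
  note h1 = h1[folded A_def B_def \<mu>_def, folded a1_def b1_def]
  note h2 = h2[folded A_def B_def \<mu>_def, folded a2_def b2_def]
  have \<eta>\<mu>: "\<eta> < \<mu>" using assms \<alpha>_pos by (simp add: \<mu>_def)
  obtain C1 where C1: "C1 > 0" "\<And>m n. Zmom \<mu> m n \<eta> \<le> ennreal (C1 * exp (real n * a1 + real m * b1))"
    using Zmom_upper[of \<eta> \<theta>1 \<mu>] assms unfolding \<mu>_def a1_def b1_def by blast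
  obtain C2 where C2: "C2 > 0" "\<And>m n. Zmom \<mu> m n \<eta> \<le> ennreal (C2 * exp (real n * a2 + real m * b2))"
    using Zmom_upper[of \<eta> \<theta>2 \<mu>] assms unfolding \<mu>_def a2_def b2_def by blast
  \<comment> \<open>Collects the rounding errors of \<open>fl\<close> and the weights of a bounded
    number of sites.\<close>
  define D where "D = \<bar>\<kappa>\<bar> + \<bar>b1 - B\<bar> + \<bar>A\<bar> + \<bar>B\<bar> + \<bar>A + a2\<bar>"
  define C where "C = (C1 + C2) * exp D"
  have T: "(\<integral>\<^sup>+\<omega>. ennreal (T (fl N s) (fl N t) l \<omega> powr \<eta>) \<partial>M) \<le> ennreal (C * exp (real (fl N s) * B - \<delta> * real N))"
    if l: "l \<in> {1..Suc (fl N t)}" and far: "real (Suc (fl N t) - l) \<le> real N * (t - \<epsilon>)" for N l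
  proof -
    define l' where "l' = Suc (fl N t) - l"
    define m where "m = fl N s"
    have "real m * (b1 - B) \<le> real N * s * (b1 - B) + \<bar>b1 - B\<bar>"
      unfolding m_def using st by (intro fl_mult_le) simp
    moreover have "real l' * (A + a1) \<le> real N * (t - \<epsilon>) * (A + a1)"
      using far h1 by (intro mult_right_mono) (auto simp: l'_def)
    moreover have "real N * ((t - \<epsilon>) * (A + a1) + s * (b1 - B)) \<le> real N * (- \<delta>)"
      using h1 by (intro mult_left_mono) auto
    ultimately have ex: "real l' * A + \<kappa> + (real l' * a1 + real m * b1) \<le> D + (real m * B - \<delta> * real N)"
      unfolding D_def by (simp add: algebra_simps)
    have "(\<integral>\<^sup>+\<omega>. ennreal (T (fl N s) (fl N t) l \<omega> powr \<eta>) \<partial>M) = ennreal (exp (real l' * A + \<kappa>)) * Zmom \<mu> m l' \<eta>"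
      using assms l \<eta>\<mu> by (subst T_moment) (auto simp: A_def \<kappa>_def \<mu>_def m_def l'_def)
    also have "\<dots> \<le> ennreal (exp (real l' * A + \<kappa>)) * ennreal (C1 * exp (real l' * a1 + real m * b1))"
      by (intro mult_left_mono C1) simp
    also have "\<dots> = ennreal (C1 * exp (real l' * A + \<kappa> + (real l' * a1 + real m * b1)))"
      using C1 by (simp add: ennreal_mult'[symmetric] exp_add mult_ac)
    also have "\<dots> \<le> ennreal (C1 * exp (D + (real m * B - \<delta> * real N)))"
      using ex C1 by (intro ennreal_leI mult_left_mono) auto
    also have "\<dots> \<le> ennreal (C * exp (real m * B - \<delta> * real N))"
      unfolding C_def exp_add using C1 C2 by (intro ennreal_leI) (simp add: mult.assoc mult_right_mono)
    finally show ?thesis unfolding m_def .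
  qed
  have S: "(\<integral>\<^sup>+\<omega>. ennreal (S (fl N s) (fl N t) k \<omega> powr \<eta>) \<partial>M) \<le> ennreal (C * exp (real (fl N s) * B - \<delta> * real N))"
    if k: "k \<in> {1..Suc (fl N s)}" and far: "real (Suc (fl N s) - k) \<le> real N * (s - \<epsilon>)" for N k
  proof -
    define k' where "k' = Suc (fl N s) - k"
    define m where "m = fl N s"
    define n where "n = fl N t"
    have kk: "real k = 1 + real m - real k'" using k by (simp add: k'_def m_def of_nat_diff)
    have "real n * (A + a2) \<le> real N * t * (A + a2) + \<bar>A + a2\<bar>"
      unfolding n_def using st by (intro fl_mult_le) simp
    moreover have "real k' * (b2 - B) \<le> real N * (s - \<epsilon>) * (b2 - B)"
      using far h2 by (intro mult_right_mono) (auto simp: k'_def)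
    moreover have "real N * (t * (A + a2) + (s - \<epsilon>) * (b2 - B)) \<le> real N * (- \<delta>)"
      using h2 by (intro mult_left_mono) auto
    ultimately have ex: "real (Suc n) * A + real k * B + \<kappa> + (real n * a2 + real k' * b2) \<le> D + (real m * B - \<delta> * real N)"
      unfolding D_def kk by (simp add: algebra_simps)
    have "(\<integral>\<^sup>+\<omega>. ennreal (S (fl N s) (fl N t) k \<omega> powr \<eta>) \<partial>M) = ennreal (exp (real (Suc n) * A + real k * B + \<kappa>)) * Zmom \<mu> k' n \<eta>"
      using assms k by (subst S_moment) (auto simp: A_def B_def \<kappa>_def \<mu>_def n_def k'_def)
    also have "\<dots> \<le> ennreal (exp (real (Suc n) * A + real k * B + \<kappa>)) * ennreal (C2 * exp (real n * a2 + real k' * b2))"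
      by (intro mult_left_mono C2) simp
    also have "\<dots> = ennreal (C2 * exp (real (Suc n) * A + real k * B + \<kappa> + (real n * a2 + real k' * b2)))"
      by (subst ennreal_mult'[symmetric], simp, simp only: exp_add mult_ac)
    also have "\<dots> \<le> ennreal (C2 * exp (D + (real m * B - \<delta> * real N)))"
      using ex C2 by (intro ennreal_leI mult_left_mono) auto
    also have "\<dots> \<le> ennreal (C * exp (real m * B - \<delta> * real N))"
      unfolding C_def exp_add using C1 C2 by (intro ennreal_leI) (simp add: mult.assoc mult_right_mono)
    finally show ?thesis unfolding m_def .
  qed
  have "C > 0" using C1 C2 by (simp add: C_def)
  then show ?thesis using T S unfolding B_def by blast
qed

lemma W_powr_le:
  assumes "0 \<le> \<eta>"
  shows "W m n \<omega> powr \<eta> \<le> real (m + n + 2) powr \<eta> * ((\<Sum>l=1..Suc n. T m n l \<omega> powr \<eta>) + (\<Sum>k=1..Suc m. S m n k \<omega> powr \<eta>))"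
proof -
  define f where "f = case_sum (\<lambda>l. T m n l \<omega>) (\<lambda>k. S m n k \<omega>)"
  let ?I = "{1..Suc n} <+> {1..Suc m}"
  have "(\<Sum>i\<in>?I. f i) powr \<eta> \<le> real (card ?I) powr \<eta> * (\<Sum>i\<in>?I. f i powr \<eta>)"
    using assms by (intro power_sum_le) (auto simp: f_def T_pos S_pos)
  moreover have "(\<Sum>i\<in>?I. f i) = W m n \<omega>"
    unfolding W_exit by (simp add: sum.Plus f_def del: sum.cl_ivl_Suc)
  moreover have "(\<Sum>i\<in>?I. f i powr \<eta>) = (\<Sum>l=1..Suc n. T m n l \<omega> powr \<eta>) + (\<Sum>k=1..Suc m. S m n k \<omega> powr \<eta>)"
    by (simp add: sum.Plus f_def del: sum.cl_ivl_Suc)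
  moreover have "card ?I = m + n + 2" by (simp add: card_Plus)
  ultimately show ?thesis by simp
qed

text \<open>A near exit leaves a rectangle that misses at most 1 + \<epsilon> N rows or columns, so
  comparing it with the full one costs at most exp (D \<epsilon> N) up to a constant.\<close>

lemma near_moment:
  assumes "0 \<le> \<eta>" "\<eta> < \<beta>" "s > 0" "t > 0" "\<epsilon> > 0"
  defines "D \<equiv> \<bar>lgm \<alpha> (- \<eta>)\<bar> + \<bar>lgm \<beta> \<eta>\<bar> + \<bar>lgm (\<alpha> + \<beta>) \<eta>\<bar>"
  defines "m \<equiv> \<lambda>N. fl N s" and "n \<equiv> \<lambda>N. fl N t"
  shows "l \<in> {1..Suc (n N)} \<Longrightarrow> real N * (t - \<epsilon>) \<le> real (Suc (n N) - l) \<Longrightarrow>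
      (\<integral>\<^sup>+\<omega>. ennreal (T (m N) (n N) l \<omega> powr \<eta>) \<partial>M) \<le> ennreal (exp (real (n N) * lgm \<alpha> (- \<eta>) + 2 * D + D * \<epsilon> * real N)) * Zmom (\<alpha> + \<beta>) (m N) (n N) \<eta>"
    and "k \<in> {1..Suc (m N)} \<Longrightarrow> real N * (s - \<epsilon>) \<le> real (Suc (m N) - k) \<Longrightarrow>
      (\<integral>\<^sup>+\<omega>. ennreal (S (m N) (n N) k \<omega> powr \<eta>) \<partial>M) \<le> ennreal (exp (real (n N) * lgm \<alpha> (- \<eta>) + 2 * D + D * \<epsilon> * real N)) * Zmom (\<alpha> + \<beta>) (m N) (n N) \<eta>"
proof -
  define \<mu> where "\<mu> = \<alpha> + \<beta>"
  define A where "A = lgm \<alpha> (- \<eta>)"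
  define B where "B = lgm \<beta> \<eta>"
  define \<kappa> where "\<kappa> = lgm \<mu> \<eta>"
  have \<eta>\<mu>: "\<eta> < \<mu>" "\<mu> > 0" using assms \<alpha>_pos \<beta>_pos by (auto simp: \<mu>_def)
  have D: "D = \<bar>A\<bar> + \<bar>B\<bar> + \<bar>\<kappa>\<bar>" by (simp add: D_def A_def B_def \<kappa>_def \<mu>_def)
  have D0: "D \<ge> 0" by (simp add: D)
  have DN: "D * x \<le> D + D * \<epsilon> * real N" if "x \<le> 1 + \<epsilon> * real N" for x
    using mult_left_mono[OF that D0] by (simp add: algebra_simps)
  show "(\<integral>\<^sup>+\<omega>. ennreal (T (m N) (n N) l \<omega> powr \<eta>) \<partial>M) \<le> ennreal (exp (real (n N) * lgm \<alpha> (- \<eta>) + 2 * D + D * \<epsilon> * real N)) * Zmom (\<alpha> + \<beta>) (m N) (n N) \<eta>"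
    if l: "l \<in> {1..Suc (n N)}" and near: "real N * (t - \<epsilon>) \<le> real (Suc (n N) - l)"
  proof -
    define l' where "l' = Suc (n N) - l"
    have l': "l' \<le> n N" using l by (auto simp: l'_def)
    define x where "x = real (n N - l')"
    have x: "x = real (n N) - real l'" using l' by (simp add: x_def of_nat_diff)
    have "real (n N) \<le> real N * t" unfolding n_def using fl_bounds assms by simp
    then have "x \<le> 1 + \<epsilon> * real N" using near unfolding x l'_def[symmetric] by (simp add: algebra_simps)
    then have Dx: "D * x \<le> D + D * \<epsilon> * real N" by (rule DN)
    have "real l' * A + \<kappa> + - (x * \<kappa>) = real (n N) * A + \<kappa> - x * (A + \<kappa>)" by (simp add: x algebra_simps)
    also have "\<dots> \<le> real (n N) * A + D + x * D"
    proof -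
      have "x * (- (A + \<kappa>)) \<le> x * D" by (rule mult_left_mono) (auto simp: D x_def)
      moreover have "\<kappa> \<le> D" by (simp add: D)
      ultimately show ?thesis by (simp add: algebra_simps)
    qed
    also have "\<dots> \<le> real (n N) * A + 2 * D + D * \<epsilon> * real N" using Dx by (simp add: mult.commute)
    finally have ex: "real l' * A + \<kappa> + - (x * \<kappa>) \<le> real (n N) * A + 2 * D + D * \<epsilon> * real N" .
    have "(\<integral>\<^sup>+\<omega>. ennreal (T (m N) (n N) l \<omega> powr \<eta>) \<partial>M) = ennreal (exp (real l' * A + \<kappa>)) * Zmom \<mu> (m N) l' \<eta>"
      using assms l \<eta>\<mu> by (subst T_moment) (auto simp: A_def \<kappa>_def \<mu>_def l'_def)
    also have "\<dots> \<le> ennreal (exp (real l' * A + \<kappa>)) * (ennreal (exp (- (x * \<kappa>))) * Zmom \<mu> (m N) (n N) \<eta>)"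
      unfolding x_def \<kappa>_def using \<eta>\<mu> assms l' by (intro mult_left_mono Zmom_extend_up) auto
    also have "\<dots> = ennreal (exp (real l' * A + \<kappa> + - (x * \<kappa>))) * Zmom \<mu> (m N) (n N) \<eta>"
      by (simp only: ennreal_exp_add mult.assoc)
    also have "\<dots> \<le> ennreal (exp (real (n N) * A + 2 * D + D * \<epsilon> * real N)) * Zmom \<mu> (m N) (n N) \<eta>"
      using ex by (intro mult_right_mono ennreal_leI) auto
    finally show ?thesis unfolding A_def \<mu>_def .
  qed
  show "(\<integral>\<^sup>+\<omega>. ennreal (S (m N) (n N) k \<omega> powr \<eta>) \<partial>M) \<le> ennreal (exp (real (n N) * lgm \<alpha> (- \<eta>) + 2 * D + D * \<epsilon> * real N)) * Zmom (\<alpha> + \<beta>) (m N) (n N) \<eta>"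
    if k: "k \<in> {1..Suc (m N)}" and near: "real N * (s - \<epsilon>) \<le> real (Suc (m N) - k)"
  proof -
    define k' where "k' = Suc (m N) - k"
    have k': "k' \<le> m N" using k by (auto simp: k'_def)
    define x where "x = real (m N - k')"
    have x: "x = real (m N) - real k'" using k' by (simp add: x_def of_nat_diff)
    have kk: "real k = 1 + x" using k by (simp add: x k'_def of_nat_diff)
    have "real (m N) \<le> real N * s" unfolding m_def using fl_bounds assms by simp
    then have "x \<le> 1 + \<epsilon> * real N" using near unfolding x k'_def[symmetric] by (simp add: algebra_simps)
    then have Dx: "D * x \<le> D + D * \<epsilon> * real N" by (rule DN)
    have "real (Suc (n N)) * A + real k * B + \<kappa> + - (x * \<kappa>) = real (n N) * A + A + B + \<kappa> + x * (B - \<kappa>)" by (simp add: kk algebra_simps)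
    also have "\<dots> \<le> real (n N) * A + D + x * D"
    proof -
      have "x * (B - \<kappa>) \<le> x * D" by (rule mult_left_mono) (auto simp: D x_def)
      moreover have "A + B + \<kappa> \<le> D" by (simp add: D)
      ultimately show ?thesis by (simp add: algebra_simps)
    qed
    also have "\<dots> \<le> real (n N) * A + 2 * D + D * \<epsilon> * real N" using Dx by (simp add: mult.commute)
    finally have ex: "real (Suc (n N)) * A + real k * B + \<kappa> + - (x * \<kappa>) \<le> real (n N) * A + 2 * D + D * \<epsilon> * real N" .
    have "(\<integral>\<^sup>+\<omega>. ennreal (S (m N) (n N) k \<omega> powr \<eta>) \<partial>M) = ennreal (exp (real (Suc (n N)) * A + real k * B + \<kappa>)) * Zmom \<mu> k' (n N) \<eta>"
      using assms k by (subst S_moment) (auto simp: A_def B_def \<kappa>_def \<mu>_def k'_def)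
    also have "\<dots> \<le> ennreal (exp (real (Suc (n N)) * A + real k * B + \<kappa>)) * (ennreal (exp (- (x * \<kappa>))) * Zmom \<mu> (m N) (n N) \<eta>)"
      unfolding x_def \<kappa>_def using \<eta>\<mu> assms k' by (intro mult_left_mono Zmom_extend_right) auto
    also have "\<dots> = ennreal (exp (real (Suc (n N)) * A + real k * B + \<kappa> + - (x * \<kappa>))) * Zmom \<mu> (m N) (n N) \<eta>"
      by (simp only: ennreal_exp_add mult.assoc)
    also have "\<dots> \<le> ennreal (exp (real (n N) * A + 2 * D + D * \<epsilon> * real N)) * Zmom \<mu> (m N) (n N) \<eta>"
      using ex by (intro mult_right_mono ennreal_leI) auto
    finally show ?thesis unfolding A_def \<mu>_def .
  qed
qed

text \<open>The moment of \<open>W\<close> is explicit and is shared by polynomially many exit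
  terms. The far ones are exponentially too small, so the near ones must carry it, and these are
  comparable to the moment without boundary.\<close>

lemma Zmom_lower_aux:
  assumes "0 \<le> \<eta>" "\<eta> < \<beta>" "\<eta> < \<theta>1" "\<theta>1 < \<alpha> + \<beta>" "\<eta> < \<theta>2" "\<theta>2 < \<alpha> + \<beta>" and st: "s > 0" "t > 0"
    and h1: "lgm \<alpha> (- \<eta>) + al \<eta> \<theta>1 \<ge> 0"
      "(t - \<epsilon>) * (lgm \<alpha> (- \<eta>) + al \<eta> \<theta>1) + s * (be (\<alpha> + \<beta>) \<eta> \<theta>1 - lgm \<beta> \<eta>) \<le> - \<delta>"
    and h2: "be (\<alpha> + \<beta>) \<eta> \<theta>2 - lgm \<beta> \<eta> \<ge> 0"
      "t * (lgm \<alpha> (- \<eta>) + al \<eta> \<theta>2) + (s - \<epsilon>) * (be (\<alpha> + \<beta>) \<eta> \<theta>2 - lgm \<beta> \<eta>) \<le> - \<delta>"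
    and \<delta>: "\<delta> > 0" and \<epsilon>: "\<epsilon> > 0"
    and \<epsilon>': "\<epsilon>' > (\<bar>lgm \<alpha> (- \<eta>)\<bar> + \<bar>lgm \<beta> \<eta>\<bar> + \<bar>lgm (\<alpha> + \<beta>) \<eta>\<bar>) * \<epsilon>"
  shows "\<forall>\<^sub>F N in sequentially. ennreal (exp (real N * (s * lgm \<beta> \<eta> - t * lgm \<alpha> (- \<eta>) - \<epsilon>'))) \<le> Zmom (\<alpha> + \<beta>) (fl N s) (fl N t) \<eta>"
proof -
  define \<mu> where "\<mu> = \<alpha> + \<beta>"
  define A where "A = lgm \<alpha> (- \<eta>)"
  define B where "B = lgm \<beta> \<eta>"
  define D where "D = \<bar>lgm \<alpha> (- \<eta>)\<bar> + \<bar>lgm \<beta> \<eta>\<bar> + \<bar>lgm (\<alpha> + \<beta>) \<eta>\<bar>"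
  define m n where "m N = fl N s" and "n N = fl N t" for N
  define z where "z N = enn2real (Zmom \<mu> (m N) (n N) \<eta>)" for N
  define R where "R N = real (m N + n N + 2)" for N
  define E where "E N = exp (real (n N) * A + 2 * D + D * \<epsilon> * real N)" for N
  have \<eta>\<mu>: "\<eta> < \<mu>" "\<mu> > 0" using assms \<alpha>_pos \<beta>_pos by (auto simp: \<mu>_def)
  have z: "Zmom \<mu> (m N) (n N) \<eta> = ennreal (z N)" "z N \<ge> 0" for N
    using Zmom_finite[OF \<eta>\<mu>(2,1), of "m N" "n N"] by (auto simp: z_def less_top)
  obtain C where C: "C > 0" and far: "\<And>N l. l \<in> {1..Suc (n N)} \<Longrightarrow> real (Suc (n N) - l) \<le> real N * (t - \<epsilon>) \<Longrightarrow>
      (\<integral>\<^sup>+\<omega>. ennreal (T (m N) (n N) l \<omega> powr \<eta>) \<partial>M) \<le> ennreal (C * exp (real (m N) * B - \<delta> * real N))"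
    "\<And>N k. k \<in> {1..Suc (m N)} \<Longrightarrow> real (Suc (m N) - k) \<le> real N * (s - \<epsilon>) \<Longrightarrow>
      (\<integral>\<^sup>+\<omega>. ennreal (S (m N) (n N) k \<omega> powr \<eta>) \<partial>M) \<le> ennreal (C * exp (real (m N) * B - \<delta> * real N))"
    using far_moment[OF assms(1-12)] unfolding m_def n_def B_def by metis
  \<comment> \<open>Bounds every single exit term: the first summand covers the far exits and the
    second the near ones.\<close>
  define Q where "Q N = C * exp (real (m N) * B - \<delta> * real N) + E N * z N" for N
  have Q0: "0 \<le> Q N" for N using C z by (simp add: Q_def E_def)
  have Tb: "(\<integral>\<^sup>+\<omega>. ennreal (T (m N) (n N) l \<omega> powr \<eta>) \<partial>M) \<le> ennreal (Q N)" if "l \<in> {1..Suc (n N)}" for N l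
  proof (cases "real (Suc (n N) - l) \<le> real N * (t - \<epsilon>)")
    case True
    from far(1)[OF that True] show ?thesis
      by (rule order_trans) (use z in \<open>auto simp: Q_def E_def intro!: ennreal_leI\<close>)
  next
    case False
    have "(\<integral>\<^sup>+\<omega>. ennreal (T (m N) (n N) l \<omega> powr \<eta>) \<partial>M) \<le> ennreal (E N) * Zmom \<mu> (m N) (n N) \<eta>"
      using near_moment(1)[OF assms(1,2) st \<epsilon>, where N=N and l=l] that False
      unfolding E_def A_def D_def \<mu>_def m_def n_def by simp
    also have "\<dots> = ennreal (E N * z N)" using z by (simp add: ennreal_mult' E_def)
    also have "\<dots> \<le> ennreal (Q N)" using C by (intro ennreal_leI) (simp add: Q_def)
    finally show ?thesis .
  qed
  have Sb: "(\<integral>\<^sup>+\<omega>. ennreal (S (m N) (n N) k \<omega> powr \<eta>) \<partial>M) \<le> ennreal (Q N)" if "k \<in> {1..Suc (m N)}" for N k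
  proof (cases "real (Suc (m N) - k) \<le> real N * (s - \<epsilon>)")
    case True
    from far(2)[OF that True] show ?thesis
      by (rule order_trans) (use z in \<open>auto simp: Q_def E_def intro!: ennreal_leI\<close>)
  next
    case False
    have "(\<integral>\<^sup>+\<omega>. ennreal (S (m N) (n N) k \<omega> powr \<eta>) \<partial>M) \<le> ennreal (E N) * Zmom \<mu> (m N) (n N) \<eta>"
      using near_moment(2)[OF assms(1,2) st \<epsilon>, where N=N and k=k] that False
      unfolding E_def A_def D_def \<mu>_def m_def n_def by simp
    also have "\<dots> = ennreal (E N * z N)" using z by (simp add: ennreal_mult' E_def)
    also have "\<dots> \<le> ennreal (Q N)" using C by (intro ennreal_leI) (simp add: Q_def)
    finally show ?thesis .
  qed
  have main: "exp (real (Suc (m N)) * B) \<le> R N powr \<eta> * (R N * Q N)" for N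
  proof -
    have "ennreal (exp (real (Suc (m N)) * B)) = (\<integral>\<^sup>+\<omega>. ennreal (W (m N) (n N) \<omega> powr \<eta>) \<partial>M)"
      unfolding B_def using assms by (intro W_moment[symmetric])
    also have "\<dots> \<le> (\<integral>\<^sup>+\<omega>. ennreal (R N powr \<eta>) * ((\<Sum>l=1..Suc (n N). ennreal (T (m N) (n N) l \<omega> powr \<eta>)) + (\<Sum>k=1..Suc (m N). ennreal (S (m N) (n N) k \<omega> powr \<eta>))) \<partial>M)"
    proof (rule nn_integral_mono)
      fix \<omega>
      have "ennreal (W (m N) (n N) \<omega> powr \<eta>) \<le> ennreal (R N powr \<eta> * ((\<Sum>l=1..Suc (n N). T (m N) (n N) l \<omega> powr \<eta>) + (\<Sum>k=1..Suc (m N). S (m N) (n N) k \<omega> powr \<eta>)))"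
        unfolding R_def by (rule ennreal_leI[OF W_powr_le[OF assms(1)]])
      also have "\<dots> = ennreal (R N powr \<eta>) * ((\<Sum>l=1..Suc (n N). ennreal (T (m N) (n N) l \<omega> powr \<eta>)) + (\<Sum>k=1..Suc (m N). ennreal (S (m N) (n N) k \<omega> powr \<eta>)))"
        by (simp only: ennreal_mult' powr_ge_zero sum_ennreal ennreal_plus sum_nonneg)
      finally show "ennreal (W (m N) (n N) \<omega> powr \<eta>) \<le> \<dots>" .
    qed
    also have "\<dots> = ennreal (R N powr \<eta>) * ((\<Sum>l=1..Suc (n N). \<integral>\<^sup>+\<omega>. ennreal (T (m N) (n N) l \<omega> powr \<eta>) \<partial>M) + (\<Sum>k=1..Suc (m N). \<integral>\<^sup>+\<omega>. ennreal (S (m N) (n N) k \<omega> powr \<eta>) \<partial>M))"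
      by (subst nn_integral_cmult, measurable, subst nn_integral_add, measurable, subst nn_integral_sum, measurable, subst nn_integral_sum, measurable)
    also have "\<dots> \<le> ennreal (R N powr \<eta>) * ((\<Sum>l=1..Suc (n N). ennreal (Q N)) + (\<Sum>k=1..Suc (m N). ennreal (Q N)))"
      by (intro mult_left_mono add_mono sum_mono Tb Sb) auto
    also have "\<dots> = ennreal (R N powr \<eta> * (R N * Q N))"
    proof -
      have "(\<Sum>l=1..Suc (n N). ennreal (Q N)) + (\<Sum>k=1..Suc (m N). ennreal (Q N)) = ennreal ((\<Sum>l=1..Suc (n N). Q N) + (\<Sum>k=1..Suc (m N). Q N))"
        using Q0 by (simp only: sum_ennreal ennreal_plus sum_nonneg)
      also have "(\<Sum>l=1..Suc (n N). Q N) + (\<Sum>k=1..Suc (m N). Q N) = R N * Q N"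
        by (simp add: R_def algebra_simps)
      finally show ?thesis by (simp add: ennreal_mult')
    qed
    finally show ?thesis by (subst (asm) ennreal_le_iff) (auto simp: Q0 R_def)
  qed
  \<comment> \<open>The margin left by the strict inequality for \<epsilon>'; it absorbs the
    polynomial factors.\<close>
  define g where "g = \<epsilon>' - D * \<epsilon>"
  have g: "g > 0" using \<epsilon>' by (simp add: g_def D_def)
  have Rle: "R N \<le> real N * (s + t) + 2" for N
    using fl_bounds(1)[of s N] fl_bounds(1)[of t N] st by (simp add: R_def m_def n_def algebra_simps)
  have st': "s + t > 0" using st by simp
  define P where "P N = (real N * (s + t) + 2) powr (1 + \<eta>)" for N :: nat
  have RP: "R N powr \<eta> * R N \<le> P N" for N
  proof -
    have "R N powr \<eta> * R N = R N powr (1 + \<eta>)" by (simp add: powr_add R_def)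
    also have "\<dots> \<le> P N" unfolding P_def using Rle assms by (intro powr_mono2) (auto simp: R_def)
    finally show ?thesis .
  qed
  have "\<forall>\<^sub>F N in sequentially. (C * exp (- B)) * (real N * (s + t) + 2) powr (1 + \<eta>) * exp (- \<delta> * real N) \<le> 1 / 2"
    by (rule poly_exp_eventually[OF \<delta> st']) simp
  moreover have "\<forall>\<^sub>F N in sequentially. (exp (2 * D + \<bar>A\<bar> + 2 * \<bar>B\<bar>)) * (real N * (s + t) + 2) powr (1 + \<eta>) * exp (- g * real N) \<le> 1 / 2"
    by (rule poly_exp_eventually[OF g st']) simp
  ultimately show ?thesis
  proof eventually_elim
    case (elim N)
    define bB where "bB = real (Suc (m N)) * B"
    have "1 = exp (- bB) * exp bB" by (simp add: exp_add[symmetric])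
    also have "\<dots> \<le> exp (- bB) * (R N powr \<eta> * (R N * Q N))"
      using main[of N] by (intro mult_left_mono) (auto simp: bB_def)
    also have "\<dots> = exp (- bB) * ((R N powr \<eta> * R N) * Q N)" by (simp only: mult.assoc)
    also have "\<dots> \<le> exp (- bB) * (P N * Q N)"
      by (intro mult_left_mono mult_right_mono RP Q0) auto
    also have "\<dots> = C * exp (- B) * P N * exp (- \<delta> * real N) + P N * (exp (- bB) * E N) * z N"
    proof -
      have "exp (real (m N) * B - \<delta> * real N) = exp bB * exp (- B) * exp (- \<delta> * real N)"
        by (simp add: exp_add[symmetric] bB_def algebra_simps)
      then show ?thesis by (simp add: Q_def exp_minus field_simps)
    qed
    \<comment> \<open>The far exits use up at most half of the total.\<close>
    finally have "1 / 2 \<le> P N * (exp (- bB) * E N) * z N" using elim(1) by (simp add: P_def)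
    also have "\<dots> \<le> P N * (exp (2 * D + \<bar>A\<bar> + 2 * \<bar>B\<bar>) * exp (- g * real N) * exp (- (real N * (s * B - t * A - \<epsilon>')))) * z N"
    proof (intro mult_right_mono mult_left_mono)
      have 1: "real (n N) * A \<le> real N * t * A + \<bar>A\<bar>" unfolding n_def using st by (intro fl_mult_le) simp
      have 2: "real (m N) * (- B) \<le> real N * s * (- B) + \<bar>- B\<bar>" unfolding m_def using st by (intro fl_mult_le) simp
      have "- bB + (real (n N) * A + 2 * D + D * \<epsilon> * real N) \<le>
         (2 * D + \<bar>A\<bar> + 2 * \<bar>B\<bar>) + (- g * real N) + (- (real N * (s * B - t * A - \<epsilon>')))"
        using 1 2 by (simp add: bB_def g_def algebra_simps)
      then show "exp (- bB) * E N \<le> exp (2 * D + \<bar>A\<bar> + 2 * \<bar>B\<bar>) * exp (- g * real N) * exp (- (real N * (s * B - t * A - \<epsilon>')))"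
        by (simp only: E_def exp_add[symmetric] exp_le_cancel_iff)
    qed (use z in \<open>auto simp: P_def\<close>)
    also have "\<dots> = (exp (2 * D + \<bar>A\<bar> + 2 * \<bar>B\<bar>) * P N * exp (- g * real N)) * (exp (- (real N * (s * B - t * A - \<epsilon>'))) * z N)"
      by (simp only: mult_ac)
    also have "\<dots> \<le> 1 / 2 * (exp (- (real N * (s * B - t * A - \<epsilon>'))) * z N)"
      using elim(2) z by (intro mult_right_mono) (auto simp: P_def)
    finally have "1 \<le> exp (- (real N * (s * B - t * A - \<epsilon>'))) * z N" by simp
    then have "exp (real N * (s * B - t * A - \<epsilon>')) * 1 \<le> exp (real N * (s * B - t * A - \<epsilon>')) * (exp (- (real N * (s * B - t * A - \<epsilon>'))) * z N)"
      by (rule mult_left_mono) simp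
    then have "exp (real N * (s * B - t * A - \<epsilon>')) \<le> z N"
      by (simp only: mult.assoc[symmetric] exp_add[symmetric] mult_1_right add.right_inverse exp_zero mult_1_left)
    then show ?case using z(1)[of N] by (simp add: A_def B_def \<mu>_def m_def n_def ennreal_leI)
  qed
qed

end

section \<open>Critical points of the exponents\<close>

lemma Digamma_at_bot: "filterlim (Digamma :: real \<Rightarrow> real) at_bot (at_right 0)"
proof (rule filterlim_at_bot_mono)
  show "filterlim (\<lambda>x::real. Digamma 2 - 1 / x) at_bot (at_right 0)" by real_asymp
  have "eventually (\<lambda>x::real. x \<in> {0<..<1}) (at_right 0)" by (rule eventually_at_right_real) simp
  then show "eventually (\<lambda>x::real. Digamma x \<le> Digamma 2 - 1 / x) (at_right 0)"
  proof eventually_elim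
    case (elim x)
    then have "Digamma (x + 1) \<le> Digamma 2" by (intro Digamma_real_mono) auto
    then show ?case using Digamma_plus1[of x] elim by simp
  qed
qed

text \<open>The shift by 1 splits off 1 / x^2 and leaves a positive remainder.\<close>

lemma Trigamma_at_top: "filterlim (Polygamma 1 :: real \<Rightarrow> real) at_top (at_right 0)"
proof (rule filterlim_at_top_mono)
  show "filterlim (\<lambda>x::real. 1 / x ^ 2) at_top (at_right 0)" by real_asymp
  show "eventually (\<lambda>x::real. 1 / x ^ 2 \<le> Polygamma 1 x) (at_right 0)"
    using eventually_at_right_less
  proof eventually_elim
    case (elim x)
    have "Polygamma 1 (x + 1) > 0" using elim by (intro Polygamma_real_odd_pos) auto
    then show ?case using Polygamma_plus1[of x 1] elim by (simp add: power2_eq_square)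
  qed
qed

lemma lgm_altdef: "0 < \<nu> \<Longrightarrow> \<xi> < \<nu> \<Longrightarrow> lgm \<nu> \<xi> = ln_Gamma (\<nu> - \<xi>) - ln_Gamma \<nu>"
  by (simp add: lgm_def ln_Gamma_real_pos)

lemma al_altdef: "0 \<le> \<xi> \<Longrightarrow> \<xi> < \<theta> \<Longrightarrow> al \<xi> \<theta> = ln_Gamma (\<theta> - \<xi>) - ln_Gamma \<theta>"
  by (simp add: al_def lgm_altdef)

lemma be_altdef: "0 \<le> \<xi> \<Longrightarrow> \<theta> < \<mu> \<Longrightarrow> be \<mu> \<xi> \<theta> = ln_Gamma (\<mu> - \<theta>) - ln_Gamma (\<mu> - \<theta> + \<xi>)"
  by (simp add: be_def lgm_altdef)

lemma pos_not_nonpos_Int: "x > 0 \<Longrightarrow> (x :: real) \<notin> \<int>\<^sub>\<le>\<^sub>0"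
  by (auto elim!: nonpos_Ints_cases)

lemma DERIV_al:
  assumes "0 \<le> \<xi>" "\<xi> < \<theta>"
  shows "(al \<xi> has_real_derivative Digamma (\<theta> - \<xi>) - Digamma \<theta>) (at \<theta>)"
proof (rule has_field_derivative_transform_within_open)
  show "((\<lambda>\<theta>. ln_Gamma (\<theta> - \<xi>) - ln_Gamma \<theta>) has_real_derivative Digamma (\<theta> - \<xi>) - Digamma \<theta>) (at \<theta>)"
    using assms by (auto intro!: derivative_eq_intros)
  show "open {\<xi><..}" "\<theta> \<in> {\<xi><..}" using assms by auto
qed (use assms in \<open>auto simp: al_altdef\<close>)

lemma DERIV_be:
  assumes "0 \<le> \<xi>" "\<theta> < \<mu>"
  shows "(be \<mu> \<xi> has_real_derivative Digamma (\<mu> - \<theta> + \<xi>) - Digamma (\<mu> - \<theta>)) (at \<theta>)"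
proof (rule has_field_derivative_transform_within_open)
  show "((\<lambda>\<theta>. ln_Gamma (\<mu> - \<theta>) - ln_Gamma (\<mu> - \<theta> + \<xi>)) has_real_derivative Digamma (\<mu> - \<theta> + \<xi>) - Digamma (\<mu> - \<theta>)) (at \<theta>)"
    using assms by (auto intro!: derivative_eq_intros)
  show "open {..<\<mu>}" "\<theta> \<in> {..<\<mu>}" using assms by auto
qed (use assms in \<open>auto simp: be_altdef\<close>)

lemma ivt_zero:
  fixes h :: "real \<Rightarrow> real"
  assumes "lo < hi" "\<And>x. lo < x \<Longrightarrow> x < hi \<Longrightarrow> isCont h x"
    and top: "filterlim h at_top (at_left hi)" and bot: "filterlim (\<lambda>x. - h x) at_top (at_right lo)"
  shows "\<exists>x. lo < x \<and> x < hi \<and> h x = 0"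
proof -
  define c where "c = (lo + hi) / 2"
  have c: "lo < c" "c < hi" using assms(1) by (auto simp: c_def)
  have "eventually (\<lambda>x. h x \<ge> 0 \<and> x \<in> {c<..<hi}) (at_left hi)"
    using top c(2) by (intro eventually_conj eventually_at_left_real) (auto simp: filterlim_at_top)
  then obtain b where b: "h b \<ge> 0" "c < b" "b < hi"
    using eventually_happens'[OF trivial_limit_at_left_real] by fastforce
  have "eventually (\<lambda>x. - h x \<ge> 0 \<and> x \<in> {lo<..<c}) (at_right lo)"
    using bot[unfolded filterlim_at_top, rule_format, of 0] c(1) by (intro eventually_conj eventually_at_right_real)
  then obtain a where a: "h a \<le> 0" "lo < a" "a < c"
    using eventually_happens'[OF trivial_limit_at_right_real] by fastforce
  have "\<exists>x\<ge>a. x \<le> b \<and> h x = 0"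
    using a b assms(2) by (intro IVT) auto
  then show ?thesis using a b by (meson less_le_trans le_less_trans)
qed

lemma filterlim_add_isCont_at_top:
  fixes f g :: "real \<Rightarrow> real"
  assumes "isCont f a" "filterlim g at_top (at a within A)"
  shows "filterlim (\<lambda>x. f x + g x) at_top (at a within A)"
  using assms by (intro filterlim_tendsto_add_at_top[OF tendsto_mono[OF at_le[OF subset_UNIV] isContD]])

lemma filterlim_scaled_at_top:
  fixes g :: "real \<Rightarrow> real"
  assumes "c > 0" "filterlim g at_top F"
  shows "filterlim (\<lambda>x. c * g x) at_top F"
  using assms by (intro filterlim_tendsto_pos_mult_at_top[OF tendsto_const])

text \<open>The expression is the \<theta>-derivative of t \<open>al\<close> + s \<open>be\<close>.
  The pole of Digamma at 0 drives it to minus infinity at \<xi> and to plus infinity at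
  \<mu>.\<close>

lemma critical_point:
  assumes "0 < \<xi>" "\<xi> < \<mu>" "s > 0" "t > 0"
  shows "\<exists>\<theta>. \<xi> < \<theta> \<and> \<theta> < \<mu> \<and>
    t * (Digamma (\<theta> - \<xi>) - Digamma \<theta>) + s * (Digamma (\<mu> - \<theta> + \<xi>) - Digamma (\<mu> - \<theta>)) = (0 :: real)"
proof -
  have neg: "filterlim (\<lambda>x::real. - Digamma x) at_top (at_right 0)"
    using Digamma_at_bot by (simp add: filterlim_uminus_at_bot)
  have hi: "filterlim (\<lambda>\<theta>. - Digamma (\<mu> - \<theta>)) at_top (at_left \<mu>)"
    unfolding filterlim_at_left_to_right filterlim_at_right_to_0[of _ _ "- \<mu>"] using neg by simp
  have lo: "filterlim (\<lambda>\<theta>. - Digamma (\<theta> - \<xi>)) at_top (at_right \<xi>)"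
    unfolding filterlim_at_right_to_0[of _ _ \<xi>] using neg by simp
  have "filterlim (\<lambda>\<theta>. (t * (Digamma (\<theta> - \<xi>) - Digamma \<theta>) + s * Digamma (\<mu> - \<theta> + \<xi>)) + s * - Digamma (\<mu> - \<theta>)) at_top (at_left \<mu>)"
    using assms hi by (intro filterlim_add_isCont_at_top filterlim_scaled_at_top continuous_intros pos_not_nonpos_Int) auto
  moreover have "filterlim (\<lambda>\<theta>. (t * Digamma \<theta> - s * (Digamma (\<mu> - \<theta> + \<xi>) - Digamma (\<mu> - \<theta>))) + t * - Digamma (\<theta> - \<xi>)) at_top (at_right \<xi>)"
    using assms lo by (intro filterlim_add_isCont_at_top filterlim_scaled_at_top continuous_intros pos_not_nonpos_Int) auto
  ultimately show ?thesis
    using assms by (intro ivt_zero continuous_intros pos_not_nonpos_Int) (auto simp: algebra_simps)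
qed

text \<open>The limit of the preceding equation divided by \<xi>, as \<xi> tends to 0; also the
  critical equation of - t Digamma \<theta> - s Digamma (\<mu> - \<theta>).\<close>

lemma critical_point_0:
  assumes "0 < \<mu>" "s > 0" "t > 0"
  shows "\<exists>\<theta>. 0 < \<theta> \<and> \<theta> < \<mu> \<and> - t * Polygamma 1 \<theta> + s * Polygamma 1 (\<mu> - \<theta>) = (0 :: real)"
proof -
  have hi: "filterlim (\<lambda>\<theta>. Polygamma 1 (\<mu> - \<theta>)) at_top (at_left \<mu>)"
    unfolding filterlim_at_left_to_right filterlim_at_right_to_0[of _ _ "- \<mu>"] using Trigamma_at_top by simp
  have "filterlim (\<lambda>\<theta>. - t * Polygamma 1 \<theta> + s * Polygamma 1 (\<mu> - \<theta>)) at_top (at_left \<mu>)"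
    using assms hi by (intro filterlim_add_isCont_at_top filterlim_scaled_at_top continuous_intros pos_not_nonpos_Int) auto
  moreover have "filterlim (\<lambda>\<theta>. - s * Polygamma 1 (\<mu> - \<theta>) + t * Polygamma 1 \<theta>) at_top (at_right 0)"
    using assms Trigamma_at_top by (intro filterlim_add_isCont_at_top filterlim_scaled_at_top continuous_intros pos_not_nonpos_Int) auto
  ultimately show ?thesis
    using assms by (intro ivt_zero continuous_intros pos_not_nonpos_Int) (auto simp: algebra_simps)
qed

text \<open>With \<open>f\<close> and \<open>g\<close> the growth exponents per vertical and per horizontal step, this makes the exit
  terms at distance at least \<open>\<epsilon> N\<close> from the origin exponentially smaller than the stationary moment.\<close>

lemma tilt_critical_point:
  fixes f g :: "real \<Rightarrow> real"
  assumes "(f has_real_derivative f') (at \<theta>)" "(g has_real_derivative g') (at \<theta>)" "f' < 0" "g' > 0"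
    and crit: "t * f' + s * g' = 0" and "\<epsilon> > 0" and \<theta>: "lo < \<theta>" "\<theta> < hi"
  obtains \<theta>1 \<theta>2 \<delta> where "lo < \<theta>1" "\<theta>1 < hi" "lo < \<theta>2" "\<theta>2 < hi" "\<delta> > 0"
    "f \<theta>1 > f \<theta>" "(t - \<epsilon>) * (f \<theta>1 - f \<theta>) + s * (g \<theta>1 - g \<theta>) \<le> - \<delta>"
    "g \<theta>2 > g \<theta>" "t * (f \<theta>2 - f \<theta>) + (s - \<epsilon>) * (g \<theta>2 - g \<theta>) \<le> - \<delta>"
proof -
  \<comment> \<open>Lowering t by \<epsilon> breaks the balance at \<theta> and leaves the slope -
    \<epsilon> f' > 0, so a small move to the left decreases the sum. Lowering s instead calls for a
    move to the right.\<close>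
  have d1: "((\<lambda>x. (t - \<epsilon>) * f x + s * g x) has_real_derivative - \<epsilon> * f') (at \<theta>)"
    using crit by (auto intro!: derivative_eq_intros assms(1,2) simp: algebra_simps)
  have d2: "((\<lambda>x. t * f x + (s - \<epsilon>) * g x) has_real_derivative - \<epsilon> * g') (at \<theta>)"
    using crit by (auto intro!: derivative_eq_intros assms(1,2) simp: algebra_simps)
  have "- \<epsilon> * f' > 0" "- \<epsilon> * g' < 0" using assms by (auto simp: mult_pos_neg)
  note der = DERIV_pos_inc_left[OF d1 this(1)] DERIV_neg_dec_right[OF d2 this(2)]
    DERIV_neg_dec_left[OF assms(1,3)] DERIV_pos_inc_right[OF assms(2,4)]
  obtain e1 where e1: "e1 > 0"
    and 1: "\<And>h. 0 < h \<Longrightarrow> h < e1 \<Longrightarrow> (t - \<epsilon>) * f (\<theta> - h) + s * g (\<theta> - h) < (t - \<epsilon>) * f \<theta> + s * g \<theta>"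
    using der(1) by auto
  obtain e2 where e2: "e2 > 0"
    and 2: "\<And>h. 0 < h \<Longrightarrow> h < e2 \<Longrightarrow> t * f (\<theta> + h) + (s - \<epsilon>) * g (\<theta> + h) < t * f \<theta> + (s - \<epsilon>) * g \<theta>"
    using der(2) by auto
  obtain e3 where e3: "e3 > 0" and 3: "\<And>h. 0 < h \<Longrightarrow> h < e3 \<Longrightarrow> f \<theta> < f (\<theta> - h)"
    using der(3) by auto
  obtain e4 where e4: "e4 > 0" and 4: "\<And>h. 0 < h \<Longrightarrow> h < e4 \<Longrightarrow> g \<theta> < g (\<theta> + h)"
    using der(4) by auto
  note e = e1 e2 e3 e4
  define m where "m = Min {e1, e2, e3, e4, \<theta> - lo, hi - \<theta>}"
  define h where "h = m / 2"
  have m: "0 < m" using e \<theta> by (simp add: m_def)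
  have hx: "h < x" if "x \<in> {e1, e2, e3, e4, \<theta> - lo, hi - \<theta>}" for x
  proof -
    have "m \<le> x" unfolding m_def using that by (intro Min_le) auto
    then show ?thesis using m by (simp add: h_def)
  qed
  have h: "0 < h" "h < e1" "h < e2" "h < e3" "h < e4" "h < \<theta> - lo" "h < hi - \<theta>"
    using hx[of e1] hx[of e2] hx[of e3] hx[of e4] hx[of "\<theta> - lo"] hx[of "hi - \<theta>"] m by (simp_all add: h_def)
  define \<delta> where "\<delta> = min ((t - \<epsilon>) * f \<theta> + s * g \<theta> - ((t - \<epsilon>) * f (\<theta> - h) + s * g (\<theta> - h)))
    (t * f \<theta> + (s - \<epsilon>) * g \<theta> - (t * f (\<theta> + h) + (s - \<epsilon>) * g (\<theta> + h)))"
  have "\<delta> > 0" using 1[OF h(1,2)] 2[OF h(1,3)] by (simp add: \<delta>_def)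
  moreover have "(t - \<epsilon>) * (f (\<theta> - h) - f \<theta>) + s * (g (\<theta> - h) - g \<theta>) \<le> - \<delta>"
    "t * (f (\<theta> + h) - f \<theta>) + (s - \<epsilon>) * (g (\<theta> + h) - g \<theta>) \<le> - \<delta>"
    using min.cobounded1[of "(t - \<epsilon>) * f \<theta> + s * g \<theta> - ((t - \<epsilon>) * f (\<theta> - h) + s * g (\<theta> - h))",
        folded \<delta>_def] min.cobounded2[of _ "t * f \<theta> + (s - \<epsilon>) * g \<theta> - (t * f (\<theta> + h) + (s - \<epsilon>) * g (\<theta> + h))",
        folded \<delta>_def] by (simp_all add: \<delta>_def algebra_simps)
  ultimately show ?thesis using that[of "\<theta> - h" "\<theta> + h" \<delta>] 3 4 h \<theta> by auto
qed

lemma Zmom_lower: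
  assumes \<xi>: "0 < \<xi>" "\<xi> < \<theta>" "\<theta> < \<mu>" and st: "s > 0" "t > 0"
    and crit: "t * (Digamma (\<theta> - \<xi>) - Digamma \<theta>) + s * (Digamma (\<mu> - \<theta> + \<xi>) - Digamma (\<mu> - \<theta>)) = 0"
    and "e > 0"
  shows "\<forall>\<^sub>F N in sequentially. ennreal (exp (real N * (t * al \<xi> \<theta> + s * be \<mu> \<xi> \<theta> - e))) \<le> Zmom \<mu> (fl N s) (fl N t) \<xi>"
proof -
  define \<alpha> \<beta> where "\<alpha> = \<theta> - \<xi>" and "\<beta> = \<mu> - \<theta> + \<xi>"
  have ab: "\<alpha> > 0" "\<beta> > 0" "\<alpha> + \<beta> = \<mu>" "\<xi> < \<beta>" using assms by (auto simp: \<alpha>_def \<beta>_def)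
  obtain M :: "(nat \<times> nat \<Rightarrow> real) measure" and X par where "boundary_env M X par \<alpha> \<beta>"
    using boundary_env_exists[OF ab(1,2)] .
  then interpret boundary_env M X par \<alpha> \<beta> .
  have la: "lgm \<alpha> (- \<xi>) = - al \<xi> \<theta>" unfolding \<alpha>_def lgm_flip al_def ..
  have lb: "lgm \<beta> \<xi> = be \<mu> \<xi> \<theta>" using lgm_flip[of \<beta> \<xi>] by (simp add: \<beta>_def be_def)
  define D where "D = \<bar>lgm \<alpha> (- \<xi>)\<bar> + \<bar>lgm \<beta> \<xi>\<bar> + \<bar>lgm (\<alpha> + \<beta>) \<xi>\<bar>"
  \<comment> \<open>Keeps D \<epsilon> below e, the margin that \<open>Zmom_lower_aux\<close> asks
    for.\<close>
  define \<epsilon> where "\<epsilon> = e / (D + 1)"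
  have D: "D \<ge> 0" by (simp add: D_def)
  have \<epsilon>: "\<epsilon> > 0" "D * \<epsilon> < e" using \<open>e > 0\<close> D by (auto simp: \<epsilon>_def field_simps)
  have "Digamma (\<theta> - \<xi>) - Digamma \<theta> < 0" "Digamma (\<mu> - \<theta> + \<xi>) - Digamma (\<mu> - \<theta>) > 0"
    using \<xi> by (auto intro!: Digamma_real_strict_mono)
  then obtain \<theta>1 \<theta>2 \<delta> where t: "\<xi> < \<theta>1" "\<theta>1 < \<mu>" "\<xi> < \<theta>2" "\<theta>2 < \<mu>" "\<delta> > 0"
    "al \<xi> \<theta>1 > al \<xi> \<theta>" "(t - \<epsilon>) * (al \<xi> \<theta>1 - al \<xi> \<theta>) + s * (be \<mu> \<xi> \<theta>1 - be \<mu> \<xi> \<theta>) \<le> - \<delta>"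
    "be \<mu> \<xi> \<theta>2 > be \<mu> \<xi> \<theta>" "t * (al \<xi> \<theta>2 - al \<xi> \<theta>) + (s - \<epsilon>) * (be \<mu> \<xi> \<theta>2 - be \<mu> \<xi> \<theta>) \<le> - \<delta>"
    using tilt_critical_point[OF DERIV_al[of \<xi> \<theta>] DERIV_be[of \<xi> \<theta> \<mu>] _ _ crit \<epsilon>(1) \<xi>(2,3)] \<xi> by auto
  have "\<forall>\<^sub>F N in sequentially. ennreal (exp (real N * (s * lgm \<beta> \<xi> - t * lgm \<alpha> (- \<xi>) - e))) \<le> Zmom (\<alpha> + \<beta>) (fl N s) (fl N t) \<xi>"
    using t \<epsilon> ab st \<xi> unfolding D_def
    by (intro Zmom_lower_aux[of \<xi> \<theta>1 \<theta>2 s t \<epsilon> \<delta>]) (simp_all add: la lb)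
  then show ?thesis by (simp add: la lb ab add.commute)
qed

section \<open>Negative moments of the partition function\<close>

text \<open>Two applications of Cauchy-Schwarz give the exponents 2, 4 and 4.\<close>

lemma nn_integral_Hoelder:
  fixes f g h :: "'a \<Rightarrow> real"
  assumes [measurable]: "f \<in> borel_measurable M" "g \<in> borel_measurable M" "h \<in> borel_measurable M"
    and pos: "\<And>x. f x \<ge> 0" "\<And>x. g x \<ge> 0" "\<And>x. h x \<ge> 0"
    and A: "(\<integral>\<^sup>+x. ennreal (f x ^ 2) \<partial>M) \<le> ennreal A" and B: "(\<integral>\<^sup>+x. ennreal (g x ^ 4) \<partial>M) \<le> ennreal B"
    and C: "(\<integral>\<^sup>+x. ennreal (h x ^ 4) \<partial>M) \<le> ennreal C" and ABC: "A \<ge> 0" "B \<ge> 0" "C \<ge> 0"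
  shows "(\<integral>\<^sup>+x. ennreal (f x * g x * h x) \<partial>M) \<le> ennreal (A powr (1/2) * B powr (1/4) * C powr (1/4))"
proof -
  let ?I = "\<integral>\<^sup>+x. ennreal (f x * g x * h x) \<partial>M"
  let ?J = "\<integral>\<^sup>+x. ennreal ((g x * h x) ^ 2) \<partial>M"
  have 1: "?I ^ 2 \<le> ennreal A * ?J"
  proof -
    have "?I ^ 2 = (\<integral>\<^sup>+x. ennreal (f x) * ennreal (g x * h x) \<partial>M) ^ 2"
      using pos by (simp add: ennreal_mult'[symmetric] mult.assoc)
    also have "\<dots> \<le> (\<integral>\<^sup>+x. ennreal (f x) ^ 2 \<partial>M) * (\<integral>\<^sup>+x. ennreal (g x * h x) ^ 2 \<partial>M)"
      by (rule Cauchy_Schwarz_nn_integral) measurable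
    also have "\<dots> = (\<integral>\<^sup>+x. ennreal (f x ^ 2) \<partial>M) * ?J"
      using pos by (simp add: ennreal_power)
    also have "\<dots> \<le> ennreal A * ?J" by (intro mult_right_mono A) simp
    finally show ?thesis .
  qed
  have 2: "?J ^ 2 \<le> ennreal B * ennreal C"
  proof -
    have "?J ^ 2 = (\<integral>\<^sup>+x. ennreal (g x ^ 2) * ennreal (h x ^ 2) \<partial>M) ^ 2"
      by (simp add: ennreal_mult'[symmetric] power_mult_distrib)
    also have "\<dots> \<le> (\<integral>\<^sup>+x. ennreal (g x ^ 2) ^ 2 \<partial>M) * (\<integral>\<^sup>+x. ennreal (h x ^ 2) ^ 2 \<partial>M)"
      by (rule Cauchy_Schwarz_nn_integral) measurable
    also have "\<dots> = (\<integral>\<^sup>+x. ennreal (g x ^ 4) \<partial>M) * (\<integral>\<^sup>+x. ennreal (h x ^ 4) \<partial>M)"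
      by (simp add: ennreal_power)
    also have "\<dots> \<le> ennreal B * ennreal C" by (intro mult_mono B C) auto
    finally show ?thesis .
  qed
  have "?I ^ 4 = (?I ^ 2) ^ 2" by simp
  also have "\<dots> \<le> (ennreal A * ?J) ^ 2" by (intro power_mono 1) simp
  also have "\<dots> = ennreal A ^ 2 * ?J ^ 2" by (rule power_mult_distrib)
  also have "\<dots> \<le> ennreal A ^ 2 * (ennreal B * ennreal C)" by (intro mult_left_mono 2) simp
  also have "\<dots> = ennreal (A ^ 2 * (B * C))" using ABC by (simp add: ennreal_mult' ennreal_power)
  finally have 3: "?I ^ 4 \<le> ennreal (A ^ 2 * (B * C))" .
  define K where "K = A powr (1/2) * B powr (1/4) * C powr (1/4)"
  have "(x powr (1/4)) ^ 4 = x" if "x \<ge> 0" for x :: real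
    using that by (cases "x = 0") (simp_all add: powr_powr flip: powr_numeral)
  moreover have "(x powr (1/2)) ^ 4 = x ^ 2" if "x \<ge> 0" for x :: real
    using that by (cases "x = 0") (simp_all add: powr_powr flip: powr_numeral)
  ultimately have K4: "K ^ 4 = A ^ 2 * (B * C)" using ABC by (simp add: K_def power_mult_distrib)
  have K0: "K \<ge> 0" by (simp add: K_def)
  have "?I < \<top>"
    using le_less_trans[OF 3 ennreal_less_top] by (simp add: power_less_top_ennreal)
  then obtain i where i: "i \<ge> 0" "?I = ennreal i" by (cases ?I) auto
  have "i ^ 4 \<le> K ^ 4" using 3 i ABC unfolding K4 by (simp add: ennreal_power)
  then have "i \<le> K" using K0 by (rule power_le_imp_le_base[where n=3, simplified])
  then show ?thesis using i K_def by (simp add: ennreal_leI)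
qed

lemma exp_powr_mult: "exp x powr y = exp (y * (x::real))"
  by (simp add: powr_def)

lemma nn_integral_sum_powr:
  fixes a :: "'i \<Rightarrow> 'a \<Rightarrow> real"
  assumes [measurable]: "\<And>i. i \<in> I \<Longrightarrow> a i \<in> borel_measurable M" and I: "finite I" "real (card I) \<le> R"
    and pos: "\<And>i x. i \<in> I \<Longrightarrow> a i x > 0" and "\<eta> \<ge> 0" "K \<ge> 0"
    and K: "\<And>i. i \<in> I \<Longrightarrow> (\<integral>\<^sup>+x. ennreal (a i x powr \<eta>) \<partial>M) \<le> ennreal K"
  shows "(\<integral>\<^sup>+x. ennreal ((\<Sum>i\<in>I. a i x) powr \<eta>) \<partial>M) \<le> ennreal (R powr \<eta> * (R * K))"
proof -
  have R: "R \<ge> 0" using I by linarith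
  have "(\<integral>\<^sup>+x. ennreal ((\<Sum>i\<in>I. a i x) powr \<eta>) \<partial>M) \<le> (\<integral>\<^sup>+x. ennreal (R powr \<eta>) * (\<Sum>i\<in>I. ennreal (a i x powr \<eta>)) \<partial>M)"
  proof (rule nn_integral_mono)
    fix x
    have "(\<Sum>i\<in>I. a i x) powr \<eta> \<le> real (card I) powr \<eta> * (\<Sum>i\<in>I. a i x powr \<eta>)"
      using pos assms by (intro power_sum_le) auto
    also have "\<dots> \<le> R powr \<eta> * (\<Sum>i\<in>I. a i x powr \<eta>)"
      using I assms by (intro mult_right_mono powr_mono2 sum_nonneg) auto
    finally have "ennreal ((\<Sum>i\<in>I. a i x) powr \<eta>) \<le> ennreal (R powr \<eta> * (\<Sum>i\<in>I. a i x powr \<eta>))"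
      by (rule ennreal_leI)
    then show "ennreal ((\<Sum>i\<in>I. a i x) powr \<eta>) \<le> ennreal (R powr \<eta>) * (\<Sum>i\<in>I. ennreal (a i x powr \<eta>))"
      by (simp only: ennreal_mult' powr_ge_zero sum_ennreal)
  qed
  also have "\<dots> = ennreal (R powr \<eta>) * (\<Sum>i\<in>I. \<integral>\<^sup>+x. ennreal (a i x powr \<eta>) \<partial>M)"
    by (subst nn_integral_cmult, measurable, subst nn_integral_sum, measurable)
  also have "\<dots> \<le> ennreal (R powr \<eta>) * (\<Sum>i\<in>I. ennreal K)"
    by (intro mult_left_mono sum_mono K) auto
  also have "(\<Sum>i\<in>I. ennreal K) = ennreal (real (card I) * K)"
    using \<open>K \<ge> 0\<close> by (simp add: ennreal_mult' ennreal_of_nat_eq_real_of_nat)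
  also have "ennreal (R powr \<eta>) * \<dots> \<le> ennreal (R powr \<eta>) * ennreal (R * K)"
    using I \<open>K \<ge> 0\<close> by (intro mult_left_mono ennreal_leI mult_right_mono) auto
  also have "\<dots> = ennreal (R powr \<eta> * (R * K))" by (simp add: ennreal_mult')
  finally show ?thesis .
qed

section \<open>First-order behaviour of the exponents at order 0\<close>

lemma lgm_0 [simp]: "lgm \<nu> 0 = 0"
  by (simp add: lgm_def)

text \<open>- Digamma \<nu> is the mean of the logarithm of an inverse gamma weight, so moments of
  small order grow at the rates of the law of large numbers.\<close>

lemma lgm_slope:
  assumes "\<nu> > 0"
  shows "((\<lambda>x. lgm \<nu> x / x) \<longlongrightarrow> - Digamma \<nu>) (at 0)"
proof -
  have "(lgm \<nu> has_real_derivative - Digamma \<nu>) (at 0)"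
  proof (rule has_field_derivative_transform_within_open)
    show "((\<lambda>x. ln_Gamma (\<nu> - x) - ln_Gamma \<nu>) has_real_derivative - Digamma \<nu>) (at 0)"
      using assms by (auto intro!: derivative_eq_intros)
    show "open {..<\<nu>}" "0 \<in> {..<\<nu>}" using assms by auto
  qed (use assms in \<open>auto simp: lgm_altdef\<close>)
  then show ?thesis by (simp add: has_field_derivative_iff)
qed

lemma lgm_slope_right:
  assumes "\<nu> > 0"
  shows "((\<lambda>x. lgm \<nu> x / x) \<longlongrightarrow> - Digamma \<nu>) (at_right 0)"
  using lgm_slope[OF assms] by (rule tendsto_mono[OF at_le[OF subset_UNIV]])

lemma lgm_slope_scaled:
  assumes "\<nu> > 0" "k \<noteq> 0"
  shows "((\<lambda>x. lgm \<nu> (k * x) / x) \<longlongrightarrow> - k * Digamma \<nu>) (at_right 0)"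
proof -
  have "filterlim (\<lambda>x. k * x) (at 0) (at_right (0::real))"
  proof (rule filterlim_atI)
    show "((\<lambda>x. k * x) \<longlongrightarrow> 0) (at_right 0)" by (auto intro!: tendsto_eq_intros)
    show "\<forall>\<^sub>F x in at_right 0. k * x \<noteq> 0"
      using eventually_at_right_less[of "0::real"] by eventually_elim (use assms in auto)
  qed
  from filterlim_compose[OF lgm_slope[OF assms(1)] this]
  have "((\<lambda>x. k * (lgm \<nu> (k * x) / (k * x))) \<longlongrightarrow> k * - Digamma \<nu>) (at_right 0)"
    by (rule tendsto_mult_left)
  then show ?thesis using assms by simp
qed

lemma lgm_linear_bound:
  assumes "\<nu> > 0" "k \<noteq> 0"
  shows "\<forall>\<^sub>F x in at_right 0. \<bar>lgm \<nu> (k * x)\<bar> \<le> \<bar>k\<bar> * (\<bar>Digamma \<nu>\<bar> + 1) * x"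
proof -
  have "\<bar>k * Digamma \<nu>\<bar> < \<bar>k\<bar> * (\<bar>Digamma \<nu>\<bar> + 1)"
    using assms by (simp add: abs_mult algebra_simps)
  moreover have "((\<lambda>x. \<bar>lgm \<nu> (k * x) / x\<bar>) \<longlongrightarrow> \<bar>k * Digamma \<nu>\<bar>) (at_right 0)"
    using tendsto_rabs[OF lgm_slope_scaled[OF assms]] by simp
  ultimately have "\<forall>\<^sub>F x in at_right 0. \<bar>lgm \<nu> (k * x) / x\<bar> < \<bar>k\<bar> * (\<bar>Digamma \<nu>\<bar> + 1)"
    by (rule order_tendstoD(2)[rotated])
  then show ?thesis using eventually_at_right_less[of "0::real"]
    by eventually_elim (simp add: abs_divide field_simps)
qed

section \<open>Small negative moments\<close>

context boundary_env begin

definition Z1 :: "nat \<Rightarrow> nat \<Rightarrow> 'a \<Rightarrow> real" where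
  "Z1 m n \<omega> = X (1, 1) \<omega> * pf (shift 1 1 (\<lambda>p. X p \<omega>)) m n"

definition PV :: "nat \<Rightarrow> 'a \<Rightarrow> real" where
  "PV n \<omega> = (\<Prod>j=1..Suc n. inverse (X (0, j) \<omega>))"

text \<open>The axis weights up to l relative to the weights beside them in column 1. The second
  product stops before l because \<open>X (1, l)\<close> is itself part of the exit term.\<close>

definition qT :: "nat \<Rightarrow> 'a \<Rightarrow> real" where
  "qT l \<omega> = (\<Prod>j=1..l. X (0, j) \<omega>) * (\<Prod>j=1..<l. inverse (X (1, j) \<omega>))"

definition qS :: "nat \<Rightarrow> 'a \<Rightarrow> real" where
  "qS k \<omega> = (\<Prod>i=1..k. X (i, 0) \<omega>) * (\<Prod>i=1..<k. inverse (X (i, 1) \<omega>))"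

lemma Z1_pos: "Z1 m n \<omega> > 0" and PV_pos: "PV n \<omega> > 0" and qT_pos: "qT l \<omega> > 0" and qS_pos: "qS k \<omega> > 0"
  by (auto simp: Z1_def PV_def qT_def qS_def X_pos pf_X_pos intro!: mult_pos_pos prod_pos)

lemma Z1_rv [measurable]: "Z1 m n \<in> borel_measurable M" and PV_rv [measurable]: "PV n \<in> borel_measurable M"
  and qT_rv [measurable]: "qT l \<in> borel_measurable M" and qS_rv [measurable]: "qS k \<in> borel_measurable M"
proof -
  note [measurable] = pf_rv
  show "Z1 m n \<in> borel_measurable M" "PV n \<in> borel_measurable M" "qT l \<in> borel_measurable M" "qS k \<in> borel_measurable M"
    unfolding Z1_def PV_def qT_def qS_def by measurable
qed

text \<open>Following row 1 from (1, 1) to (k, 1) is one way into the bulk part of the exit term, so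
  \<open>Z1\<close> dominates that part up to the weights of the row.\<close>

lemma S_le:
  assumes "k \<in> {1..Suc m}"
  shows "S m n k \<omega> \<le> PV n \<omega> * Z1 m n \<omega> * qS k \<omega>"
proof -
  define k' where "k' = k - 1"
  have k: "k = Suc k'" using assms by (simp add: k'_def)
  let ?w = "shift 1 1 (\<lambda>p. X p \<omega>)"
  have "pf ?w k' 0 * pf (shift k' 0 ?w) (m - k') n \<le> pf ?w (k' + (m - k')) (0 + n)"
    by (rule pf_superadditive) (simp add: shift_def X_pos)
  also have "k' + (m - k') = m" using assms k by simp
  finally have a: "X (1, 1) \<omega> * (pf ?w k' 0 * pf (shift k' 0 ?w) (m - k') n) \<le> Z1 m n \<omega>"
    unfolding Z1_def using X_pos by (intro mult_left_mono) (auto intro: less_imp_le)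
  have b: "X (1, 1) \<omega> * pf ?w k' 0 = (\<Prod>i=1..k. X (i, 1) \<omega>)"
    unfolding pf_right k by (simp add: prod.atLeast_Suc_atMost[of 1 "Suc k'"] prod.atLeast_Suc_atMost_Suc_shift prod.atLeast_Suc_atMost[of 0] del: prod.cl_ivl_Suc)
  have c: "(\<Prod>i=1..k. X (i, 1) \<omega>) = (\<Prod>i=1..<k. X (i, 1) \<omega>) * X (k, 1) \<omega>"
    unfolding k by (simp add: atLeastLessThanSuc_atLeastAtMost)
  have P: "pf (shift k' 0 ?w) (m - k') n = pf (shift k 1 (\<lambda>p. X p \<omega>)) (Suc m - k) n"
    by (simp add: k)
  have "(\<Prod>i=1..<k. X (i, 1) \<omega>) * (X (k, 1) \<omega> * pf (shift k 1 (\<lambda>p. X p \<omega>)) (Suc m - k) n) = X (1, 1) \<omega> * (pf ?w k' 0 * pf (shift k' 0 ?w) (m - k') n)"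
    by (simp only: P mult.assoc[symmetric] b c)
  with a have "(\<Prod>i=1..<k. X (i, 1) \<omega>) * (X (k, 1) \<omega> * pf (shift k 1 (\<lambda>p. X p \<omega>)) (Suc m - k) n) \<le> Z1 m n \<omega>" by simp
  moreover have "(\<Prod>i=1..<k. X (i, 1) \<omega>) > 0" by (intro prod_pos) (simp add: X_pos)
  ultimately have "X (k, 1) \<omega> * pf (shift k 1 (\<lambda>p. X p \<omega>)) (Suc m - k) n \<le> Z1 m n \<omega> / (\<Prod>i=1..<k. X (i, 1) \<omega>)"
    by (simp add: pos_le_divide_eq mult.commute)
  also have "\<dots> = Z1 m n \<omega> * (\<Prod>i=1..<k. inverse (X (i, 1) \<omega>))"
    using prod_inversef[of "\<lambda>i. X (i, 1) \<omega>" "{1..<k}"] by (simp add: divide_inverse comp_def)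
  finally have "PV n \<omega> * (\<Prod>i=1..k. X (i, 0) \<omega>) * (X (k, 1) \<omega> * pf (shift k 1 (\<lambda>p. X p \<omega>)) (Suc m - k) n)
    \<le> PV n \<omega> * (\<Prod>i=1..k. X (i, 0) \<omega>) * (Z1 m n \<omega> * (\<Prod>i=1..<k. inverse (X (i, 1) \<omega>)))"
    using PV_pos X_pos by (intro mult_left_mono mult_nonneg_nonneg prod_nonneg) (auto intro: less_imp_le)
  then show ?thesis by (simp only: S_def PV_def[symmetric] qS_def mult_ac)
qed

text \<open>As in \<open>S_le\<close>, now along column 1; the axis weights up to l cancel against
  \<open>PV\<close>.\<close>

lemma T_le:
  assumes "l \<in> {1..Suc n}"
  shows "T m n l \<omega> \<le> PV n \<omega> * Z1 m n \<omega> * qT l \<omega>"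
proof -
  define l' where "l' = l - 1"
  have l: "l = Suc l'" using assms by (simp add: l'_def)
  let ?w = "shift 1 1 (\<lambda>p. X p \<omega>)"
  have nz: "X p \<omega> \<noteq> 0" for p using X_pos[of p \<omega>] by simp
  have "pf ?w 0 l' * pf (shift 0 l' ?w) m (n - l') \<le> pf ?w (0 + m) (l' + (n - l'))"
    by (rule pf_superadditive) (simp add: shift_def X_pos)
  also have "l' + (n - l') = n" using assms l by simp
  finally have a: "X (1, 1) \<omega> * (pf ?w 0 l' * pf (shift 0 l' ?w) m (n - l')) \<le> Z1 m n \<omega>"
    unfolding Z1_def using X_pos by (intro mult_left_mono) (auto intro: less_imp_le)
  have b: "X (1, 1) \<omega> * pf ?w 0 l' = (\<Prod>j=1..l. X (1, j) \<omega>)"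
    unfolding pf_up l by (simp add: prod.atLeast_Suc_atMost[of 1 "Suc l'"] prod.atLeast_Suc_atMost_Suc_shift prod.atLeast_Suc_atMost[of 0] del: prod.cl_ivl_Suc)
  have c: "(\<Prod>j=1..l. X (1, j) \<omega>) = (\<Prod>j=1..<l. X (1, j) \<omega>) * X (1, l) \<omega>"
    unfolding l by (simp add: atLeastLessThanSuc_atLeastAtMost)
  have P: "pf (shift 0 l' ?w) m (n - l') = pf (shift 1 l (\<lambda>p. X p \<omega>)) m (Suc n - l)"
    by (simp add: l)
  have "(\<Prod>j=1..<l. X (1, j) \<omega>) * (X (1, l) \<omega> * pf (shift 1 l (\<lambda>p. X p \<omega>)) m (Suc n - l)) = X (1, 1) \<omega> * (pf ?w 0 l' * pf (shift 0 l' ?w) m (n - l'))"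
    by (simp only: P mult.assoc[symmetric] b c)
  with a have "(\<Prod>j=1..<l. X (1, j) \<omega>) * (X (1, l) \<omega> * pf (shift 1 l (\<lambda>p. X p \<omega>)) m (Suc n - l)) \<le> Z1 m n \<omega>" by simp
  moreover have "(\<Prod>j=1..<l. X (1, j) \<omega>) > 0" by (intro prod_pos) (simp add: X_pos)
  ultimately have "X (1, l) \<omega> * pf (shift 1 l (\<lambda>p. X p \<omega>)) m (Suc n - l) \<le> Z1 m n \<omega> / (\<Prod>j=1..<l. X (1, j) \<omega>)"
    by (simp add: pos_le_divide_eq mult.commute)
  also have "\<dots> = Z1 m n \<omega> * (\<Prod>j=1..<l. inverse (X (1, j) \<omega>))"
    using prod_inversef[of "\<lambda>j. X (1, j) \<omega>" "{1..<l}"] by (simp add: divide_inverse comp_def)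
  finally have le: "PV n \<omega> * (\<Prod>j=1..l. X (0, j) \<omega>) * (X (1, l) \<omega> * pf (shift 1 l (\<lambda>p. X p \<omega>)) m (Suc n - l))
    \<le> PV n \<omega> * (\<Prod>j=1..l. X (0, j) \<omega>) * (Z1 m n \<omega> * (\<Prod>j=1..<l. inverse (X (1, j) \<omega>)))"
    using PV_pos X_pos by (intro mult_left_mono mult_nonneg_nonneg prod_nonneg) (auto intro: less_imp_le)
  have PVe: "PV n \<omega> * (\<Prod>j=1..l. X (0, j) \<omega>) = (\<Prod>j=Suc l..Suc n. inverse (X (0, j) \<omega>))"
  proof -
    have "{1..Suc n} = {1..l} \<union> {Suc l..Suc n}" using assms by auto
    then have "PV n \<omega> = (\<Prod>j=1..l. inverse (X (0, j) \<omega>)) * (\<Prod>j=Suc l..Suc n. inverse (X (0, j) \<omega>))"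
      unfolding PV_def by (simp add: prod.union_disjoint del: prod.cl_ivl_Suc)
    moreover have "(\<Prod>j=1..l. inverse (X (0, j) \<omega>)) * (\<Prod>j=1..l. X (0, j) \<omega>) = 1"
      using nz by (simp add: prod.distrib[symmetric])
    ultimately show ?thesis by (simp add: mult_ac del: prod.cl_ivl_Suc)
  qed
  have "T m n l \<omega> \<le> PV n \<omega> * (\<Prod>j=1..l. X (0, j) \<omega>) * (Z1 m n \<omega> * (\<Prod>j=1..<l. inverse (X (1, j) \<omega>)))"
    using le unfolding T_def PVe .
  also have "\<dots> = PV n \<omega> * Z1 m n \<omega> * qT l \<omega>" by (simp only: qT_def mult_ac)
  finally show ?thesis .
qed

lemma monomial_powr_moment:
  assumes "finite A" "finite B" "A \<inter> B = {}" "\<And>p. p \<in> A \<Longrightarrow> par p = a" "\<And>p. p \<in> B \<Longrightarrow> par p = b" "x < a" "- x < b"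
  shows "(\<integral>\<^sup>+\<omega>. ennreal (((\<Prod>p\<in>A. X p \<omega>) * (\<Prod>p\<in>B. inverse (X p \<omega>))) powr x) \<partial>M) =
    ennreal (exp (real (card A) * lgm a x + real (card B) * lgm b (- x)))"
proof -
  define e where "e p = (if p \<in> A then x else - x)" for p
  have P: "(\<Prod>p\<in>A \<union> B. q p) = (\<Prod>p\<in>A. q p) * (\<Prod>p\<in>B. q p)" for q :: "nat \<times> nat \<Rightarrow> 'c::comm_monoid_mult"
    using assms by (simp add: prod.union_disjoint)
  have "((\<Prod>p\<in>A. X p \<omega>) * (\<Prod>p\<in>B. inverse (X p \<omega>))) powr x = (\<Prod>p\<in>A \<union> B. X p \<omega> powr e p)" for \<omega>
  proof -
    have "(\<Prod>p\<in>A. X p \<omega>) powr x = (\<Prod>p\<in>A. X p \<omega> powr e p)"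
      unfolding prod_powr_distrib by (intro prod.cong) (auto simp: e_def)
    moreover have "(\<Prod>p\<in>B. inverse (X p \<omega>)) powr x = (\<Prod>p\<in>B. X p \<omega> powr e p)"
      unfolding prod_powr_distrib inverse_powr powr_minus[symmetric] using assms by (intro prod.cong) (auto simp: e_def)
    ultimately show ?thesis unfolding powr_mult P by simp
  qed
  then have "(\<integral>\<^sup>+\<omega>. ennreal (((\<Prod>p\<in>A. X p \<omega>) * (\<Prod>p\<in>B. inverse (X p \<omega>))) powr x) \<partial>M) = (\<integral>\<^sup>+\<omega>. (\<Prod>p\<in>A \<union> B. ennreal (X p \<omega> powr e p)) \<partial>M)"
    by (simp only: prod_ennreal powr_ge_zero)
  also have "\<dots> = (\<Prod>p\<in>A \<union> B. \<integral>\<^sup>+\<omega>. ennreal (X p \<omega> powr e p) \<partial>M)"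
    using assms by (intro monomial_moment) auto
  also have "\<dots> = (\<Prod>p\<in>A. ennreal (exp (lgm a x))) * (\<Prod>p\<in>B. ennreal (exp (lgm b (- x))))"
    unfolding P
  proof (intro arg_cong2[where f="(*)"] prod.cong refl)
    show "(\<integral>\<^sup>+\<omega>. ennreal (X p \<omega> powr e p) \<partial>M) = ennreal (exp (lgm a x))" if "p \<in> A" for p
      using moment[of x p] that assms by (simp add: e_def)
    show "(\<integral>\<^sup>+\<omega>. ennreal (X p \<omega> powr e p) \<partial>M) = ennreal (exp (lgm b (- x)))" if "p \<in> B" for p
    proof -
      have "p \<notin> A" using that assms by auto
      then show ?thesis using moment[of "- x" p] that assms by (simp add: e_def)
    qed
  qed
  also have "\<dots> = ennreal (exp (real (card A) * lgm a x + real (card B) * lgm b (- x)))"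
    by (simp add: ennreal_power ennreal_mult'[symmetric] exp_of_nat_mult exp_add)
  finally show ?thesis .
qed

lemma qT_moment:
  assumes "l \<ge> 1" "x < \<alpha>" "- x < \<alpha> + \<beta>"
  shows "(\<integral>\<^sup>+\<omega>. ennreal (qT l \<omega> powr x) \<partial>M) = ennreal (exp (real l * lgm \<alpha> x + real (l - 1) * lgm (\<alpha> + \<beta>) (- x)))"
proof -
  have "(\<Prod>j=1..l. X (0, j) \<omega>) = (\<Prod>p\<in>{0} \<times> {1..l}. X p \<omega>)" for \<omega>
    by (rule prod.reindex_bij_witness[where i=snd and j="\<lambda>j. (0, j)"]) auto
  moreover have "(\<Prod>j=1..<l. inverse (X (1, j) \<omega>)) = (\<Prod>p\<in>{1} \<times> {1..<l}. inverse (X p \<omega>))" for \<omega>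
    by (rule prod.reindex_bij_witness[where i=snd and j="\<lambda>j. (1, j)"]) auto
  ultimately show ?thesis unfolding qT_def
    using assms by (simp only:, subst monomial_powr_moment[where a=\<alpha> and b="\<alpha> + \<beta>"])
      (auto simp: par_up par_bulk card_cartesian_product)
qed

lemma qS_moment:
  assumes "k \<ge> 1" "x < \<beta>" "- x < \<alpha> + \<beta>"
  shows "(\<integral>\<^sup>+\<omega>. ennreal (qS k \<omega> powr x) \<partial>M) = ennreal (exp (real k * lgm \<beta> x + real (k - 1) * lgm (\<alpha> + \<beta>) (- x)))"
proof -
  have "(\<Prod>i=1..k. X (i, 0) \<omega>) = (\<Prod>p\<in>{1..k} \<times> {0}. X p \<omega>)" for \<omega>
    by (rule prod.reindex_bij_witness[where i=fst and j="\<lambda>j. (j, 0)"]) auto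
  moreover have "(\<Prod>i=1..<k. inverse (X (i, 1) \<omega>)) = (\<Prod>p\<in>{1..<k} \<times> {1}. inverse (X p \<omega>))" for \<omega>
    by (rule prod.reindex_bij_witness[where i=fst and j="\<lambda>j. (j, 1)"]) auto
  ultimately show ?thesis unfolding qS_def
    using assms by (simp only:, subst monomial_powr_moment[where a=\<beta> and b="\<alpha> + \<beta>"])
      (auto simp: par_right par_bulk card_cartesian_product)
qed

lemma PV_moment:
  assumes "- x < \<alpha>"
  shows "(\<integral>\<^sup>+\<omega>. ennreal (PV n \<omega> powr x) \<partial>M) = ennreal (exp (real (Suc n) * lgm \<alpha> (- x)))"
proof -
  have "PV n \<omega> = (\<Prod>p\<in>{}. X p \<omega>) * (\<Prod>p\<in>{0} \<times> {1..Suc n}. inverse (X p \<omega>))" for \<omega>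
    unfolding PV_def by (simp del: prod.cl_ivl_Suc, rule prod.reindex_bij_witness[where i=snd and j="\<lambda>j. (0, j)"]) auto
  then show ?thesis
    \<comment> \<open>The set A is empty here, so the value of a only has to exceed x.\<close>
    using assms by (simp only:, subst monomial_powr_moment[where a="x + 1" and b=\<alpha>])
      (auto simp: par_up card_cartesian_product)
qed

lemma Z1_moment:
  assumes "x < \<alpha> + \<beta>"
  shows "(\<integral>\<^sup>+\<omega>. ennreal (Z1 m n \<omega> powr x) \<partial>M) = ennreal (exp (lgm (\<alpha> + \<beta>) x)) * Zmom (\<alpha> + \<beta>) m n x"
proof -
  have "(\<integral>\<^sup>+\<omega>. ennreal (Z1 m n \<omega> powr x) \<partial>M) =
    (\<integral>\<^sup>+\<omega>. (\<Prod>p\<in>{(1, 1)}. ennreal (X p \<omega> powr x)) * ennreal (pf (shift 1 1 (\<lambda>p. X p \<omega>)) m n powr x) \<partial>M)"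
    by (simp add: Z1_def powr_mult ennreal_mult')
  also have "\<dots> = (\<Prod>p\<in>{(1, 1)}. \<integral>\<^sup>+\<omega>. ennreal (X p \<omega> powr x) \<partial>M) * (\<integral>\<^sup>+\<omega>. ennreal (pf (shift 1 1 (\<lambda>p. X p \<omega>)) m n powr x) \<partial>M)"
    by (rule monomial_pf_moment) (auto simp: sites_def)
  also have "(\<integral>\<^sup>+\<omega>. ennreal (pf (shift 1 1 (\<lambda>p. X p \<omega>)) m n powr x) \<partial>M) = Zmom (\<alpha> + \<beta>) m n x"
    by (intro Zmom_eq par_bulk) auto
  also have "(\<Prod>p\<in>{(1, 1)}. \<integral>\<^sup>+\<omega>. ennreal (X p \<omega> powr x) \<partial>M) = ennreal (exp (lgm (\<alpha> + \<beta>) x))"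
    using moment[of x "(1, 1)"] assms by (simp add: par_bulk)
  finally show ?thesis .
qed


text \<open>\<open>W\<close> is at most Far + PV Z1 Q. If the second term carries half of
  \<open>W\<close>, then 1 / Z1 <= 2 PV Q / W: the moments of PV and W give the right rate, and Q
  costs only order c \<epsilon> N since it runs over near exits. Otherwise 1 <= (2 Far / W)^(\<eta>
  / 4), which is exponentially small in mean by \<open>far_moment\<close> and \<open>slack\<close>,
  while Z1 is bounded crudely by one path; \<open>ce\<close> makes c so small that the gain
  wins.\<close>

lemma neg_moment_aux:
  fixes s t \<epsilon> \<eta> \<delta> c h e
  defines "pp \<equiv> t * Digamma \<alpha> + s * Digamma \<beta>"
  assumes "0 < \<eta>" "\<eta> < \<beta>" "\<eta> < \<theta>1" "\<theta>1 < \<alpha> + \<beta>" "\<eta> < \<theta>2" "\<theta>2 < \<alpha> + \<beta>" and st: "s > 0" "t > 0"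
    and h1: "lgm \<alpha> (- \<eta>) + al \<eta> \<theta>1 \<ge> 0"
      "(t - \<epsilon>) * (lgm \<alpha> (- \<eta>) + al \<eta> \<theta>1) + s * (be (\<alpha> + \<beta>) \<eta> \<theta>1 - lgm \<beta> \<eta>) \<le> - \<delta>"
    and h2: "be (\<alpha> + \<beta>) \<eta> \<theta>2 - lgm \<beta> \<eta> \<ge> 0"
      "t * (lgm \<alpha> (- \<eta>) + al \<eta> \<theta>2) + (s - \<epsilon>) * (be (\<alpha> + \<beta>) \<eta> \<theta>2 - lgm \<beta> \<eta>) \<le> - \<delta>"
    and \<delta>: "\<delta> > 0" and \<epsilon>: "\<epsilon> > 0" and e: "e > 0"
    and slack: "s * (lgm \<beta> \<eta> + lgm \<beta> (- \<eta>)) \<le> \<delta> / 2"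
    and c: "c > 0" "4 * c < \<alpha>" "4 * c < \<beta>" and h: "h \<ge> 0"
    and c1: "lgm \<alpha> (- (2 * c)) \<le> 2 * c * (Digamma \<alpha> + \<epsilon>)" "lgm \<beta> (- (4 * c)) \<le> 4 * c * (Digamma \<beta> + \<epsilon>)"
    and c2: "lgm \<alpha> (4 * c) \<le> 4 * c * h" "lgm \<beta> (4 * c) \<le> 4 * c * h" "lgm (\<alpha> + \<beta>) (- (4 * c)) \<le> 4 * c * h"
      "lgm (\<alpha> + \<beta>) (- (2 * c)) \<le> 2 * c * h"
    and ce: "c * (h * (s + t)) \<le> \<delta> / 16 + c * pp" and \<epsilon>e: "\<epsilon> * (s + t + 2 * h) \<le> e / 2"
  shows "\<forall>\<^sub>F N in sequentially. Zmom (\<alpha> + \<beta>) (fl N s) (fl N t) (- c) \<le> ennreal (exp (c * (pp + e) * real N))"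
proof -
  define \<mu> where "\<mu> = \<alpha> + \<beta>"
  have \<mu>: "\<mu> > 0" "- (2 * c) < \<mu>" "- c < \<mu>" "- (4 * c) < \<mu>" using \<alpha>_pos \<beta>_pos c by (auto simp: \<mu>_def)
  define m n where "m N = fl N s" and "n N = fl N t" for N
  define B where "B = lgm \<beta> \<eta>"
  define R where "R N = real (m N + n N + 2)" for N
  have R1: "R N \<ge> 1" for N by (simp add: R_def)
  define fT where "fT N = {l\<in>{1..Suc (n N)}. real (Suc (n N) - l) \<le> real N * (t - \<epsilon>)}" for N
  define fS where "fS N = {k\<in>{1..Suc (m N)}. real (Suc (m N) - k) \<le> real N * (s - \<epsilon>)}" for N
  define nT where "nT N = {1..Suc (n N)} - fT N" for N
  define nS where "nS N = {1..Suc (m N)} - fS N" for N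
  define Far where "Far N \<omega> = (\<Sum>i\<in>fT N <+> fS N. case i of Inl l \<Rightarrow> T (m N) (n N) l \<omega> | Inr k \<Rightarrow> S (m N) (n N) k \<omega>)" for N \<omega>
  define Q where "Q N \<omega> = (\<Sum>i\<in>nT N <+> nS N. case i of Inl l \<Rightarrow> qT l \<omega> | Inr k \<Rightarrow> qS k \<omega>)" for N \<omega>
  have fin: "finite (fT N)" "finite (fS N)" "finite (nT N)" "finite (nS N)" for N
    by (auto simp: fT_def fS_def nT_def nS_def)
  have sub: "fT N \<subseteq> {1..Suc (n N)}" "fS N \<subseteq> {1..Suc (m N)}" "nT N \<subseteq> {1..Suc (n N)}" "nS N \<subseteq> {1..Suc (m N)}" for N
    by (auto simp: fT_def fS_def nT_def nS_def)
  have card: "card (A <+> A') \<le> R N" if "A \<subseteq> {1..Suc (n N)}" "A' \<subseteq> {1..Suc (m N)}" for A A' N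
  proof -
    have "finite A" "finite A'" using that by (auto intro: finite_subset)
    moreover have "card A \<le> Suc (n N)" "card A' \<le> Suc (m N)" using card_mono[OF _ that(1)] card_mono[OF _ that(2)] by auto
    ultimately show ?thesis by (simp add: card_Plus R_def)
  qed
  have Far_rv [measurable]: "Far N \<in> borel_measurable M" for N
    unfolding Far_def sum.Plus[OF fin(1,2)] by simp
  have Q_rv [measurable]: "Q N \<in> borel_measurable M" for N
    unfolding Q_def sum.Plus[OF fin(3,4)] by simp
  have Far0: "Far N \<omega> \<ge> 0" for N \<omega>
    unfolding Far_def by (intro sum_nonneg) (auto split: sum.split intro: less_imp_le T_pos S_pos)
  have Q0: "Q N \<omega> \<ge> 0" for N \<omega>
    unfolding Q_def by (intro sum_nonneg) (auto split: sum.split intro: less_imp_le qT_pos qS_pos)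
  have W_split: "W (m N) (n N) \<omega> \<le> Far N \<omega> + PV (n N) \<omega> * Z1 (m N) (n N) \<omega> * Q N \<omega>" for N \<omega>
  proof -
    have "(\<Sum>l = 1..Suc (n N). T (m N) (n N) l \<omega>) = (\<Sum>l\<in>fT N. T (m N) (n N) l \<omega>) + (\<Sum>l\<in>nT N. T (m N) (n N) l \<omega>)"
      unfolding nT_def using sum.subset_diff[OF sub(1)[of N], of "\<lambda>l. T (m N) (n N) l \<omega>"] by (simp del: sum.cl_ivl_Suc)
    moreover have "(\<Sum>k = 1..Suc (m N). S (m N) (n N) k \<omega>) = (\<Sum>k\<in>fS N. S (m N) (n N) k \<omega>) + (\<Sum>k\<in>nS N. S (m N) (n N) k \<omega>)"
      unfolding nS_def using sum.subset_diff[OF sub(2)[of N], of "\<lambda>k. S (m N) (n N) k \<omega>"] by (simp del: sum.cl_ivl_Suc)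
    moreover have "(\<Sum>l\<in>nT N. T (m N) (n N) l \<omega>) \<le> (\<Sum>l\<in>nT N. PV (n N) \<omega> * Z1 (m N) (n N) \<omega> * qT l \<omega>)"
      by (intro sum_mono T_le subsetD[OF sub(3)])
    moreover have "(\<Sum>k\<in>nS N. S (m N) (n N) k \<omega>) \<le> (\<Sum>k\<in>nS N. PV (n N) \<omega> * Z1 (m N) (n N) \<omega> * qS k \<omega>)"
      by (intro sum_mono S_le subsetD[OF sub(4)])
    moreover have "Far N \<omega> = (\<Sum>l\<in>fT N. T (m N) (n N) l \<omega>) + (\<Sum>k\<in>fS N. S (m N) (n N) k \<omega>)"
      unfolding Far_def sum.Plus[OF fin(1,2)] by simp
    moreover have "PV (n N) \<omega> * Z1 (m N) (n N) \<omega> * Q N \<omega> =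
       (\<Sum>l\<in>nT N. PV (n N) \<omega> * Z1 (m N) (n N) \<omega> * qT l \<omega>) + (\<Sum>k\<in>nS N. PV (n N) \<omega> * Z1 (m N) (n N) \<omega> * qS k \<omega>)"
      unfolding Q_def sum.Plus[OF fin(3,4)] by (simp add: distrib_left sum_distrib_left)
    ultimately show ?thesis unfolding W_exit by linarith
  qed
  have pointwise: "Z1 (m N) (n N) \<omega> powr - c \<le>
      2 powr c * (PV (n N) \<omega> powr c * Q N \<omega> powr c * W (m N) (n N) \<omega> powr - c) +
      2 powr (\<eta> / 4) * (Z1 (m N) (n N) \<omega> powr - c * Far N \<omega> powr (\<eta> / 4) * W (m N) (n N) \<omega> powr - (\<eta> / 4))" for N \<omega>
  proof -
    define w z q v f where "w = W (m N) (n N) \<omega>" and "z = Z1 (m N) (n N) \<omega>" and "q = Q N \<omega>" and "v = PV (n N) \<omega>" and "f = Far N \<omega>"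
    have pos: "w > 0" "z > 0" "q \<ge> 0" "v > 0" "f \<ge> 0"
      by (simp_all add: w_def z_def q_def v_def f_def W_pos Z1_pos Q0 PV_pos Far0)
    have le: "w \<le> f + v * z * q" using W_split[of N \<omega>] by (simp add: w_def z_def q_def v_def f_def)
    \<comment> \<open>Either the near exits carry half of \<open>w\<close>, which bounds \<open>z\<close> from below, or the far exits do, which is a
      rare event.\<close>
    show ?thesis unfolding w_def[symmetric] z_def[symmetric] q_def[symmetric] v_def[symmetric] f_def[symmetric]
    proof (cases "2 * f \<le> w")
      case True
      then have "w \<le> 2 * (v * q) * z" using le by (simp add: mult_ac)
      then have "w powr c \<le> (2 * (v * q) * z) powr c" using pos c by (intro powr_mono2) auto
      also have "\<dots> = 2 powr c * (v powr c * q powr c) * z powr c" by (simp add: powr_mult)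
      finally have "w powr c * z powr - c * w powr - c \<le> 2 powr c * (v powr c * q powr c) * z powr c * z powr - c * w powr - c"
        by (intro mult_right_mono) auto
      moreover have "w powr c * w powr - c = 1" "z powr c * z powr - c = 1" using pos by (simp_all flip: powr_add)
      moreover have "w powr c * z powr - c * w powr - c = (w powr c * w powr - c) * z powr - c"
        "2 powr c * (v powr c * q powr c) * z powr c * z powr - c * w powr - c =
          2 powr c * (v powr c * q powr c * w powr - c) * (z powr c * z powr - c)" by (simp_all only: mult_ac)
      ultimately have "z powr - c \<le> 2 powr c * (v powr c * q powr c * w powr - c)" by simp
      moreover have "0 \<le> 2 powr (\<eta> / 4) * (z powr - c * f powr (\<eta> / 4) * w powr - (\<eta> / 4))" by simp
      ultimately show "z powr - c \<le> 2 powr c * (v powr c * q powr c * w powr - c) + 2 powr (\<eta> / 4) * (z powr - c * f powr (\<eta> / 4) * w powr - (\<eta> / 4))"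
        by linarith
    next
      case False
      then have "w powr (\<eta> / 4) \<le> (2 * f) powr (\<eta> / 4)" using pos \<open>0 < \<eta>\<close> by (intro powr_mono2) auto
      also have "\<dots> = 2 powr (\<eta> / 4) * f powr (\<eta> / 4)" by (simp add: powr_mult)
      finally have "w powr (\<eta> / 4) * (w powr - (\<eta> / 4) * z powr - c) \<le> 2 powr (\<eta> / 4) * f powr (\<eta> / 4) * (w powr - (\<eta> / 4) * z powr - c)"
        by (intro mult_right_mono) auto
      moreover have "w powr (\<eta> / 4) * (w powr - (\<eta> / 4) * z powr - c) = z powr - c" using pos by (simp add: mult.assoc[symmetric] flip: powr_add)
      moreover have "2 powr (\<eta> / 4) * f powr (\<eta> / 4) * (w powr - (\<eta> / 4) * z powr - c) =
          2 powr (\<eta> / 4) * (z powr - c * f powr (\<eta> / 4) * w powr - (\<eta> / 4))" by (simp only: mult_ac)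
      ultimately have "z powr - c \<le> 2 powr (\<eta> / 4) * (z powr - c * f powr (\<eta> / 4) * w powr - (\<eta> / 4))" by simp
      moreover have "0 \<le> 2 powr c * (v powr c * q powr c * w powr - c)" by simp
      ultimately show "z powr - c \<le> 2 powr c * (v powr c * q powr c * w powr - c) + 2 powr (\<eta> / 4) * (z powr - c * f powr (\<eta> / 4) * w powr - (\<eta> / 4))"
        by linarith
    qed
  qed
  obtain C where C: "C > 0" and far: "\<And>N l. l \<in> {1..Suc (n N)} \<Longrightarrow> real (Suc (n N) - l) \<le> real N * (t - \<epsilon>) \<Longrightarrow>
      (\<integral>\<^sup>+\<omega>. ennreal (T (m N) (n N) l \<omega> powr \<eta>) \<partial>M) \<le> ennreal (C * exp (real (m N) * B - \<delta> * real N))"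
    "\<And>N k. k \<in> {1..Suc (m N)} \<Longrightarrow> real (Suc (m N) - k) \<le> real N * (s - \<epsilon>) \<Longrightarrow>
      (\<integral>\<^sup>+\<omega>. ennreal (S (m N) (n N) k \<omega> powr \<eta>) \<partial>M) \<le> ennreal (C * exp (real (m N) * B - \<delta> * real N))"
    using far_moment[OF less_imp_le[OF \<open>0 < \<eta>\<close>] assms(3-13)] unfolding m_def n_def B_def by metis
  \<comment> \<open>\<open>A1\<close>, \<open>B1\<close>, \<open>C1\<close> bound the three factors
    of the near term in Hoelder's inequality, \<open>A2\<close>, \<open>B2\<close>,
    \<open>C2\<close> those of the far term; \<open>E1\<close> and \<open>E2\<close> bound single
    summands of \<open>Q\<close> and \<open>Far\<close>.\<close>
  define A1 where "A1 N = exp (real (Suc (n N)) * (2 * c * (Digamma \<alpha> + \<epsilon>)))" for N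
  define C1 where "C1 N = exp (real (Suc (m N)) * (4 * c * (Digamma \<beta> + \<epsilon>)))" for N
  define E1 where "E1 N = exp (8 * c * h * (1 + \<epsilon> * real N))" for N
  define A2 where "A2 N = exp (real (m N + n N + 1) * (2 * c * h))" for N
  define E2 where "E2 N = C * exp (real (m N) * B - \<delta> * real N)" for N
  define C2 where "C2 N = exp (real (Suc (m N)) * lgm \<beta> (- \<eta>))" for N
  define B1 where "B1 N = R N powr (4 * c) * (R N * E1 N)" for N
  define B2 where "B2 N = R N powr \<eta> * (R N * E2 N)" for N
  define K1 where "K1 N = A1 N powr (1/2) * B1 N powr (1/4) * C1 N powr (1/4)" for N
  define K2 where "K2 N = A2 N powr (1/2) * B2 N powr (1/4) * C2 N powr (1/4)" for N
  have sq: "(x powr y) ^ 2 = x powr (2 * y)" "(x powr y) ^ 4 = x powr (4 * y)" if "x \<ge> 0" for x y :: real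
    using that by (cases "x = 0", simp, simp add: powr_power)+
  have I1: "(\<integral>\<^sup>+\<omega>. ennreal (PV (n N) \<omega> powr c * Q N \<omega> powr c * W (m N) (n N) \<omega> powr - c) \<partial>M) \<le> ennreal (K1 N)" for N
    unfolding K1_def
  proof (rule nn_integral_Hoelder)
    have "(\<integral>\<^sup>+\<omega>. ennreal ((PV (n N) \<omega> powr c) ^ 2) \<partial>M) = ennreal (exp (real (Suc (n N)) * lgm \<alpha> (- (2 * c))))"
      using \<alpha>_pos c by (simp only: sq less_imp_le[OF PV_pos]) (rule PV_moment, simp)
    also have "\<dots> \<le> ennreal (A1 N)"
      unfolding A1_def using c1 by (intro ennreal_leI) (simp del: of_nat_Suc)
    finally show "(\<integral>\<^sup>+\<omega>. ennreal ((PV (n N) \<omega> powr c) ^ 2) \<partial>M) \<le> ennreal (A1 N)" .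
    have "(\<integral>\<^sup>+\<omega>. ennreal ((W (m N) (n N) \<omega> powr - c) ^ 4) \<partial>M) = ennreal (exp (real (Suc (m N)) * lgm \<beta> (- (4 * c))))"
      using \<beta>_pos c by (simp only: sq less_imp_le[OF W_pos] mult_minus_right) (rule W_moment, simp)
    also have "\<dots> \<le> ennreal (C1 N)"
      unfolding C1_def using c1 by (intro ennreal_leI) (simp del: of_nat_Suc)
    finally show "(\<integral>\<^sup>+\<omega>. ennreal ((W (m N) (n N) \<omega> powr - c) ^ 4) \<partial>M) \<le> ennreal (C1 N)" .
    have "(\<integral>\<^sup>+\<omega>. ennreal ((Q N \<omega> powr c) ^ 4) \<partial>M) = (\<integral>\<^sup>+\<omega>. ennreal (Q N \<omega> powr (4 * c)) \<partial>M)"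
      by (simp only: sq Q0)
    also have "\<dots> \<le> ennreal (B1 N)"
      unfolding Q_def B1_def
    proof (rule nn_integral_sum_powr)
      show "real (card (nT N <+> nS N)) \<le> R N" by (rule card[OF sub(3,4)])
      show "finite (nT N <+> nS N)" using fin by simp
      show "(\<lambda>\<omega>. case i of Inl l \<Rightarrow> qT l \<omega> | Inr k \<Rightarrow> qS k \<omega>) \<in> borel_measurable M" for i
        by (cases i) simp_all
      show "(case i of Inl l \<Rightarrow> qT l \<omega> | Inr k \<Rightarrow> qS k \<omega>) > 0" for i \<omega>
        by (cases i) (simp_all add: qT_pos qS_pos)
      have q: "real l * (4 * c * h) + real (l - 1) * (4 * c * h) \<le> 8 * c * h * (1 + \<epsilon> * real N)" if "real l \<le> 1 + \<epsilon> * real N" for l :: nat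
      proof -
        have "real (l - 1) \<le> real l" by simp
        then have "real l + real (l - 1) \<le> (1 + \<epsilon> * real N) + (1 + \<epsilon> * real N)" by (rule add_mono[OF that order_trans[OF _ that]])
        then have "(real l + real (l - 1)) * (4 * c * h) \<le> ((1 + \<epsilon> * real N) + (1 + \<epsilon> * real N)) * (4 * c * h)"
          using c h by (intro mult_right_mono) auto
        moreover have "((1 + \<epsilon> * real N) + (1 + \<epsilon> * real N)) * (4 * c * h) = 8 * c * h * (1 + \<epsilon> * real N)"
          by (simp add: algebra_simps)
        ultimately show ?thesis by (simp only: distrib_right[of "real l"])
      qed
      fix i assume i: "i \<in> nT N <+> nS N"
      show "(\<integral>\<^sup>+\<omega>. ennreal ((case i of Inl l \<Rightarrow> qT l \<omega> | Inr k \<Rightarrow> qS k \<omega>) powr (4 * c)) \<partial>M) \<le> ennreal (E1 N)"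
      proof (cases i)
        case (Inl l)
        then have l: "l \<ge> 1" "l \<le> Suc (n N)" "real (Suc (n N) - l) > real N * (t - \<epsilon>)" using i by (auto simp: nT_def fT_def)
        have "real (n N) \<le> real N * t" unfolding n_def using st by (intro fl_bounds) simp
        then have "real l \<le> 1 + \<epsilon> * real N" using l by (simp add: of_nat_diff algebra_simps)
        note q = q[OF this]
        have "(\<integral>\<^sup>+\<omega>. ennreal (qT l \<omega> powr (4 * c)) \<partial>M) = ennreal (exp (real l * lgm \<alpha> (4 * c) + real (l - 1) * lgm (\<alpha> + \<beta>) (- (4 * c))))"
          using l c \<alpha>_pos \<beta>_pos by (intro qT_moment) auto
        also have "\<dots> \<le> ennreal (exp (real l * (4 * c * h) + real (l - 1) * (4 * c * h)))"
          using c2 by (intro ennreal_leI iffD2[OF exp_le_cancel_iff] add_mono mult_left_mono) auto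
        also have "\<dots> \<le> ennreal (E1 N)" unfolding E1_def using q by (intro ennreal_leI) simp
        finally show ?thesis using Inl by simp
      next
        case (Inr k)
        then have k: "k \<ge> 1" "k \<le> Suc (m N)" "real (Suc (m N) - k) > real N * (s - \<epsilon>)" using i by (auto simp: nS_def fS_def)
        have "real (m N) \<le> real N * s" unfolding m_def using st by (intro fl_bounds) simp
        then have "real k \<le> 1 + \<epsilon> * real N" using k by (simp add: of_nat_diff algebra_simps)
        note q = q[OF this]
        have "(\<integral>\<^sup>+\<omega>. ennreal (qS k \<omega> powr (4 * c)) \<partial>M) = ennreal (exp (real k * lgm \<beta> (4 * c) + real (k - 1) * lgm (\<alpha> + \<beta>) (- (4 * c))))"
          using k c \<alpha>_pos \<beta>_pos by (intro qS_moment) auto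
        also have "\<dots> \<le> ennreal (exp (real k * (4 * c * h) + real (k - 1) * (4 * c * h)))"
          using c2 by (intro ennreal_leI iffD2[OF exp_le_cancel_iff] add_mono mult_left_mono) auto
        also have "\<dots> \<le> ennreal (E1 N)" unfolding E1_def using q by (intro ennreal_leI) simp
        finally show ?thesis using Inr by simp
      qed
    qed (use c in \<open>auto simp: E1_def\<close>)
    finally show "(\<integral>\<^sup>+\<omega>. ennreal ((Q N \<omega> powr c) ^ 4) \<partial>M) \<le> ennreal (B1 N)" .
  qed (use R1 in \<open>auto simp: A1_def B1_def C1_def E1_def R_def\<close>)
  have I2: "(\<integral>\<^sup>+\<omega>. ennreal (Z1 (m N) (n N) \<omega> powr - c * Far N \<omega> powr (\<eta> / 4) * W (m N) (n N) \<omega> powr - (\<eta> / 4)) \<partial>M) \<le> ennreal (K2 N)" for N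
    unfolding K2_def
  proof (rule nn_integral_Hoelder)
    have "(\<integral>\<^sup>+\<omega>. ennreal ((Z1 (m N) (n N) \<omega> powr - c) ^ 2) \<partial>M) = ennreal (exp (lgm \<mu> (- (2 * c)))) * Zmom \<mu> (m N) (n N) (- (2 * c))"
      unfolding \<mu>_def using \<mu> by (simp only: sq less_imp_le[OF Z1_pos] mult_minus_right) (rule Z1_moment, simp add: \<mu>_def)
    \<comment> \<open>The crude bound by one path. After the square root its rate is at most c h (s
      + t), which \<open>ce\<close> balances.\<close>
    also have "\<dots> \<le> ennreal (exp (lgm \<mu> (- (2 * c)))) * ennreal (exp (real (m N + n N) * lgm \<mu> (- (2 * c))))"
      using c \<mu> by (intro mult_left_mono Zmom_path_upper) auto
    also have "\<dots> = ennreal (exp (real (m N + n N + 1) * lgm \<mu> (- (2 * c))))"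
      by (simp add: ennreal_mult'[symmetric] exp_add[symmetric] algebra_simps)
    also have "\<dots> \<le> ennreal (A2 N)"
      unfolding A2_def using c2(4) by (intro ennreal_leI iffD2[OF exp_le_cancel_iff] mult_left_mono) (auto simp: \<mu>_def)
    finally show "(\<integral>\<^sup>+\<omega>. ennreal ((Z1 (m N) (n N) \<omega> powr - c) ^ 2) \<partial>M) \<le> ennreal (A2 N)" .
    have "(\<integral>\<^sup>+\<omega>. ennreal ((W (m N) (n N) \<omega> powr - (\<eta> / 4)) ^ 4) \<partial>M) = (\<integral>\<^sup>+\<omega>. ennreal (W (m N) (n N) \<omega> powr - \<eta>) \<partial>M)"
      by (simp add: sq less_imp_le[OF W_pos])
    also have "\<dots> = ennreal (C2 N)"
      unfolding C2_def using \<beta>_pos \<open>0 < \<eta>\<close> by (intro W_moment) simp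
    finally show "(\<integral>\<^sup>+\<omega>. ennreal ((W (m N) (n N) \<omega> powr - (\<eta> / 4)) ^ 4) \<partial>M) \<le> ennreal (C2 N)" by simp
    have "(\<integral>\<^sup>+\<omega>. ennreal ((Far N \<omega> powr (\<eta> / 4)) ^ 4) \<partial>M) = (\<integral>\<^sup>+\<omega>. ennreal (Far N \<omega> powr \<eta>) \<partial>M)"
      by (simp add: sq Far0)
    also have "\<dots> \<le> ennreal (B2 N)"
      unfolding Far_def B2_def
    proof (rule nn_integral_sum_powr)
      show "real (card (fT N <+> fS N)) \<le> R N" by (rule card[OF sub(1,2)])
      show "finite (fT N <+> fS N)" using fin by simp
      show "(\<lambda>\<omega>. case i of Inl l \<Rightarrow> T (m N) (n N) l \<omega> | Inr k \<Rightarrow> S (m N) (n N) k \<omega>) \<in> borel_measurable M" for i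
        by (cases i) simp_all
      show "(case i of Inl l \<Rightarrow> T (m N) (n N) l \<omega> | Inr k \<Rightarrow> S (m N) (n N) k \<omega>) > 0" for i \<omega>
        by (cases i) (simp_all add: T_pos S_pos)
      fix i assume i: "i \<in> fT N <+> fS N"
      show "(\<integral>\<^sup>+\<omega>. ennreal ((case i of Inl l \<Rightarrow> T (m N) (n N) l \<omega> | Inr k \<Rightarrow> S (m N) (n N) k \<omega>) powr \<eta>) \<partial>M) \<le> ennreal (E2 N)"
        using i far unfolding E2_def by (cases i) (auto simp: fT_def fS_def)
    qed (use C \<open>0 < \<eta>\<close> in \<open>auto simp: E2_def\<close>)
    finally show "(\<integral>\<^sup>+\<omega>. ennreal ((Far N \<omega> powr (\<eta> / 4)) ^ 4) \<partial>M) \<le> ennreal (B2 N)" .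
  qed (use R1 C in \<open>auto simp: A2_def B2_def C2_def E2_def R_def\<close>)
  \<comment> \<open>The weight at (1, 1) is part of \<open>Z1\<close> but not of
    \<open>Zmom\<close>.\<close>
  define \<kappa> where "\<kappa> = exp (lgm \<mu> (- c))"
  have main: "ennreal \<kappa> * Zmom \<mu> (m N) (n N) (- c) \<le> ennreal (2 powr c * K1 N + 2 powr (\<eta> / 4) * K2 N)" for N
  proof -
    have K0: "K1 N \<ge> 0" "K2 N \<ge> 0" by (simp_all add: K1_def K2_def)
    have "ennreal \<kappa> * Zmom \<mu> (m N) (n N) (- c) = (\<integral>\<^sup>+\<omega>. ennreal (Z1 (m N) (n N) \<omega> powr - c) \<partial>M)"
      unfolding \<kappa>_def \<mu>_def using \<mu> by (intro Z1_moment[symmetric]) (simp add: \<mu>_def)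
    also have "\<dots> \<le> (\<integral>\<^sup>+\<omega>. ennreal (2 powr c) * ennreal (PV (n N) \<omega> powr c * Q N \<omega> powr c * W (m N) (n N) \<omega> powr - c) +
      ennreal (2 powr (\<eta> / 4)) * ennreal (Z1 (m N) (n N) \<omega> powr - c * Far N \<omega> powr (\<eta> / 4) * W (m N) (n N) \<omega> powr - (\<eta> / 4)) \<partial>M)"
    proof (rule nn_integral_mono)
      fix \<omega>
      show "ennreal (Z1 (m N) (n N) \<omega> powr - c) \<le> ennreal (2 powr c) * ennreal (PV (n N) \<omega> powr c * Q N \<omega> powr c * W (m N) (n N) \<omega> powr - c) +
        ennreal (2 powr (\<eta> / 4)) * ennreal (Z1 (m N) (n N) \<omega> powr - c * Far N \<omega> powr (\<eta> / 4) * W (m N) (n N) \<omega> powr - (\<eta> / 4))"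
        using ennreal_leI[OF pointwise[of N \<omega>]] by (simp add: ennreal_mult')
    qed
    also have "\<dots> = ennreal (2 powr c) * (\<integral>\<^sup>+\<omega>. ennreal (PV (n N) \<omega> powr c * Q N \<omega> powr c * W (m N) (n N) \<omega> powr - c) \<partial>M) +
      ennreal (2 powr (\<eta> / 4)) * (\<integral>\<^sup>+\<omega>. ennreal (Z1 (m N) (n N) \<omega> powr - c * Far N \<omega> powr (\<eta> / 4) * W (m N) (n N) \<omega> powr - (\<eta> / 4)) \<partial>M)"
      by (subst nn_integral_add, measurable, subst nn_integral_cmult, measurable, subst nn_integral_cmult, measurable)
    also have "\<dots> \<le> ennreal (2 powr c) * ennreal (K1 N) + ennreal (2 powr (\<eta> / 4)) * ennreal (K2 N)"
      by (intro add_mono mult_left_mono I1 I2) auto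
    also have "\<dots> = ennreal (2 powr c * K1 N + 2 powr (\<eta> / 4) * K2 N)"
      using K0 by (simp add: ennreal_mult')
    finally show ?thesis .
  qed
  define r where "r N = real N * (s + t) + 2" for N
  have Rr: "R N \<le> r N" for N
    using fl_bounds(1)[of s N] fl_bounds(1)[of t N] st by (simp add: R_def r_def m_def n_def algebra_simps)
  define k1 where "k1 = c * (2 * \<bar>Digamma \<alpha> + \<epsilon>\<bar> + 2 * \<bar>Digamma \<beta> + \<epsilon>\<bar> + 2 * h)"
  \<comment> \<open>The three rates add up to c (pp + \<epsilon> (s + t + 2 h)), at most c (pp + e /
    2); the other half of e absorbs the polynomial factor.\<close>
  have K1: "K1 N \<le> exp k1 * r N powr ((1 + 4 * c) / 4) * exp (- (c * e / 2) * real N) * exp (c * (pp + e) * real N)" for N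
  proof -
    have "B1 N powr (1/4) = (R N powr (1 + 4 * c)) powr (1/4) * E1 N powr (1/4)"
      using R1[of N] by (simp add: B1_def powr_add powr_mult mult_ac)
    also have "(R N powr (1 + 4 * c)) powr (1/4) = R N powr ((1 + 4 * c) / 4)" by (simp add: powr_powr)
    also have "\<dots> * E1 N powr (1/4) \<le> r N powr ((1 + 4 * c) / 4) * E1 N powr (1/4)"
      using R1[of N] Rr[of N] c by (intro mult_right_mono powr_mono2) auto
    finally have B: "B1 N powr (1/4) \<le> r N powr ((1 + 4 * c) / 4) * E1 N powr (1/4)" .
    have "K1 N \<le> A1 N powr (1/2) * (r N powr ((1 + 4 * c) / 4) * E1 N powr (1/4)) * C1 N powr (1/4)"
      unfolding K1_def by (intro mult_right_mono mult_left_mono B) auto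
    also have "\<dots> = r N powr ((1 + 4 * c) / 4) * (A1 N powr (1/2) * E1 N powr (1/4) * C1 N powr (1/4))" by (simp only: mult_ac)
    also have "\<dots> \<le> r N powr ((1 + 4 * c) / 4) * (exp k1 * (exp (- (c * e / 2) * real N) * exp (c * (pp + e) * real N)))"
    proof (rule mult_left_mono)
      have "A1 N powr (1/2) * E1 N powr (1/4) * C1 N powr (1/4) =
        exp (c * ((real (n N) * (Digamma \<alpha> + \<epsilon>) + (Digamma \<alpha> + \<epsilon>)) + 2 * h * (1 + \<epsilon> * real N) + (real (m N) * (Digamma \<beta> + \<epsilon>) + (Digamma \<beta> + \<epsilon>))))"
        by (simp add: A1_def E1_def C1_def exp_powr_mult exp_add[symmetric] algebra_simps)
      also have "\<dots> \<le> exp (k1 + c * (pp + e / 2) * real N)"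
      proof -
        have "real (n N) * (Digamma \<alpha> + \<epsilon>) \<le> real N * t * (Digamma \<alpha> + \<epsilon>) + \<bar>Digamma \<alpha> + \<epsilon>\<bar>"
          "real (m N) * (Digamma \<beta> + \<epsilon>) \<le> real N * s * (Digamma \<beta> + \<epsilon>) + \<bar>Digamma \<beta> + \<epsilon>\<bar>"
          unfolding m_def n_def using st by (auto intro!: fl_mult_le)
        moreover have "Digamma \<alpha> + \<epsilon> \<le> \<bar>Digamma \<alpha> + \<epsilon>\<bar>" "Digamma \<beta> + \<epsilon> \<le> \<bar>Digamma \<beta> + \<epsilon>\<bar>" by simp_all
        ultimately have "(real (n N) * (Digamma \<alpha> + \<epsilon>) + (Digamma \<alpha> + \<epsilon>)) + 2 * h * (1 + \<epsilon> * real N) + (real (m N) * (Digamma \<beta> + \<epsilon>) + (Digamma \<beta> + \<epsilon>))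
          \<le> (2 * \<bar>Digamma \<alpha> + \<epsilon>\<bar> + 2 * \<bar>Digamma \<beta> + \<epsilon>\<bar> + 2 * h) +
            (real N * t * (Digamma \<alpha> + \<epsilon>) + real N * s * (Digamma \<beta> + \<epsilon>) + 2 * h * \<epsilon> * real N)"
          by (simp add: distrib_left)
        also have "real N * t * (Digamma \<alpha> + \<epsilon>) + real N * s * (Digamma \<beta> + \<epsilon>) + 2 * h * \<epsilon> * real N = real N * (pp + \<epsilon> * (s + t + 2 * h))"
          by (simp add: pp_def algebra_simps)
        also have "\<dots> \<le> real N * (pp + e / 2)" using \<epsilon>e by (intro mult_left_mono) auto
        finally have "c * ((real (n N) * (Digamma \<alpha> + \<epsilon>) + (Digamma \<alpha> + \<epsilon>)) + 2 * h * (1 + \<epsilon> * real N) + (real (m N) * (Digamma \<beta> + \<epsilon>) + (Digamma \<beta> + \<epsilon>)))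
          \<le> c * ((2 * \<bar>Digamma \<alpha> + \<epsilon>\<bar> + 2 * \<bar>Digamma \<beta> + \<epsilon>\<bar> + 2 * h) + real N * (pp + e / 2))"
          using c by (intro mult_left_mono) auto
        also have "\<dots> = k1 + c * (pp + e / 2) * real N" by (simp only: k1_def distrib_left mult_ac)
        finally show ?thesis by simp
      qed
      also have "\<dots> = exp k1 * (exp (- (c * e / 2) * real N) * exp (c * (pp + e) * real N))"
        by (simp add: exp_add[symmetric] algebra_simps)
      finally show "A1 N powr (1/2) * E1 N powr (1/4) * C1 N powr (1/4) \<le> exp k1 * (exp (- (c * e / 2) * real N) * exp (c * (pp + e) * real N))" .
    qed simp
    finally show ?thesis by (simp only: mult_ac)
  qed
  define b where "b = lgm \<beta> (- \<eta>)"
  define k2 where "k2 = c * h + \<bar>B + b\<bar> / 4 + \<bar>b\<bar> / 4"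
  \<comment> \<open>The fourth roots turn the gain \<delta>, diminished by the slack \<delta> / 2,
    into \<delta> / 8. Of this \<open>ce\<close> spends \<delta> / 16.\<close>
  have K2: "K2 N \<le> (exp k2 * C powr (1/4)) * r N powr ((1 + \<eta>) / 4) * exp (- (\<delta> / 16) * real N) * exp (c * (pp + e) * real N)" for N
  proof -
    have "B2 N powr (1/4) = (R N powr (1 + \<eta>)) powr (1/4) * (C powr (1/4) * exp (real (m N) * B - \<delta> * real N) powr (1/4))"
      using R1[of N] by (simp add: B2_def E2_def powr_add powr_mult mult_ac)
    also have "(R N powr (1 + \<eta>)) powr (1/4) = R N powr ((1 + \<eta>) / 4)" by (simp add: powr_powr)
    also have "\<dots> * (C powr (1/4) * exp (real (m N) * B - \<delta> * real N) powr (1/4)) \<le>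
       r N powr ((1 + \<eta>) / 4) * (C powr (1/4) * exp (real (m N) * B - \<delta> * real N) powr (1/4))"
      using R1[of N] Rr[of N] \<open>0 < \<eta>\<close> by (intro mult_right_mono powr_mono2) auto
    finally have B': "B2 N powr (1/4) \<le> r N powr ((1 + \<eta>) / 4) * (C powr (1/4) * exp (real (m N) * B - \<delta> * real N) powr (1/4))" .
    have "K2 N \<le> A2 N powr (1/2) * (r N powr ((1 + \<eta>) / 4) * (C powr (1/4) * exp (real (m N) * B - \<delta> * real N) powr (1/4))) * C2 N powr (1/4)"
      unfolding K2_def by (intro mult_right_mono mult_left_mono B') auto
    also have "\<dots> = (C powr (1/4) * r N powr ((1 + \<eta>) / 4)) * (A2 N powr (1/2) * exp (real (m N) * B - \<delta> * real N) powr (1/4) * C2 N powr (1/4))" by (simp only: mult_ac)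
    also have "\<dots> \<le> (C powr (1/4) * r N powr ((1 + \<eta>) / 4)) * (exp k2 * exp (- (\<delta> / 16) * real N) * exp (c * (pp + e) * real N))"
    proof (rule mult_left_mono)
      have "A2 N powr (1/2) * exp (real (m N) * B - \<delta> * real N) powr (1/4) * C2 N powr (1/4) =
        exp ((real (m N) + real (n N) + 1) * (c * h) + (real (m N) * (B + b) - \<delta> * real N + b) / 4)"
        by (simp add: A2_def C2_def exp_powr_mult exp_add[symmetric] b_def) (simp add: algebra_simps add_divide_distrib diff_divide_distrib)
      also have "\<dots> \<le> exp (k2 + (c * pp - \<delta> / 16) * real N)"
      proof -
        have "real (m N) + real (n N) + 1 \<le> real N * (s + t) + 1" using Rr[of N] by (simp add: R_def r_def)
        then have "(real (m N) + real (n N) + 1) * (c * h) \<le> (real N * (s + t) + 1) * (c * h)"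
          using c h by (intro mult_right_mono) auto
        moreover have "real (m N) * (B + b) \<le> real N * s * (B + b) + \<bar>B + b\<bar>"
          unfolding m_def using st by (intro fl_mult_le) simp
        moreover have "real N * (s * (B + b)) \<le> real N * (\<delta> / 2)"
          using slack unfolding B_def b_def by (intro mult_left_mono) auto
        moreover have "real N * (c * (h * (s + t))) \<le> real N * (\<delta> / 16 + c * pp)"
          using ce by (intro mult_left_mono) auto
        moreover have "b \<le> \<bar>b\<bar>" by simp
        ultimately have "(real (m N) + real (n N) + 1) * (c * h) + (real (m N) * (B + b) - \<delta> * real N + b) / 4 \<le> k2 + (c * pp - \<delta> / 16) * real N"
          unfolding k2_def by (simp add: algebra_simps add_divide_distrib diff_divide_distrib)
        then show ?thesis by simp
      qed
      also have "\<dots> \<le> exp (k2 + - (\<delta> / 16) * real N + c * (pp + e) * real N)"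
        using c e by (simp add: algebra_simps)
      also have "\<dots> = exp k2 * exp (- (\<delta> / 16) * real N) * exp (c * (pp + e) * real N)"
        by (simp only: exp_add)
      finally show "A2 N powr (1/2) * exp (real (m N) * B - \<delta> * real N) powr (1/4) * C2 N powr (1/4) \<le> exp k2 * exp (- (\<delta> / 16) * real N) * exp (c * (pp + e) * real N)" .
    qed simp
    finally show ?thesis by (simp only: mult_ac)
  qed
  have st': "s + t > 0" and \<kappa>: "\<kappa> > 0" using st by (auto simp: \<kappa>_def)
  have "\<forall>\<^sub>F N in sequentially. (2 powr c * exp k1) * (real N * (s + t) + 2) powr ((1 + 4 * c) / 4) * exp (- (c * e / 2) * real N) \<le> \<kappa> / 2"
    using c e \<kappa> by (intro poly_exp_eventually[OF _ st']) auto
  moreover have "\<forall>\<^sub>F N in sequentially. (2 powr (\<eta> / 4) * (exp k2 * C powr (1/4))) * (real N * (s + t) + 2) powr ((1 + \<eta>) / 4) * exp (- (\<delta> / 16) * real N) \<le> \<kappa> / 2"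
    using \<delta> \<kappa> by (intro poly_exp_eventually[OF _ st']) auto
  ultimately show ?thesis
  proof eventually_elim
    case (elim N)
    define G where "G = exp (c * (pp + e) * real N)"
    have G: "G > 0" by (simp add: G_def)
    have "2 powr c * K1 N \<le> 2 powr c * (exp k1 * r N powr ((1 + 4 * c) / 4) * exp (- (c * e / 2) * real N) * G)"
      unfolding G_def by (intro mult_left_mono K1) simp
    also have "\<dots> = ((2 powr c * exp k1) * (real N * (s + t) + 2) powr ((1 + 4 * c) / 4) * exp (- (c * e / 2) * real N)) * G"
      by (simp only: r_def mult_ac)
    also have "\<dots> \<le> \<kappa> / 2 * G" using elim(1) G by (intro mult_right_mono) auto
    finally have 1: "2 powr c * K1 N \<le> \<kappa> / 2 * G" .
    have "2 powr (\<eta> / 4) * K2 N \<le> 2 powr (\<eta> / 4) * ((exp k2 * C powr (1/4)) * r N powr ((1 + \<eta>) / 4) * exp (- (\<delta> / 16) * real N) * G)"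
      unfolding G_def by (intro mult_left_mono K2) simp
    also have "\<dots> = ((2 powr (\<eta> / 4) * (exp k2 * C powr (1/4))) * (real N * (s + t) + 2) powr ((1 + \<eta>) / 4) * exp (- (\<delta> / 16) * real N)) * G"
      by (simp only: r_def mult_ac)
    also have "\<dots> \<le> \<kappa> / 2 * G" using elim(2) G by (intro mult_right_mono) auto
    finally have 2: "2 powr (\<eta> / 4) * K2 N \<le> \<kappa> / 2 * G" .
    have "ennreal \<kappa> * Zmom \<mu> (m N) (n N) (- c) \<le> ennreal (\<kappa> * G)"
      using 1 2 by (intro order_trans[OF main] ennreal_leI) (simp add: field_simps)
    also have "\<dots> = ennreal (exp (lgm \<mu> (- c) + c * (pp + e) * real N))"
      by (simp add: \<kappa>_def G_def exp_add)
    finally have "Zmom \<mu> (m N) (n N) (- c) \<le> ennreal (exp ((lgm \<mu> (- c) + c * (pp + e) * real N) - lgm \<mu> (- c)))"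
      unfolding \<kappa>_def by (rule ennreal_exp_shift)
    then show ?case by (simp add: \<mu>_def m_def n_def)
  qed
qed

end

text \<open>Divided by \<eta>, the conditions on the far exits converge, as \<eta> tends to 0, to
  the conclusion of \<open>tilt_critical_point\<close> for the slopes of the exponents. Hence some
  \<eta> satisfies them; it fixes the gain \<delta>', and c is chosen small against that gain
  afterwards.\<close>

lemma Zmom_neg_small:
  assumes "s > 0" "t > 0" and \<theta>: "0 < \<theta>" "\<theta> < \<mu>" and crit: "- t * Polygamma 1 \<theta> + s * Polygamma 1 (\<mu> - \<theta>) = 0" and "e > 0"
  shows "\<exists>c>0. \<forall>\<^sub>F N in sequentially. Zmom \<mu> (fl N s) (fl N t) (- c) \<le> ennreal (exp (c * (t * Digamma \<theta> + s * Digamma (\<mu> - \<theta>) + e) * real N))"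
proof -
  define \<alpha> \<beta> where "\<alpha> = \<theta>" and "\<beta> = \<mu> - \<theta>"
  have ab: "\<alpha> > 0" "\<beta> > 0" "\<alpha> + \<beta> = \<mu>" "\<mu> > 0" using assms by (auto simp: \<alpha>_def \<beta>_def)
  obtain M :: "(nat \<times> nat \<Rightarrow> real) measure" and X par where "boundary_env M X par \<alpha> \<beta>"
    using boundary_env_exists[OF ab(1,2)] .
  then interpret boundary_env M X par \<alpha> \<beta> .
  define h where "h = \<bar>Digamma \<alpha>\<bar> + \<bar>Digamma \<beta>\<bar> + \<bar>Digamma \<mu>\<bar> + 3"
  have h: "h > 0" "\<bar>Digamma \<alpha>\<bar> + 1 \<le> h" "\<bar>Digamma \<beta>\<bar> + 1 \<le> h" "\<bar>Digamma \<mu>\<bar> + 1 \<le> h" by (auto simp: h_def)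
  \<comment> \<open>The value for which the last hypothesis of \<open>neg_moment_aux\<close> becomes
    an equality.\<close>
  define \<epsilon> where "\<epsilon> = e / (2 * (s + t + 2 * h))"
  have d: "s + t + 2 * h > 0" using assms h by simp
  have \<epsilon>: "\<epsilon> > 0" "\<epsilon> * (s + t + 2 * h) \<le> e / 2" using d \<open>e > 0\<close> by (auto simp: \<epsilon>_def field_simps)
  define pp where "pp = t * Digamma \<alpha> + s * Digamma \<beta>"
  \<comment> \<open>The slopes of \<open>al\<close> and \<open>be\<close> at order 0, as functions
    of \<theta>.\<close>
  define f g where "f x = - Digamma x" and "g x = - Digamma (\<mu> - x)" for x :: real
  have df: "(f has_real_derivative - Polygamma 1 \<theta>) (at \<theta>)"
    unfolding f_def using \<theta> pos_not_nonpos_Int[of \<theta>] by (auto intro!: derivative_eq_intros)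
  have dg: "(g has_real_derivative Polygamma 1 (\<mu> - \<theta>)) (at \<theta>)"
    unfolding g_def using \<theta> pos_not_nonpos_Int[of "\<mu> - \<theta>"] by (auto intro!: derivative_eq_intros)
  have signs: "- Polygamma 1 \<theta> < 0" "Polygamma 1 (\<mu> - \<theta>) > 0"
    using Polygamma_real_odd_pos[of \<theta> 1] Polygamma_real_odd_pos[of "\<mu> - \<theta>" 1] \<theta> pos_not_nonpos_Int by auto
  have crit': "t * - Polygamma 1 \<theta> + s * Polygamma 1 (\<mu> - \<theta>) = 0" using crit by simp
  obtain \<theta>1 \<theta>2 \<delta> where t: "0 < \<theta>1" "\<theta>1 < \<mu>" "0 < \<theta>2" "\<theta>2 < \<mu>" "\<delta> > 0"
    "f \<theta>1 > f \<theta>" "(t - \<epsilon>) * (f \<theta>1 - f \<theta>) + s * (g \<theta>1 - g \<theta>) \<le> - \<delta>"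
    "g \<theta>2 > g \<theta>" "t * (f \<theta>2 - f \<theta>) + (s - \<epsilon>) * (g \<theta>2 - g \<theta>) \<le> - \<delta>"
    by (rule tilt_critical_point[OF df dg signs crit' \<epsilon>(1) \<theta>])
  have la: "((\<lambda>x. lgm \<alpha> (- x) / x) \<longlongrightarrow> - f \<theta>) (at_right 0)"
    using lgm_slope_scaled[OF ab(1), of "-1"] by (simp add: f_def \<alpha>_def)
  have lb: "((\<lambda>x. lgm \<beta> x / x) \<longlongrightarrow> g \<theta>) (at_right 0)"
    using lgm_slope_right[OF ab(2)] by (simp add: g_def \<beta>_def)
  have lb': "((\<lambda>x. lgm \<beta> (- x) / x) \<longlongrightarrow> - g \<theta>) (at_right 0)"
    using lgm_slope_scaled[OF ab(2), of "-1"] by (simp add: g_def \<beta>_def)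
  have l1: "((\<lambda>x. al x \<theta>' / x) \<longlongrightarrow> f \<theta>') (at_right 0)" if "0 < \<theta>'" for \<theta>'
    using lgm_slope_right[OF that] by (simp add: al_def f_def)
  have l2: "((\<lambda>x. be \<mu> x \<theta>' / x) \<longlongrightarrow> g \<theta>') (at_right 0)" if "\<theta>' < \<mu>" for \<theta>'
    using tendsto_minus[OF lgm_slope_scaled[of "\<mu> - \<theta>'" "-1"]] that by (simp add: be_def g_def)
  have pos: "\<forall>\<^sub>F x in at_right (0::real). x > 0" by (rule eventually_at_right_less)
  have small: "\<forall>\<^sub>F x in at_right (0::real). x < y" if "y > 0" for y :: real
    using eventually_at_right_real[OF that] by eventually_elim simp
  have "((\<lambda>x. lgm \<alpha> (- x) / x + al x \<theta>1 / x) \<longlongrightarrow> - f \<theta> + f \<theta>1) (at_right 0)"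
    using la l1 t by (intro tendsto_add)
  from order_tendstoD(1)[OF this, of 0] have e1: "\<forall>\<^sub>F x in at_right 0. 0 < lgm \<alpha> (- x) / x + al x \<theta>1 / x" using t by simp
  have "((\<lambda>x. be \<mu> x \<theta>2 / x - lgm \<beta> x / x) \<longlongrightarrow> g \<theta>2 - g \<theta>) (at_right 0)"
    using lb l2 t by (intro tendsto_diff)
  from order_tendstoD(1)[OF this, of 0] have e2: "\<forall>\<^sub>F x in at_right 0. 0 < be \<mu> x \<theta>2 / x - lgm \<beta> x / x" using t by simp
  have "((\<lambda>x. (t - \<epsilon>) * (lgm \<alpha> (- x) / x + al x \<theta>1 / x) + s * (be \<mu> x \<theta>1 / x - lgm \<beta> x / x)) \<longlongrightarrow>
    (t - \<epsilon>) * (- f \<theta> + f \<theta>1) + s * (g \<theta>1 - g \<theta>)) (at_right 0)"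
    using la lb l1 l2 t by (intro tendsto_intros)
  from order_tendstoD(2)[OF this, of "- \<delta> / 2"]
  have e3: "\<forall>\<^sub>F x in at_right 0. (t - \<epsilon>) * (lgm \<alpha> (- x) / x + al x \<theta>1 / x) + s * (be \<mu> x \<theta>1 / x - lgm \<beta> x / x) < - \<delta> / 2" using t by simp
  have "((\<lambda>x. t * (lgm \<alpha> (- x) / x + al x \<theta>2 / x) + (s - \<epsilon>) * (be \<mu> x \<theta>2 / x - lgm \<beta> x / x)) \<longlongrightarrow>
    t * (- f \<theta> + f \<theta>2) + (s - \<epsilon>) * (g \<theta>2 - g \<theta>)) (at_right 0)"
    using la lb l1 l2 t by (intro tendsto_intros)
  from order_tendstoD(2)[OF this, of "- \<delta> / 2"]
  have e4: "\<forall>\<^sub>F x in at_right 0. t * (lgm \<alpha> (- x) / x + al x \<theta>2 / x) + (s - \<epsilon>) * (be \<mu> x \<theta>2 / x - lgm \<beta> x / x) < - \<delta> / 2" using t by simp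
  \<comment> \<open>The first-order terms of \<open>lgm \<beta>\<close> at x and - x cancel, so the
    slack is of smaller order than the gain.\<close>
  have "((\<lambda>x. s * (lgm \<beta> x / x + lgm \<beta> (- x) / x)) \<longlongrightarrow> s * (g \<theta> + - g \<theta>)) (at_right 0)"
    using lb lb' by (intro tendsto_intros)
  from order_tendstoD(2)[OF this, of "\<delta> / 4"] have e5: "\<forall>\<^sub>F x in at_right 0. s * (lgm \<beta> x / x + lgm \<beta> (- x) / x) < \<delta> / 4" using t by simp
  obtain \<eta> where \<eta>: "\<eta> > 0" "\<eta> < \<beta>" "\<eta> < \<theta>1" "\<eta> < \<theta>2" "0 < lgm \<alpha> (- \<eta>) / \<eta> + al \<eta> \<theta>1 / \<eta>" "0 < be \<mu> \<eta> \<theta>2 / \<eta> - lgm \<beta> \<eta> / \<eta>"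
    "(t - \<epsilon>) * (lgm \<alpha> (- \<eta>) / \<eta> + al \<eta> \<theta>1 / \<eta>) + s * (be \<mu> \<eta> \<theta>1 / \<eta> - lgm \<beta> \<eta> / \<eta>) < - \<delta> / 2"
    "t * (lgm \<alpha> (- \<eta>) / \<eta> + al \<eta> \<theta>2 / \<eta>) + (s - \<epsilon>) * (be \<mu> \<eta> \<theta>2 / \<eta> - lgm \<beta> \<eta> / \<eta>) < - \<delta> / 2"
    "s * (lgm \<beta> \<eta> / \<eta> + lgm \<beta> (- \<eta>) / \<eta>) < \<delta> / 4"
  proof -
    have "\<forall>\<^sub>F x in at_right 0. x > 0 \<and> x < \<beta> \<and> x < \<theta>1 \<and> x < \<theta>2 \<and> 0 < lgm \<alpha> (- x) / x + al x \<theta>1 / x \<and> 0 < be \<mu> x \<theta>2 / x - lgm \<beta> x / x \<and>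
      (t - \<epsilon>) * (lgm \<alpha> (- x) / x + al x \<theta>1 / x) + s * (be \<mu> x \<theta>1 / x - lgm \<beta> x / x) < - \<delta> / 2 \<and>
      t * (lgm \<alpha> (- x) / x + al x \<theta>2 / x) + (s - \<epsilon>) * (be \<mu> x \<theta>2 / x - lgm \<beta> x / x) < - \<delta> / 2 \<and>
      s * (lgm \<beta> x / x + lgm \<beta> (- x) / x) < \<delta> / 4"
      using ab t by (intro eventually_conj pos small e1 e2 e3 e4 e5)
    from eventually_happens'[OF trivial_limit_at_right_real this] that show ?thesis by blast
  qed
  \<comment> \<open>The factor \<eta> undoes the division by \<eta>; one half of \<delta> pays for
    replacing the limits by values at \<eta>.\<close>
  define \<delta>' where "\<delta>' = \<eta> * \<delta> / 2"
  have \<delta>': "\<delta>' > 0" using \<eta> t by (simp add: \<delta>'_def)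
  have H1: "lgm \<alpha> (- \<eta>) + al \<eta> \<theta>1 \<ge> 0"
    using \<eta>(1,5) by (simp add: add_divide_distrib[symmetric] zero_less_divide_iff)
  have H2: "be \<mu> \<eta> \<theta>2 - lgm \<beta> \<eta> \<ge> 0"
    using \<eta>(1,6) by (simp add: diff_divide_distrib[symmetric] zero_less_divide_iff)
  have scale: "x / \<eta> < y \<Longrightarrow> x \<le> \<eta> * y" for x y
    using \<eta>(1) by (simp add: divide_less_eq mult.commute)
  have scale2: "a * (p + q) + b * (r - u) \<le> - \<delta>'"
    if "a * (p / \<eta> + q / \<eta>) + b * (r / \<eta> - u / \<eta>) < - \<delta> / 2" for a b p q r u
  proof -
    have "a * (p / \<eta> + q / \<eta>) + b * (r / \<eta> - u / \<eta>) = (a * (p + q) + b * (r - u)) / \<eta>"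
      by (simp only: add_divide_distrib diff_divide_distrib times_divide_eq_right[symmetric])
    then show ?thesis using scale[of "a * (p + q) + b * (r - u)" "- \<delta> / 2"] that by (simp add: \<delta>'_def)
  qed
  note H3 = scale2[OF \<eta>(7)] and H4 = scale2[OF \<eta>(8)]
  have H5: "s * (lgm \<beta> \<eta> + lgm \<beta> (- \<eta>)) \<le> \<delta>' / 2"
    using scale[of "s * (lgm \<beta> \<eta> + lgm \<beta> (- \<eta>))" "\<delta> / 4"] \<eta>(9)
    by (simp only: \<delta>'_def add_divide_distrib[symmetric] times_divide_eq_right) simp
  have "((\<lambda>c. c * (h * (s + t)) - c * pp) \<longlongrightarrow> 0 * (h * (s + t)) - 0 * pp) (at_right 0)"
    by (intro tendsto_intros)
  from order_tendstoD(2)[OF this, of "\<delta>' / 16"] have c5: "\<forall>\<^sub>F c in at_right 0. c * (h * (s + t)) - c * pp < \<delta>' / 16" using \<delta>' by simp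
  have c1: "\<forall>\<^sub>F c in at_right 0. lgm \<alpha> (- 2 * c) / c < 2 * (Digamma \<alpha> + \<epsilon>)"
    using \<epsilon> by (intro order_tendstoD(2)[OF lgm_slope_scaled[OF ab(1), of "-2"]]) auto
  have c2: "\<forall>\<^sub>F c in at_right 0. lgm \<beta> (- 4 * c) / c < 4 * (Digamma \<beta> + \<epsilon>)"
    using \<epsilon> by (intro order_tendstoD(2)[OF lgm_slope_scaled[OF ab(2), of "-4"]]) auto
  obtain c where c: "c > 0" "c < \<alpha> / 4" "c < \<beta> / 4" "c * (h * (s + t)) - c * pp < \<delta>' / 16"
    "lgm \<alpha> (- 2 * c) / c < 2 * (Digamma \<alpha> + \<epsilon>)" "lgm \<beta> (- 4 * c) / c < 4 * (Digamma \<beta> + \<epsilon>)"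
    "\<bar>lgm \<alpha> (4 * c)\<bar> \<le> \<bar>4\<bar> * (\<bar>Digamma \<alpha>\<bar> + 1) * c" "\<bar>lgm \<beta> (4 * c)\<bar> \<le> \<bar>4\<bar> * (\<bar>Digamma \<beta>\<bar> + 1) * c"
    "\<bar>lgm \<mu> (- 4 * c)\<bar> \<le> \<bar>- 4\<bar> * (\<bar>Digamma \<mu>\<bar> + 1) * c" "\<bar>lgm \<mu> (- 2 * c)\<bar> \<le> \<bar>- 2\<bar> * (\<bar>Digamma \<mu>\<bar> + 1) * c"
  proof -
    have "\<forall>\<^sub>F c in at_right 0. c > 0 \<and> c < \<alpha> / 4 \<and> c < \<beta> / 4 \<and> c * (h * (s + t)) - c * pp < \<delta>' / 16 \<and>
      lgm \<alpha> (- 2 * c) / c < 2 * (Digamma \<alpha> + \<epsilon>) \<and> lgm \<beta> (- 4 * c) / c < 4 * (Digamma \<beta> + \<epsilon>) \<and>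
      \<bar>lgm \<alpha> (4 * c)\<bar> \<le> \<bar>4\<bar> * (\<bar>Digamma \<alpha>\<bar> + 1) * c \<and> \<bar>lgm \<beta> (4 * c)\<bar> \<le> \<bar>4\<bar> * (\<bar>Digamma \<beta>\<bar> + 1) * c \<and>
      \<bar>lgm \<mu> (- 4 * c)\<bar> \<le> \<bar>- 4\<bar> * (\<bar>Digamma \<mu>\<bar> + 1) * c \<and> \<bar>lgm \<mu> (- 2 * c)\<bar> \<le> \<bar>- 2\<bar> * (\<bar>Digamma \<mu>\<bar> + 1) * c"
      using ab by (intro eventually_conj pos small c1 c2 c5 lgm_linear_bound) auto
    from eventually_happens'[OF trivial_limit_at_right_real this] that show ?thesis by blast
  qed
  have lin: "x \<le> k * c * h" if "\<bar>x\<bar> \<le> k * (y + 1) * c" "y + 1 \<le> h" "k \<ge> 0" for x k y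
  proof -
    have "x \<le> k * (y + 1) * c" using that by simp
    also have "\<dots> \<le> k * h * c" using that c by (intro mult_right_mono mult_left_mono) auto
    finally show ?thesis by (simp add: mult_ac)
  qed
  have "\<forall>\<^sub>F N in sequentially. Zmom (\<alpha> + \<beta>) (fl N s) (fl N t) (- c) \<le> ennreal (exp (c * ((t * Digamma \<alpha> + s * Digamma \<beta>) + e) * real N))"
  proof (rule neg_moment_aux[of \<eta> \<theta>1 \<theta>2 s t \<epsilon> \<delta>' e c h])
    show "lgm \<alpha> (- (2 * c)) \<le> 2 * c * (Digamma \<alpha> + \<epsilon>)" "lgm \<beta> (- (4 * c)) \<le> 4 * c * (Digamma \<beta> + \<epsilon>)"
      using c(1,5,6) by (simp_all add: divide_less_eq mult_ac)
    show "lgm \<alpha> (4 * c) \<le> 4 * c * h" "lgm \<beta> (4 * c) \<le> 4 * c * h" "lgm (\<alpha> + \<beta>) (- (4 * c)) \<le> 4 * c * h" "lgm (\<alpha> + \<beta>) (- (2 * c)) \<le> 2 * c * h"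
      using lin[of "lgm \<alpha> (4 * c)" 4 "\<bar>Digamma \<alpha>\<bar>"] lin[of "lgm \<beta> (4 * c)" 4 "\<bar>Digamma \<beta>\<bar>"]
        lin[of "lgm \<mu> (- (4 * c))" 4 "\<bar>Digamma \<mu>\<bar>"] lin[of "lgm \<mu> (- (2 * c))" 2 "\<bar>Digamma \<mu>\<bar>"] c(7-10) h ab(3) by simp_all
    show "c * (h * (s + t)) \<le> \<delta>' / 16 + c * (t * Digamma \<alpha> + s * Digamma \<beta>)" using c(4) by (simp add: pp_def)
    show "4 * c < \<alpha>" "4 * c < \<beta>" using c(2,3) by simp_all
    show "h \<ge> 0" using h(1) by simp
  qed (unfold ab(3), (fact H1 H2 H3 H4 H5 \<eta>(1-4) t(1-4) assms(1,2) \<open>e > 0\<close> \<delta>' \<epsilon> c(1))+)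
  then have "\<forall>\<^sub>F N in sequentially. Zmom \<mu> (fl N s) (fl N t) (- c) \<le> ennreal (exp (c * (t * Digamma \<theta> + s * Digamma (\<mu> - \<theta>) + e) * real N))"
    by (simp add: \<alpha>_def \<beta>_def)
  then show ?thesis using c(1) by blast
qed

section \<open>Real-valued moments and their log-convexity\<close>

lemma ennreal_linear:
  "0 \<le> a \<Longrightarrow> 0 \<le> b \<Longrightarrow> 0 \<le> x \<Longrightarrow> 0 \<le> y \<Longrightarrow> ennreal (a * x + b * y) = ennreal a * ennreal x + ennreal b * ennreal y"
  by (simp add: ennreal_mult')

lemma powr_power_pos: "x > 0 \<Longrightarrow> (x powr y) ^ n = x powr (real n * y)"
  by (simp add: powr_power mult.commute)

text \<open>Faithful for \<xi> < \<mu>, where the moment is finite and, by \<open>zm_pos\<close>,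
  has a logarithm.\<close>

definition zm :: "real \<Rightarrow> nat \<Rightarrow> nat \<Rightarrow> real \<Rightarrow> real" where
  "zm \<mu> m n \<xi> = enn2real (Zmom \<mu> m n \<xi>)"

lemma Zmom_zm: "\<mu> > 0 \<Longrightarrow> \<xi> < \<mu> \<Longrightarrow> Zmom \<mu> m n \<xi> = ennreal (zm \<mu> m n \<xi>)"
  using Zmom_finite[of \<mu> \<xi> m n] by (simp add: zm_def less_top)

lemma Zmom_0: "\<mu> > 0 \<Longrightarrow> Zmom \<mu> m n 0 = 1"
proof -
  assume "\<mu> > 0"
  then obtain M :: "(nat \<times> nat \<Rightarrow> real) measure" and X where "lg_env M X (\<lambda>_. \<mu>)" by (rule iid_env_exists)
  then interpret lg_env M X "\<lambda>_. \<mu>" .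
  have "(\<integral>\<^sup>+\<omega>. ennreal (pf (\<lambda>p. X p \<omega>) m n powr 0) \<partial>M) = 1"
    using less_imp_neq[OF pf_X_pos0] by (simp add: emeasure_space_1 powr_zero_eq_one less_imp_neq[OF pf_X_pos0, THEN not_sym])
  then show ?thesis using Zmom_eq0[of \<mu> m n 0] by simp
qed

lemma Zmom_nonzero:
  assumes "\<mu> > 0"
  shows "Zmom \<mu> m n \<xi> \<noteq> 0"
proof
  obtain M :: "(nat \<times> nat \<Rightarrow> real) measure" and X where "lg_env M X (\<lambda>_. \<mu>)" using assms by (rule iid_env_exists)
  then interpret lg_env M X "\<lambda>_. \<mu>" .
  assume "Zmom \<mu> m n \<xi> = 0"
  then have "(\<integral>\<^sup>+\<omega>. ennreal (pf (\<lambda>p. X p \<omega>) m n powr \<xi>) \<partial>M) = 0" using Zmom_eq0[of \<mu> m n \<xi>] by simp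
  then have "AE \<omega> in M. ennreal (pf (\<lambda>p. X p \<omega>) m n powr \<xi>) = 0"
    by (subst (asm) nn_integral_0_iff_AE) auto
  moreover have "ennreal (pf (\<lambda>p. X p \<omega>) m n powr \<xi>) \<noteq> 0" for \<omega>
    using pf_X_pos0[of \<omega> m n] by (simp add: ennreal_eq_0_iff)
  ultimately have "AE \<omega> in M. False" by simp
  then show False by simp
qed

lemma zm_pos:
  assumes "\<mu> > 0" "\<xi> < \<mu>"
  shows "zm \<mu> m n \<xi> > 0"
  using Zmom_finite[OF assms, of m n] Zmom_nonzero[OF assms(1), of m n \<xi>]
  by (simp add: zm_def enn2real_positive_iff zero_less_iff_neq_zero)

text \<open>Hoelder's inequality, obtained by integrating Young's inequality for the two powers of
  Z, each normalised by its own mean.\<close>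

lemma zm_logconvex:
  assumes \<mu>: "\<mu> > 0" "\<xi>1 < \<mu>" "\<xi>2 < \<mu>" and u: "0 \<le> u" "0 \<le> v" "u + v = 1"
  shows "zm \<mu> m n (u * \<xi>1 + v * \<xi>2) \<le> zm \<mu> m n \<xi>1 powr u * zm \<mu> m n \<xi>2 powr v"
proof -
  obtain M :: "(nat \<times> nat \<Rightarrow> real) measure" and X where "lg_env M X (\<lambda>_. \<mu>)" using assms(1) by (rule iid_env_exists)
  then interpret lg_env M X "\<lambda>_. \<mu>" .
  define A B where "A = zm \<mu> m n \<xi>1" and "B = zm \<mu> m n \<xi>2"
  have AB: "A > 0" "B > 0" using zm_pos \<mu> by (auto simp: A_def B_def)
  define x where "x = u * \<xi>1 + v * \<xi>2"
  have x: "x < \<mu>"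
  proof -
    have "u * \<xi>1 + v * \<xi>2 < u * \<mu> + v * \<mu>"
      using u \<mu> by (cases "u = 0") (auto intro!: add_less_le_mono mult_strict_left_mono mult_left_mono)
    also have "\<dots> = \<mu>" using u(3) by (metis distrib_right mult_1_left)
    finally show ?thesis by (simp add: x_def)
  qed
  define K where "K = A powr u * B powr v"
  have pw: "z powr x \<le> K * (u / A) * z powr \<xi>1 + K * (v / B) * z powr \<xi>2" if "z > 0" for z
  proof -
    have "(z powr \<xi>1 / A) powr u * (z powr \<xi>2 / B) powr v \<le> u * (z powr \<xi>1 / A) + v * (z powr \<xi>2 / B)"
      using u AB that by (intro Youngs_inequality_0) auto
    moreover have "(z powr \<xi>1 / A) powr u * (z powr \<xi>2 / B) powr v = z powr x / K"
      by (simp add: powr_divide powr_powr x_def powr_add K_def mult.commute)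
    ultimately have "z powr x / K \<le> u * (z powr \<xi>1 / A) + v * (z powr \<xi>2 / B)" by simp
    moreover have "K > 0" using AB by (simp add: K_def)
    ultimately have "z powr x \<le> (u * (z powr \<xi>1 / A) + v * (z powr \<xi>2 / B)) * K"
      by (simp add: pos_divide_le_eq)
    then show ?thesis by (simp add: algebra_simps)
  qed
  have K0: "K > 0" using AB by (simp add: K_def)
  have "ennreal (zm \<mu> m n x) = (\<integral>\<^sup>+\<omega>. ennreal (pf (\<lambda>p. X p \<omega>) m n powr x) \<partial>M)"
    using Zmom_zm[OF \<mu>(1) x] Zmom_eq0[of \<mu> m n x] by simp
  also have "\<dots> \<le> (\<integral>\<^sup>+\<omega>. ennreal (K * (u / A)) * ennreal (pf (\<lambda>p. X p \<omega>) m n powr \<xi>1) + ennreal (K * (v / B)) * ennreal (pf (\<lambda>p. X p \<omega>) m n powr \<xi>2) \<partial>M)"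
  proof (rule nn_integral_mono)
    fix \<omega>
    have "ennreal (pf (\<lambda>p. X p \<omega>) m n powr x) \<le> ennreal (K * (u / A) * pf (\<lambda>p. X p \<omega>) m n powr \<xi>1 + K * (v / B) * pf (\<lambda>p. X p \<omega>) m n powr \<xi>2)"
      by (rule ennreal_leI[OF pw[OF pf_X_pos0]])
    then show "ennreal (pf (\<lambda>p. X p \<omega>) m n powr x) \<le> ennreal (K * (u / A)) * ennreal (pf (\<lambda>p. X p \<omega>) m n powr \<xi>1) + ennreal (K * (v / B)) * ennreal (pf (\<lambda>p. X p \<omega>) m n powr \<xi>2)"
      using u AB K0 by (subst (asm) ennreal_linear) auto
  qed
  also have "\<dots> = ennreal (K * (u / A)) * Zmom \<mu> m n \<xi>1 + ennreal (K * (v / B)) * Zmom \<mu> m n \<xi>2"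
    by (subst nn_integral_add, measurable, subst nn_integral_cmult, measurable, subst nn_integral_cmult, measurable)
       (simp only: Zmom_eq0[OF refl])
  also have "\<dots> = ennreal (K * (u / A) * A + K * (v / B) * B)"
    using u AB K0 \<mu> by (simp add: Zmom_zm A_def[symmetric] B_def[symmetric] ennreal_mult'[symmetric])
  also have "K * (u / A) * A + K * (v / B) * B = K" using AB u(3) by (simp add: distrib_left[symmetric])
  finally show ?thesis using K0 by (simp add: x_def K_def A_def B_def)
qed

lemma zm_0: "\<mu> > 0 \<Longrightarrow> zm \<mu> m n 0 = 1"
  by (simp add: zm_def Zmom_0)

text \<open>Log-convexity between the orders - c and 0; at order 0 the moment is 1.\<close>

lemma zm_Lyapunov:
  assumes "\<mu> > 0" "0 \<le> x" "x \<le> c" "c > 0"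
  shows "zm \<mu> m n (- x) \<le> zm \<mu> m n (- c) powr (x / c)"
  using zm_logconvex[of \<mu> "- c" 0 "x / c" "1 - x / c" m n] assms by (simp add: zm_0)

section \<open>Disjoint tubes and arbitrary negative moments\<close>

lemma pf_chain:
  assumes pos: "\<And>p. w p > 0"
  shows "(\<Prod>j<q. pf (shift (x + j * m) (y + j * n) w) m n) \<le> pf (shift x y w) (q * m) (q * n)"
proof (induction q)
  case (Suc q)
  have p: "shift a b w p > 0" for a b p using pos by (simp add: shift_def)
  have "(\<Prod>j<Suc q. pf (shift (x + j * m) (y + j * n) w) m n) \<le> pf (shift x y w) (q * m) (q * n) * pf (shift (x + q * m) (y + q * n) w) m n"
    using Suc less_imp_le[OF pf_pos[OF p]] by (simp add: mult_right_mono)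
  also have "\<dots> \<le> pf (shift x y w) (q * m + m) (q * n + n)"
    using pf_superadditive[of "shift x y w" "q * m" "q * n" m n] p by simp
  finally show ?case by (simp add: add.commute)
qed simp

text \<open>A geometric mean is at most the maximum and thus the sum. This replaces independence for
  factors that share sites.\<close>

lemma prod_root_le_sum:
  fixes x :: "nat \<Rightarrow> real"
  assumes "K > 0" "\<And>k. k < K \<Longrightarrow> x k > 0"
  shows "(\<Prod>k<K. x k powr (1 / real K)) \<le> (\<Sum>k<K. x k)"
proof -
  have S: "(\<Sum>k<K. x k) > 0" using assms by (intro sum_pos) auto
  have "(\<Prod>k<K. x k powr (1 / real K)) \<le> (\<Prod>k<K. (\<Sum>k<K. x k) powr (1 / real K))"
    using assms by (intro prod_mono conjI powr_mono2 member_le_sum) (auto intro: less_imp_le)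
  also have "\<dots> = (\<Sum>k<K. x k)" using S assms(1) by (simp add: powr_power)
  finally show ?thesis .
qed

text \<open>A common row forces the block indices j and j' to differ by at most 1. Then both blocks
  lie in a window of 2 m columns shifted by their tube, and tubes are 2 m + 1 columns apart, so k =
  k'. Consecutive blocks of one tube meet in a corner only, which \<open>sites\<close> leaves out of
  the later block.\<close>

lemma tube_sites_disjoint:
  fixes m n :: nat
  assumes n: "n > 0" and ne: "(k, j) \<noteq> (k', j')"
  shows "sites (k * (2 * m + 1) + j * m) (j * n) m n \<inter> sites (k' * (2 * m + 1) + j' * m) (j' * n) m n = {}"
  using ne
proof (induction j j' arbitrary: k k' rule: linorder_wlog)
  case (le j j')
  show ?case
  proof (rule ccontr)
    assume "\<not> ?thesis"
    then obtain x y where 1: "(x, y) \<in> sites (k * (2 * m + 1) + j * m) (j * n) m n"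
      and 2: "(x, y) \<in> sites (k' * (2 * m + 1) + j' * m) (j' * n) m n" by auto
    have y: "j' * n \<le> y" "y \<le> j * n + n" using 1 2 by (auto simp: sites_def)
    then have "j' * n \<le> (j + 1) * n" by simp
    then have j': "j' \<le> j + 1" using n by (simp only: mult_le_cancel2)
    have x: "k * (2 * m + 1) + j * m \<le> x" "x \<le> k * (2 * m + 1) + j * m + m"
      "k' * (2 * m + 1) + j' * m \<le> x" "x \<le> k' * (2 * m + 1) + j' * m + m" using 1 2 by (auto simp: sites_def)
    have jm: "j * m \<le> j' * m" "j' * m \<le> j * m + m" using le j' mult_le_mono1[OF j', of m] by (auto simp: mult_le_mono1)
    have "k = k'"
    proof (rule ccontr)
      assume "k \<noteq> k'"
      then consider "k + 1 \<le> k'" | "k' + 1 \<le> k" by linarith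
      then show False
      proof cases
        case 1
        from mult_le_mono1[OF this, of "2 * m + 1"] show False using x jm by simp
      next
        case 2
        from mult_le_mono1[OF this, of "2 * m + 1"] show False using x jm by simp
      qed
    qed
    then have "j \<noteq> j'" using le(2) by auto
    then have "j' = j + 1" using le(1) j' by simp
    then have "y = j' * n" "x = k' * (2 * m + 1) + j' * m" using x y \<open>k = k'\<close> by simp_all
    then show False using 2 by (simp add: sites_def)
  qed
next
  case (sym j j')
  from sym(1)[of k' k] sym(2) show ?case by (auto simp: Int_commute)
qed

text \<open>For each \<open>k < K\<close> the paths that follow the axis to \<open>(k (2 m0 + 1), 0)\<close> and then cross \<open>q\<close> consecutive
  \<open>m0 \<times> n0\<close> blocks give a lower bound of \<open>Z\<close>. The tubes are disjoint, so the geometric mean over \<open>k\<close> only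
  needs moments of a block of the small order \<open>a / K\<close>.\<close>

lemma Zmom_tubes:
  assumes \<mu>: "\<mu> > 0" and a: "a > 0" and K: "K > 0" and n0: "n0 > 0"
    and m: "K * (2 * m0 + 1) + q * m0 \<le> m" and n: "q * n0 \<le> n"
  defines "H \<equiv> \<bar>lgm \<mu> (- (4 * a))\<bar>"
  shows "zm \<mu> m n (- a) \<le> (zm \<mu> m0 n0 (- (2 * a / real K)) ^ (K * q)) powr (1/2) *
    (real K * exp (real (K * (2 * m0 + 1)) * H)) powr (1/4) * (real K * exp (real (m + n - q * (m0 + n0)) * H)) powr (1/4)"
proof -
  obtain M :: "(nat \<times> nat \<Rightarrow> real) measure" and X where "lg_env M X (\<lambda>_. \<mu>)" using \<mu> by (rule iid_env_exists)
  then interpret lg_env M X "\<lambda>_. \<mu>" .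
  define M0 where "M0 = 2 * m0 + 1"
  define b where "b = a / real K"
  have b: "b > 0" using a K by (simp add: b_def)
  let ?P = "\<lambda>x y m n \<omega>. pf (shift x y (\<lambda>p. X p \<omega>)) m n"
  \<comment> \<open>\<open>A\<close> leads along the axis to the k-th tube and \<open>D\<close> from
    its end to (m, n). For different k these segments overlap, unlike the blocks
    \<open>B\<close>.\<close>
  define A where "A k \<omega> = pf (\<lambda>p. X p \<omega>) (k * M0) 0" for k \<omega>
  define B where "B k j \<omega> = ?P (k * M0 + j * m0) (j * n0) m0 n0 \<omega>" for k j \<omega>
  define D where "D k \<omega> = ?P (k * M0 + q * m0) (q * n0) (m - (k * M0 + q * m0)) (n - q * n0) \<omega>" for k \<omega>
  note [measurable] = pf_rv
  have [measurable]: "A k \<in> borel_measurable M" "B k j \<in> borel_measurable M" "D k \<in> borel_measurable M" for k j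
    unfolding A_def B_def D_def by measurable
  have pos: "A k \<omega> > 0" "B k j \<omega> > 0" "D k \<omega> > 0" for k j \<omega>
    by (simp_all add: A_def B_def D_def pf_X_pos pf_X_pos0)
  have kM: "k * M0 + q * m0 \<le> m" if "k < K" for k
  proof -
    have "k * M0 \<le> K * M0" using that by (intro mult_le_mono1) simp
    then show ?thesis using m by (simp add: M0_def)
  qed
  have ge: "A k \<omega> * (\<Prod>j<q. B k j \<omega>) * D k \<omega> \<le> pf (\<lambda>p. X p \<omega>) m n" if "k < K" for k \<omega>
  proof -
    have "A k \<omega> * (\<Prod>j<q. B k j \<omega>) * D k \<omega> \<le> A k \<omega> * ?P (k * M0) 0 (q * m0) (q * n0) \<omega> * D k \<omega>"
      unfolding B_def using pf_chain[of "\<lambda>p. X p \<omega>" "k * M0" m0 0 n0 q] pos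
      by (intro mult_right_mono mult_left_mono) (auto simp: X_pos intro: less_imp_le)
    also have "A k \<omega> * ?P (k * M0) 0 (q * m0) (q * n0) \<omega> \<le> pf (\<lambda>p. X p \<omega>) (k * M0 + q * m0) (q * n0)"
      using pf_superadditive[of "\<lambda>p. X p \<omega>" "k * M0" 0 "q * m0" "q * n0"] by (simp add: A_def X_pos)
    also have "pf (\<lambda>p. X p \<omega>) (k * M0 + q * m0) (q * n0) * D k \<omega> \<le> pf (\<lambda>p. X p \<omega>) m n"
      using pf_superadditive[of "\<lambda>p. X p \<omega>" "k * M0 + q * m0" "q * n0" "m - (k * M0 + q * m0)" "n - q * n0"] kM[OF that] n
      by (simp add: D_def X_pos)
    finally show ?thesis using pos by (simp add: mult_right_mono less_imp_le)
  qed
  \<comment> \<open>Each of the K tubes bounds the same Z from below and supplies the power - b of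
    it, with K b = a.\<close>
  have pw: "pf (\<lambda>p. X p \<omega>) m n powr - a \<le>
     (\<Prod>k<K. \<Prod>j<q. B k j \<omega> powr - b) * (\<Prod>k<K. A k \<omega> powr - b) * (\<Prod>k<K. D k \<omega> powr - b)" for \<omega>
  proof -
    have "pf (\<lambda>p. X p \<omega>) m n powr - a = (\<Prod>k<K. pf (\<lambda>p. X p \<omega>) m n powr - b)"
      using K pf_X_pos0[of \<omega> m n] by (simp add: powr_power_pos b_def)
    also have "\<dots> \<le> (\<Prod>k<K. (A k \<omega> * (\<Prod>j<q. B k j \<omega>) * D k \<omega>) powr - b)"
      using b ge pos by (intro prod_mono conjI powr_mono2' mult_pos_pos prod_pos) auto
    also have "\<dots> = (\<Prod>k<K. \<Prod>j<q. B k j \<omega> powr - b) * (\<Prod>k<K. A k \<omega> powr - b) * (\<Prod>k<K. D k \<omega> powr - b)"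
      by (simp add: powr_mult prod_powr_distrib prod.distrib mult_ac)
    finally show ?thesis .
  qed
  have bb: "- (2 * b) = - (2 * a / real K)" by (simp add: b_def)
  have IB: "(\<integral>\<^sup>+\<omega>. ennreal ((\<Prod>k<K. \<Prod>j<q. B k j \<omega> powr - b) ^ 2) \<partial>M) \<le> ennreal (zm \<mu> m0 n0 (- (2 * a / real K)) ^ (K * q))"
  proof -
    define g where "g = (\<lambda>(k, j) w. ennreal (pf (shift (k * M0 + j * m0) (j * n0) w) m0 n0 powr - (2 * b)))"
    define S where "S = (\<lambda>(k, j). sites (k * M0 + j * m0) (j * n0) m0 n0)"
    have "(\<Prod>k<K. \<Prod>j<q. B k j \<omega> powr - b) ^ 2 = (\<Prod>(k, j)\<in>{..<K} \<times> {..<q}. B k j \<omega> powr - (2 * b))" for \<omega>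
      using pos by (simp add: prod.cartesian_product prod_power_distrib powr_power_pos case_prod_beta')
    then have "(\<integral>\<^sup>+\<omega>. ennreal ((\<Prod>k<K. \<Prod>j<q. B k j \<omega> powr - b) ^ 2) \<partial>M) = (\<integral>\<^sup>+\<omega>. (\<Prod>i\<in>{..<K} \<times> {..<q}. g i (\<lambda>p. X p \<omega>)) \<partial>M)"
      by (simp add: g_def B_def case_prod_beta' prod_ennreal)
    also have "\<dots> = (\<Prod>i\<in>{..<K} \<times> {..<q}. \<integral>\<^sup>+\<omega>. g i (\<lambda>p. X p \<omega>) \<partial>M)"
    proof (rule indep_groups[where K=S])
      show "disjoint_family_on S ({..<K} \<times> {..<q})"
        using tube_sites_disjoint[OF n0, of _ _ _ _ m0] unfolding disjoint_family_on_def S_def M0_def by fastforce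
      fix i :: "nat \<times> nat" obtain k j where i: "i = (k, j)" by (cases i)
      have [measurable]: "(\<lambda>w. pf (shift (k * M0 + j * m0) (j * n0) w) m0 n0) \<in> borel_measurable (PiM (S i) (\<lambda>_. borel))"
        by (rule pf_shift_measurable) (simp add: i S_def)
      show "g i \<in> borel_measurable (PiM (S i) (\<lambda>_. borel))"
        unfolding i g_def prod.case by (simp only: i[symmetric]) measurable
      fix w w' :: "nat \<times> nat \<Rightarrow> real" assume "\<And>p. p \<in> S i \<Longrightarrow> w p = w' p"
      then show "g i w = g i w'"
        using pf_shift_cong[of "k * M0 + j * m0" "j * n0" m0 n0 w w'] by (simp add: g_def i S_def)
    qed simp
    also have "\<dots> = (\<Prod>i\<in>{..<K} \<times> {..<q}. ennreal (zm \<mu> m0 n0 (- (2 * b))))"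
    proof (rule prod.cong)
      fix i :: "nat \<times> nat" obtain k j where i: "i = (k, j)" by (cases i)
      have "(\<integral>\<^sup>+\<omega>. g i (\<lambda>p. X p \<omega>) \<partial>M) = Zmom \<mu> m0 n0 (- (2 * b))"
        unfolding g_def i prod.case by (rule Zmom_eq) simp
      then show "(\<integral>\<^sup>+\<omega>. g i (\<lambda>p. X p \<omega>) \<partial>M) = ennreal (zm \<mu> m0 n0 (- (2 * b)))"
        using Zmom_zm[OF \<mu>, of "- (2 * b)" m0 n0] b \<mu> by simp
    qed simp
    also have "\<dots> = ennreal (zm \<mu> m0 n0 (- (2 * b)) ^ (K * q))"
      using zm_pos[OF \<mu>, of "- (2 * b)" m0 n0] b \<mu> by (simp add: card_cartesian_product ennreal_power less_imp_le)
    finally show ?thesis unfolding bb by simp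
  qed
  \<comment> \<open>The fourth power of the product over the overlapping segments is a geometric
    mean of the powers - 4 a, bounded by their sum.\<close>
  have IE: "(\<integral>\<^sup>+\<omega>. ennreal ((\<Prod>k<K. E k \<omega> powr - b) ^ 4) \<partial>M) \<le> ennreal (real K * exp (real r * H))"
    if [measurable]: "\<And>k. E k \<in> borel_measurable M" and E: "\<And>k \<omega>. E k \<omega> > 0"
      and bound: "\<And>k. k < K \<Longrightarrow> \<exists>x y. x + y \<le> r \<and> (\<integral>\<^sup>+\<omega>. ennreal (E k \<omega> powr - (4 * a)) \<partial>M) = Zmom \<mu> x y (- (4 * a))"
    for E :: "nat \<Rightarrow> _ \<Rightarrow> real" and r :: nat
  proof -
    have "(\<Prod>k<K. E k \<omega> powr - b) ^ 4 \<le> (\<Sum>k<K. E k \<omega> powr - (4 * a))" for \<omega>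
    proof -
      have "(\<Prod>k<K. E k \<omega> powr - b) ^ 4 = (\<Prod>k<K. (E k \<omega> powr - (4 * a)) powr (1 / real K))"
        using E by (simp add: prod_power_distrib powr_power_pos powr_powr b_def)
      also have "\<dots> \<le> (\<Sum>k<K. E k \<omega> powr - (4 * a))"
        using E K less_imp_neq[OF E, THEN not_sym] by (intro prod_root_le_sum) auto
      finally show ?thesis .
    qed
    then have "(\<integral>\<^sup>+\<omega>. ennreal ((\<Prod>k<K. E k \<omega> powr - b) ^ 4) \<partial>M) \<le> (\<integral>\<^sup>+\<omega>. (\<Sum>k<K. ennreal (E k \<omega> powr - (4 * a))) \<partial>M)"
      by (intro nn_integral_mono) (simp add: ennreal_leI)
    also have "\<dots> = (\<Sum>k<K. \<integral>\<^sup>+\<omega>. ennreal (E k \<omega> powr - (4 * a)) \<partial>M)"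
      by (rule nn_integral_sum) simp
    also have "\<dots> \<le> (\<Sum>k<K. ennreal (exp (real r * H)))"
    proof (rule sum_mono)
      fix k assume "k \<in> {..<K}"
      then have "k < K" by simp
      from bound[OF this] obtain x y where xy: "x + y \<le> r" "(\<integral>\<^sup>+\<omega>. ennreal (E k \<omega> powr - (4 * a)) \<partial>M) = Zmom \<mu> x y (- (4 * a))"
        by blast
      have "Zmom \<mu> x y (- (4 * a)) \<le> ennreal (exp (real (x + y) * lgm \<mu> (- (4 * a))))"
        using a \<mu> by (intro Zmom_path_upper) auto
      also have "\<dots> \<le> ennreal (exp (real r * H))"
      proof -
        have "real (x + y) * lgm \<mu> (- (4 * a)) \<le> real (x + y) * H" by (intro mult_left_mono) (auto simp: H_def)
        also have "\<dots> \<le> real r * H" using xy(1) by (intro mult_right_mono) (auto simp: H_def)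
        finally show ?thesis by (intro ennreal_leI) simp
      qed
      finally show "(\<integral>\<^sup>+\<omega>. ennreal (E k \<omega> powr - (4 * a)) \<partial>M) \<le> ennreal (exp (real r * H))" using xy by simp
    qed
    also have "\<dots> = ennreal (real K * exp (real r * H))" by (simp add: ennreal_mult' ennreal_of_nat_eq_real_of_nat)
    finally show ?thesis .
  qed
  have IA: "(\<integral>\<^sup>+\<omega>. ennreal ((\<Prod>k<K. A k \<omega> powr - b) ^ 4) \<partial>M) \<le> ennreal (real K * exp (real (K * M0) * H))"
  proof (rule IE)
    fix k assume "k < K"
    then show "\<exists>x y. x + y \<le> K * M0 \<and> (\<integral>\<^sup>+\<omega>. ennreal (A k \<omega> powr - (4 * a)) \<partial>M) = Zmom \<mu> x y (- (4 * a))"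
      by (intro exI[of _ "k * M0"] exI[of _ 0]) (auto simp: A_def Zmom_eq0)
  qed (auto simp: pos)
  have ID: "(\<integral>\<^sup>+\<omega>. ennreal ((\<Prod>k<K. D k \<omega> powr - b) ^ 4) \<partial>M) \<le> ennreal (real K * exp (real (m + n - q * (m0 + n0)) * H))"
  proof (rule IE)
    fix k assume "k < K"
    have "m - (k * M0 + q * m0) + (n - q * n0) \<le> m + n - q * (m0 + n0)"
      using kM[OF \<open>k < K\<close>] n by (simp add: distrib_left)
    then show "\<exists>x y. x + y \<le> m + n - q * (m0 + n0) \<and> (\<integral>\<^sup>+\<omega>. ennreal (D k \<omega> powr - (4 * a)) \<partial>M) = Zmom \<mu> x y (- (4 * a))"
      by (intro exI[of _ "m - (k * M0 + q * m0)"] exI[of _ "n - q * n0"]) (auto simp: D_def Zmom_eq)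
  qed (auto simp: pos)
  have "ennreal (zm \<mu> m n (- a)) = (\<integral>\<^sup>+\<omega>. ennreal (pf (\<lambda>p. X p \<omega>) m n powr - a) \<partial>M)"
    using Zmom_zm[OF \<mu>, of "- a" m n] Zmom_eq0[OF refl, of m n "- a"] a \<mu> by simp
  also have "\<dots> \<le> (\<integral>\<^sup>+\<omega>. ennreal ((\<Prod>k<K. \<Prod>j<q. B k j \<omega> powr - b) * (\<Prod>k<K. A k \<omega> powr - b) * (\<Prod>k<K. D k \<omega> powr - b)) \<partial>M)"
    by (intro nn_integral_mono ennreal_leI pw)
  also have "\<dots> \<le> ennreal ((zm \<mu> m0 n0 (- (2 * a / real K)) ^ (K * q)) powr (1/2) *
    (real K * exp (real (K * M0) * H)) powr (1/4) * (real K * exp (real (m + n - q * (m0 + n0)) * H)) powr (1/4))"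
    by (intro nn_integral_Hoelder IB IA ID) (auto intro!: prod_nonneg simp: zm_def)
  finally show ?thesis by (subst (asm) ennreal_le_iff) (auto simp: M0_def)
qed

lemma eventually_real_ge: "\<forall>\<^sub>F N in sequentially. x \<le> real N"
  using filterlim_real_sequentially unfolding filterlim_at_top by (rule spec)

text \<open>With K large, the blocks are needed only at order 2 a / K <= c, where
  \<open>Zmom_neg_small\<close> and \<open>zm_Lyapunov\<close> apply. Outside the blocks a tube has
  a bounded number of steps plus a rounding loss of at most 2 per block, and long blocks make the
  total loss a small fraction of N.\<close>

lemma zm_neg_upper:
  assumes st: "s > 0" "t > 0" and \<theta>: "0 < \<theta>" "\<theta> < \<mu>" and crit: "- t * Polygamma 1 \<theta> + s * Polygamma 1 (\<mu> - \<theta>) = 0"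
    and a: "a > 0" and e: "e > 0"
  defines "pp \<equiv> t * Digamma \<theta> + s * Digamma (\<mu> - \<theta>)"
  shows "\<forall>\<^sub>F N in sequentially. ln (zm \<mu> (fl N s) (fl N t) (- a)) \<le> a * real N * (pp + e)"
proof -
  have \<mu>: "\<mu> > 0" using \<theta> by simp
  obtain c where c: "c > 0" and ev: "\<forall>\<^sub>F N in sequentially. Zmom \<mu> (fl N s) (fl N t) (- c) \<le> ennreal (exp (c * (pp + e / 2) * real N))"
    using Zmom_neg_small[OF st \<theta> crit, of "e / 2"] e unfolding pp_def by auto
  define K where "K = nat \<lceil>2 * a / c\<rceil>"
  have "2 * a / c > 0" using a c by simp
  then have Kr: "real K \<ge> 2 * a / c" and K: "K > 0" unfolding K_def by linarith+
  have Kc: "2 * a / real K \<le> c" using Kr K c by (simp add: field_simps)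
  define H where "H = \<bar>lgm \<mu> (- (4 * a))\<bar>"
  have H: "H \<ge> 0" by (simp add: H_def)
  \<comment> \<open>The first bound on L makes a block at least one row high; the last keeps the
    rounding loss 2 H / L below a e.\<close>
  have "\<forall>\<^sub>F L in sequentially. real L \<ge> max (1 / t) (max 1 (2 * H / (a * e)))"
    by (rule eventually_real_ge)
  with ev have "\<forall>\<^sub>F L in sequentially. Zmom \<mu> (fl L s) (fl L t) (- c) \<le> ennreal (exp (c * (pp + e / 2) * real L)) \<and>
    real L \<ge> max (1 / t) (max 1 (2 * H / (a * e)))" by (rule eventually_conj)
  then obtain L where L: "Zmom \<mu> (fl L s) (fl L t) (- c) \<le> ennreal (exp (c * (pp + e / 2) * real L))"
    "real L \<ge> 1 / t" "real L \<ge> 1" "real L \<ge> 2 * H / (a * e)"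
    using eventually_happens'[OF sequentially_bot] by fastforce
  define m0 n0 M0 where "m0 = fl L s" and "n0 = fl L t" and "M0 = 2 * m0 + 1"
  have L0: "L > 0" using L(3) by simp
  have mb: "real m0 \<le> real L * s" "real L * s - 1 \<le> real m0" "real n0 \<le> real L * t" "real L * t - 1 \<le> real n0"
    unfolding m0_def n0_def using fl_bounds st by auto
  have n0: "n0 > 0"
  proof -
    have "real L * t \<ge> 1" using L(2) st by (simp add: field_simps)
    then show ?thesis unfolding n0_def fl_def by linarith
  qed
  define Z0 where "Z0 = zm \<mu> m0 n0 (- (2 * a / real K))"
  have Z0p: "Z0 > 0"
  proof -
    have "2 * a / real K > 0" using a K by simp
    then show ?thesis unfolding Z0_def using \<mu> by (intro zm_pos) linarith+
  qed
  have lnZ0: "ln Z0 \<le> (2 * a / real K) * ((pp + e / 2) * real L)"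
  proof -
    have "zm \<mu> m0 n0 (- c) \<le> exp (c * (pp + e / 2) * real L)"
      using L(1) Zmom_zm[OF \<mu>, of "- c" m0 n0] c \<mu> by (simp add: m0_def n0_def)
    then have 1: "ln (zm \<mu> m0 n0 (- c)) \<le> c * (pp + e / 2) * real L"
      using zm_pos[OF \<mu>, of "- c" m0 n0] c \<mu> by (subst (asm) ln_le_cancel_iff[symmetric]) auto
    have "Z0 \<le> zm \<mu> m0 n0 (- c) powr ((2 * a / real K) / c)"
      unfolding Z0_def using a K Kc c by (intro zm_Lyapunov[OF \<mu>]) auto
    then have "ln Z0 \<le> ln (zm \<mu> m0 n0 (- c) powr ((2 * a / real K) / c))"
      using Z0p by (subst ln_le_cancel_iff) auto
    also have "\<dots> = (2 * a / real K) / c * ln (zm \<mu> m0 n0 (- c))"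
      using zm_pos[OF \<mu>, of "- c" m0 n0] c \<mu> by (simp add: ln_powr)
    also have "\<dots> \<le> (2 * a / real K) / c * (c * (pp + e / 2) * real L)"
      using a K c by (intro mult_left_mono 1) auto
    also have "\<dots> = (2 * a / real K) * ((pp + e / 2) * real L)" using c by simp
    finally show ?thesis .
  qed
  \<comment> \<open>Reserves room for the axis segments of all K tubes and for the rounding in both
    directions.\<close>
  define Q0 where "Q0 = nat \<lceil>(real (K * M0) + 1) / s\<rceil> + nat \<lceil>1 / t\<rceil>"
  have Q0: "real Q0 * s \<ge> real (K * M0) + 1" "real Q0 * t \<ge> 1"
  proof -
    have "real Q0 \<ge> (real (K * M0) + 1) / s" "real Q0 \<ge> 1 / t" unfolding Q0_def by linarith+
    then show "real Q0 * s \<ge> real (K * M0) + 1" "real Q0 * t \<ge> 1" using st by (simp_all add: field_simps)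
  qed
  define J where "J = \<bar>pp + e / 2\<bar>"
  \<comment> \<open>Everything that does not grow with N.\<close>
  define con where "con = a * J * (real Q0 + real L) + (ln (real K) + real (K * M0) * H) / 4 + (ln (real K) + (s + t) * (real Q0 + real L) * H) / 4"
  have step: "ln (zm \<mu> (fl N s) (fl N t) (- a)) \<le> a * real N * (pp + e / 2) + con + a * e / 4 * real N" if N: "N \<ge> Q0" for N
  proof -
    define q where "q = (N - Q0) div L"
    define m n where "m = fl N s" and "n = fl N t"
    have q1: "real q * real L \<le> real N - real Q0"
    proof -
      have "q * L \<le> N - Q0" by (simp add: q_def)
      then have "real (q * L) \<le> real (N - Q0)" by (rule of_nat_mono)
      then show ?thesis using N by (simp add: of_nat_diff)
    qed
    have q2: "real N - real q * real L \<le> real Q0 + real L"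
    proof -
      have "N - Q0 < (q + 1) * L" using L0 dividend_less_div_times[of L "N - Q0"] by (simp add: q_def algebra_simps)
      then have "real (N - Q0) \<le> real ((q + 1) * L)" by (simp only: of_nat_le_iff)
      then show ?thesis using N by (simp add: of_nat_diff algebra_simps)
    qed
    have b: "real m \<le> real N * s" "real N * s - 1 \<le> real m" "real n \<le> real N * t" "real N * t - 1 \<le> real n"
      unfolding m_def n_def using fl_bounds st by auto
    have qm: "real q * real m0 \<le> (real N - real Q0) * s"
    proof -
      have "real q * real m0 \<le> real q * (real L * s)" by (intro mult_left_mono mb) simp
      also have "\<dots> \<le> (real N - real Q0) * s" using mult_right_mono[OF q1, of s] st by (simp add: mult.assoc)
      finally show ?thesis .
    qed
    have qn: "real q * real n0 \<le> (real N - real Q0) * t"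
    proof -
      have "real q * real n0 \<le> real q * (real L * t)" by (intro mult_left_mono mb) simp
      also have "\<dots> \<le> (real N - real Q0) * t" using mult_right_mono[OF q1, of t] st by (simp add: mult.assoc)
      finally show ?thesis .
    qed
    have "real (K * M0 + q * m0) \<le> real m" using qm Q0 b by (simp add: algebra_simps)
    then have h1: "K * (2 * m0 + 1) + q * m0 \<le> m" unfolding M0_def by (simp only: of_nat_le_iff)
    have "real (q * n0) \<le> real n" using qn Q0 b by (simp add: algebra_simps)
    then have h2: "q * n0 \<le> n" by (simp only: of_nat_le_iff)
    define r where "r = m + n - q * (m0 + n0)"
    have "zm \<mu> m n (- a) \<le> (Z0 ^ (K * q)) powr (1/2) * (real K * exp (real (K * M0) * H)) powr (1/4) * (real K * exp (real r * H)) powr (1/4)"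
      unfolding Z0_def M0_def H_def r_def by (rule Zmom_tubes[OF \<mu> a K n0 h1 h2])
    then have "ln (zm \<mu> m n (- a)) \<le> ln ((Z0 ^ (K * q)) powr (1/2) * (real K * exp (real (K * M0) * H)) powr (1/4) * (real K * exp (real r * H)) powr (1/4))"
      using zm_pos[OF \<mu>, of "- a" m n] a \<mu> Z0p K by (subst ln_le_cancel_iff) auto
    also have "\<dots> = real (K * q) * ln Z0 / 2 + (ln (real K) + real (K * M0) * H) / 4 + (ln (real K) + real r * H) / 4"
      using Z0p K by (simp add: ln_mult ln_powr ln_realpow)
    also have "\<dots> \<le> a * real q * real L * (pp + e / 2) + (ln (real K) + real (K * M0) * H) / 4 + (ln (real K) + real r * H) / 4"
    proof -
      have "real (K * q) * ln Z0 \<le> real (K * q) * ((2 * a / real K) * ((pp + e / 2) * real L))"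
        by (intro mult_left_mono lnZ0) simp
      also have "\<dots> = 2 * (a * real q * real L * (pp + e / 2))" using K by simp
      finally show ?thesis by simp
    qed
    also have "\<dots> \<le> a * real N * (pp + e / 2) + con + a * e / 4 * real N"
    proof -
      have "(real q * real L - real N) * (pp + e / 2) \<le> \<bar>real q * real L - real N\<bar> * J"
        unfolding J_def abs_mult[symmetric] by (rule abs_ge_self)
      also have "\<dots> \<le> (real Q0 + real L) * J" using q1 q2 by (intro mult_right_mono) (auto simp: J_def)
      finally have "a * ((real q * real L - real N) * (pp + e / 2)) \<le> a * ((real Q0 + real L) * J)"
        using a by (intro mult_left_mono) auto
      then have 1: "a * real q * real L * (pp + e / 2) \<le> a * real N * (pp + e / 2) + a * J * (real Q0 + real L)"
        by (simp add: algebra_simps)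
      have qle: "real q \<le> real N / real L" using q1 L0 by (simp add: field_simps)
      have "real r = real m + real n - real q * (real m0 + real n0)"
        unfolding r_def using h1 h2 by (subst of_nat_diff) (auto simp: distrib_left)
      also have "\<dots> \<le> (s + t) * (real N - real q * real L) + 2 * real q"
      proof -
        have "real q * (real L * s - 1 + (real L * t - 1)) \<le> real q * (real m0 + real n0)"
          using mb by (intro mult_left_mono add_mono) auto
        then show ?thesis using b by (simp add: algebra_simps)
      qed
      also have "\<dots> \<le> (s + t) * (real Q0 + real L) + 2 * (real N / real L)"
        using q2 st qle by (intro add_mono mult_left_mono) auto
      finally have "real r * H \<le> ((s + t) * (real Q0 + real L) + 2 * (real N / real L)) * H"
        using H by (intro mult_right_mono)
      also have "\<dots> \<le> (s + t) * (real Q0 + real L) * H + a * e * real N"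
      proof -
        have "2 * H / real L \<le> a * e" using L(3,4) a e by (simp add: field_simps)
        then have "real N * (2 * H / real L) \<le> real N * (a * e)" by (intro mult_left_mono) auto
        then show ?thesis by (simp add: algebra_simps)
      qed
      finally have "real r * H \<le> (s + t) * (real Q0 + real L) * H + a * e * real N" .
      with 1 show ?thesis unfolding con_def by (simp add: field_simps)
    qed
    finally show ?thesis unfolding m_def n_def .
  qed
  have "\<forall>\<^sub>F N in sequentially. real N \<ge> max (real Q0) (con / (a * e / 4))"
    by (rule eventually_real_ge)
  then show ?thesis
  proof eventually_elim
    case (elim N)
    then have "con \<le> a * e / 4 * real N" using a e by (simp add: field_simps)
    moreover have "ln (zm \<mu> (fl N s) (fl N t) (- a)) \<le> a * real N * (pp + e / 2) + con + a * e / 4 * real N"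
      using elim by (intro step) simp
    ultimately show ?case by (simp add: algebra_simps)
  qed
qed

section \<open>The limiting logarithmic moment generating function\<close>

lemma inf_gamma_mgf_eq:
  assumes "0 \<le> \<xi>"
  shows "inf_gamma_mgf \<mu> s t \<xi> = (INF \<theta>\<in>{\<xi><..<\<mu>}. ereal (t * al \<xi> \<theta> + s * be \<mu> \<xi> \<theta>))"
  unfolding inf_gamma_mgf_def
  by (rule INF_cong) (use assms in \<open>auto simp: log_gamma_mgf_def al_def be_def lgm_def algebra_simps\<close>)

lemma fl_tendsto: "s \<ge> 0 \<Longrightarrow> (\<lambda>N. real (fl N s) / real N) \<longlonglongrightarrow> s"
proof (rule real_tendsto_sandwich)
  assume s: "s \<ge> 0"
  show "\<forall>\<^sub>F N in sequentially. s - 1 / real N \<le> real (fl N s) / real N"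
    using eventually_gt_at_top[of 0]
  proof eventually_elim
    case (elim N)
    then show ?case using divide_right_mono[OF fl_bounds(2)[OF s, of N], of "real N"] by (simp add: diff_divide_distrib)
  qed
  show "\<forall>\<^sub>F N in sequentially. real (fl N s) / real N \<le> s"
    using eventually_gt_at_top[of 0] by eventually_elim (use fl_bounds[OF s] in \<open>auto simp: field_simps\<close>)
  show "(\<lambda>N. s - 1 / real N) \<longlonglongrightarrow> s" by real_asymp
qed simp

text \<open>\<open>ln_Gamma x\<close> is \<open>ln_Gamma (x + 1)\<close> minus \<open>ln x\<close>,
  and the first term stays finite at x = 0.\<close>

lemma lgm_at_top:
  assumes "\<mu> > 0"
  shows "filterlim (lgm \<mu>) at_top (at_left \<mu>)"
proof -
  have 1: "filterlim (\<lambda>x. ln_Gamma (x + 1) - ln x) at_top (at_right (0::real))"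
  proof -
    have "((\<lambda>x::real. ln_Gamma (x + 1)) \<longlongrightarrow> ln_Gamma (0 + 1)) (at_right 0)"
    proof -
      have "isCont (\<lambda>x::real. ln_Gamma (x + 1)) 0"
        by (rule DERIV_isCont) (auto intro!: derivative_eq_intros)
      then show ?thesis unfolding isCont_def by (rule tendsto_mono[OF at_le[OF subset_UNIV]])
    qed
    moreover have "filterlim (\<lambda>x::real. - ln x) at_top (at_right 0)" by real_asymp
    ultimately show ?thesis using filterlim_tendsto_add_at_top by fastforce
  qed
  have 2: "filterlim (\<lambda>x. \<mu> - x) (at_right 0) (at_left \<mu>)"
  proof -
    have "((\<lambda>x. \<mu> - x) \<longlongrightarrow> \<mu> - \<mu>) (at_left \<mu>)" by (intro tendsto_intros)
    then show ?thesis by (auto simp: filterlim_at eventually_at_filter)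
  qed
  have "filterlim (\<lambda>x. - ln_Gamma \<mu> + (ln_Gamma (\<mu> - x + 1) - ln (\<mu> - x))) at_top (at_left \<mu>)"
    by (rule filterlim_tendsto_add_at_top[OF tendsto_const filterlim_compose[OF 1 2]])
  moreover have "\<forall>\<^sub>F x in at_left \<mu>. - ln_Gamma \<mu> + (ln_Gamma (\<mu> - x + 1) - ln (\<mu> - x)) = lgm \<mu> x"
  proof -
    have "\<forall>\<^sub>F x in at_left \<mu>. x < \<mu>" by (simp add: eventually_at_filter)
    then show ?thesis
    proof eventually_elim
      case (elim x)
      then have "ln_Gamma (\<mu> - x + 1) = ln_Gamma (\<mu> - x) + ln (\<mu> - x)"
        by (simp add: ln_Gamma_real_pos Gamma_plus1 ln_mult pos_not_nonpos_Int Gamma_eq_zero_iff)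
      then show ?case using elim assms by (simp add: lgm_altdef)
    qed
  qed
  ultimately show ?thesis by (rule filterlim_cong[OF refl refl, THEN iffD1, rotated])
qed

section \<open>Limits of the normalised logarithmic moments\<close>

locale polymer_limit =
  fixes \<mu> s t \<theta> :: real
  assumes s: "s > 0" and t: "t > 0" and \<theta>: "0 < \<theta>" "\<theta> < \<mu>"
    and crit: "- t * Polygamma 1 \<theta> + s * Polygamma 1 (\<mu> - \<theta>) = 0"
begin

text \<open>The value of - t Digamma - s Digamma at the critical \<theta>, a candidate that
  \<open>free_energy_eq\<close> identifies with the free energy.\<close>

definition p :: real where "p = - (t * Digamma \<theta> + s * Digamma (\<mu> - \<theta>))"

definition LN :: "nat \<Rightarrow> real \<Rightarrow> real" where
  "LN N \<xi> = ln (zm \<mu> (fl N s) (fl N t) \<xi>) / real N"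

definition F :: "real \<Rightarrow> real" where "F \<xi> = real_of_ereal (inf_gamma_mgf \<mu> s t \<xi>)"

lemma \<mu>: "\<mu> > 0" using \<theta> by simp

lemma LN_0: "LN N 0 = 0" by (simp add: LN_def zm_0 \<mu>)

lemma LN_convex:
  assumes "\<xi>1 < \<mu>" "\<xi>2 < \<mu>" "0 \<le> u" "0 \<le> v" "u + v = 1"
  shows "LN N (u * \<xi>1 + v * \<xi>2) \<le> u * LN N \<xi>1 + v * LN N \<xi>2"
proof -
  let ?z = "zm \<mu> (fl N s) (fl N t)"
  have x: "u * \<xi>1 + v * \<xi>2 < \<mu>"
    using convex_bound_lt[OF assms(1,2) assms(3-5)] .
  have "ln (?z (u * \<xi>1 + v * \<xi>2)) \<le> ln (?z \<xi>1 powr u * ?z \<xi>2 powr v)"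
    using zm_pos[OF \<mu> assms(1), of "fl N s" "fl N t"] zm_pos[OF \<mu> assms(2), of "fl N s" "fl N t"]
      zm_pos[OF \<mu> x, of "fl N s" "fl N t"] zm_logconvex[OF \<mu> assms, of "fl N s" "fl N t"]
    by (subst ln_le_cancel_iff) auto
  also have "\<dots> = u * ln (?z \<xi>1) + v * ln (?z \<xi>2)"
    using zm_pos[OF \<mu> assms(1), of "fl N s" "fl N t"] zm_pos[OF \<mu> assms(2), of "fl N s" "fl N t"] by (simp add: ln_mult ln_powr)
  finally have "ln (?z (u * \<xi>1 + v * \<xi>2)) \<le> u * ln (?z \<xi>1) + v * ln (?z \<xi>2)" .
  from divide_right_mono[OF this, of "real N"] show ?thesis by (simp add: LN_def add_divide_distrib)
qed

lemma LN_upper: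
  assumes "0 \<le> \<xi>" "\<xi> < \<eta>" "\<eta> < \<mu>" "e > 0"
  shows "\<forall>\<^sub>F N in sequentially. LN N \<xi> \<le> t * al \<xi> \<eta> + s * be \<mu> \<xi> \<eta> + e"
proof -
  obtain C where C: "C > 0" and le: "\<And>m n. Zmom \<mu> m n \<xi> \<le> ennreal (C * exp (real n * al \<xi> \<eta> + real m * be \<mu> \<xi> \<eta>))"
    using Zmom_upper[OF assms(1-3)] by auto
  have "(\<lambda>N. ln C / real N + real (fl N t) / real N * al \<xi> \<eta> + real (fl N s) / real N * be \<mu> \<xi> \<eta>) \<longlonglongrightarrow>
    0 + t * al \<xi> \<eta> + s * be \<mu> \<xi> \<eta>"
    using s t by (intro tendsto_intros fl_tendsto lim_const_over_n) auto
  then have "\<forall>\<^sub>F N in sequentially. ln C / real N + real (fl N t) / real N * al \<xi> \<eta> + real (fl N s) / real N * be \<mu> \<xi> \<eta> <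
     t * al \<xi> \<eta> + s * be \<mu> \<xi> \<eta> + e"
    by (rule order_tendstoD) (use assms in simp)
  then show ?thesis using eventually_gt_at_top[of 0]
  proof eventually_elim
    case (elim N)
    let ?z = "zm \<mu> (fl N s) (fl N t) \<xi>"
    have "?z \<le> C * exp (real (fl N t) * al \<xi> \<eta> + real (fl N s) * be \<mu> \<xi> \<eta>)"
      using le[of "fl N s" "fl N t"] assms C by (simp add: Zmom_zm \<mu>)
    then have "ln ?z \<le> ln (C * exp (real (fl N t) * al \<xi> \<eta> + real (fl N s) * be \<mu> \<xi> \<eta>))"
      using zm_pos[OF \<mu>] assms C by (subst ln_le_cancel_iff) auto
    also have "\<dots> = ln C + real (fl N t) * al \<xi> \<eta> + real (fl N s) * be \<mu> \<xi> \<eta>"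
      using C by (simp add: ln_mult)
    finally have "LN N \<xi> \<le> (ln C + real (fl N t) * al \<xi> \<eta> + real (fl N s) * be \<mu> \<xi> \<eta>) / real N"
      unfolding LN_def by (rule divide_right_mono) simp
    with elim show ?case by (simp add: add_divide_distrib)
  qed
qed

text \<open>The upper bound holds for each \<eta>, the lower bound at the critical one. Comparing
  both with the limit shows that the critical value is the minimum, so the infimum is attained
  there.\<close>

lemma LN_tendsto_pos:
  assumes \<xi>: "0 < \<xi>" "\<xi> < \<mu>"
  shows "(\<lambda>N. LN N \<xi>) \<longlonglongrightarrow> F \<xi>" "inf_gamma_mgf \<mu> s t \<xi> = ereal (F \<xi>)"
proof -
  obtain \<eta> where \<eta>: "\<xi> < \<eta>" "\<eta> < \<mu>"
    and cr: "t * (Digamma (\<eta> - \<xi>) - Digamma \<eta>) + s * (Digamma (\<mu> - \<eta> + \<xi>) - Digamma (\<mu> - \<eta>)) = 0"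
    using critical_point[OF \<xi> s t] by blast
  let ?v = "\<lambda>\<eta>. t * al \<xi> \<eta> + s * be \<mu> \<xi> \<eta>"
  have lower: "\<forall>\<^sub>F N in sequentially. ?v \<eta> - e \<le> LN N \<xi>" if "e > 0" for e
    using Zmom_lower[OF \<xi>(1) \<eta> s t cr that] eventually_gt_at_top[of 0]
  proof eventually_elim
    case (elim N)
    then have "exp (real N * (?v \<eta> - e)) \<le> zm \<mu> (fl N s) (fl N t) \<xi>"
      using zm_pos[OF \<mu> \<xi>(2), THEN less_imp_le] by (simp add: Zmom_zm \<mu> \<xi>)
    then have "real N * (?v \<eta> - e) \<le> ln (zm \<mu> (fl N s) (fl N t) \<xi>)"
      using zm_pos[OF \<mu> \<xi>(2)] by (simp add: ln_ge_iff)
    then show ?case using elim unfolding LN_def by (simp add: field_simps)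
  qed
  have lim: "(\<lambda>N. LN N \<xi>) \<longlonglongrightarrow> ?v \<eta>"
  proof (rule order_tendstoI)
    fix a assume "a < ?v \<eta>"
    then have "(?v \<eta> - a) / 2 > 0" by simp
    from lower[OF this] show "\<forall>\<^sub>F N in sequentially. a < LN N \<xi>"
      by eventually_elim (use \<open>a < ?v \<eta>\<close> in \<open>simp add: field_simps\<close>)
  next
    fix a assume "a > ?v \<eta>"
    then have "(a - ?v \<eta>) / 2 > 0" by simp
    from LN_upper[OF less_imp_le[OF \<xi>(1)] \<eta> this] show "\<forall>\<^sub>F N in sequentially. a > LN N \<xi>"
      by eventually_elim (use \<open>a > ?v \<eta>\<close> in \<open>simp add: field_simps\<close>)
  qed
  have min: "?v \<eta> \<le> ?v \<eta>'" if "\<xi> < \<eta>'" "\<eta>' < \<mu>" for \<eta>'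
  proof (rule field_le_epsilon)
    fix e :: real assume "e > 0"
    from LN_upper[OF less_imp_le[OF \<xi>(1)] that this] show "?v \<eta> \<le> ?v \<eta>' + e"
      by (intro tendsto_upperbound[OF lim]) auto
  qed
  have "inf_gamma_mgf \<mu> s t \<xi> = ereal (?v \<eta>)"
    unfolding inf_gamma_mgf_eq[OF less_imp_le[OF \<xi>(1)]]
    by (rule INF_eqI) (use min \<eta> in auto)
  then show "inf_gamma_mgf \<mu> s t \<xi> = ereal (F \<xi>)" "(\<lambda>N. LN N \<xi>) \<longlonglongrightarrow> F \<xi>"
    using lim by (simp_all add: F_def)
qed

lemma inf_gamma_mgf_0: "inf_gamma_mgf \<mu> s t 0 = 0"
proof -
  have "{0<..<\<mu>} \<noteq> {}" using \<theta> by auto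
  then show ?thesis by (simp add: inf_gamma_mgf_eq al_def be_def zero_ereal_def[symmetric])
qed

lemma F_0: "F 0 = 0" by (simp add: F_def inf_gamma_mgf_0)

lemma LN_tendsto: "0 \<le> \<xi> \<Longrightarrow> \<xi> < \<mu> \<Longrightarrow> (\<lambda>N. LN N \<xi>) \<longlonglongrightarrow> F \<xi>"
  using LN_tendsto_pos[of \<xi>] by (cases "\<xi> = 0") (auto simp: LN_0 F_0)

lemma inf_gamma_mgf_F: "0 \<le> \<xi> \<Longrightarrow> \<xi> < \<mu> \<Longrightarrow> inf_gamma_mgf \<mu> s t \<xi> = ereal (F \<xi>)"
  using LN_tendsto_pos[of \<xi>] by (cases "\<xi> = 0") (auto simp: F_0 inf_gamma_mgf_0 zero_ereal_def)

lemma F_le: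
  assumes "0 \<le> \<xi>" "\<xi> < \<eta>" "\<eta> < \<mu>"
  shows "F \<xi> \<le> t * al \<xi> \<eta> + s * be \<mu> \<xi> \<eta>"
proof -
  have "ereal (F \<xi>) \<le> ereal (t * al \<xi> \<eta> + s * be \<mu> \<xi> \<eta>)"
    unfolding inf_gamma_mgf_F[OF assms(1) less_trans[OF assms(2,3)], symmetric] inf_gamma_mgf_eq[OF assms(1)]
    by (rule INF_lower) (use assms in simp)
  then show ?thesis by simp
qed

lemma F_convex:
  assumes "0 \<le> \<xi>1" "0 \<le> \<xi>2" "\<xi>1 < \<mu>" "\<xi>2 < \<mu>" "0 \<le> u" "0 \<le> v" "u + v = 1"
  shows "F (u * \<xi>1 + v * \<xi>2) \<le> u * F \<xi>1 + v * F \<xi>2"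
proof (rule LIMSEQ_le)
  show "(\<lambda>N. LN N (u * \<xi>1 + v * \<xi>2)) \<longlonglongrightarrow> F (u * \<xi>1 + v * \<xi>2)"
    using assms by (intro LN_tendsto convex_bound_lt) auto
  show "(\<lambda>N. u * LN N \<xi>1 + v * LN N \<xi>2) \<longlonglongrightarrow> u * F \<xi>1 + v * F \<xi>2"
    using assms by (intro tendsto_intros LN_tendsto)
qed (use LN_convex[OF assms(3-7)] in blast)

lemma LN_neg_upper:
  assumes "a > 0" "e > 0"
  shows "\<forall>\<^sub>F N in sequentially. LN N (- a) \<le> - a * p + e"
proof -
  have "e / a > 0" using assms by simp
  from zm_neg_upper[OF s t \<theta> crit assms(1) this] eventually_gt_at_top[of 0] show ?thesis
  proof eventually_elim
    case (elim N)
    then have "LN N (- a) \<le> (a * real N * (t * Digamma \<theta> + s * Digamma (\<mu> - \<theta>) + e / a)) / real N"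
      unfolding LN_def by (intro divide_right_mono) auto
    also have "\<dots> = - a * p + e" using elim assms by (simp add: p_def field_simps)
    finally show ?case .
  qed
qed

text \<open>0 is a convex combination of \<xi> and - a, and \<open>LN N 0 = 0\<close>. This trades
  upper bounds on one side of 0 for lower bounds on the other.\<close>

lemma LN_convex_0:
  assumes "0 < \<xi>" "\<xi> < \<mu>" "a > 0"
  shows "0 \<le> a * LN N \<xi> + \<xi> * LN N (- a)"
proof -
  have "LN N (a / (a + \<xi>) * \<xi> + \<xi> / (a + \<xi>) * - a) \<le> a / (a + \<xi>) * LN N \<xi> + \<xi> / (a + \<xi>) * LN N (- a)"
    using assms \<mu> by (intro LN_convex) (auto simp: add_divide_distrib[symmetric])
  also have "a / (a + \<xi>) * \<xi> + \<xi> / (a + \<xi>) * - a = 0" by simp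
  finally have "0 \<le> (a * LN N \<xi> + \<xi> * LN N (- a)) / (a + \<xi>)"
    by (simp add: LN_0 add_divide_distrib)
  then show ?thesis using assms by (simp add: zero_le_divide_iff)
qed

text \<open>By \<open>LN_convex_0\<close> the upper bound for the moment of order - 1 becomes a
  lower bound at \<xi>.\<close>

lemma F_ge:
  assumes "0 \<le> \<xi>" "\<xi> < \<mu>"
  shows "p * \<xi> \<le> F \<xi>"
proof (cases "\<xi> = 0")
  case False
  then have \<xi>: "\<xi> > 0" using assms by simp
  show ?thesis
  proof (rule field_le_epsilon)
    fix e :: real assume e: "e > 0"
    then have "e / \<xi> > 0" using \<xi> by simp
    from LN_neg_upper[OF zero_less_one this]
    have "\<forall>\<^sub>F N in sequentially. p * \<xi> - e \<le> LN N \<xi>"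
    proof eventually_elim
      case (elim N)
      have "\<xi> * LN N (- 1) \<le> \<xi> * (- 1 * p + e / \<xi>)" using elim \<xi> by (intro mult_left_mono) auto
      also have "\<dots> = - p * \<xi> + e" using \<xi> by (simp add: field_simps)
      finally show ?case using LN_convex_0[OF \<xi> assms(2) zero_less_one, of N] by simp
    qed
    then have "p * \<xi> - e \<le> F \<xi>"
      by (intro tendsto_lowerbound[OF LN_tendsto[OF assms]]) auto
    then show "p * \<xi> \<le> F \<xi> + e" by simp
  qed
qed (simp add: F_0)

text \<open>Inserting the critical \<theta> of order 0 into the infimum gives an upper bound whose
  slope at 0 is p.\<close>

lemma F_slope:
  assumes "e > 0"
  obtains \<xi> where "0 < \<xi>" "\<xi> < \<mu>" "F \<xi> \<le> (p + e) * \<xi>"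
proof -
  have "((\<lambda>x. t * (lgm \<theta> x / x) - s * (lgm (\<mu> - \<theta>) (- 1 * x) / x)) \<longlongrightarrow> t * - Digamma \<theta> - s * (- (- 1) * Digamma (\<mu> - \<theta>))) (at_right 0)"
    using \<theta> by (intro tendsto_intros lgm_slope_right lgm_slope_scaled) auto
  then have "\<forall>\<^sub>F x in at_right 0. t * (lgm \<theta> x / x) - s * (lgm (\<mu> - \<theta>) (- 1 * x) / x) < p + e"
    by (rule order_tendstoD) (use assms in \<open>simp add: p_def\<close>)
  moreover have "\<forall>\<^sub>F x in at_right 0. x \<in> {0<..<\<theta>}" using \<theta> by (intro eventually_at_right_real)
  ultimately have "\<forall>\<^sub>F x in at_right 0. 0 < x \<and> x < \<mu> \<and> F x \<le> (p + e) * x"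
  proof eventually_elim
    case (elim x)
    then have "F x \<le> t * al x \<theta> + s * be \<mu> x \<theta>" using \<theta> by (intro F_le) auto
    also have "\<dots> = (t * (lgm \<theta> x / x) - s * (lgm (\<mu> - \<theta>) (- 1 * x) / x)) * x"
      using elim by (simp add: al_def be_def field_simps)
    also have "\<dots> \<le> (p + e) * x" using elim by (intro mult_right_mono) auto
    finally show ?case using elim \<theta> by auto
  qed
  then obtain x where "0 < x \<and> x < \<mu> \<and> F x \<le> (p + e) * x"
    using eventually_happens'[OF trivial_limit_at_right_real] by blast
  then show ?thesis using that by blast
qed

lemma LN_tendsto_neg:
  assumes "\<xi> < 0"
  shows "(\<lambda>N. LN N \<xi>) \<longlonglongrightarrow> p * \<xi>"
proof (rule order_tendstoI)
  define a where "a = - \<xi>"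
  have a: "a > 0" "\<xi> = - a" using assms by (auto simp: a_def)
  fix b assume b: "b < p * \<xi>"
  \<comment> \<open>Makes a (p + 2 e) equal to - b: one e is spent in \<open>F_slope\<close>, the
    other on the convergence of LN at x.\<close>
  define e where "e = (p * \<xi> - b) / (2 * a)"
  have e: "e > 0" using a b by (simp add: e_def)
  obtain x where x: "0 < x" "x < \<mu>" "F x \<le> (p + e) * x" using F_slope[OF e] .
  have "\<forall>\<^sub>F N in sequentially. LN N x < (p + 2 * e) * x"
    by (rule order_tendstoD[OF LN_tendsto]) (use x e in \<open>auto intro: le_less_trans[OF x(3)]\<close>)
  then show "\<forall>\<^sub>F N in sequentially. b < LN N \<xi>"
  proof eventually_elim
    case (elim N)
    have "a * LN N x < a * ((p + 2 * e) * x)" using elim a by simp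
    with LN_convex_0[OF x(1,2) a(1), of N] have "0 < x * (a * (p + 2 * e) + LN N \<xi>)"
      using a by (simp add: algebra_simps)
    then have "0 < a * (p + 2 * e) + LN N \<xi>" using x by (simp add: zero_less_mult_iff)
    moreover have "a * (p + 2 * e) = - b" using a by (simp add: e_def field_simps)
    ultimately show ?case by simp
  qed
next
  fix b assume b: "b > p * \<xi>"
  have "- \<xi> > 0" "(b - p * \<xi>) / 2 > 0" using assms b by auto
  from LN_neg_upper[OF this] show "\<forall>\<^sub>F N in sequentially. b > LN N \<xi>"
    by eventually_elim (use b in \<open>simp add: field_simps\<close>)
qed

text \<open>The rate of a single path; it forces F to blow up at \<mu>.\<close>

lemma F_lgm:
  assumes "0 \<le> \<xi>" "\<xi> < \<mu>"
  shows "(s + t) * lgm \<mu> \<xi> \<le> F \<xi>"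
proof (rule LIMSEQ_le)
  show "(\<lambda>N. LN N \<xi>) \<longlonglongrightarrow> F \<xi>" by (rule LN_tendsto[OF assms])
  show "(\<lambda>N. (real (fl N s) / real N + real (fl N t) / real N) * lgm \<mu> \<xi>) \<longlonglongrightarrow> (s + t) * lgm \<mu> \<xi>"
    using s t by (intro tendsto_intros fl_tendsto) auto
  have "(real (fl N s) / real N + real (fl N t) / real N) * lgm \<mu> \<xi> \<le> LN N \<xi>" for N
  proof -
    have "exp (real (fl N s + fl N t) * lgm \<mu> \<xi>) \<le> zm \<mu> (fl N s) (fl N t) \<xi>"
      using Zmom_path_lower[OF \<mu> assms, of "fl N s" "fl N t"] zm_pos[OF \<mu> assms(2), THEN less_imp_le]
      by (simp add: Zmom_zm \<mu> assms)
    then have "real (fl N s + fl N t) * lgm \<mu> \<xi> \<le> ln (zm \<mu> (fl N s) (fl N t) \<xi>)"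
      using zm_pos[OF \<mu> assms(2)] by (simp add: ln_ge_iff)
    from divide_right_mono[OF this, of "real N"] show ?thesis by (simp add: LN_def add_divide_distrib[symmetric])
  qed
  then show "\<exists>N. \<forall>n\<ge>N. (real (fl n s) / real n + real (fl n t) / real n) * lgm \<mu> \<xi> \<le> LN n \<xi>" by blast
qed

lemma F_at_top: "filterlim F at_top (at_left \<mu>)"
proof (rule filterlim_at_top_mono)
  show "filterlim (\<lambda>\<xi>. (s + t) * lgm \<mu> \<xi>) at_top (at_left \<mu>)"
    using s t \<mu> by (intro filterlim_tendsto_pos_mult_at_top[OF tendsto_const] lgm_at_top) auto
  have "\<forall>\<^sub>F x in at_left \<mu>. x \<in> {0<..<\<mu>}" using \<mu> by (intro eventually_at_left_real)
  then show "\<forall>\<^sub>F \<xi> in at_left \<mu>. (s + t) * lgm \<mu> \<xi> \<le> F \<xi>"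
    by eventually_elim (auto intro: F_lgm)
qed

end

section \<open>Convex dual of the rate function\<close>

context polymer_limit begin

definition rate :: "real \<Rightarrow> ereal" where
  "rate r = (if p \<le> r then SUP \<xi> \<in> {0..<\<mu>}. ereal (r * \<xi>) - inf_gamma_mgf \<mu> s t \<xi> else \<infinity>)"

lemma rate_ge: "0 \<le> y \<Longrightarrow> y < \<mu> \<Longrightarrow> ereal (r * y - F y) \<le> rate r"
proof -
  assume y: "0 \<le> y" "y < \<mu>"
  then have "ereal (r * y) - inf_gamma_mgf \<mu> s t y \<le> (SUP \<xi> \<in> {0..<\<mu>}. ereal (r * \<xi>) - inf_gamma_mgf \<mu> s t \<xi>)"
    by (intro SUP_upper) auto
  then show ?thesis using y by (simp add: rate_def inf_gamma_mgf_F)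
qed

lemma rate_le: "p \<le> r \<Longrightarrow> (\<And>y. 0 \<le> y \<Longrightarrow> y < \<mu> \<Longrightarrow> r * y - F y \<le> c) \<Longrightarrow> rate r \<le> ereal c"
  unfolding rate_def by (auto intro!: SUP_least simp: inf_gamma_mgf_F)

lemma rate_eq_top: "r < p \<Longrightarrow> rate r = \<infinity>"
  by (simp add: rate_def)

text \<open>At y = 0 the slope p works by \<open>F_ge\<close>. At y > 0 the supporting line tested
  at z = 0 gives F y <= r y, and F y >= p y then yields r >= p, so that r is a point where the rate
  is given by the supremum.\<close>

lemma subgradient:
  assumes y: "0 \<le> y" "y < \<mu>"
  obtains r where "p \<le> r" "F y \<le> r * y" "\<And>z. 0 \<le> z \<Longrightarrow> z < \<mu> \<Longrightarrow> F y + r * (z - y) \<le> F z"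
proof (cases "y = 0")
  case True
  then show ?thesis using that[of p] F_ge by (simp add: F_0)
next
  case False
  then have y0: "y > 0" using y by simp
  have "convex_on {0..<\<mu>} F"
    by (rule convex_onI) (auto intro!: F_convex)
  moreover have "y \<in> interior {0..<\<mu>}" using y0 y by simp
  ultimately obtain r where r: "\<And>z. z \<in> {0..<\<mu>} \<Longrightarrow> F z \<ge> F y + r * (z - y)"
    using convex_le_Inf_differential by blast
  have 1: "F y \<le> r * y" using r[of 0] \<mu> by (simp add: F_0)
  then have "p * y \<le> r * y" using F_ge[OF y] by simp
  then have "p \<le> r" using y0 by simp
  then show ?thesis using that r 1 by simp
qed

text \<open>A supporting line at y bounds the rate at its slope r by r y - F y, and this one r
  bounds the dual at every x. The choices y = 0, y = x and y near \<mu> serve the three ranges of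
  x.\<close>

lemma dual_rate_ge:
  assumes "p \<le> r" and sub: "\<And>z. 0 \<le> z \<Longrightarrow> z < \<mu> \<Longrightarrow> F y + r * (z - y) \<le> F z"
  shows "ereal (F y + r * (x - y)) \<le> convex_dual rate x"
proof -
  have "rate r \<le> ereal (r * y - F y)"
    using assms(1) by (rule rate_le) (use sub in \<open>force simp: algebra_simps\<close>)
  then have "ereal (r * x) - ereal (r * y - F y) \<le> ereal (r * x) - rate r"
    by (rule ereal_minus_mono[OF order_refl])
  also have "\<dots> \<le> convex_dual rate x" unfolding convex_dual_def by (rule SUP_upper) simp
  finally show ?thesis by (simp add: algebra_simps)
qed

lemma dual_rate_le:
  assumes "\<And>r. p \<le> r \<Longrightarrow> ereal (r * x) - rate r \<le> c"
  shows "convex_dual rate x \<le> c"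
  unfolding convex_dual_def
proof (rule SUP_least)
  fix r show "ereal (r * x) - rate r \<le> c"
    by (cases "p \<le> r") (simp_all add: assms rate_eq_top)
qed

lemma dual_rate_neg:
  assumes "x < 0"
  shows "convex_dual rate x = ereal (p * x)"
proof (rule antisym)
  show "convex_dual rate x \<le> ereal (p * x)"
  proof (rule dual_rate_le)
    fix r assume r: "p \<le> r"
    have "0 \<le> rate r" using rate_ge[of 0 r] \<mu> by (simp add: F_0 zero_ereal_def)
    then have "ereal (r * x) - rate r \<le> ereal (r * x) - 0" by (rule ereal_minus_mono[OF order_refl])
    also have "\<dots> \<le> ereal (p * x)" using r assms by (simp add: mult_right_mono_neg)
    finally show "ereal (r * x) - rate r \<le> ereal (p * x)" .
  qed
  show "ereal (p * x) \<le> convex_dual rate x"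
    using dual_rate_ge[of p 0 x] F_ge by (simp add: F_0)
qed

lemma dual_rate_mid:
  assumes "0 \<le> x" "x < \<mu>"
  shows "convex_dual rate x = ereal (F x)"
proof (rule antisym)
  show "convex_dual rate x \<le> ereal (F x)"
  proof (rule dual_rate_le)
    fix r
    have "ereal (r * x) - rate r \<le> ereal (r * x) - ereal (r * x - F x)"
      using rate_ge[OF assms] by (rule ereal_minus_mono[OF order_refl])
    then show "ereal (r * x) - rate r \<le> ereal (F x)" by simp
  qed
  obtain r where "p \<le> r" "\<And>z. 0 \<le> z \<Longrightarrow> z < \<mu> \<Longrightarrow> F x + r * (z - x) \<le> F z"
    using subgradient[OF assms] by metis
  from dual_rate_ge[OF this, of x] show "ereal (F x) \<le> convex_dual rate x" by simp
qed

text \<open>Supporting lines at y near \<mu> start from large values F y and have slopes r >= 0, so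
  they are still large at x >= \<mu>.\<close>

lemma dual_rate_top:
  assumes "\<mu> \<le> x"
  shows "convex_dual rate x = \<infinity>"
proof (rule ereal_top)
  fix B :: real
  have "\<forall>\<^sub>F y in at_left \<mu>. F y \<ge> max B 0" using F_at_top unfolding filterlim_at_top by (rule spec)
  moreover have "\<forall>\<^sub>F y in at_left \<mu>. y \<in> {0<..<\<mu>}" using \<mu> by (intro eventually_at_left_real)
  ultimately have "\<forall>\<^sub>F y in at_left \<mu>. F y \<ge> max B 0 \<and> y \<in> {0<..<\<mu>}" by (rule eventually_conj)
  then obtain y where y: "F y \<ge> max B 0" "0 < y" "y < \<mu>"
    using eventually_happens'[OF trivial_limit_at_left_real] by fastforce
  obtain r where r: "p \<le> r" "F y \<le> r * y" "\<And>z. 0 \<le> z \<Longrightarrow> z < \<mu> \<Longrightarrow> F y + r * (z - y) \<le> F z"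
    using subgradient[OF less_imp_le[OF y(2)] y(3)] by metis
  have "0 \<le> r * y" using r(2) y by simp
  then have "0 \<le> r" using y by (simp add: zero_le_mult_iff)
  then have "0 \<le> r * (x - y)" using assms y by simp
  then have "ereal B \<le> ereal (F y + r * (x - y))" using y by simp
  also have "\<dots> \<le> convex_dual rate x" by (rule dual_rate_ge[OF r(1,3)])
  finally show "ereal B \<le> convex_dual rate x" .
qed

end

text \<open>Paths through (1, 0) carry the factor \<open>X (1, 0)\<close>, whose moment is already
  infinite; m > 0 ensures that there are such paths.\<close>

lemma Zmom_infinite:
  assumes \<mu>: "\<mu> > 0" and \<xi>: "\<xi> \<ge> \<mu>" and m: "m > 0"
  shows "Zmom \<mu> m n \<xi> = \<infinity>"
proof -
  obtain M :: "(nat \<times> nat \<Rightarrow> real) measure" and X where "lg_env M X (\<lambda>_. \<mu>)" using \<mu> by (rule iid_env_exists)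
  then interpret lg_env M X "\<lambda>_. \<mu>" .
  have "Zmom \<mu> 1 0 \<xi> = (\<integral>\<^sup>+\<omega>. ennreal (X (1, 0) \<omega> powr \<xi>) \<partial>M)"
    using Zmom_eq0[of \<mu> 1 0 \<xi>] by simp
  also have "\<dots> = \<infinity>" by (rule moment_infinite[OF \<xi>])
  finally have "Zmom \<mu> 1 0 \<xi> * Zmom \<mu> (m - 1) n \<xi> = \<infinity>"
    using Zmom_nonzero[OF \<mu>] by (simp add: ennreal_top_mult)
  then show ?thesis using Zmom_super[of \<mu> \<xi> 1 0 "m - 1" n] \<mu> \<xi> m by (simp add: top_unique)
qed

section \<open>Almost sure limit and transfer to the given weights\<close>

locale iid_polymer = lg_env M X "\<lambda>_. \<mu>" + polymer_limit \<mu> s t \<theta>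
  for M :: "'a measure" and X \<mu> s t \<theta>
begin

abbreviation ZN :: "nat \<Rightarrow> 'a \<Rightarrow> real" where
  "ZN N \<omega> \<equiv> pf (\<lambda>p. X p \<omega>) (fl N s) (fl N t)"

text \<open>The exponential Markov inequality makes the exceptional probabilities at most exp (- d
  N), and Borel-Cantelli applies. Both signs of x are allowed, which gives both tails.\<close>

lemma deviation:
  assumes x: "x < \<mu>" and d: "d > 0" and LN: "\<forall>\<^sub>F N in sequentially. LN N x \<le> c - d"
  shows "AE \<omega> in M. \<forall>\<^sub>F N in sequentially. x * ln (ZN N \<omega>) < real N * c"
proof -
  define A where "A N = {\<omega> \<in> space M. real N * c \<le> x * ln (ZN N \<omega>)}" for N
  have [measurable]: "A N \<in> sets M" for N unfolding A_def by measurable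
  have "AE \<omega> in M. \<forall>\<^sub>F N in sequentially. \<omega> \<in> space M - A N"
  proof (rule borel_cantelli_AE1)
    show "summable (\<lambda>N. measure M (A N))"
    proof (rule summable_comparison_test_ev)
      have "summable (\<lambda>N. exp (- d) ^ N)" using d by (intro summable_geometric) simp
      then show "summable (\<lambda>N. exp (- d * real N))" by (simp add: exp_of_nat_mult[symmetric] mult.commute)
      show "\<forall>\<^sub>F N in sequentially. norm (measure M (A N)) \<le> exp (- d * real N)"
        using LN eventually_gt_at_top[of 0]
      proof eventually_elim
        case (elim N)
        let ?z = "zm \<mu> (fl N s) (fl N t) x"
        have "emeasure M (A N) = (\<integral>\<^sup>+\<omega>. indicator (A N) \<omega> \<partial>M)" by simp
        also have "\<dots> \<le> (\<integral>\<^sup>+\<omega>. ennreal (exp (- (real N * c))) * ennreal (ZN N \<omega> powr x) \<partial>M)"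
        proof (rule nn_integral_mono)
          fix \<omega>
          show "indicator (A N) \<omega> \<le> ennreal (exp (- (real N * c))) * ennreal (ZN N \<omega> powr x)"
          proof (cases "\<omega> \<in> A N")
            case True
            then have "0 \<le> - (real N * c) + x * ln (ZN N \<omega>)" by (simp add: A_def)
            then have "1 \<le> exp (- (real N * c) + x * ln (ZN N \<omega>))" by simp
            also have "\<dots> = exp (- (real N * c)) * ZN N \<omega> powr x"
              using pf_X_pos0[of \<omega> "fl N s" "fl N t"] by (simp only: exp_add powr_def) auto
            finally show ?thesis using True by (simp add: ennreal_mult'[symmetric])
          qed simp
        qed
        also have "\<dots> = ennreal (exp (- (real N * c))) * Zmom \<mu> (fl N s) (fl N t) x"
          by (subst nn_integral_cmult) (simp_all add: Zmom_eq0[of \<mu>])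
        also have "\<dots> = ennreal (exp (- (real N * c)) * ?z)"
          by (simp add: Zmom_zm \<mu> x ennreal_mult')
        finally have "measure M (A N) \<le> exp (- (real N * c)) * ?z"
          using zm_pos[OF \<mu> x, of "fl N s" "fl N t"] by (simp add: emeasure_eq_measure)
        also have "?z = exp (real N * LN N x)"
          using zm_pos[OF \<mu> x, of "fl N s" "fl N t"] elim by (simp add: LN_def)
        also have "exp (- (real N * c)) * exp (real N * LN N x) = exp (real N * (LN N x - c))"
          by (simp add: exp_add[symmetric] algebra_simps)
        also have "\<dots> \<le> exp (real N * (- d))"
          using mult_left_mono[of "LN N x - c" "- d" "real N"] elim by simp
        finally show ?case by (simp add: mult.commute)
      qed
    qed
  qed (auto simp: emeasure_eq_measure)
  then show ?thesis
    by eventually_elim (auto elim!: eventually_mono simp: A_def not_le)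
qed

lemma AE_upper:
  assumes "e > 0"
  shows "AE \<omega> in M. \<forall>\<^sub>F N in sequentially. ln (ZN N \<omega>) / real N < p + e"
proof -
  obtain x where x: "0 < x" "x < \<mu>" "F x \<le> (p + e / 2) * x" using F_slope[of "e / 2"] assms by auto
  have "\<forall>\<^sub>F N in sequentially. LN N x < (p + e) * x - e * x / 4"
    by (rule order_tendstoD[OF LN_tendsto])
      (use x mult_pos_pos[OF assms x(1)] in \<open>auto simp: algebra_simps\<close>)
  then have "AE \<omega> in M. \<forall>\<^sub>F N in sequentially. x * ln (ZN N \<omega>) < real N * ((p + e) * x)"
    using x assms by (intro deviation[where d = "e * x / 4"]) (auto elim: eventually_mono)
  then show ?thesis
  proof eventually_elim
    case (elim \<omega>)
    then show ?case using eventually_gt_at_top[of 0]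
    proof eventually_elim
      case (elim N)
      then have "x * ln (ZN N \<omega>) < x * (real N * (p + e))" by (simp add: mult_ac)
      then have "ln (ZN N \<omega>) < real N * (p + e)" using x by simp
      then show ?case using elim by (simp add: field_simps)
    qed
  qed
qed

lemma AE_lower:
  assumes "e > 0"
  shows "AE \<omega> in M. \<forall>\<^sub>F N in sequentially. p - e < ln (ZN N \<omega>) / real N"
proof -
  have "AE \<omega> in M. \<forall>\<^sub>F N in sequentially. (- 1) * ln (ZN N \<omega>) < real N * (- p + e)"
    using LN_neg_upper[of 1 "e / 2"] assms \<mu>
    by (intro deviation[where d = "e / 2"]) (auto elim: eventually_mono)
  then show ?thesis
  proof eventually_elim
    case (elim \<omega>)
    then show ?case using eventually_gt_at_top[of 0]
      by eventually_elim (simp add: field_simps)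
  qed
qed

lemma AE_limit: "AE \<omega> in M. (\<lambda>N. ln (ZN N \<omega>) / real N) \<longlonglongrightarrow> p"
proof -
  have "AE \<omega> in M. \<forall>k. (\<forall>\<^sub>F N in sequentially. ln (ZN N \<omega>) / real N < p + 1 / Suc k) \<and>
    (\<forall>\<^sub>F N in sequentially. p - 1 / Suc k < ln (ZN N \<omega>) / real N)"
    unfolding AE_all_countable by (intro allI AE_conjI AE_upper AE_lower) auto
  then show ?thesis
  proof eventually_elim
    case (elim \<omega>)
    show ?case
    proof (rule order_tendstoI)
      fix a assume "a < p"
      then obtain k where k: "1 / Suc k < p - a" using nat_approx_posE[of "p - a"] by auto
      have "\<forall>\<^sub>F N in sequentially. p - 1 / Suc k < ln (ZN N \<omega>) / real N" using elim by blast
      then show "\<forall>\<^sub>F N in sequentially. a < ln (ZN N \<omega>) / real N"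
        by eventually_elim (use k in linarith)
    next
      fix a assume "p < a"
      then obtain k where k: "1 / Suc k < a - p" using nat_approx_posE[of "a - p"] by auto
      have "\<forall>\<^sub>F N in sequentially. ln (ZN N \<omega>) / real N < p + 1 / Suc k" using elim by blast
      then show "\<forall>\<^sub>F N in sequentially. ln (ZN N \<omega>) / real N < a"
        by eventually_elim (use k in linarith)
    qed
  qed
qed

context
  fixes Y :: "nat \<times> nat \<Rightarrow> 'a \<Rightarrow> real"
  assumes Y: "AE \<omega> in M. \<forall>p. Y p \<omega> = X p \<omega>"
begin

lemma scaled_partition_fun_AE: "AE \<omega> in M. \<forall>N. scaled_partition_fun Y s t N \<omega> = ZN N \<omega>"
  using Y
proof eventually_elim
  case (elim \<omega>)
  then have "(\<lambda>p. Y p \<omega>) = (\<lambda>p. X p \<omega>)" by auto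
  then show ?case by (simp add: scaled_partition_fun_def partition_fun_eq_pf fl_def)
qed

text \<open>Two almost sure limits agree at some point of a probability space, hence are equal; this
  justifies the description operator.\<close>

lemma free_energy_eq: "free_energy M Y s t = p"
  unfolding free_energy_def
proof (rule the_equality)
  show lim: "AE \<omega> in M. (\<lambda>n. ln (scaled_partition_fun Y s t n \<omega>) / real n) \<longlonglongrightarrow> p"
    using scaled_partition_fun_AE AE_limit by eventually_elim simp
  fix q assume "AE \<omega> in M. (\<lambda>n. ln (scaled_partition_fun Y s t n \<omega>) / real n) \<longlonglongrightarrow> q"
  with lim have "AE \<omega> in M. q = p" by eventually_elim (rule LIMSEQ_unique)
  then show "q = p" by simp
qed

lemma rate_fun_eq: "rate_fun M Y \<mu> s t = rate"
  by (rule ext) (simp add: rate_fun_def rate_def free_energy_eq)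

lemma scaled_log_mgf_eq: "scaled_log_mgf M Y s t \<xi> N = ln_ennreal (Zmom \<mu> (fl N s) (fl N t) \<xi>) / ereal (real N)"
proof -
  have "(\<integral>\<^sup>+\<omega>. ennreal (exp (\<xi> * ln (scaled_partition_fun Y s t N \<omega>))) \<partial>M) = (\<integral>\<^sup>+\<omega>. ennreal (ZN N \<omega> powr \<xi>) \<partial>M)"
  proof (rule nn_integral_cong_AE)
    show "AE \<omega> in M. ennreal (exp (\<xi> * ln (scaled_partition_fun Y s t N \<omega>))) = ennreal (ZN N \<omega> powr \<xi>)"
      using scaled_partition_fun_AE
      by eventually_elim (use less_imp_neq[OF pf_X_pos0] in \<open>auto simp: powr_def\<close>)
  qed
  also have "\<dots> = Zmom \<mu> (fl N s) (fl N t) \<xi>" by (rule Zmom_eq0) simp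
  finally show ?thesis by (simp add: scaled_log_mgf_def)
qed

lemma scaled_log_mgf_LN:
  assumes "\<xi> < \<mu>" "N > 0"
  shows "scaled_log_mgf M Y s t \<xi> N = ereal (LN N \<xi>)"
  using zm_pos[OF \<mu> assms(1), of "fl N s" "fl N t"] assms
  by (simp add: scaled_log_mgf_eq Zmom_zm \<mu> ln_ennreal_def LN_def)

lemma scaled_log_mgf_tendsto:
  assumes "\<xi> < \<mu>" "(\<lambda>N. LN N \<xi>) \<longlonglongrightarrow> l"
  shows "scaled_log_mgf M Y s t \<xi> \<longlonglongrightarrow> ereal l"
proof (rule Lim_transform_eventually)
  show "(\<lambda>N. ereal (LN N \<xi>)) \<longlonglongrightarrow> ereal l" using assms(2) by simp
  show "\<forall>\<^sub>F N in sequentially. ereal (LN N \<xi>) = scaled_log_mgf M Y s t \<xi> N"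
    using eventually_gt_at_top[of 0] by eventually_elim (simp add: scaled_log_mgf_LN assms(1))
qed

lemma scaled_log_mgf_top:
  assumes "\<mu> \<le> \<xi>"
  shows "scaled_log_mgf M Y s t \<xi> \<longlonglongrightarrow> \<infinity>"
proof (rule Lim_transform_eventually)
  show "(\<lambda>_. \<infinity>) \<longlonglongrightarrow> (\<infinity> :: ereal)" by simp
  show "\<forall>\<^sub>F N in sequentially. \<infinity> = scaled_log_mgf M Y s t \<xi> N"
    \<comment> \<open>N s >= 2 guarantees a horizontal step, the source of the infinite
      moment.\<close>
    using eventually_real_ge[of "2 / s"] eventually_gt_at_top[of 0]
  proof eventually_elim
    case (elim N)
    then have "2 \<le> real N * s" using s by (simp add: field_simps)
    then have "fl N s > 0" using fl_bounds(2)[of s N] s by simp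
    then show ?case using elim by (simp add: scaled_log_mgf_eq Zmom_infinite \<mu> assms ln_ennreal_def)
  qed
qed

end

end

theorem corollary2p5:
  fixes M :: "'a measure" and Y :: "nat \<times> nat \<Rightarrow> 'a \<Rightarrow> real" and \<mu> s t \<xi> :: real
  assumes "prob_space M"
    and "\<mu> > 0" and "s > 0" and "t > 0"
    and "prob_space.indep_vars M (\<lambda>_. borel) Y UNIV"
    and "\<And>ij. distributed M lborel (\<lambda>\<omega>. inverse (Y ij \<omega>)) (\<lambda>x. ennreal (gamma_density \<mu> x))"
  shows "\<exists>\<Lambda> :: ereal. scaled_log_mgf M Y s t \<xi> \<longlonglongrightarrow> \<Lambda> \<and> \<Lambda> \<noteq> -\<infinity> \<and>
    \<Lambda> = convex_dual (rate_fun M Y \<mu> s t) \<xi> \<and>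
    \<Lambda> = (if \<xi> < 0 then ereal (free_energy M Y s t * \<xi>)
         else if \<xi> < \<mu> then inf_gamma_mgf \<mu> s t \<xi>
         else \<infinity>)"
proof -
  interpret prob_space M by fact
  \<comment> \<open>The given weights are positive almost surely only; X is an everywhere positive
    version, as \<open>lg_env\<close> requires.\<close>
  define X where "X p \<omega> = (if Y p \<omega> > 0 then Y p \<omega> else 1)" for p \<omega>
  have law: "distr M borel (\<lambda>\<omega>. inverse (Y p \<omega>)) = gamma_law \<mu>" for p
    using distributed_distr_eq_density[OF assms(6)[of p]] unfolding gamma_law_def
    by (metis distr_cong sets_lborel)
  have "indep_vars (\<lambda>_. borel) (\<lambda>p \<omega>. inverse (Y p \<omega>)) UNIV"
    by (rule indep_vars_compose2[OF assms(5), of "\<lambda>_. inverse" "\<lambda>_. borel"]) simp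
  then have fam: "gamma_family UNIV (\<lambda>p \<omega>. inverse (Y p \<omega>)) (\<lambda>_. \<mu>)"
    by (simp add: gamma_family_def law)
  obtain \<theta> where "0 < \<theta>" "\<theta> < \<mu>" "- t * Polygamma 1 \<theta> + s * Polygamma 1 (\<mu> - \<theta>) = 0"
    using critical_point_0[OF assms(2-4)] by blast
  moreover have "lg_env M X (\<lambda>_. \<mu>)"
    unfolding X_def using lg_envI[OF assms(1) fam] assms(2) by simp
  ultimately interpret iid_polymer M X \<mu> s t \<theta>
    using assms(3,4) by (intro iid_polymer.intro polymer_limit.intro)
  have "AE \<omega> in M. \<forall>p. inverse (Y p \<omega>) > 0"
    unfolding AE_all_countable using gamma_family_AE_pos[OF fam] by simp
  then have Y: "AE \<omega> in M. \<forall>p. Y p \<omega> = X p \<omega>"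
    by eventually_elim (simp add: X_def)
  note eqs = rate_fun_eq[OF Y] free_energy_eq[OF Y]
  consider "\<xi> < 0" | "0 \<le> \<xi>" "\<xi> < \<mu>" | "\<mu> \<le> \<xi>" by linarith
  then show ?thesis
  proof cases
    case 1
    then show ?thesis
      using scaled_log_mgf_tendsto[OF Y _ LN_tendsto_neg] dual_rate_neg \<mu> by (intro exI[of _ "ereal (p * \<xi>)"]) (simp add: eqs)
  next
    case 2
    then show ?thesis
      using scaled_log_mgf_tendsto[OF Y _ LN_tendsto] dual_rate_mid by (intro exI[of _ "ereal (F \<xi>)"]) (simp add: eqs inf_gamma_mgf_F)
  next
    case 3
    then show ?thesis
      using scaled_log_mgf_top[OF Y] dual_rate_top \<mu> by (intro exI[of _ \<infinity>]) (simp add: eqs)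
  qed
qed

end
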